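(* Let $1<p,q<\infty$ and let $\sigma,w$ be Radon measures on $\mathbb{R}^N$ satisfying the quadratic $\mathscr{A}_{p,q}$-condition, i.e. $[\sigma,w]_{p,q}<\infty$. Let $\mathscr{T}$ be a collection of dyadic shifts $T^\sigma$ with complexities at most $\kappa$. Then $\mathscr{T}$ is $\mathcal{R}$-bounded from $L^p(\sigma)$ into $L^q(w)$ if and only if it satisfies the quadratic testing conditions: there are finite constants $\mathcal{T}^\sigma$ and $\mathcal{T}^w$ such that for every $U\in\{1,2,\dots\}$ and all sequences $(a_u)_{u=1}^U\subset\mathbb{R}$, $(T_u^\sigma)_{u=1}^U\subset\mathscr{T}$ and $(Q_u)_{u=1}^U\subset\mathscr{D}$ (repetitions allowed), $$\Big\|\Big(\sum_{u=1}^U (a_u1_{Q_u}T_u^\sigma 1_{Q_u})^2\Big)^{1/2}\Big\|_{L^q(w)}\le \mathcal{T}^\sigma\Big\|\Big(\sum_{u=1}^U a_u^21_{Q_u}\Big)^{1/2}\Big\|_{L^p(\sigma)}$$ and $$\Big\|\Big(\sum_{u=1}^U (a_u1_{Q_u}T_u^w 1_{Q_u})^2\Big)^{1/2}\Big\|_{L^{p'}(\sigma)}\le \mathcal{T}^w\Big\|\Big(\sum_{u=1}^U a_u^21_{Q_u}\Big)^{1/2}\Big\|_{L^{q'}(w)},$$ where $T_u^w$ is the formal adjoint of $T_u^\sigma$. In this case, with $\mathcal{T}^\sigma,\mathcal{T}^w$ the best possible constants, $$\mathcal{R}(\mathscr{T})\lesssim(1+\kappa)(\mathcal{T}^\sigma+\mathcal{T}^w)+(1+\kappa)^2[\sigma,w]_{p,q},$$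 where the implicit constant depends only on $p$, $q$ and $N$.
   Context: All functions are real valued; $p',q'$ are the Hölder conjugate exponents of $p,q$. Dyadic lattice. A dyadic lattice $\mathscr{D}=\bigcup_{k\in\mathbb{Z}}\mathscr{D}_k$ on $\mathbb{R}^N$ is fixed: each $\mathscr{D}_k$ is a disjoint cover of $\mathbb{R}^N$ by cubes of the form $x+[0,2^{-k})^N$, and every cube in $\mathscr{D}_k$ is a union of $2^N$ cubes of $\mathscr{D}_{k+1}$ (its dyadic children). $|Q|$ is the Lebesgue measure of $Q$. For $Q\in\mathscr{D}_k$, $Q^{(0)}=Q$, and for $r\ge1$, $Q^{(r)}$ is the unique cube in $\mathscr{D}_{k-r}$ containing $Q$. Haar functions. For an interval $I\subset\mathbb{R}$, $h_I^0:=|I|^{-1/2}1_I$ and $h_I^1:=|I|^{-1/2}(1_{I_l}-1_{I_r})$, with $I_l,I_r$ the left and right halves of $I$. For a cube $Q=I_1\times\dots\times I_N\in\mathscr{D}$ and $\eta\in\{0,1\}^N$, $h_Q^\eta(x):=\prod_{i=1}^N h_{I_i}^{\eta_i}(x_i)$. Any of the functions $h_Q^\eta$, $\eta\in\{0,1\}^N$, is called a Haar function related to $Q$. Dyadic shifts. Write $\langle f,g\rangle_\mu=\int fg\,d\mu$. Fix integers $m,n\ge0$. A dyadic shift with parameters $(m,n)$ is an operator $T^\sigma f=\sum_{K\in\mathscr{D}}A_K^\sigma f$, $f\in L^1_{loc}(\sigma)$, where $$A_K^\sigma f=\sum_{I,J\in\mathscr{D}:\ I^{(m)}=J^{(n)}=K}a_{IJK}\langle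 f,h_I^J\rangle_\sigma h_J^I,$$ $h_I^J$ is some Haar function related to the cube $I$, $h_J^I$ is some Haar function related to the cube $J$ (arbitrary choices, which may depend on the pair $(I,J)$), $a_{IJK}\in\mathbb{R}$ satisfy $|a_{IJK}|\le \sqrt{|I||J|}/|K|$, and only finitely many $K\in\mathscr{D}$ have some non-zero coefficient $a_{IJK}$. Its formal adjoint is $T^w g=\sum_K A_K^w g$, $g\in L^1_{loc}(w)$, with $A_K^wg=\sum_{I^{(m)}=J^{(n)}=K}a_{IJK}\langle g,h_J^I\rangle_w h_I^J$. The complexity of the shift is $\max\{m,n\}$. Different shifts in $\mathscr{T}$ may have different parameters. Quadratic $\mathscr{A}_{p,q}$-condition. $[\sigma,w]_{p,q}\in[0,\infty]$ is the best constant such that for every collection $\{a_Q\}_{Q\in\mathscr{D}}\subset\mathbb{R}$ $$\Big\|\Big(\sum_{Q\in\mathscr{D}}\Big(a_Q\frac{\sigma(Q)}{|Q|}\Big)^21_Q\Big)^{1/2}\Big\|_{L^q(w)}\le[\sigma,w]_{p,q}\Big\|\Big(\sum_{Q\in\mathscr{D}}a_Q^21_Q\Big)^{1/2}\Big\|_{L^p(\sigma)};$$ the condition holds if $[\sigma,w]_{p,q}<\infty$. $\mathcal{R}$-boundedness. Let $(\varepsilon_u)_{u\ge1}$ be independent random signs ($\mathbb{P}(\varepsilon_u=\pm1)=1/2$), $\mathbb{E}$ the expectation. A family $\mathscr{T}$ of linear operators from a Banach space $X$ into a Banach space $Y$ is $\mathcal{R}$-bounded if there is a constant $C$ such that $\mathbb{E}\|\sum_{u=1}^U\varepsilon_uT_ux_u\|_Y\le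 C\,\mathbb{E}\|\sum_{u=1}^U\varepsilon_ux_u\|_X$ for all $U\in\{1,2,\dots\}$, $(T_u)_{u=1}^U\subset\mathscr{T}$, $(x_u)_{u=1}^U\subset X$; the smallest such $C$ is $\mathcal{R}(\mathscr{T})$. Here $X=L^p(\sigma)$, $Y=L^q(w)$. *)

theory Defs
  imports "HOL-Probability.Probability"
begin

section \<open>Radon measures and Lebesgue norms\<close>

definition radon_measure :: "(real ^ 'n) measure \<Rightarrow> bool" where
  "radon_measure \<mu> \<longleftrightarrow>
     sets \<mu> = sets borel \<and>
     (\<forall>K. compact K \<longrightarrow> emeasure \<mu> K < \<infinity>) \<and>
     (\<forall>B\<in>sets borel. emeasure \<mu> B = (SUP K\<in>{K. compact K \<and> K \<subseteq> B}. emeasure \<mu> K))"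

text \<open>Only used for exponents \<open>r > 0\<close>, where \<open>\<infinity>\<close> raised to \<open>r\<close> is \<open>\<infinity>\<close>.\<close>

definition epowr :: "ennreal \<Rightarrow> real \<Rightarrow> ennreal" where
  "epowr x r = (if x = \<infinity> then \<infinity> else ennreal (enn2real x powr r))"

definition eLp_norm :: "'a measure \<Rightarrow> real \<Rightarrow> ('a \<Rightarrow> ennreal) \<Rightarrow> ennreal" where
  "eLp_norm \<mu> p F = epowr (\<integral>\<^sup>+ x. epowr (F x) p \<partial>\<mu>) (1 / p)"

definition Lp_norm :: "'a measure \<Rightarrow> real \<Rightarrow> ('a \<Rightarrow> real) \<Rightarrow> ennreal" where
  "Lp_norm \<mu> p f = eLp_norm \<mu> p (\<lambda>x. ennreal \<bar>f x\<bar>)"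

definition Lp :: "'a measure \<Rightarrow> real \<Rightarrow> ('a \<Rightarrow> real) set" where
  "Lp \<mu> p = {f \<in> borel_measurable \<mu>. Lp_norm \<mu> p f < \<infinity>}"

definition conj_exponent :: "real \<Rightarrow> real" where
  "conj_exponent p = p / (p - 1)"

section \<open>Dyadic lattices and Haar functions\<close>

definition half_open_cube :: "real ^ 'n \<Rightarrow> real \<Rightarrow> (real ^ 'n) set" where
  "half_open_cube x l = {y. \<forall>i. x $ i \<le> y $ i \<and> y $ i < x $ i + l}"

definition dyadic_lattice :: "(int \<Rightarrow> (real ^ 'n) set set) \<Rightarrow> bool" where
  "dyadic_lattice D \<longleftrightarrow>
     (\<forall>k. disjoint (D k) \<and> \<Union>(D k) = UNIV \<and>
          (\<forall>Q\<in>D k. \<exists>x. Q = half_open_cube x (2 powi (- k))) \<and>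
          (\<forall>Q\<in>D k. \<exists>C\<subseteq>D (k + 1). card C = 2 ^ CARD('n) \<and> Q = \<Union>C))"

definition cubes :: "(int \<Rightarrow> (real ^ 'n) set set) \<Rightarrow> (real ^ 'n) set set" where
  "cubes D = (\<Union>k. D k)"

abbreviation vol :: "(real ^ 'n) set \<Rightarrow> real" where
  "vol Q \<equiv> measure lborel Q"

text \<open>The ancestor of \<open>Q\<close> lying \<open>r\<close> generations above \<open>Q\<close>.\<close>

definition ancestor ::
  "(int \<Rightarrow> (real ^ 'n) set set) \<Rightarrow> nat \<Rightarrow> (real ^ 'n) set \<Rightarrow> (real ^ 'n) set" where
  "ancestor D r Q = (THE R. \<exists>k. Q \<in> D k \<and> R \<in> D (k - int r) \<and> Q \<subseteq> R)"

definition left_half :: "real set \<Rightarrow> real set" where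
  "left_half I = {t\<in>I. t < (Inf I + Sup I) / 2}"

definition right_half :: "real set \<Rightarrow> real set" where
  "right_half I = {t\<in>I. (Inf I + Sup I) / 2 \<le> t}"

text \<open>The upper index in \<open>{0, 1}\<close> of a Haar function is encoded as a truth value.\<close>

definition haar_interval :: "bool \<Rightarrow> real set \<Rightarrow> real \<Rightarrow> real" where
  "haar_interval e I t =
     (if e then indicator (left_half I) t - indicator (right_half I) t else indicator I t)
       / sqrt (measure lborel I)"

definition haar :: "(real ^ 'n) set \<Rightarrow> ('n \<Rightarrow> bool) \<Rightarrow> real ^ 'n \<Rightarrow> real" where
  "haar Q \<eta> x = (\<Prod>i\<in>UNIV. haar_interval (\<eta> i) ((\<lambda>y. y $ i) ` Q) (x $ i))"

definition haar_related :: "(real ^ 'n) set \<Rightarrow> (real ^ 'n \<Rightarrow> real) \<Rightarrow> bool" where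
  "haar_related Q h \<longleftrightarrow> (\<exists>\<eta>. h = haar Q \<eta>)"

section \<open>Dyadic shifts\<close>

text \<open>
  A shift is represented by its defining data, so that the same record determines the operator
  for \<open>\<sigma>\<close> and its formal adjoint for \<open>w\<close>. Here \<open>sh_coeff S I J K\<close> is the coefficient with
  indices \<open>I\<close>, \<open>J\<close>, \<open>K\<close>; \<open>sh_in S I J\<close> is the Haar function related to \<open>I\<close> and
  \<open>sh_out S I J\<close> the Haar function related to \<open>J\<close>, both chosen for the pair \<open>(I, J)\<close>.
\<close>

record ('n::finite) dyadic_shift =
  sh_m :: nat
  sh_n :: nat
  sh_coeff :: "(real ^ 'n) set \<Rightarrow> (real ^ 'n) set \<Rightarrow> (real ^ 'n) set \<Rightarrow> real"
  sh_in :: "(real ^ 'n) set \<Rightarrow> (real ^ 'n) set \<Rightarrow> real ^ 'n \<Rightarrow> real"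
  sh_out :: "(real ^ 'n) set \<Rightarrow> (real ^ 'n) set \<Rightarrow> real ^ 'n \<Rightarrow> real"

definition shift_pairs ::
  "(int \<Rightarrow> (real ^ 'n) set set) \<Rightarrow> 'n dyadic_shift \<Rightarrow> (real ^ 'n) set
     \<Rightarrow> ((real ^ 'n) set \<times> (real ^ 'n) set) set" where
  "shift_pairs D S K =
     {(I, J). I \<in> cubes D \<and> J \<in> cubes D \<and>
              ancestor D (sh_m S) I = K \<and> ancestor D (sh_n S) J = K}"

definition is_dyadic_shift ::
  "(int \<Rightarrow> (real ^ 'n) set set) \<Rightarrow> 'n dyadic_shift \<Rightarrow> bool" where
  "is_dyadic_shift D S \<longleftrightarrow>
     (\<forall>K\<in>cubes D. \<forall>(I, J)\<in>shift_pairs D S K.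
        haar_related I (sh_in S I J) \<and> haar_related J (sh_out S I J) \<and>
        \<bar>sh_coeff S I J K\<bar> \<le> sqrt (vol I * vol J) / vol K) \<and>
     finite {K \<in> cubes D. \<exists>(I, J)\<in>shift_pairs D S K. sh_coeff S I J K \<noteq> 0}"

definition complexity :: "'n::finite dyadic_shift \<Rightarrow> nat" where
  "complexity S = max (sh_m S) (sh_n S)"

definition shift_op ::
  "(int \<Rightarrow> (real ^ 'n) set set) \<Rightarrow> (real ^ 'n) measure \<Rightarrow> 'n dyadic_shift
     \<Rightarrow> (real ^ 'n \<Rightarrow> real) \<Rightarrow> real ^ 'n \<Rightarrow> real" where
  "shift_op D \<sigma> S f x =
     (\<Sum>\<^sub>\<infinity>K\<in>cubes D. \<Sum>(I, J)\<in>shift_pairs D S K.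
        sh_coeff S I J K * (\<integral>y. f y * sh_in S I J y \<partial>\<sigma>) * sh_out S I J x)"

definition shift_adj ::
  "(int \<Rightarrow> (real ^ 'n) set set) \<Rightarrow> (real ^ 'n) measure \<Rightarrow> 'n dyadic_shift
     \<Rightarrow> (real ^ 'n \<Rightarrow> real) \<Rightarrow> real ^ 'n \<Rightarrow> real" where
  "shift_adj D w S g x =
     (\<Sum>\<^sub>\<infinity>K\<in>cubes D. \<Sum>(I, J)\<in>shift_pairs D S K.
        sh_coeff S I J K * (\<integral>y. g y * sh_out S I J y \<partial>w) * sh_in S I J x)"

section \<open>The quadratic two-weight condition\<close>

definition quadratic_A_const ::
  "(int \<Rightarrow> (real ^ 'n) set set) \<Rightarrow> real \<Rightarrow> real \<Rightarrow> (real ^ 'n) measure \<Rightarrow> (real ^ 'n) measure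
     \<Rightarrow> ennreal" where
  "quadratic_A_const D p q \<sigma> w =
     Inf {C. \<forall>a :: (real ^ 'n) set \<Rightarrow> real.
       eLp_norm w q (\<lambda>x. epowr (\<Sum>\<^sub>\<infinity>Q\<in>cubes D.
           ennreal ((a Q * (measure \<sigma> Q / vol Q))\<^sup>2 * indicator Q x)) (1 / 2))
       \<le> C * eLp_norm \<sigma> p (\<lambda>x. epowr (\<Sum>\<^sub>\<infinity>Q\<in>cubes D.
           ennreal ((a Q)\<^sup>2 * indicator Q x)) (1 / 2))}"

section \<open>R-boundedness\<close>

text \<open>
  \<open>Lp\<close> consists of functions rather than of their almost everywhere equivalence classes, so
  an operator between the quotients is required to respect almost everywhere equality.
\<close>

definition linear_Lp_operator ::
  "'a measure \<Rightarrow> real \<Rightarrow> 'b measure \<Rightarrow> real \<Rightarrow> (('a \<Rightarrow> real) \<Rightarrow> 'b \<Rightarrow> real) \<Rightarrow> bool" where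
  "linear_Lp_operator \<mu> p \<nu> q T \<longleftrightarrow>
     (\<forall>f\<in>Lp \<mu> p. T f \<in> Lp \<nu> q) \<and>
     (\<forall>f\<in>Lp \<mu> p. \<forall>g\<in>Lp \<mu> p. (AE x in \<mu>. f x = g x) \<longrightarrow> (AE x in \<nu>. T f x = T g x)) \<and>
     (\<forall>f\<in>Lp \<mu> p. \<forall>g\<in>Lp \<mu> p. AE x in \<nu>. T (\<lambda>y. f y + g y) x = T f x + T g x) \<and>
     (\<forall>f\<in>Lp \<mu> p. \<forall>c. AE x in \<nu>. T (\<lambda>y. c * f y) x = c * T f x)"

text \<open>The joint law of the first \<open>U\<close> of a sequence of independent random signs.\<close>

definition random_signs :: "nat \<Rightarrow> (nat \<Rightarrow> real) pmf" where
  "random_signs U = Pi_pmf {1..U} 0 (\<lambda>_. pmf_of_set {-1, 1})"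

definition R_bound ::
  "'a measure \<Rightarrow> real \<Rightarrow> 'b measure \<Rightarrow> real \<Rightarrow> (('a \<Rightarrow> real) \<Rightarrow> 'b \<Rightarrow> real) set
     \<Rightarrow> ennreal \<Rightarrow> bool" where
  "R_bound \<mu> p \<nu> q \<T> C \<longleftrightarrow>
     (\<forall>U\<ge>1. \<forall>T f. (\<forall>u\<in>{1..U}. T u \<in> \<T> \<and> f u \<in> Lp \<mu> p) \<longrightarrow>
        (\<integral>\<^sup>+ \<epsilon>. Lp_norm \<nu> q (\<lambda>x. \<Sum>u=1..U. \<epsilon> u * T u (f u) x) \<partial>random_signs U)
        \<le> C * (\<integral>\<^sup>+ \<epsilon>. Lp_norm \<mu> p (\<lambda>x. \<Sum>u=1..U. \<epsilon> u * f u x) \<partial>random_signs U))"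

definition R_bounded ::
  "'a measure \<Rightarrow> real \<Rightarrow> 'b measure \<Rightarrow> real \<Rightarrow> (('a \<Rightarrow> real) \<Rightarrow> 'b \<Rightarrow> real) set \<Rightarrow> bool" where
  "R_bounded \<mu> p \<nu> q \<T> \<longleftrightarrow>
     (\<forall>T\<in>\<T>. linear_Lp_operator \<mu> p \<nu> q T) \<and> (\<exists>C<\<infinity>. R_bound \<mu> p \<nu> q \<T> C)"

definition R_const ::
  "'a measure \<Rightarrow> real \<Rightarrow> 'b measure \<Rightarrow> real \<Rightarrow> (('a \<Rightarrow> real) \<Rightarrow> 'b \<Rightarrow> real) set \<Rightarrow> ennreal" where
  "R_const \<mu> p \<nu> q \<T> = Inf {C. R_bound \<mu> p \<nu> q \<T> C}"

section \<open>Quadratic testing conditions\<close>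

text \<open>
  The two testing conditions are the instances of the following one for
  \<open>shift_op D \<sigma>\<close> from \<open>Lp \<sigma> p\<close> to \<open>Lp w q\<close>, and for \<open>shift_adj D w\<close> between
  the spaces with the conjugate exponents.
\<close>

definition quadratic_testing ::
  "(int \<Rightarrow> (real ^ 'n) set set) \<Rightarrow> (real ^ 'n) measure \<Rightarrow> real \<Rightarrow> (real ^ 'n) measure \<Rightarrow> real
     \<Rightarrow> ('n dyadic_shift \<Rightarrow> (real ^ 'n \<Rightarrow> real) \<Rightarrow> real ^ 'n \<Rightarrow> real)
     \<Rightarrow> 'n dyadic_shift set \<Rightarrow> ennreal \<Rightarrow> bool" where
  "quadratic_testing D \<mu> r \<nu> s op \<S> C \<longleftrightarrow>
     (\<forall>U\<ge>1. \<forall>a :: nat \<Rightarrow> real. \<forall>S Q. (\<forall>u\<in>{1..U}. S u \<in> \<S> \<and> Q u \<in> cubes D) \<longrightarrow>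
        Lp_norm \<nu> s (\<lambda>x. sqrt (\<Sum>u=1..U.
            (a u * indicator (Q u) x * op (S u) (indicator (Q u)) x)\<^sup>2))
        \<le> C * Lp_norm \<mu> r (\<lambda>x. sqrt (\<Sum>u=1..U. (a u)\<^sup>2 * indicator (Q u) x)))"

definition testing_const ::
  "(int \<Rightarrow> (real ^ 'n) set set) \<Rightarrow> (real ^ 'n) measure \<Rightarrow> real \<Rightarrow> (real ^ 'n) measure \<Rightarrow> real
     \<Rightarrow> ('n dyadic_shift \<Rightarrow> (real ^ 'n \<Rightarrow> real) \<Rightarrow> real ^ 'n \<Rightarrow> real)
     \<Rightarrow> 'n dyadic_shift set \<Rightarrow> ennreal" where
  "testing_const D \<mu> r \<nu> s op \<S> = Inf {C. quadratic_testing D \<mu> r \<nu> s op \<S> C}"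

end

theory Submission
  imports Defs
begin

text \<open>
  The inequalities only ever involve finitely many shifts and finitely many test cubes, and a shift
  has finitely many cubes with a non-zero coefficient. Hence there are a coarsest and a finest
  generation beyond which nothing happens: on the cubes of the finest generation (the atoms) all
  operators produce constants, and they see a function only through its integrals over atoms. This
  turns every norm into a finite weighted sum and every shift into a matrix, a sum over the
  generations \<open>j\<close> of kernels that live on the cubes of generation \<open>j\<close>, are bounded by the inverse
  volume, and are constant on cubes of generation \<open>j + \<kappa> + 1\<close> (\<open>kernels_on_atoms\<close>).

  By the inequalities of Khintchine and Minkowski, R-boundedness from \<open>L\<^sup>p(\<sigma>)\<close> into \<open>L\<^sup>q(w)\<close> is the same
  as the square function estimate
  \<open>\<parallel>(\<Sum>\<^sub>u |T\<^sub>u f\<^sub>u|\<^sup>2)^(1/2)\<parallel> \<le> C \<parallel>(\<Sum>\<^sub>u |f\<^sub>u|\<^sup>2)^(1/2)\<parallel>\<close>, up to constants that depend on the exponents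
  (\<open>random_sum_le_square_function\<close>, \<open>square_function_le_random_sum\<close>). Necessity of testing is then
  immediate: insert multiples of the indicators of the cubes, also for the adjoints, which satisfy the dual
  square function estimate with the same constant (\<open>kernel_bound_dual\<close>).

  For sufficiency one has to bound \<open>\<Sum>\<^sub>u \<langle>T\<^sub>u f\<^sub>u, g\<^sub>u\<rangle>\<close> (\<open>form_bound\<close>). Expand \<open>f\<^sub>u\<close> and \<open>g\<^sub>u\<close> in martingale
  differences of levels \<open>k\<close> and \<open>l\<close>, with respect to \<open>\<sigma>\<close> and \<open>w\<close>. With \<open>s = \<kappa> + 1\<close>, the kernel of level \<open>j\<close>
  does not see differences of level above \<open>j + s\<close>, and treats those of level at most \<open>j\<close> as constants.

  \<^item> If \<open>k + s \<le> l\<close>, the terms sum up to a paraproduct: averages of \<open>f\<^sub>u\<close> times the shift of the constant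
    function, restricted to fine levels, paired with differences of \<open>g\<^sub>u\<close>. Averages are replaced by
    their values on stopping cells, where they double; these are controlled by the maximal function
    and are admissible coefficients in the testing condition (\<open>paraproduct_bound\<close>). The case
    \<open>l + s \<le> k\<close> is the same for the adjoints.

  \<^item> If \<open>|k - l| < s\<close> and \<open>k, l \<le> j\<close>, the differences come out of the kernel and testing applies
    directly, for each of the \<open>2 s - 1\<close> values of \<open>k - l\<close> (\<open>diagonal_bound\<close>).

  \<^item> If \<open>|k - l| < s\<close> and \<open>k\<close> or \<open>l\<close> exceeds \<open>j\<close>, both are within distance \<open>s\<close> of \<open>j\<close>. The size bound
    of the kernel and the quadratic condition suffice, once for each of the at most \<open>4 s\<^sup>2\<close> pairs
    \<open>(k - j, l - j)\<close> (\<open>near_bound\<close>).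

  The tools are Stein's inequality and the two-sided square function estimate for vector valued
  martingales with respect to an arbitrary weight. They follow from the vector valued maximal
  inequality (\<open>maximal_inequality\<close>), which is obtained for all exponents above \<open>1\<close> at once by summing
  the increments of the running maximum.
\<close>

section \<open>Powers and square sums\<close>

text \<open>
  A telescoping bound for sums of the form \<open>\<Sum> (a\<^sub>k powr (\<theta> - 1) - a\<^sub>k\<^sub>+\<^sub>1 powr (\<theta> - 1)) a\<^sub>k\<close>, in which the
  weights decrease while \<open>a\<close> increases. It is Young's inequality for the exponents \<open>1/\<theta>\<close>, \<open>1/(1 - \<theta>)\<close>.
\<close>

lemma powr_concave_chord:
  fixes a b \<theta> :: real
  assumes "0 < \<theta>" "\<theta> \<le> 1" "0 \<le> a" "a \<le> b"
  shows "a powr \<theta> - b powr (\<theta> - 1) * a \<le> (1 - \<theta>) / \<theta> * (b powr \<theta> - a powr \<theta>)"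
proof (cases "a = 0")
  case True
  then show ?thesis using assms by simp
next
  case False
  then have ab: "a > 0" "b > 0" using assms by auto
  have Y: "a powr \<theta> * b powr (1 - \<theta>) \<le> \<theta> * a + (1 - \<theta>) * b"
    using Youngs_inequality_0[of \<theta> "1 - \<theta>" a b] assms ab by simp
  have e: "b powr (1 - \<theta>) * b powr (\<theta> - 1) = 1" "b * b powr (\<theta> - 1) = b powr \<theta>"
    using ab by (simp_all add: powr_diff field_simps flip: powr_add)
  have "a powr \<theta> * b powr (1 - \<theta>) * b powr (\<theta> - 1) \<le> (\<theta> * a + (1 - \<theta>) * b) * b powr (\<theta> - 1)"
    using Y by (intro mult_right_mono) auto
  then have "a powr \<theta> \<le> \<theta> * (b powr (\<theta> - 1) * a) + (1 - \<theta>) * b powr \<theta>"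
    by (simp add: mult.assoc e distrib_right) (simp add: mult_ac)
  then show ?thesis using assms(1) by (simp add: field_simps)
qed

text \<open>
  The discrete form of \<open>d(t powr r) = r t powr (r - 1) dt\<close>, with the power evaluated at the right end
  point; for \<open>r < 1\<close> the factor \<open>r\<close> has to be given up.
\<close>

lemma powr_increment_le:
  fixes a b r :: real
  assumes "0 < r" "0 \<le> a" "a \<le> b"
  shows "b powr r - a powr r \<le> max 1 r * (b powr (r - 1) * (b - a))"
proof (cases "a = 0")
  case True
  have "b powr r = b powr (r - 1) * b" 
  proof (cases "b = 0")
    case False
    then show ?thesis using powr_mult_base[of b "r - 1"] assms by (simp add: mult.commute)
  qed simp
  moreover have "1 * (b powr (r - 1) * b) \<le> max 1 r * (b powr (r - 1) * b)"
    using assms by (intro mult_right_mono) auto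
  ultimately show ?thesis using True assms by simp
next
  case False
  then have ab: "a > 0" "b > 0" using assms by auto
  have b1: "b powr r = b powr (r - 1) * b"
    using powr_mult_base[of b "r - 1"] ab by (simp add: mult.commute)
  have a1: "a powr r = a powr (r - 1) * a"
    using powr_mult_base[of a "r - 1"] ab by (simp add: mult.commute)
  show ?thesis
  proof (cases "r \<ge> 1")
    case True
    have "(a powr r) powr (1/r) * (b powr r) powr (1 - 1/r) \<le> 1/r * a powr r + (1 - 1/r) * b powr r"
      using True ab by (intro Youngs_inequality_0) auto
    moreover have "(b powr r) powr (1 - 1/r) = b powr (r - 1)" "(a powr r) powr (1/r) = a"
      using True ab by (simp_all add: powr_powr right_diff_distrib)
    ultimately have "a * b powr (r - 1) \<le> 1/r * a powr r + (1 - 1/r) * b powr r" by simp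
    then have "r * (a * b powr (r - 1)) \<le> r * (1/r * a powr r + (1 - 1/r) * b powr r)"
      using True by (intro mult_left_mono) auto
    moreover have "r * (1/r * a powr r + (1 - 1/r) * b powr r) = a powr r + (r - 1) * b powr r"
      using True by (simp add: field_simps)
    ultimately have "r * (a * b powr (r - 1)) \<le> a powr r + (r - 1) * b powr r" by simp
    then show ?thesis using True by (simp add: b1 algebra_simps)
  next
    case False
    have "b powr (r - 1) \<le> a powr (r - 1)"
      using False ab assms by (intro powr_mono2') auto
    then have "b powr (r - 1) * a \<le> a powr (r - 1) * a" using ab by (intro mult_right_mono) auto
    then show ?thesis using False by (simp add: a1 b1 algebra_simps)
  qed
qed

text \<open>
  The form in which Young's inequality is used to absorb a term: after summation,
  \<open>\<parallel>Y\<parallel>\<^sup>p \<le> K \<Sum> h Y\<^bsup>p - 1\<^esup>\<close> gives \<open>\<parallel>Y\<parallel> \<le> K \<parallel>h\<parallel>\<close> with no loss in the constant.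
\<close>

lemma Young_absorb:
  fixes K h Y p :: real
  assumes "1 < p" "0 \<le> K" "0 \<le> h" "0 \<le> Y"
  shows "K * (h * Y powr (p - 1)) \<le> (K * h) powr p / p + (1 - 1/p) * Y powr p"
proof -
  have c: "p / (p - 1) > 1" "1/p + 1/(p/(p-1)) = 1" "1 / (p/(p-1)) = 1 - 1/p"
    using assms by (auto simp: field_simps)
  have "(K * h) * Y powr (p - 1) \<le> (K * h) powr p / p + (Y powr (p - 1)) powr (p/(p-1)) / (p/(p-1))"
    using assms c by (intro Youngs_inequality) auto
  moreover have "(Y powr (p - 1)) powr (p/(p-1)) = Y powr p"
    using assms by (simp add: powr_powr)
  moreover have "Y powr p / (p/(p-1)) = (1 - 1/p) * Y powr p"
    using assms by (simp add: field_simps)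
  ultimately show ?thesis by (simp add: mult.assoc)
qed

lemma sqrt_powr_half: "0 \<le> x \<Longrightarrow> sqrt x powr p = x powr (p / 2)"
  by (simp add: powr_half_sqrt[symmetric] powr_powr)

lemma L2_set_power2: "(L2_set f A)\<^sup>2 = (\<Sum>i\<in>A. (f i)\<^sup>2)"
  by (simp add: L2_set_def sum_nonneg)

lemma L2_set_mono_abs:
  assumes "\<And>i. i \<in> A \<Longrightarrow> \<bar>f i\<bar> \<le> \<bar>g i\<bar>"
  shows "L2_set f A \<le> L2_set g A"
  unfolding L2_set_def using assms by (intro real_sqrt_le_mono sum_mono) (auto simp: abs_le_square_iff)

lemma L2_set_Cauchy_Schwarz: "(\<Sum>i\<in>A. f i * g i) \<le> L2_set f A * L2_set g A"
  by (rule order_trans[OF sum_mono L2_set_mult_ineq]) (metis abs_mult abs_ge_self)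

lemma L2_set_scale: "L2_set (\<lambda>i. c * f i) A = \<bar>c\<bar> * L2_set f A"
  by (simp add: L2_set_def power_mult_distrib sum_distrib_left[symmetric] real_sqrt_mult)

lemma L2_set_minus_triangle: "L2_set (\<lambda>i. f i - g i) A \<le> L2_set f A + L2_set g A"
  using L2_set_triangle_ineq[of f "\<lambda>i. - g i" A] by (simp add: L2_set_def)

text \<open>
  This is the pointwise heart of the maximal inequality. Think of \<open>V k u\<close> as the running maximum of the
  component \<open>u\<close>, so that \<open>sqrt (G k)\<close> is its length. For \<open>p \<ge> 2\<close> the weights \<open>G powr (p/2 - 1)\<close> increase
  and the sum is dominated by its telescoped version; for \<open>p < 2\<close> they decrease and summation by
  parts leads to \<open>powr_concave_chord\<close> with \<open>\<theta> = p - 1\<close>.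
\<close>

lemma L2_weighted_increments_le:
  fixes V :: "nat \<Rightarrow> 'u \<Rightarrow> real" and I :: "'u set"
  assumes p: "1 < p"
    and V0: "\<And>u. V 0 u = 0" and Vm: "\<And>k u. V k u \<le> V (Suc k) u"
  defines "G \<equiv> \<lambda>k. \<Sum>u\<in>I. (V k u)\<^sup>2"
  shows "L2_set (\<lambda>u. \<Sum>k<n. G (Suc k) powr (p/2 - 1) * (V (Suc k) u - V k u)) I
     \<le> max 1 (1/(p-1)) * sqrt (G n) powr (p - 1)"
proof -
  have Vnn: "0 \<le> V k u" for k u
  proof (induction k)
    case (Suc k)
    then show ?case using Vm[of k u] by linarith
  qed (simp add: V0)
  have Vmono: "V j u \<le> V k u" if "j \<le> k" for j k u
    using that
  proof (induction rule: dec_induct)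
    case (step k)
    then show ?case using Vm[of k u] by linarith
  qed simp
  have Gnn: "0 \<le> G k" for k by (simp add: G_def sum_nonneg)
  have Gmono: "G j \<le> G k" if "j \<le> k" for j k
    unfolding G_def using that Vnn Vmono by (intro sum_mono power_mono) auto
  have L2V: "L2_set (V k) I = sqrt (G k)" for k by (simp add: L2_set_def G_def)
  let ?x = "\<lambda>n u. \<Sum>k<n. G (Suc k) powr (p/2 - 1) * (V (Suc k) u - V k u)"
  have G2: "G k powr (p/2 - 1) * sqrt (G k) = sqrt (G k) powr (p - 1)" for k
  proof (cases "G k = 0")
    case False
    then have "0 < G k" using Gnn[of k] by simp
    then have "G k powr (p/2 - 1) * sqrt (G k) = G k powr (p/2 - 1 + 1/2)"
      by (simp only: powr_add powr_half_sqrt)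
    also have "\<dots> = sqrt (G k) powr (p - 1)"
      using Gnn[of k] by (simp add: sqrt_powr_half diff_divide_distrib)
    finally show ?thesis .
  qed simp
  show ?thesis
  proof (cases "p \<ge> 2")
    case True
    have "L2_set (?x n) I \<le> L2_set (\<lambda>u. G n powr (p/2 - 1) * V n u) I"
    proof (rule L2_set_mono)
      fix u assume "u \<in> I"
      show "0 \<le> ?x n u" using Vm by (intro sum_nonneg) auto
      have "?x n u \<le> (\<Sum>k<n. G n powr (p/2 - 1) * (V (Suc k) u - V k u))"
        using Vm True Gnn Gmono by (intro sum_mono mult_right_mono powr_mono2) auto
      also have "\<dots> = G n powr (p/2 - 1) * V n u"
        using sum_lessThan_telescope[of "\<lambda>k. V k u" n] by (simp add: sum_distrib_left[symmetric] V0)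
      finally show "?x n u \<le> G n powr (p/2 - 1) * V n u" .
    qed
    also have "\<dots> = sqrt (G n) powr (p - 1)"
      by (simp add: L2_set_right_distrib[symmetric] L2V G2)
    also have "\<dots> \<le> max 1 (1/(p-1)) * sqrt (G n) powr (p - 1)"
      by (simp add: mult_le_cancel_right1)
    finally show ?thesis .
  next
    case False
    define \<theta> where "\<theta> = p - 1"
    have \<theta>: "0 < \<theta>" "\<theta> \<le> 1" using p False by (auto simp: \<theta>_def)
    define \<beta> where "\<beta> = (1 - \<theta>) / \<theta>"
    \<comment> \<open>Abel summation: subtracting the boundary term leaves a telescoping bound.\<close>
    have main: "L2_set (\<lambda>u. ?x n u - G n powr (p/2 - 1) * V n u) I \<le> \<beta> * sqrt (G n) powr \<theta>" for n
    proof (induction n)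
      case 0
      then show ?case by (simp add: L2_set_def V0 G_def)
    next
      case (Suc n)
      let ?c = "\<lambda>k. G k powr (p/2 - 1)"
      have eq: "?x (Suc n) u - ?c (Suc n) * V (Suc n) u = (?x n u - ?c n * V n u) + (?c n - ?c (Suc n)) * V n u" for u
        by (simp add: algebra_simps)
      have "L2_set (\<lambda>u. ?x (Suc n) u - ?c (Suc n) * V (Suc n) u) I
          \<le> L2_set (\<lambda>u. ?x n u - ?c n * V n u) I + L2_set (\<lambda>u. (?c n - ?c (Suc n)) * V n u) I"
        unfolding eq by (rule L2_set_triangle_ineq)
      also have "L2_set (\<lambda>u. (?c n - ?c (Suc n)) * V n u) I
          \<le> sqrt (G n) powr \<theta> - sqrt (G (Suc n)) powr (\<theta> - 1) * sqrt (G n)"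
      proof (cases "G n = 0")
        case True
        then have "L2_set (V n) I = 0" using L2V[of n] by simp
        then have "L2_set (\<lambda>u. (?c n - ?c (Suc n)) * V n u) I = 0"
          by (simp only: L2_set_scale)
        then show ?thesis using True by simp
      next
        case False
        then have pos: "0 < G n" "0 < G (Suc n)" using Gnn[of n] Gmono[of n "Suc n"] by auto
        have "?c (Suc n) \<le> ?c n"
          using pos False \<theta> Gmono[of n "Suc n"] by (intro powr_mono2') (auto simp: \<theta>_def)
        then have "L2_set (\<lambda>u. (?c n - ?c (Suc n)) * V n u) I = (?c n - ?c (Suc n)) * sqrt (G n)"
          by (simp add: L2_set_right_distrib[symmetric] L2V)
        also have "\<dots> = sqrt (G n) powr \<theta> - sqrt (G (Suc n)) powr (\<theta> - 1) * sqrt (G n)"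
          using pos G2[of n] by (simp add: \<theta>_def left_diff_distrib sqrt_powr_half diff_divide_distrib)
        finally show ?thesis by simp
      qed
      also have "\<dots> \<le> \<beta> * (sqrt (G (Suc n)) powr \<theta> - sqrt (G n) powr \<theta>)"
        unfolding \<beta>_def using \<theta> Gnn Gmono[of n "Suc n"] by (intro powr_concave_chord) auto
      finally show ?case using Suc by (simp add: algebra_simps)
    qed
    have "L2_set (?x n) I = L2_set (\<lambda>u. (?x n u - G n powr (p/2 - 1) * V n u) + G n powr (p/2 - 1) * V n u) I"
      by simp
    also have "\<dots> \<le> L2_set (\<lambda>u. ?x n u - G n powr (p/2 - 1) * V n u) I + L2_set (\<lambda>u. G n powr (p/2 - 1) * V n u) I"
      by (rule L2_set_triangle_ineq)
    also have "\<dots> \<le> \<beta> * sqrt (G n) powr \<theta> + sqrt (G n) powr \<theta>"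
      using main[of n] by (simp add: L2_set_right_distrib[symmetric] L2V G2 \<theta>_def)
    also have "\<dots> = (1/(p-1)) * sqrt (G n) powr (p-1)"
      using \<theta> by (simp add: \<beta>_def \<theta>_def field_simps)
    also have "\<dots> \<le> max 1 (1/(p-1)) * sqrt (G n) powr (p - 1)"
      by (intro mult_right_mono) auto
    finally show ?thesis .
  qed
qed

definition maximal_const :: "real \<Rightarrow> real" where
  "maximal_const p = 2 * max 1 (p/2) * max 1 (1/(p-1))"

lemma maximal_const_ge: "2 \<le> maximal_const p"
proof -
  have "1 * 1 \<le> max 1 (p/2) * max 1 (1/(p-1))" by (intro mult_mono) auto
  then show ?thesis unfolding maximal_const_def by simp
qed

section \<open>Martingales on a finite set\<close>

text \<open>
  The set \<open>cl k x\<close> is the cell of generation \<open>k\<close> that contains \<open>x\<close>. Weights may vanish, so the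
  average over a null cell is \<open>0 / 0 = 0\<close>. Averaging over the finest cells thus reproduces a function only
  up to weight zero, which integration against the weight does not notice.
\<close>

locale finite_filtration =
  fixes X :: "'a set" and cl :: "nat \<Rightarrow> 'a \<Rightarrow> 'a set" and M :: nat
  assumes fin: "finite X"
    and cl_self: "x \<in> X \<Longrightarrow> x \<in> cl k x"
    and cl_sub: "x \<in> X \<Longrightarrow> cl k x \<subseteq> X"
    and cl_eq: "x \<in> X \<Longrightarrow> y \<in> cl k x \<Longrightarrow> cl k y = cl k x"
    and cl_Suc: "x \<in> X \<Longrightarrow> cl (Suc k) x \<subseteq> cl k x"
    and cl_fine: "x \<in> X \<Longrightarrow> M \<le> k \<Longrightarrow> cl k x = {x}"
begin

lemma cl_mono:
  assumes x: "x \<in> X" and "j \<le> k"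
  shows "cl k x \<subseteq> cl j x"
  using \<open>j \<le> k\<close>
proof (induction k rule: dec_induct)
  case (step k)
  then show ?case using cl_Suc[OF x, of k] by blast
qed simp

lemma cl_sym: "x \<in> X \<Longrightarrow> y \<in> X \<Longrightarrow> y \<in> cl k x \<longleftrightarrow> x \<in> cl k y"
  using cl_self cl_eq by blast

definition adapted :: "nat \<Rightarrow> ('a \<Rightarrow> 'b) \<Rightarrow> bool" where
  "adapted k f \<longleftrightarrow> (\<forall>x\<in>X. \<forall>y\<in>cl k x. f y = f x)"

lemma adaptedI: "(\<And>x y. x \<in> X \<Longrightarrow> y \<in> X \<Longrightarrow> y \<in> cl k x \<Longrightarrow> f y = f x) \<Longrightarrow> adapted k f"
  unfolding adapted_def using cl_sub by blast

lemma adaptedD: "adapted k f \<Longrightarrow> x \<in> X \<Longrightarrow> y \<in> cl k x \<Longrightarrow> f y = f x"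
  unfolding adapted_def by blast

lemma adapted_mono: "adapted j f \<Longrightarrow> j \<le> k \<Longrightarrow> adapted k f"
  unfolding adapted_def using cl_mono by blast

lemma adapted_comp: "adapted k f \<Longrightarrow> adapted k (\<lambda>x. h (f x))"
  unfolding adapted_def by auto

lemma adapted_comp2: "adapted k f \<Longrightarrow> adapted k g \<Longrightarrow> adapted k (\<lambda>x. h (f x) (g x))"
  unfolding adapted_def by auto

lemma adapted_sum: "(\<And>i. i \<in> I \<Longrightarrow> adapted k (f i)) \<Longrightarrow> adapted k (\<lambda>x. \<Sum>i\<in>I. f i x)"
  unfolding adapted_def by (auto intro!: sum.cong)

lemma adapted_L2: "(\<And>i. i \<in> I \<Longrightarrow> adapted k (f i)) \<Longrightarrow> adapted k (\<lambda>x. L2_set (\<lambda>i. f i x) I)"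
  unfolding adapted_def by (auto intro!: L2_set_cong)

end

locale weighted_filtration = finite_filtration +
  fixes \<mu> :: "'a \<Rightarrow> real"
  assumes weight_nonneg: "x \<in> X \<Longrightarrow> 0 \<le> \<mu> x"
begin

definition avg :: "nat \<Rightarrow> ('a \<Rightarrow> real) \<Rightarrow> 'a \<Rightarrow> real" where
  "avg k f x = (\<Sum>y\<in>cl k x. \<mu> y * f y) / (\<Sum>y\<in>cl k x. \<mu> y)"

lemma adapted_avg: "adapted k (avg k f)"
  unfolding adapted_def avg_def using cl_eq by metis

lemma fin_cl: "x \<in> X \<Longrightarrow> finite (cl k x)"
  using fin cl_sub finite_subset by blast

lemma cl_weight_nonneg: "x \<in> X \<Longrightarrow> 0 \<le> (\<Sum>y\<in>cl k x. \<mu> y)"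
  using weight_nonneg cl_sub by (intro sum_nonneg) blast

lemma sum_cl_eq: "x \<in> X \<Longrightarrow> (\<Sum>y\<in>cl k x. g y) = (\<Sum>y\<in>X. if y \<in> cl k x then g y else 0)"
  using cl_sub[of x k] by (simp add: sum.If_cases fin Int_absorb1)

lemma cl_null: "x \<in> X \<Longrightarrow> (\<Sum>y\<in>cl k x. \<mu> y) = 0 \<Longrightarrow> y \<in> cl k x \<Longrightarrow> \<mu> y = 0"
  using sum_nonneg_eq_0_iff[of "cl k x" \<mu>] fin_cl[of x k] weight_nonneg cl_sub[of x k] by blast

lemma cl_weight_avg: "x \<in> X \<Longrightarrow> (\<Sum>y\<in>cl k x. \<mu> y) * avg k f x = (\<Sum>y\<in>cl k x. \<mu> y * f y)"
  using cl_null[of x k] by (cases "(\<Sum>y\<in>cl k x. \<mu> y) = 0") (auto simp: avg_def)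

text \<open>
  Averaging over cells is self-adjoint, since \<open>y \<in> cl k x\<close> is a symmetric relation; functions
  that are constant on cells are reproduced up to weight zero.
\<close>

lemma integral_avg:
  assumes \<phi>: "adapted k \<phi>"
  shows "(\<Sum>x\<in>X. \<mu> x * (\<phi> x * avg k f x)) = (\<Sum>x\<in>X. \<mu> x * (\<phi> x * f x))"
proof -
  let ?m = "\<lambda>x. \<Sum>y\<in>cl k x. \<mu> y"
  have "(\<Sum>x\<in>X. \<mu> x * (\<phi> x * avg k f x)) =
      (\<Sum>x\<in>X. \<Sum>y\<in>X. if y \<in> cl k x then \<mu> x * \<phi> x * (\<mu> y * f y) / ?m x else 0)"
  proof (intro sum.cong refl)
    fix x assume x: "x \<in> X"
    have "\<mu> x * (\<phi> x * avg k f x) = (\<Sum>y\<in>cl k x. \<mu> x * \<phi> x * (\<mu> y * f y) / ?m x)"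
      by (simp add: avg_def sum_divide_distrib sum_distrib_left mult.assoc)
    then show "\<mu> x * (\<phi> x * avg k f x) =
        (\<Sum>y\<in>X. if y \<in> cl k x then \<mu> x * \<phi> x * (\<mu> y * f y) / ?m x else 0)"
      using sum_cl_eq[OF x] by metis
  qed
  also have "\<dots> = (\<Sum>y\<in>X. \<Sum>x\<in>X. if y \<in> cl k x then \<mu> x * \<phi> x * (\<mu> y * f y) / ?m x else 0)"
    by (rule sum.swap)
  also have "\<dots> = (\<Sum>y\<in>X. \<mu> y * (\<phi> y * f y))"
  proof (intro sum.cong refl)
    fix y assume y: "y \<in> X"
    have "(\<Sum>x\<in>X. if y \<in> cl k x then \<mu> x * \<phi> x * (\<mu> y * f y) / ?m x else 0) =
        (\<Sum>x\<in>X. if x \<in> cl k y then \<mu> x * (\<phi> y * (\<mu> y * f y) / ?m y) else 0)"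
    proof (intro sum.cong refl)
      fix x assume x: "x \<in> X"
      have "x \<in> cl k y \<Longrightarrow> cl k x = cl k y \<and> \<phi> x = \<phi> y"
        using y cl_eq adaptedD[OF \<phi>] by blast
      then show "(if y \<in> cl k x then \<mu> x * \<phi> x * (\<mu> y * f y) / ?m x else 0) =
          (if x \<in> cl k y then \<mu> x * (\<phi> y * (\<mu> y * f y) / ?m y) else 0)"
        using cl_sym[OF x y] by auto
    qed
    also have "\<dots> = (\<Sum>x\<in>cl k y. \<mu> x * (\<phi> y * (\<mu> y * f y) / ?m y))"
      by (rule sum_cl_eq[OF y, symmetric])
    also have "\<dots> = ?m y * (\<phi> y * (\<mu> y * f y) / ?m y)"
      by (simp only: sum_distrib_right)
    also have "\<dots> = \<mu> y * (\<phi> y * f y)"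
      using cl_null[OF y _ cl_self[OF y]] by (cases "?m y = 0") auto
    finally show "(\<Sum>x\<in>X. if y \<in> cl k x then \<mu> x * \<phi> x * (\<mu> y * f y) / ?m x else 0) = \<mu> y * (\<phi> y * f y)" .
  qed
  finally show ?thesis .
qed

lemma abs_avg_le: "x \<in> X \<Longrightarrow> \<bar>avg k f x\<bar> \<le> avg k (\<lambda>y. \<bar>f y\<bar>) x"
  unfolding avg_def abs_divide
  using cl_weight_nonneg[of x k] weight_nonneg cl_sub[of x k]
  by (auto intro!: divide_right_mono order_trans[OF sum_abs] sum_mono simp: abs_mult)

lemma avg_nonneg: "x \<in> X \<Longrightarrow> (\<And>y. y \<in> X \<Longrightarrow> 0 \<le> f y) \<Longrightarrow> 0 \<le> avg k f x"
  unfolding avg_def using cl_weight_nonneg[of x k] weight_nonneg cl_sub[of x k]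
  by (intro divide_nonneg_nonneg sum_nonneg) (auto intro!: mult_nonneg_nonneg)

lemma avg_fine: "x \<in> X \<Longrightarrow> M \<le> k \<Longrightarrow> \<mu> x \<noteq> 0 \<Longrightarrow> avg k f x = f x"
  by (simp add: avg_def cl_fine)

text \<open>
  Generation \<open>k\<close> uses the averages of generations below \<open>k\<close> only, and starts at \<open>0\<close>, so that the
  increments from \<open>k\<close> to \<open>Suc k\<close> sum up to the whole maximal function.
\<close>

primrec running_max :: "('a \<Rightarrow> real) \<Rightarrow> nat \<Rightarrow> 'a \<Rightarrow> real" where
  "running_max f 0 x = 0"
| "running_max f (Suc k) x = max (running_max f k x) (avg k (\<lambda>y. \<bar>f y\<bar>) x)"

lemma running_max_nonneg: "0 \<le> running_max f k x"
  by (induction k) auto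

lemma running_max_mono: "j \<le> k \<Longrightarrow> running_max f j x \<le> running_max f k x"
  by (induction rule: dec_induct) auto

lemma avg_le_running_max: "j < k \<Longrightarrow> avg j (\<lambda>y. \<bar>f y\<bar>) x \<le> running_max f k x"
  using running_max_mono[of "Suc j" k f x] by auto

lemma abs_avg_le_running_max: "x \<in> X \<Longrightarrow> j < k \<Longrightarrow> \<bar>avg j f x\<bar> \<le> running_max f k x"
  using abs_avg_le avg_le_running_max by (rule order_trans)

lemma adapted_running_max: "adapted k (running_max f (Suc k))"
proof (induction k)
  case 0
  then show ?case using adapted_avg[of 0 "\<lambda>y. \<bar>f y\<bar>"] by (auto simp: adapted_def)
next
  case (Suc k)
  have "adapted (Suc k) (running_max f (Suc k))" using Suc by (rule adapted_mono) simp
  moreover have "adapted (Suc k) (avg (Suc k) (\<lambda>y. \<bar>f y\<bar>))" by (rule adapted_avg)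
  ultimately show ?case by (auto simp: adapted_def)
qed

lemma adapted_running_max': "adapted k (running_max f k)"
proof (cases k)
  case 0 then show ?thesis by (simp add: adapted_def)
next
  case (Suc j)
  then show ?thesis using adapted_mono[OF adapted_running_max[of j f], of k] by simp
qed

text \<open>
  The running maximum only moves at generations where it equals the current average, and there
  \<open>a\<^sup>2 - m\<^sup>2 \<le> 2 a (a - m)\<close>.
\<close>

lemma running_max_step:
  "(running_max f (Suc k) x)\<^sup>2 - (running_max f k x)\<^sup>2 \<le> 2 * (avg k (\<lambda>y. \<bar>f y\<bar>) x * (running_max f (Suc k) x - running_max f k x))"
proof (cases "avg k (\<lambda>y. \<bar>f y\<bar>) x \<le> running_max f k x")
  case False
  define a where "a = avg k (\<lambda>y. \<bar>f y\<bar>) x"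
  have "a\<^sup>2 - (running_max f k x)\<^sup>2 \<le> 2 * (a * (a - running_max f k x))"
    using zero_le_power2[of "a - running_max f k x"] by (simp add: power2_eq_square algebra_simps)
  then show ?thesis using False by (simp add: a_def)
qed (simp add: max_def)

text \<open>
  Write the \<open>p\<close>-th power of the length of the vector of running maxima as a telescoping sum. Each
  increment contains the current average of \<open>|f u|\<close> multiplied by an adapted function, so the average may be
  replaced by \<open>|f u|\<close> itself. The sums over the generations that remain are bounded by
  \<open>L2_weighted_increments_le\<close>, which leaves \<open>\<Sum> h Y\<^bsup>p - 1\<^esup>\<close>, and \<open>Young_absorb\<close> concludes. Compared with the
  usual proof through duality or through interpolation, this one treats vectors directly and gives an
  explicit constant.
\<close>

theorem maximal_inequality:
  fixes f :: "'u \<Rightarrow> 'a \<Rightarrow> real"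
  assumes p: "1 < p" 
  shows "(\<Sum>x\<in>X. \<mu> x * L2_set (\<lambda>u. running_max (f u) n x) I powr p)
     \<le> maximal_const p powr p * (\<Sum>x\<in>X. \<mu> x * L2_set (\<lambda>u. f u x) I powr p)"
proof -
  define V where "V k u x = running_max (f u) k x" for k u x
  define G where "G k x = (\<Sum>u\<in>I. (V k u x)\<^sup>2)" for k x
  define c where "c = max 1 (p/2)"
  define s where "s k u x = avg k (\<lambda>y. \<bar>f u y\<bar>) x" for k u x
  define K where "K = maximal_const p"
  define h where "h x = L2_set (\<lambda>u. f u x) I" for x
  define Y where "Y x = sqrt (G n x)" for x
  have c: "c > 0" by (simp add: c_def)
  have Vmono: "V k u x \<le> V (Suc k) u x" for k u x by (simp add: V_def)
  have Vnn: "0 \<le> V k u x" for k u x by (simp add: V_def running_max_nonneg)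
  have Gnn: "0 \<le> G k x" for k x by (simp add: G_def sum_nonneg)
  have Gmono: "G k x \<le> G (Suc k) x" for k x
    unfolding G_def using Vmono Vnn by (intro sum_mono power_mono) auto
  have LY: "L2_set (\<lambda>u. running_max (f u) n x) I = Y x" for x
    by (simp add: Y_def G_def V_def L2_set_def)
  define w where "w k x = 2 * c * G (Suc k) x powr (p/2 - 1)" for k x
  have step: "G (Suc k) x powr (p/2) - G k x powr (p/2)
      \<le> (\<Sum>u\<in>I. w k x * (V (Suc k) u x - V k u x) * s k u x)" for k x
  proof -
    have "G (Suc k) x powr (p/2) - G k x powr (p/2) \<le> c * (G (Suc k) x powr (p/2 - 1) * (G (Suc k) x - G k x))"
      unfolding c_def using p Gnn Gmono by (intro powr_increment_le) auto
    also have "\<dots> \<le> c * (G (Suc k) x powr (p/2 - 1) * (\<Sum>u\<in>I. 2 * (s k u x * (V (Suc k) u x - V k u x))))"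
      unfolding G_def sum_subtractf[symmetric] V_def s_def using c
      by (intro mult_left_mono sum_mono running_max_step) auto
    also have "\<dots> = (\<Sum>u\<in>I. w k x * (V (Suc k) u x - V k u x) * s k u x)"
      by (simp add: sum_distrib_left w_def mult_ac)
    finally show ?thesis .
  qed
  have "(\<Sum>x\<in>X. \<mu> x * Y x powr p) = (\<Sum>x\<in>X. \<mu> x * (\<Sum>k<n. G (Suc k) x powr (p/2) - G k x powr (p/2)))"
  proof (intro sum.cong refl arg_cong2[where f="(*)"])
    fix x
    have "G 0 x = 0" by (simp add: G_def V_def)
    then show "Y x powr p = (\<Sum>k<n. G (Suc k) x powr (p/2) - G k x powr (p/2))"
      using sum_lessThan_telescope[of "\<lambda>k. G k x powr (p/2)" n] Gnn by (simp add: Y_def sqrt_powr_half)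
  qed
  also have "\<dots> \<le> (\<Sum>x\<in>X. \<mu> x * (\<Sum>k<n. \<Sum>u\<in>I. w k x * (V (Suc k) u x - V k u x) * s k u x))"
    by (intro sum_mono mult_left_mono step weight_nonneg)
  also have "\<dots> = (\<Sum>k<n. \<Sum>u\<in>I. \<Sum>x\<in>X. \<mu> x * (w k x * (V (Suc k) u x - V k u x) * s k u x))"
    by (simp only: sum_distrib_left) (subst sum.swap, subst (2) sum.swap, rule refl)
  \<comment> \<open>The weight and the increment are constant on cells of generation \<open>k\<close>: here the average is undone.\<close>
  also have "\<dots> = (\<Sum>k<n. \<Sum>u\<in>I. \<Sum>x\<in>X. \<mu> x * (w k x * (V (Suc k) u x - V k u x) * \<bar>f u x\<bar>))"
  proof (rule sum.cong[OF refl], rule sum.cong[OF refl])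
    fix k u
    have "adapted k (V (Suc k) u)" "adapted k (V k u)" for u
      unfolding V_def using adapted_running_max adapted_running_max' by auto
    moreover from this have "adapted k (G (Suc k))"
      unfolding G_def by (intro adapted_sum) (auto simp: adapted_def)
    ultimately have "adapted k (\<lambda>x. w k x * (V (Suc k) u x - V k u x))"
      by (auto simp: adapted_def w_def)
    from integral_avg[OF this, of "\<lambda>y. \<bar>f u y\<bar>"]
    show "(\<Sum>x\<in>X. \<mu> x * (w k x * (V (Suc k) u x - V k u x) * s k u x)) = 
      (\<Sum>x\<in>X. \<mu> x * (w k x * (V (Suc k) u x - V k u x) * \<bar>f u x\<bar>))" 
      by (simp add: s_def)
  qed
  also have "\<dots> = (\<Sum>x\<in>X. \<mu> x * (\<Sum>u\<in>I. \<bar>f u x\<bar> * (\<Sum>k<n. w k x * (V (Suc k) u x - V k u x))))"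
    by (simp only: sum_distrib_left) 
      (subst sum.swap, subst (2) sum.swap, subst (1) sum.swap, simp add: mult_ac)
  also have "\<dots> \<le> (\<Sum>x\<in>X. \<mu> x * (K * (h x * Y x powr (p - 1))))"
  proof (intro sum_mono mult_left_mono weight_nonneg)
    fix x
    have "(\<Sum>u\<in>I. \<bar>f u x\<bar> * (\<Sum>k<n. w k x * (V (Suc k) u x - V k u x)))
       \<le> L2_set (\<lambda>u. \<bar>f u x\<bar>) I * L2_set (\<lambda>u. \<Sum>k<n. w k x * (V (Suc k) u x - V k u x)) I"
      by (rule L2_set_Cauchy_Schwarz)
    also have "L2_set (\<lambda>u. \<bar>f u x\<bar>) I = h x" by (simp add: h_def L2_set_def)
    also have "L2_set (\<lambda>u. \<Sum>k<n. w k x * (V (Suc k) u x - V k u x)) I =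
       2 * c * L2_set (\<lambda>u. \<Sum>k<n. G (Suc k) x powr (p/2 - 1) * (V (Suc k) u x - V k u x)) I"
      using c by (simp add: w_def mult.assoc sum_distrib_left[symmetric] L2_set_right_distrib[symmetric])
    also have "h x * (2 * c * L2_set (\<lambda>u. \<Sum>k<n. G (Suc k) x powr (p/2 - 1) * (V (Suc k) u x - V k u x)) I)
       \<le> h x * (2 * c * (max 1 (1/(p-1)) * sqrt (G n x) powr (p - 1)))"
      unfolding G_def using L2_weighted_increments_le[OF p, of "\<lambda>k u. V k u x" I n] Vmono c
      by (intro mult_left_mono) (auto simp: V_def h_def)
    finally show "(\<Sum>u\<in>I. \<bar>f u x\<bar> * (\<Sum>k<n. w k x * (V (Suc k) u x - V k u x))) \<le> K * (h x * Y x powr (p - 1))"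
      by (simp add: K_def maximal_const_def c_def Y_def mult_ac)
  qed
  also have "\<dots> \<le> (\<Sum>x\<in>X. \<mu> x * ((K * h x) powr p / p + (1 - 1/p) * Y x powr p))"
    using p maximal_const_ge[of p]
    by (intro sum_mono mult_left_mono weight_nonneg Young_absorb) (auto simp: h_def Y_def K_def Gnn)
  also have "\<dots> = K powr p / p * (\<Sum>x\<in>X. \<mu> x * h x powr p) + (1 - 1/p) * (\<Sum>x\<in>X. \<mu> x * Y x powr p)"
    using maximal_const_ge[of p]
    by (simp add: sum_distrib_left sum.distrib[symmetric] powr_mult K_def h_def algebra_simps)
  finally have "(\<Sum>x\<in>X. \<mu> x * Y x powr p) / p \<le> K powr p / p * (\<Sum>x\<in>X. \<mu> x * h x powr p)"
    using p by (simp add: algebra_simps)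
  then show ?thesis using p by (simp add: LY K_def h_def divide_le_cancel)
qed

end

section \<open>Weighted norms on a finite set\<close>

definition wnorm :: "'a set \<Rightarrow> ('a \<Rightarrow> real) \<Rightarrow> real \<Rightarrow> ('a \<Rightarrow> real) \<Rightarrow> real" where
  "wnorm X \<mu> p F = (\<Sum>x\<in>X. \<mu> x * F x powr p) powr (1 / p)"

lemma wnorm_nonneg [simp]: "0 \<le> wnorm X \<mu> p F"
  by (simp add: wnorm_def)

lemma wnorm_cong: "(\<And>x. x \<in> X \<Longrightarrow> F x = G x) \<Longrightarrow> wnorm X \<mu> p F = wnorm X \<mu> p G"
  by (simp add: wnorm_def)

lemma wnorm_powr:
  assumes "\<And>x. x \<in> X \<Longrightarrow> 0 \<le> \<mu> x" "0 < p"
  shows "wnorm X \<mu> p F powr p = (\<Sum>x\<in>X. \<mu> x * F x powr p)"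
  using assms by (simp add: wnorm_def powr_powr sum_nonneg)

text \<open>The bridge between the norms and the power sums in which the martingale estimates are phrased.\<close>

lemma wnorm_le_iff:
  assumes "\<And>x. x \<in> X \<Longrightarrow> 0 \<le> \<mu> x" "0 < p" "\<And>x. x \<in> Y \<Longrightarrow> 0 \<le> \<nu> x" "0 \<le> C"
  shows "wnorm X \<mu> p F \<le> C * wnorm Y \<nu> p G \<longleftrightarrow>
    (\<Sum>x\<in>X. \<mu> x * F x powr p) \<le> C powr p * (\<Sum>x\<in>Y. \<nu> x * G x powr p)"
proof -
  have "wnorm X \<mu> p F \<le> C * wnorm Y \<nu> p G \<longleftrightarrow> wnorm X \<mu> p F powr p \<le> (C * wnorm Y \<nu> p G) powr p"
  proof
    assume le: "wnorm X \<mu> p F powr p \<le> (C * wnorm Y \<nu> p G) powr p"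
    show "wnorm X \<mu> p F \<le> C * wnorm Y \<nu> p G"
    proof (rule ccontr)
      assume "\<not> wnorm X \<mu> p F \<le> C * wnorm Y \<nu> p G"
      then have "(C * wnorm Y \<nu> p G) powr p < wnorm X \<mu> p F powr p"
        using assms by (intro powr_less_mono2) auto
      then show False using le by simp
    qed
  qed (use assms in \<open>auto intro: powr_mono2\<close>)
  also have "\<dots> \<longleftrightarrow> (\<Sum>x\<in>X. \<mu> x * F x powr p) \<le> C powr p * (\<Sum>x\<in>Y. \<nu> x * G x powr p)"
    using assms by (simp add: powr_mult wnorm_powr)
  finally show ?thesis .
qed

lemma wnorm_mono:
  assumes "\<And>x. x \<in> X \<Longrightarrow> 0 \<le> \<mu> x" "0 < p" 
    "\<And>x. x \<in> X \<Longrightarrow> 0 \<le> F x" "\<And>x. x \<in> X \<Longrightarrow> F x \<le> G x"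
  shows "wnorm X \<mu> p F \<le> wnorm X \<mu> p G"
  unfolding wnorm_def using assms 
  by (intro powr_mono2 sum_mono mult_left_mono sum_nonneg) auto

lemma wnorm_scale:
  assumes "\<And>x. x \<in> X \<Longrightarrow> 0 \<le> \<mu> x" "0 < p" "0 \<le> c" "\<And>x. x \<in> X \<Longrightarrow> 0 \<le> F x"
  shows "wnorm X \<mu> p (\<lambda>x. c * F x) = c * wnorm X \<mu> p F"
proof -
  have "(\<Sum>x\<in>X. \<mu> x * (c * F x) powr p) = c powr p * (\<Sum>x\<in>X. \<mu> x * F x powr p)"
    using assms by (simp add: sum_distrib_left powr_mult mult_ac)
  then show ?thesis using assms by (simp add: wnorm_def powr_mult powr_powr sum_nonneg)
qed

lemma conj_exponent_gt_1: "1 < p \<Longrightarrow> 1 < conj_exponent p"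
  by (simp add: conj_exponent_def field_simps)

lemma conj_exponent_sum: "1 < p \<Longrightarrow> 1 / p + 1 / conj_exponent p = 1"
  by (simp add: conj_exponent_def field_simps)

lemma conj_conj_exponent: "1 < p \<Longrightarrow> conj_exponent (conj_exponent p) = p"
  by (simp add: conj_exponent_def field_simps)

lemma wnorm_Hoelder:
  assumes X: "finite X" and \<mu>: "\<And>x. x \<in> X \<Longrightarrow> 0 \<le> \<mu> x" and p: "1 < p"
    and F: "\<And>x. x \<in> X \<Longrightarrow> 0 \<le> F x" and G: "\<And>x. x \<in> X \<Longrightarrow> 0 \<le> G x"
  shows "(\<Sum>x\<in>X. \<mu> x * (F x * G x)) \<le> wnorm X \<mu> p F * wnorm X \<mu> (conj_exponent p) G"
proof -
  let ?q = "conj_exponent p"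
  define a where "a = wnorm X \<mu> p F"
  define b where "b = wnorm X \<mu> ?q G"
  have q: "1 < ?q" "1/p + 1/?q = 1" using p by (auto simp: conj_exponent_gt_1 conj_exponent_sum)
  have null: "(\<Sum>x\<in>X. \<mu> x * (F x * G x)) = 0" if "wnorm X \<mu> r H = 0" "0 < r" "\<And>x. x \<in> X \<Longrightarrow> H x = 0 \<Longrightarrow> F x * G x = 0" for r H
  proof -
    have "(\<Sum>x\<in>X. \<mu> x * H x powr r) = 0" using that \<mu> wnorm_powr[of X \<mu> r H] by simp
    then have "\<forall>x\<in>X. \<mu> x * H x powr r = 0" using \<mu> X by (subst (asm) sum_nonneg_eq_0_iff) auto
    then show ?thesis using that by (intro sum.neutral) auto
  qed
  show ?thesis
  proof (cases "a = 0 \<or> b = 0")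
    case True
    then have "(\<Sum>x\<in>X. \<mu> x * (F x * G x)) = 0"
      using null[of p F] null[of ?q G] p q by (auto simp: a_def b_def)
    then show ?thesis by (simp add: mult_nonneg_nonneg)
  next
    case False
    then have ab: "0 < a" "0 < b" by (auto simp: a_def b_def less_le)
    have "(\<Sum>x\<in>X. \<mu> x * ((F x / a) * (G x / b))) \<le> (\<Sum>x\<in>X. \<mu> x * ((F x / a) powr p / p + (G x / b) powr ?q / ?q))"
      using p q \<mu> F G ab by (intro sum_mono mult_left_mono Youngs_inequality) auto
    also have "\<dots> = (\<Sum>x\<in>X. \<mu> x * F x powr p) / a powr p / p + (\<Sum>x\<in>X. \<mu> x * G x powr ?q) / b powr ?q / ?q"
      using F G ab by (simp add: powr_divide distrib_left sum.distrib sum_divide_distrib)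
    also have "\<dots> = 1"
      using ab p q \<mu> by (simp add: wnorm_powr[symmetric] a_def[symmetric] b_def[symmetric])
    finally have "(\<Sum>x\<in>X. \<mu> x * (F x * G x)) / (a * b) \<le> 1"
      by (simp add: sum_divide_distrib)
    then show ?thesis using ab by (simp add: a_def b_def divide_le_eq)
  qed
qed

lemma wnorm_pairing:
  assumes X: "finite X" and \<mu>: "\<And>x. x \<in> X \<Longrightarrow> 0 \<le> \<mu> x" and p: "1 < p"
  shows "(\<Sum>x\<in>X. \<mu> x * (\<Sum>i\<in>I. f i x * g i x))
    \<le> wnorm X \<mu> p (\<lambda>x. L2_set (\<lambda>i. f i x) I) * wnorm X \<mu> (conj_exponent p) (\<lambda>x. L2_set (\<lambda>i. g i x) I)"
  by (rule order_trans[OF sum_mono wnorm_Hoelder])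
     (use assms in \<open>auto intro!: mult_left_mono L2_set_Cauchy_Schwarz\<close>)

text \<open>The converse of Hoelder's inequality: \<open>g = f |f|^(p - 2)\<close> is extremal.\<close>

lemma wnorm_duality:
  assumes X: "finite X" and \<mu>: "\<And>x. x \<in> X \<Longrightarrow> 0 \<le> \<mu> x" and p: "1 < p" and C: "0 \<le> C"
    and le: "\<And>g. (\<Sum>x\<in>X. \<mu> x * (\<Sum>i\<in>I. f i x * g i x)) 
        \<le> C * wnorm X \<mu> (conj_exponent p) (\<lambda>x. L2_set (\<lambda>i. g i x) I)"
  shows "wnorm X \<mu> p (\<lambda>x. L2_set (\<lambda>i. f i x) I) \<le> C"
proof -
  let ?q = "conj_exponent p"
  define F where "F x = L2_set (\<lambda>i. f i x) I" for x
  define g where "g i x = F x powr (p - 2) * f i x" for i x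
  define N where "N = wnorm X \<mu> p F"
  have Fnn: "0 \<le> F x" for x by (simp add: F_def)
  have Lg: "L2_set (\<lambda>i. g i x) I = F x powr (p - 1)" for x
  proof -
    have "L2_set (\<lambda>i. g i x) I = F x powr (p - 2) * F x"
      unfolding g_def L2_set_scale by (simp add: F_def)
    also have "\<dots> = F x powr (p - 1)"
      using Fnn[of x] powr_mult_base[of "F x" "p - 2"] by (cases "F x = 0") (auto simp: mult.commute)
    finally show ?thesis .
  qed
  have pair: "(\<Sum>i\<in>I. f i x * g i x) = F x powr p" for x
  proof -
    have "(\<Sum>i\<in>I. f i x * g i x) = F x powr (p - 2) * (\<Sum>i\<in>I. (f i x)\<^sup>2)"
      by (simp add: g_def sum_distrib_left power2_eq_square mult_ac)
    also have "\<dots> = F x powr (p - 2) * (F x)\<^sup>2" by (simp add: F_def L2_set_power2)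
    also have "\<dots> = F x powr p"
    proof (cases "F x = 0")
      case False
      then have "0 < F x" using Fnn[of x] by simp
      then show ?thesis by (simp add: powr_numeral[symmetric] powr_add[symmetric] del: powr_numeral)
    qed simp
    finally show ?thesis .
  qed
  have "N powr p = (\<Sum>x\<in>X. \<mu> x * F x powr p)" unfolding N_def using \<mu> p by (intro wnorm_powr) auto
  also have "\<dots> = (\<Sum>x\<in>X. \<mu> x * (\<Sum>i\<in>I. f i x * g i x))" by (simp add: pair)
  also have "\<dots> \<le> C * wnorm X \<mu> ?q (\<lambda>x. F x powr (p - 1))" using le[of g] by (simp add: Lg)
  also have "wnorm X \<mu> ?q (\<lambda>x. F x powr (p - 1)) = N powr (p - 1)"
  proof -
    have "(p - 1) * ?q = p" "1 / ?q = 1/p * (p - 1)" using p by (auto simp: conj_exponent_def field_simps)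
    then show ?thesis by (simp add: wnorm_def N_def powr_powr)
  qed
  finally have le': "N powr p \<le> C * N powr (p - 1)" .
  show ?thesis
  proof (cases "N = 0")
    case False
    then have N: "0 < N" by (simp add: N_def less_le)
    have "N powr p = N * N powr (p - 1)" using N powr_mult_base[of N "p - 1"] by simp
    then show ?thesis using le' N by (simp add: N_def F_def[abs_def])
  qed (use C in \<open>simp add: N_def F_def[abs_def]\<close>)
qed

section \<open>Stein's inequality and square functions\<close>

lemma L2_set_Times:
  "L2_set (\<lambda>(i, j). f i j) (I \<times> J) = sqrt (\<Sum>j\<in>J. \<Sum>i\<in>I. (f i j)\<^sup>2)"
  unfolding L2_set_def by (subst sum.swap) (simp add: sum.cartesian_product split_def)

text \<open>
  It controls the cross terms that appear when a decreasing weight \<open>G powr (r - 1)\<close> is moved from one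
  generation to the previous one. The lower bound on \<open>r\<close> makes \<open>t powr (r - 1/2)\<close> increasing.
\<close>

lemma powr_cross_term_le:
  fixes a b r :: real
  assumes "1/2 \<le> r" "r \<le> 1" "0 < a" "a \<le> b"
  shows "(a powr (r - 1) - b powr (r - 1)) * (sqrt a * sqrt b) \<le> b powr r - a powr r"
proof -
  have ab: "0 < b" using assms by simp
  have e: "c powr (r - 1) * sqrt c = c powr (r - 1/2)" if "0 < c" for c
    using that by (simp add: powr_half_sqrt[symmetric] powr_add[symmetric])
  have f: "c powr (r - 1/2) * sqrt c = c powr r" if "0 < c" for c
    using that by (simp add: powr_half_sqrt[symmetric] powr_add[symmetric])
  have "a powr (r - 1/2) * sqrt b \<le> b powr (r - 1/2) * sqrt b"
    using assms by (intro mult_right_mono powr_mono2) auto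
  moreover have "a powr (r - 1/2) * sqrt a \<le> b powr (r - 1/2) * sqrt a"
    using assms by (intro mult_right_mono powr_mono2) auto
  ultimately have "a powr (r - 1/2) * sqrt b - b powr (r - 1/2) * sqrt a \<le> b powr r - a powr r"
    using f[of a] f[of b] assms ab by linarith
  then show ?thesis using e[of a, symmetric] e[of b, symmetric] assms ab by (simp add: algebra_simps)
qed

definition square_const :: "real \<Rightarrow> real" where
  "square_const p = 5 * max 1 p * maximal_const p"

lemma square_const_pos: "0 < square_const p"
  using maximal_const_ge[of p] by (simp add: square_const_def)

context weighted_filtration
begin

text \<open>
  Averages are dominated by the maximal function, so no martingale structure of the family \<open>h\<close> is
  involved; in particular the generation may depend on the index in any way.
\<close>

theorem Stein_inequality:
  fixes h :: "'i \<Rightarrow> 'a \<Rightarrow> real"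
  assumes p: "1 < p" and I: "finite I"
  shows "wnorm X \<mu> p (\<lambda>x. L2_set (\<lambda>i. avg (lev i) (h i) x) I)
     \<le> maximal_const p * wnorm X \<mu> p (\<lambda>x. L2_set (\<lambda>i. h i x) I)"
proof -
  obtain n where n: "\<And>i. i \<in> I \<Longrightarrow> lev i < n"
    using finite_nat_set_iff_bounded[of "lev ` I"] I by auto
  have "wnorm X \<mu> p (\<lambda>x. L2_set (\<lambda>i. avg (lev i) (h i) x) I) \<le> wnorm X \<mu> p (\<lambda>x. L2_set (\<lambda>i. running_max (h i) n x) I)"
    using p weight_nonneg n abs_avg_le_running_max
    by (intro wnorm_mono L2_set_mono_abs) (auto simp: running_max_nonneg)
  also have "\<dots> \<le> maximal_const p * wnorm X \<mu> p (\<lambda>x. L2_set (\<lambda>i. h i x) I)"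
    using maximal_const_ge[of p] p maximal_inequality[OF p, of h n I]
    by (subst wnorm_le_iff) (auto simp: weight_nonneg)
  finally show ?thesis .
qed

definition dif :: "nat \<Rightarrow> ('a \<Rightarrow> real) \<Rightarrow> 'a \<Rightarrow> real" where
  "dif k f x = (if k = 0 then avg 0 f x else avg k f x - avg (k - 1) f x)"

lemma dif_simps: "dif 0 f x = avg 0 f x" "dif (Suc k) f x = avg (Suc k) f x - avg k f x"
  by (simp_all add: dif_def)

lemma sum_dif: "(\<Sum>j\<le>k. dif j f x) = avg k f x"
  by (induction k) (auto simp: dif_simps)

lemma adapted_dif: "adapted k (dif k f)"
proof (cases k)
  case 0
  then show ?thesis using adapted_avg[of 0 f] by (simp add: adapted_def dif_simps)
next
  case (Suc j)
  have "adapted k (avg j f)" using adapted_mono[OF adapted_avg] Suc by simp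
  then show ?thesis using Suc adapted_avg[of k f] by (simp add: adapted_def dif_simps)
qed

lemma integral_dif_0:
  assumes "adapted k \<phi>"
  shows "(\<Sum>x\<in>X. \<mu> x * (\<phi> x * dif (Suc k) f x)) = 0"
  using integral_avg[OF assms, of f] integral_avg[OF adapted_mono[OF assms, of "Suc k"], of f]
  by (simp add: dif_simps right_diff_distrib sum_subtractf)

text \<open>
  Let \<open>N\<close>, \<open>D\<close>, \<open>G\<close> be the squared lengths of the vectors of averages, differences and running maxima.
  Expanding the square gives \<open>D (Suc k) = N (Suc k) - N k - 2 * P k\<close>, where \<open>P k\<close> integrates to
  zero against any function that is constant on cells of generation \<open>k\<close>. With \<open>r = p/2\<close>, this is
  summed against suitable adapted weights.

  If \<open>r \<le> 1\<close> the weights are \<open>G powr (r - 1)\<close>: moving them by one generation costs a telescoping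
  error by \<open>powr_cross_term_le\<close>, and \<open>\<Sum> D\<close> is recovered from the weighted sum by Young's inequality. If
  \<open>r > 1\<close> the weights are \<open>S powr (r - 1)\<close> with \<open>S\<close> the partial sums of \<open>D\<close>: now the error of moving
  them by one generation is bounded by means of \<open>D \<le> 4 G\<close>, and the resulting factor
  \<open>S powr (r - 1)\<close> is absorbed on the left.
\<close>

lemma square_function_le_maximal:
  fixes f :: "'u \<Rightarrow> 'a \<Rightarrow> real"
  assumes p: "1 < p"
  shows "(\<Sum>x\<in>X. \<mu> x * (\<Sum>k\<le>n. \<Sum>u\<in>I. (dif k (f u) x)\<^sup>2) powr (p/2))
    \<le> (5 * max 1 p) powr p * (\<Sum>x\<in>X. \<mu> x * (\<Sum>u\<in>I. (running_max (f u) (Suc n) x)\<^sup>2) powr (p/2))"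
proof -
  define r where "r = p/2"
  define G where "G k x = (\<Sum>u\<in>I. (running_max (f u) (Suc k) x)\<^sup>2)" for k x
  define D where "D k x = (\<Sum>u\<in>I. (dif k (f u) x)\<^sup>2)" for k x
  define N where "N k x = (\<Sum>u\<in>I. (avg k (f u) x)\<^sup>2)" for k x
  define P where "P k x = (\<Sum>u\<in>I. avg k (f u) x * dif (Suc k) (f u) x)" for k x
  have r: "1/2 < r" using p by (simp add: r_def)
  have nn: "0 \<le> G k x" "0 \<le> D k x" "0 \<le> N k x" for k x
    by (simp_all add: G_def D_def N_def sum_nonneg)
  have Gmono: "G j x \<le> G k x" if "j \<le> k" for j k x
    unfolding G_def using that by (intro sum_mono power_mono running_max_mono running_max_nonneg) auto
  have NG: "N j x \<le> G k x" if "j \<le> k" "x \<in> X" for j k x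
    unfolding N_def G_def using that abs_avg_le_running_max[of x j "Suc k"]
    by (intro sum_mono) (auto simp: abs_le_square_iff[symmetric] running_max_nonneg simp del: running_max.simps)
  have L2N: "L2_set (\<lambda>u. avg k (f u) x) I = sqrt (N k x)" for k x by (simp add: L2_set_def N_def)
  have L2D: "L2_set (\<lambda>u. dif k (f u) x) I = sqrt (D k x)" for k x by (simp add: L2_set_def D_def)
  have sqD: "sqrt (D k x) \<le> 2 * sqrt (G k x)" if x: "x \<in> X" for k x
  proof (cases k)
    case 0
    have "sqrt (D k x) \<le> sqrt (G k x)" using NG[of k k x] x 0 by (simp add: D_def N_def dif_simps)
    then show ?thesis using nn(1)[of k x] real_sqrt_ge_zero[of "G k x"] by linarith
  next
    case (Suc j)
    have "sqrt (D k x) \<le> sqrt (N k x) + sqrt (N j x)"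
      unfolding L2D[symmetric] L2N[symmetric] Suc dif_simps by (rule L2_set_minus_triangle)
    also have "\<dots> \<le> sqrt (G k x) + sqrt (G k x)"
      using NG[of k k x] NG[of j k x] x Suc by (intro add_mono) auto
    finally show ?thesis by simp
  qed
  have DG: "D k x \<le> 4 * G k x" if "x \<in> X" for k x
    using power_mono[OF sqD[OF that, of k], of 2] nn[of k x] by (simp add: power_mult_distrib)
  have Dexp: "D (Suc k) x = N (Suc k) x - N k x - 2 * P k x" for k x
  proof -
    have "(dif (Suc k) (f u) x)\<^sup>2 = (avg (Suc k) (f u) x)\<^sup>2 - (avg k (f u) x)\<^sup>2
        - 2 * (avg k (f u) x * dif (Suc k) (f u) x)" for u
      by (simp add: dif_simps power2_eq_square algebra_simps)
    then show ?thesis by (simp only: D_def N_def P_def sum_subtractf sum_distrib_left)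
  qed
  have D0: "D 0 x = N 0 x" for x by (simp add: D_def N_def dif_simps)
  have P0: "(\<Sum>x\<in>X. \<mu> x * (c x * P k x)) = 0" if "adapted k c" for c k
  proof -
    have "(\<Sum>x\<in>X. \<mu> x * (c x * P k x)) = (\<Sum>u\<in>I. \<Sum>x\<in>X. \<mu> x * ((c x * avg k (f u) x) * dif (Suc k) (f u) x))"
      unfolding P_def sum_distrib_left by (subst sum.swap) (simp only: mult.assoc)
    also have "\<dots> = 0"
      using that adapted_avg by (intro sum.neutral ballI integral_dif_0 adapted_comp2[where h = "(*)"])
    finally show ?thesis .
  qed
  have main: "(\<Sum>x\<in>X. \<mu> x * (\<Sum>k\<le>n. D k x) powr r) \<le> (5 * max 1 p) powr p * (\<Sum>x\<in>X. \<mu> x * G n x powr r)"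
  proof (cases "r \<le> 1")
    case True
    define c where "c k x = G k x powr (r - 1)" for k x
    have c_anti: "c k x \<le> c j x" if "j \<le> k" "0 < G j x" for j k x
      unfolding c_def using that True Gmono[of j k x] by (intro powr_mono2') auto
    have ad_c: "adapted k (c k)" for k
    proof -
      have "adapted k (\<lambda>x. (running_max (f u) (Suc k) x)\<^sup>2)" for u
        using adapted_running_max by (rule adapted_comp)
      then have "adapted k (G k)" unfolding G_def by (rule adapted_sum)
      then show ?thesis unfolding c_def by (rule adapted_comp)
    qed
    define T where "T n x = c 0 x * N 0 x + (\<Sum>k<n. c (Suc k) x * (N (Suc k) x - N k x))" for n x
    have cG: "c k x * G k x = G k x powr r" for k x
      using powr_mult_base[of "G k x" "r - 1"] nn[of k x] by (cases "G k x = 0") (auto simp: c_def mult.commute)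
    \<comment> \<open>Summation by parts: the weights decrease and \<open>N \<le> G\<close>.\<close>
    have T: "T n x - c n x * N n x \<le> (1 - r)/r * G n x powr r" if x: "x \<in> X" for n x
    proof (induction n)
      case 0
      then show ?case using r True by (simp add: T_def)
    next
      case (Suc n)
      have "T (Suc n) x - c (Suc n) x * N (Suc n) x = (T n x - c n x * N n x) + (c n x - c (Suc n) x) * N n x"
        by (simp add: T_def algebra_simps)
      also have "(c n x - c (Suc n) x) * N n x \<le> G n x powr r - G (Suc n) x powr (r - 1) * G n x"
      proof (cases "G n x = 0")
        case True
        then show ?thesis using NG[of n n x] nn[of n x] x by simp
      next
        case False
        then have "0 < G n x" using nn[of n x] by simp
        then have "(c n x - c (Suc n) x) * N n x \<le> (c n x - c (Suc n) x) * G n x"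
          using c_anti[of n "Suc n" x] NG[of n n x] x by (intro mult_left_mono) auto
        then show ?thesis using cG[of n x] by (simp add: c_def algebra_simps)
      qed
      also have "\<dots> \<le> (1 - r)/r * (G (Suc n) x powr r - G n x powr r)"
        using r True nn Gmono by (intro powr_concave_chord) auto
      finally show ?case using Suc by (simp add: algebra_simps)
    qed
    have T': "T n x \<le> 1/r * G n x powr r" if x: "x \<in> X" for x
    proof -
      have "c n x * N n x \<le> G n x powr r"
        using NG[of n n x] x cG[of n x, symmetric] by (auto intro!: mult_left_mono simp: c_def)
      moreover have "(1 - r)/r * G n x powr r + G n x powr r = 1/r * G n x powr r"
        using r by (simp add: field_simps)
      ultimately show ?thesis using T[OF x, of n] by linarith
    qed
    \<comment> \<open>The price of replacing the weight of generation \<open>Suc k\<close> by the adapted one of generation \<open>k\<close>.\<close>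
    have cross: "(c k x - c (Suc k) x) * P k x \<le> 2 * (G (Suc k) x powr r - G k x powr r)" if x: "x \<in> X" for k x
    proof (cases "G k x = 0")
      case True
      then have "N k x = 0" using NG[of k k x] nn[of k x] x by simp
      have "P k x = 0"
      proof (cases "finite I")
        case True
        then show ?thesis using \<open>N k x = 0\<close> by (simp add: P_def N_def sum_nonneg_eq_0_iff)
      qed (simp add: P_def)
      then show ?thesis using \<open>G k x = 0\<close> by simp
    next
      case False
      then have pos: "0 < G k x" using nn[of k x] by simp
      have "P k x \<le> sqrt (N k x) * sqrt (D (Suc k) x)"
        unfolding P_def L2N[symmetric] L2D[symmetric] by (rule L2_set_Cauchy_Schwarz)
      also have "\<dots> \<le> sqrt (G k x) * (2 * sqrt (G (Suc k) x))"
        using NG[of k k x] sqD[OF x, of "Suc k"] x nn by (intro mult_mono) auto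
      finally have "(c k x - c (Suc k) x) * P k x \<le> (c k x - c (Suc k) x) * (2 * (sqrt (G k x) * sqrt (G (Suc k) x)))"
        using c_anti[of k "Suc k" x] pos by (intro mult_left_mono) auto
      also have "\<dots> \<le> 2 * (G (Suc k) x powr r - G k x powr r)"
        using powr_cross_term_le[of r "G k x" "G (Suc k) x"] r \<open>r \<le> 1\<close> pos Gmono[of k "Suc k" x] by (simp add: c_def)
      finally show ?thesis .
    qed
    have expand: "(\<Sum>k\<le>n. c k x * D k x) = T n x + 2 * (\<Sum>k<n. (c k x - c (Suc k) x) * P k x) - 2 * (\<Sum>k<n. c k x * P k x)" for x
    proof -
      have "(\<Sum>k\<le>n. c k x * D k x) = c 0 x * D 0 x + (\<Sum>k<n. c (Suc k) x * D (Suc k) x)"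
        by (simp add: sum.atMost_shift)
      moreover have "c (Suc k) x * D (Suc k) x = c (Suc k) x * (N (Suc k) x - N k x)
          + 2 * ((c k x - c (Suc k) x) * P k x) - 2 * (c k x * P k x)" for k
        by (simp add: Dexp algebra_simps)
      ultimately show ?thesis
        by (simp only: T_def D0 sum.distrib sum_subtractf sum_distrib_left)
    
    qed
    have "(\<Sum>x\<in>X. \<mu> x * (\<Sum>k<n. c k x * P k x)) = (\<Sum>k<n. \<Sum>x\<in>X. \<mu> x * (c k x * P k x))"
      unfolding sum_distrib_left by (rule sum.swap)
    also have "\<dots> = 0" using P0[OF ad_c] by simp
    finally have cross0: "(\<Sum>x\<in>X. \<mu> x * (\<Sum>k<n. c k x * P k x)) = 0" .
    have "(\<Sum>x\<in>X. \<mu> x * (\<Sum>k\<le>n. c k x * D k x))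
        = (\<Sum>x\<in>X. \<mu> x * (T n x + 2 * (\<Sum>k<n. (c k x - c (Suc k) x) * P k x))) - 2 * (\<Sum>x\<in>X. \<mu> x * (\<Sum>k<n. c k x * P k x))"
    proof -
      have "(\<Sum>x\<in>X. \<mu> x * (a x - 2 * b x)) = (\<Sum>x\<in>X. \<mu> x * a x) - 2 * (\<Sum>x\<in>X. \<mu> x * b x)"
        for a b :: "'a \<Rightarrow> real"
        by (simp add: sum_distrib_left sum_subtractf right_diff_distrib mult_ac)
      then show ?thesis unfolding expand .
    qed
    also have "\<dots> = (\<Sum>x\<in>X. \<mu> x * (T n x + 2 * (\<Sum>k<n. (c k x - c (Suc k) x) * P k x)))"
      by (simp add: cross0)
    also have "\<dots> \<le> (\<Sum>x\<in>X. \<mu> x * ((1/r + 4) * G n x powr r))"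
    proof (intro sum_mono mult_left_mono weight_nonneg)
      fix x assume x: "x \<in> X"
      have "(\<Sum>k<n. (c k x - c (Suc k) x) * P k x) \<le> (\<Sum>k<n. 2 * (G (Suc k) x powr r - G k x powr r))"
        by (intro sum_mono cross x)
      also have "\<dots> = 2 * (G n x powr r - G 0 x powr r)"
        using sum_lessThan_telescope[of "\<lambda>k. G k x powr r" n] by (simp only: sum_distrib_left[symmetric])
      also have "\<dots> \<le> 2 * G n x powr r" by simp
      finally show "T n x + 2 * (\<Sum>k<n. (c k x - c (Suc k) x) * P k x) \<le> (1/r + 4) * G n x powr r"
        using T'[OF x] by (simp add: distrib_right)
    qed
    finally have E: "(\<Sum>x\<in>X. \<mu> x * (\<Sum>k\<le>n. c k x * D k x)) \<le> (1/r + 4) * (\<Sum>x\<in>X. \<mu> x * G n x powr r)"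
      by (simp add: sum_distrib_left mult_ac)
    \<comment> \<open>Young's inequality in the form \<open>S\<^sup>r = (S G\<^bsup>r - 1\<^esup>)\<^sup>r (G\<^sup>r)\<^bsup>1 - r\<^esup>\<close>.\<close>
    have pt: "(\<Sum>k\<le>n. D k x) powr r \<le> r * (\<Sum>k\<le>n. c k x * D k x) + (1 - r) * G n x powr r" if x: "x \<in> X" for x
    proof (cases "(\<Sum>k\<le>n. D k x) = 0")
      case True
      then show ?thesis using r \<open>r \<le> 1\<close> nn by (simp add: sum_nonneg c_def)
    next
      case False
      define S where "S = (\<Sum>k\<le>n. D k x)"
      have S: "0 < S" using False nn by (simp add: S_def sum_nonneg less_le)
      have "S \<le> (\<Sum>k\<le>n. 4 * G n x)"
        unfolding S_def using DG[OF x] Gmono by (intro sum_mono order_trans[OF DG[OF x]]) auto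
      then have G: "0 < G n x" using S nn(1)[of n x] by (cases "G n x = 0") auto
      have "S * G n x powr (r - 1) = (\<Sum>k\<le>n. G n x powr (r - 1) * D k x)"
        by (simp add: S_def sum_distrib_left sum_distrib_right mult.commute)
      also have "\<dots> \<le> (\<Sum>k\<le>n. c k x * D k x)"
      proof (intro sum_mono)
        fix k assume k: "k \<in> {..n}"
        show "G n x powr (r - 1) * D k x \<le> c k x * D k x"
        proof (cases "G k x = 0")
          case True
          then show ?thesis using DG[OF x, of k] nn[of k x] by simp
        next
          case False
          then show ?thesis using c_anti[of k n x] k nn[of k x] by (intro mult_right_mono) (auto simp: c_def)
        qed
      qed
      finally have le: "S * G n x powr (r - 1) \<le> (\<Sum>k\<le>n. c k x * D k x)" .
      have "S powr r = (S * G n x powr (r - 1)) powr r * (G n x powr r) powr (1 - r)"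
      proof -
        have "(r - 1) * r + r * (1 - r) = 0" by (simp add: algebra_simps)
        then have "G n x powr ((r - 1) * r) * G n x powr (r * (1 - r)) = 1"
          using G by (simp only: powr_add[symmetric]) simp
        then show ?thesis using S G by (simp add: powr_mult powr_powr mult.assoc)
      qed
      also have "\<dots> \<le> r * (S * G n x powr (r - 1)) + (1 - r) * G n x powr r"
        using r \<open>r \<le> 1\<close> S G by (intro Youngs_inequality_0) auto
      also have "\<dots> \<le> r * (\<Sum>k\<le>n. c k x * D k x) + (1 - r) * G n x powr r"
        using le r by (intro add_right_mono mult_left_mono) auto
      finally show ?thesis by (simp add: S_def)
    qed
    have "(\<Sum>x\<in>X. \<mu> x * (\<Sum>k\<le>n. D k x) powr r) \<le> (\<Sum>x\<in>X. \<mu> x * (r * (\<Sum>k\<le>n. c k x * D k x) + (1 - r) * G n x powr r))"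
      by (intro sum_mono mult_left_mono weight_nonneg pt)
    also have "\<dots> = r * (\<Sum>x\<in>X. \<mu> x * (\<Sum>k\<le>n. c k x * D k x)) + (1 - r) * (\<Sum>x\<in>X. \<mu> x * G n x powr r)"
      by (simp add: sum_distrib_left sum.distrib[symmetric] distrib_left mult_ac)
    also have "\<dots> \<le> r * ((1/r + 4) * (\<Sum>x\<in>X. \<mu> x * G n x powr r)) + (1 - r) * (\<Sum>x\<in>X. \<mu> x * G n x powr r)"
      using E r by (intro add_right_mono mult_left_mono) auto
    also have "\<dots> = (2 + 3 * r) * (\<Sum>x\<in>X. \<mu> x * G n x powr r)"
      using r by (simp add: field_simps)
    also have "\<dots> \<le> (5 * max 1 p) powr p * (\<Sum>x\<in>X. \<mu> x * G n x powr r)"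
    proof (intro mult_right_mono sum_nonneg mult_nonneg_nonneg weight_nonneg)
      have "2 + 3 * r \<le> (5 * max 1 p) powr 1" using \<open>r \<le> 1\<close> by (simp add: max_def)
      also have "\<dots> \<le> (5 * max 1 p) powr p" using p by (intro powr_mono) auto
      finally show "2 + 3 * r \<le> (5 * max 1 p) powr p" .
    qed auto
    finally show ?thesis .
  next
    case False
    then have r1: "1 < r" by simp
    define S where "S n x = (\<Sum>k\<le>n. D k x)" for n x
    define c where "c k x = S k x powr (r - 1)" for k x
    have Snn: "0 \<le> S k x" for k x by (simp add: S_def sum_nonneg nn)
    have Smono: "S k x \<le> S (Suc k) x" for k x by (simp add: S_def nn)
    have cmono: "c k x \<le> c (Suc k) x" for k x
      unfolding c_def using r1 Snn Smono by (intro powr_mono2) auto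
    have ad_c: "adapted k (c k)" for k
    proof -
      have "adapted k (\<lambda>x. (dif j (f u) x)\<^sup>2)" if "j \<le> k" for j u
        using adapted_mono[OF adapted_dif that] by (rule adapted_comp)
      then have "adapted k (S k)" unfolding S_def D_def by (intro adapted_sum) auto
      then show ?thesis unfolding c_def by (rule adapted_comp)
    qed
    \<comment> \<open>The \<open>r\<close>-th power of the square sum as a weighted sum of its increments.\<close>
    have up: "S n x powr r \<le> r * (\<Sum>k\<le>n. c k x * D k x)" for n x
    proof (induction n)
      case 0
      have "S 0 x powr r = c 0 x * D 0 x" 
        using powr_mult_base[of "S 0 x" "r - 1"] Snn[of 0 x] by (simp add: c_def S_def mult.commute)
      moreover have "1 * (c 0 x * D 0 x) \<le> r * (c 0 x * D 0 x)"
        using r1 nn by (intro mult_right_mono) (auto simp: c_def)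
      ultimately show ?case by simp
    next
      case (Suc n)
      have "S (Suc n) x powr r - S n x powr r \<le> max 1 r * (S (Suc n) x powr (r - 1) * (S (Suc n) x - S n x))"
        using r Snn Smono by (intro powr_increment_le) auto
      also have "\<dots> = r * (c (Suc n) x * D (Suc n) x)" using r1 by (simp add: c_def S_def)
      finally show ?case using Suc by (simp add: algebra_simps)
    qed
    define Q where "Q n x = c 0 x * N 0 x + (\<Sum>k<n. c k x * (N (Suc k) x - N k x))" for n x
    \<comment> \<open>Summation by parts again; now the weights increase.\<close>
    have Q: "Q n x \<le> c n x * N n x" for n x
    proof (induction n)
      case (Suc n)
      have "Q (Suc n) x \<le> c n x * N (Suc n) x" using Suc by (simp add: Q_def algebra_simps)
      also have "\<dots> \<le> c (Suc n) x * N (Suc n) x" using cmono nn by (intro mult_right_mono) auto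
      finally show ?case .
    qed (simp add: Q_def)
    have expand: "(\<Sum>k\<le>n. c k x * D k x) = (Q n x + (\<Sum>k<n. (c (Suc k) x - c k x) * D (Suc k) x)) - 2 * (\<Sum>k<n. c k x * P k x)" for x
    proof -
      have "(\<Sum>k\<le>n. c k x * D k x) = c 0 x * D 0 x + (\<Sum>k<n. c (Suc k) x * D (Suc k) x)"
        by (simp add: sum.atMost_shift)
      moreover have "c (Suc k) x * D (Suc k) x = c k x * (N (Suc k) x - N k x)
          + (c (Suc k) x - c k x) * D (Suc k) x - 2 * (c k x * P k x)" for k
        by (simp add: Dexp algebra_simps)
      ultimately show ?thesis
        by (simp only: Q_def D0 sum.distrib sum_subtractf sum_distrib_left)
    qed
    have "(\<Sum>x\<in>X. \<mu> x * (\<Sum>k<n. c k x * P k x)) = (\<Sum>k<n. \<Sum>x\<in>X. \<mu> x * (c k x * P k x))"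
      unfolding sum_distrib_left by (rule sum.swap)
    also have "\<dots> = 0" using P0[OF ad_c] by simp
    finally have cross0: "(\<Sum>x\<in>X. \<mu> x * (\<Sum>k<n. c k x * P k x)) = 0" .
    have bd: "Q n x + (\<Sum>k<n. (c (Suc k) x - c k x) * D (Suc k) x) \<le> 5 * (G n x * c n x)" if x: "x \<in> X" for x
    proof -
      have "(\<Sum>k<n. (c (Suc k) x - c k x) * D (Suc k) x) \<le> (\<Sum>k<n. (c (Suc k) x - c k x) * (4 * G n x))"
        using cmono DG[OF x] Gmono 
        by (intro sum_mono mult_left_mono order_trans[OF DG[OF x]]) auto
      also have "\<dots> = (c n x - c 0 x) * (4 * G n x)"
        using sum_lessThan_telescope[of "\<lambda>k. c k x" n] by (simp only: sum_distrib_right[symmetric])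
      also have "\<dots> \<le> c n x * (4 * G n x)" using nn by (intro mult_right_mono) (auto simp: c_def)
      finally have "(\<Sum>k<n. (c (Suc k) x - c k x) * D (Suc k) x) \<le> 4 * (G n x * c n x)" by (simp add: mult_ac)
      moreover have "c n x * N n x \<le> c n x * G n x" using NG[of n n x] x by (intro mult_left_mono) (auto simp: c_def)
      ultimately show ?thesis using Q[of n x] by (simp add: mult.commute)
    qed
    let ?Z = "\<Sum>x\<in>X. \<mu> x * S n x powr r"
    have "?Z \<le> (\<Sum>x\<in>X. \<mu> x * (r * (\<Sum>k\<le>n. c k x * D k x)))"
      by (intro sum_mono mult_left_mono weight_nonneg up)
    also have "\<dots> = r * (\<Sum>x\<in>X. \<mu> x * (Q n x + (\<Sum>k<n. (c (Suc k) x - c k x) * D (Suc k) x)))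
        - 2 * r * (\<Sum>x\<in>X. \<mu> x * (\<Sum>k<n. c k x * P k x))"
    proof -
      have "(\<Sum>x\<in>X. \<mu> x * (r * (a x - 2 * b x))) = r * (\<Sum>x\<in>X. \<mu> x * a x) - 2 * r * (\<Sum>x\<in>X. \<mu> x * b x)"
        for a b :: "'a \<Rightarrow> real"
        by (simp add: sum_distrib_left sum_subtractf right_diff_distrib mult_ac)
      then show ?thesis unfolding expand .
    qed
    also have "\<dots> = (\<Sum>x\<in>X. \<mu> x * (r * (Q n x + (\<Sum>k<n. (c (Suc k) x - c k x) * D (Suc k) x))))"
      unfolding cross0 sum_distrib_left[of r _ X] by (simp add: mult_ac)
    also have "\<dots> \<le> (\<Sum>x\<in>X. \<mu> x * ((5 * r * G n x) powr r / r + (1 - 1/r) * S n x powr r))"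
    proof (intro sum_mono mult_left_mono weight_nonneg)
      fix x assume x: "x \<in> X"
      have "r * (Q n x + (\<Sum>k<n. (c (Suc k) x - c k x) * D (Suc k) x)) \<le> r * (5 * (G n x * c n x))"
        using bd[OF x] r by (intro mult_left_mono) auto
      also have "\<dots> = 5 * r * (G n x * S n x powr (r - 1))" by (simp add: c_def)
      also have "\<dots> \<le> (5 * r * G n x) powr r / r + (1 - 1/r) * S n x powr r"
        using r1 nn Snn by (intro Young_absorb) auto
      finally show "r * (Q n x + (\<Sum>k<n. (c (Suc k) x - c k x) * D (Suc k) x)) \<le> (5 * r * G n x) powr r / r + (1 - 1/r) * S n x powr r" .
    qed
    also have "\<dots> = (5 * r) powr r / r * (\<Sum>x\<in>X. \<mu> x * G n x powr r) + (1 - 1/r) * ?Z"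
    proof -
      have "\<mu> x * ((5 * r * G n x) powr r / r + (1 - 1/r) * S n x powr r)
          = (5 * r) powr r / r * (\<mu> x * G n x powr r) + (1 - 1/r) * (\<mu> x * S n x powr r)" for x
        using r nn by (simp add: powr_mult algebra_simps)
      then show ?thesis by (simp only: sum_distrib_left sum.distrib)
    qed
    finally have "?Z / r \<le> (5 * r) powr r / r * (\<Sum>x\<in>X. \<mu> x * G n x powr r)"
      by (simp add: algebra_simps)
    then have "?Z \<le> (5 * r) powr r * (\<Sum>x\<in>X. \<mu> x * G n x powr r)"
      using r1 by (simp add: divide_le_cancel)
    also have "\<dots> \<le> (5 * max 1 p) powr p * (\<Sum>x\<in>X. \<mu> x * G n x powr r)"
    proof (intro mult_right_mono sum_nonneg mult_nonneg_nonneg weight_nonneg)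
      have "(5 * r) powr r \<le> (5 * r) powr p" using r1 by (intro powr_mono) (auto simp: r_def)
      also have "\<dots> \<le> (5 * max 1 p) powr p" using r1 p by (intro powr_mono2) (auto simp: r_def)
      finally show "(5 * r) powr r \<le> (5 * max 1 p) powr p" .
    qed auto
    finally show ?thesis by (simp add: S_def)
  qed
  then show ?thesis by (simp add: D_def G_def r_def)
qed

theorem square_function_upper:
  fixes f :: "'u \<Rightarrow> 'a \<Rightarrow> real"
  assumes p: "1 < p"
  shows "wnorm X \<mu> p (\<lambda>x. L2_set (\<lambda>(u, k). dif k (f u) x) (I \<times> {..n}))
     \<le> square_const p * wnorm X \<mu> p (\<lambda>x. L2_set (\<lambda>u. f u x) I)"
proof -
  have L2I: "L2_set (\<lambda>u. running_max (f u) (Suc n) x) I = sqrt (\<Sum>u\<in>I. (running_max (f u) (Suc n) x)\<^sup>2)" for x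
    by (rule L2_set_def)
  have "wnorm X \<mu> p (\<lambda>x. L2_set (\<lambda>(u, k). dif k (f u) x) (I \<times> {..n}))
      \<le> 5 * max 1 p * wnorm X \<mu> p (\<lambda>x. L2_set (\<lambda>u. running_max (f u) (Suc n) x) I)"
    using p square_function_le_maximal[OF p, where f = f and n = n and I = I]
    by (subst wnorm_le_iff)
      (auto simp: weight_nonneg L2_set_Times sqrt_powr_half sum_nonneg L2I simp del: running_max.simps)
  also have "\<dots> \<le> 5 * max 1 p * (maximal_const p * wnorm X \<mu> p (\<lambda>x. L2_set (\<lambda>u. f u x) I))"
    using maximal_const_ge[of p] p maximal_inequality[OF p, of f "Suc n" I]
    by (intro mult_left_mono, subst wnorm_le_iff) (auto simp: weight_nonneg simp del: running_max.simps)
  finally show ?thesis by (simp add: square_const_def mult_ac)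
qed

text \<open>
  By duality with \<open>square_function_upper\<close> for the conjugate exponent: testing against \<open>g\<close>, the function
  \<open>\<delta> i k\<close> only sees the difference of \<open>g i\<close> of generation \<open>k\<close>. The families \<open>\<delta> i\<close> are arbitrary
  martingale difference sequences; the paraproduct needs this generality.
\<close>

theorem square_function_lower:
  fixes \<delta> :: "'i \<Rightarrow> nat \<Rightarrow> 'a \<Rightarrow> real"
  assumes p: "1 < p"
    and ad: "\<And>i k. adapted k (\<delta> i k)"
    and orth: "\<And>i k \<phi>. adapted k \<phi> \<Longrightarrow> (\<Sum>x\<in>X. \<mu> x * (\<phi> x * \<delta> i (Suc k) x)) = 0"
  shows "wnorm X \<mu> p (\<lambda>x. L2_set (\<lambda>i. \<Sum>k\<le>n. \<delta> i k x) I)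
     \<le> square_const (conj_exponent p) * wnorm X \<mu> p (\<lambda>x. L2_set (\<lambda>(i, k). \<delta> i k x) (I \<times> {..n}))"
proof (rule wnorm_duality[OF fin weight_nonneg p])
  let ?q = "conj_exponent p"
  let ?N = "wnorm X \<mu> p (\<lambda>x. L2_set (\<lambda>(i, k). \<delta> i k x) (I \<times> {..n}))"
  show "0 \<le> square_const ?q * ?N" using square_const_pos[of ?q] by simp
  fix g :: "'i \<Rightarrow> 'a \<Rightarrow> real"
  have "(\<Sum>x\<in>X. \<mu> x * (\<Sum>i\<in>I. (\<Sum>k\<le>n. \<delta> i k x) * g i x)) = (\<Sum>i\<in>I. \<Sum>k\<le>n. \<Sum>x\<in>X. \<mu> x * (\<delta> i k x * g i x))"
    by (simp only: sum_distrib_left sum_distrib_right)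
      (subst sum.swap, rule sum.cong[OF refl], rule sum.swap)
  also have "\<dots> = (\<Sum>i\<in>I. \<Sum>k\<le>n. \<Sum>x\<in>X. \<mu> x * (\<delta> i k x * dif k (g i) x))"
  proof (rule sum.cong[OF refl], rule sum.cong[OF refl])
    fix i k
    show "(\<Sum>x\<in>X. \<mu> x * (\<delta> i k x * g i x)) = (\<Sum>x\<in>X. \<mu> x * (\<delta> i k x * dif k (g i) x))"
    proof (cases k)
      case 0
      then show ?thesis using integral_avg[OF ad[of 0 i], of "g i"] by (simp add: dif_simps)
    next
      case (Suc j)
      then show ?thesis using integral_avg[OF ad[of k i], of "g i"] orth[OF adapted_avg[of j "g i"], of i]
        by (simp add: dif_simps right_diff_distrib sum_subtractf mult_ac)
    qed
  qed
  also have "\<dots> = (\<Sum>x\<in>X. \<mu> x * (\<Sum>j\<in>I \<times> {..n}. (\<lambda>(i, k). \<delta> i k x) j * (\<lambda>(i, k). dif k (g i) x) j))"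
  proof -
    have "(\<Sum>j\<in>I \<times> {..n}. (\<lambda>(i, k). \<delta> i k x) j * (\<lambda>(i, k). dif k (g i) x) j)
       = (\<Sum>i\<in>I. \<Sum>k\<le>n. \<delta> i k x * dif k (g i) x)" for x
      by (simp add: sum.cartesian_product split_def)
    then show ?thesis
      by (simp only: sum_distrib_left) (rule sym, subst sum.swap, rule sum.cong[OF refl], rule sum.swap)
  qed
  also have "\<dots> \<le> ?N * wnorm X \<mu> ?q (\<lambda>x. L2_set (\<lambda>(i, k). dif k (g i) x) (I \<times> {..n}))"
    using wnorm_pairing[OF fin weight_nonneg p, where f = "\<lambda>(i, k). \<delta> i k" and g = "\<lambda>(i, k). dif k (g i)" and I = "I \<times> {..n}"]
    by (simp add: split_def)
  also have "\<dots> \<le> ?N * (square_const ?q * wnorm X \<mu> ?q (\<lambda>x. L2_set (\<lambda>i. g i x) I))"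
    using p by (intro mult_left_mono square_function_upper) (auto simp: conj_exponent_gt_1)
  finally show "(\<Sum>x\<in>X. \<mu> x * (\<Sum>i\<in>I. (\<Sum>k\<le>n. \<delta> i k x) * g i x))
     \<le> square_const ?q * ?N * wnorm X \<mu> ?q (\<lambda>x. L2_set (\<lambda>i. g i x) I)" by (simp add: mult_ac)
qed

end

section \<open>Stopping levels\<close>

text \<open>The last generation up to \<open>i\<close> at which the sequence has more than doubled since the previous such generation, the first one being \<open>0\<close>.\<close>

primrec stop :: "(nat \<Rightarrow> real) \<Rightarrow> nat \<Rightarrow> nat" where
  "stop c 0 = 0"
| "stop c (Suc i) = (if 2 * c (stop c i) < c (Suc i) then Suc i else stop c i)"

lemma stop_le: "stop c i \<le> i"
  by (induction i) auto

lemma stop_stop: "stop c (stop c i) = stop c i"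
  by (induction i) auto

lemma le_stop: "(\<And>i. 0 \<le> c i) \<Longrightarrow> c i \<le> 2 * c (stop c i)"
proof (induction i)
  case 0
  then show ?case using 0[of 0] by simp
next
  case (Suc i)
  then show ?case using Suc.prems[of "Suc i"] by auto
qed

lemma stop_cong: "(\<And>j. j \<le> i \<Longrightarrow> c j = d j) \<Longrightarrow> stop c i = stop d i"
proof (induction i)
  case (Suc i)
  have "stop c i = stop d i" using Suc by simp
  moreover have "c (stop d i) = d (stop d i)" using Suc.prems stop_le[of d i] by (simp add: le_SucI)
  ultimately show ?case using Suc.prems by simp
qed simp

text \<open>At successive stopping levels the values at least double, so their squares sum geometrically.\<close>

lemma sum_stop_le:
  assumes c: "\<And>i. 0 \<le> c i"
  shows "(\<Sum>r\<le>n. (if stop c r = r then c r else 0)\<^sup>2) \<le> 4/3 * (c (stop c n))\<^sup>2"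
proof (induction n)
  case (Suc n)
  show ?case
  proof (cases "2 * c (stop c n) < c (Suc n)")
    case True
    have "(2 * c (stop c n))\<^sup>2 \<le> (c (Suc n))\<^sup>2" using True c[of "stop c n"] by (intro power_mono) auto
    then show ?thesis using Suc True by (simp add: power_mult_distrib)
  next
    case False
    then have "stop c (Suc n) \<noteq> Suc n" using stop_le[of c n] by simp
    then show ?thesis using Suc False by simp
  qed
qed simp

section \<open>Sums over bands of levels\<close>

lemma L2_set_L2_set: "L2_set (\<lambda>j. L2_set (\<lambda>i. f i j) I) J = L2_set (\<lambda>(i, j). f i j) (I \<times> J)"
  by (simp add: L2_set_Times) (simp add: L2_set_def sum_nonneg)

text \<open>
  These reindexings turn sums over levels near a given level \<open>j\<close> into sums over the distance to \<open>j\<close>,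
  so that the number of distances becomes a factor in the estimates. The distance is shifted by \<open>s\<close> to
  stay in the natural numbers.
\<close>

lemma sum_window:
  fixes H :: "nat \<Rightarrow> 'b::comm_monoid_add"
  assumes "j + s < N"
  shows "(\<Sum>k<N. if j < k + s \<and> k \<le> j + s then H k else 0) = (\<Sum>\<alpha>\<in>{1..2 * s}. if s \<le> j + \<alpha> then H (j + \<alpha> - s) else 0)"
proof -
  have "(\<Sum>k<N. if j < k + s \<and> k \<le> j + s then H k else 0) = (\<Sum>k\<in>{k. j < k + s \<and> k \<le> j + s}. H k)"
    using assms by (subst sum.inter_filter[symmetric]) (auto intro!: sum.cong)
  also have "\<dots> = (\<Sum>\<alpha>\<in>{\<alpha>\<in>{1..2 * s}. s \<le> j + \<alpha>}. H (j + \<alpha> - s))"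
    by (rule sum.reindex_bij_witness[of _ "\<lambda>\<alpha>. j + \<alpha> - s" "\<lambda>k. k + s - j"]) auto
  also have "\<dots> = (\<Sum>\<alpha>\<in>{1..2 * s}. if s \<le> j + \<alpha> then H (j + \<alpha> - s) else 0)"
    by (rule sum.inter_filter) simp
  finally show ?thesis .
qed

lemma sum_lower_band:
  fixes H :: "nat \<Rightarrow> 'b::comm_monoid_add"
  assumes "k < N"
  shows "(\<Sum>l<N. if l \<le> k \<and> k < l + s then H l else 0) = (\<Sum>t<s. if t \<le> k then H (k - t) else 0)"
proof -
  have "(\<Sum>l<N. if l \<le> k \<and> k < l + s then H l else 0) = (\<Sum>l\<in>{l. l \<le> k \<and> k < l + s}. H l)"
    using assms by (subst sum.inter_filter[symmetric]) (auto intro!: sum.cong)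
  also have "\<dots> = (\<Sum>t\<in>{t\<in>{..<s}. t \<le> k}. H (k - t))"
    by (rule sum.reindex_bij_witness[of _ "\<lambda>t. k - t" "\<lambda>l. k - l"]) auto
  also have "\<dots> = (\<Sum>t<s. if t \<le> k then H (k - t) else 0)"
    by (rule sum.inter_filter) simp
  finally show ?thesis .
qed

lemma sum_lower_band':
  fixes H :: "nat \<Rightarrow> 'b::comm_monoid_add"
  assumes "k < N"
  shows "(\<Sum>l<N. if l < k \<and> k < l + s then H l else 0) = (\<Sum>t\<in>{1..<s}. if t \<le> k then H (k - t) else 0)"
proof -
  have "(\<Sum>l<N. if l < k \<and> k < l + s then H l else 0) = (\<Sum>l\<in>{l. l < k \<and> k < l + s}. H l)"
    using assms by (subst sum.inter_filter[symmetric]) (auto intro!: sum.cong)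
  also have "\<dots> = (\<Sum>t\<in>{t\<in>{1..<s}. t \<le> k}. H (k - t))"
    by (rule sum.reindex_bij_witness[of _ "\<lambda>t. k - t" "\<lambda>l. k - l"]) auto
  also have "\<dots> = (\<Sum>t\<in>{1..<s}. if t \<le> k then H (k - t) else 0)"
    by (rule sum.inter_filter) simp
  finally show ?thesis .
qed

lemma sum_shift_le:
  fixes H :: "nat \<Rightarrow> real" and M :: nat
  assumes "\<And>k. 0 \<le> H k" "inj_on \<pi> {m. m < M \<and> P m}" "\<And>m. m < M \<Longrightarrow> P m \<Longrightarrow> \<pi> m < N"
  shows "(\<Sum>m<M. if P m then H (\<pi> m) else 0) \<le> (\<Sum>k<N. H k)"
proof -
  have "(\<Sum>m<M. if P m then H (\<pi> m) else 0) = (\<Sum>m\<in>{m. m < M \<and> P m}. H (\<pi> m))"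
    by (subst sum.inter_filter[symmetric]) (auto intro!: sum.cong)
  also have "\<dots> = (\<Sum>k\<in>\<pi> ` {m. m < M \<and> P m}. H k)"
    by (rule sum.reindex[OF assms(2), symmetric, unfolded o_def])
  also have "\<dots> \<le> (\<Sum>k<N. H k)"
    using assms by (intro sum_mono2) auto
  finally show ?thesis .
qed

section \<open>Kernels between two weighted filtrations\<close>

text \<open>
  A discrete model of a finite family of dyadic shifts, with cells in place of cubes and \<open>V j\<close> in place
  of the volume of a cube of generation \<open>j\<close>. The parameter \<open>s\<close> is the complexity plus one. The
  assumptions are symmetric in the two variables of the kernels, so the adjoints form an instance
  with the weights exchanged.
\<close>

locale shift_kernels =
  S: weighted_filtration X cl M \<sigma> + W: weighted_filtration X cl M w
  for X :: "'a set" and cl M \<sigma> w +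
  fixes V :: "nat \<Rightarrow> real" and s :: nat and U :: "'u set"
    and ker :: "'u \<Rightarrow> nat \<Rightarrow> 'a \<Rightarrow> 'a \<Rightarrow> real"
  assumes V_pos: "0 < V j" and V_half: "2 * V (Suc j) \<le> V j"
    and s_pos: "1 \<le> s" and fin_U: "finite U"
    and ker_supp: "u \<in> U \<Longrightarrow> x \<in> X \<Longrightarrow> y \<in> X \<Longrightarrow> y \<notin> cl j x \<Longrightarrow> ker u j x y = 0"
    and ker_bound: "u \<in> U \<Longrightarrow> x \<in> X \<Longrightarrow> y \<in> X \<Longrightarrow> \<bar>ker u j x y\<bar> \<le> 1 / V j"
    and ker_out: "u \<in> U \<Longrightarrow> y \<in> X \<Longrightarrow> S.adapted (j + s) (\<lambda>x. ker u j x y)"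
    and ker_in: "u \<in> U \<Longrightarrow> x \<in> X \<Longrightarrow> S.adapted (j + s) (\<lambda>y. ker u j x y)"
begin

lemma swapped: "shift_kernels X cl M w \<sigma> V s U (\<lambda>u j x y. ker u j y x)"
proof
  fix u x y j assume "u \<in> U" "x \<in> X" "y \<in> X" "y \<notin> cl j x"
  then show "ker u j y x = 0" using ker_supp[of u y x j] S.cl_sym[of x y j] by simp
qed (use V_pos V_half s_pos fin_U ker_bound ker_out ker_in in auto)

text \<open>The part of level \<open>j\<close> of the shift, applied to the constant function \<open>1\<close>.\<close>

definition kernel_one :: "'u \<Rightarrow> nat \<Rightarrow> 'a \<Rightarrow> real" where
  "kernel_one u j x = (\<Sum>y\<in>cl j x. \<sigma> y * ker u j x y)"

text \<open>
  On a cell of level \<open>i\<close>, levels from \<open>i\<close> on of the shift applied to \<open>1\<close> depend on the values inside this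
  cell only. Up to an error of size \<open>ratio\<close> this is the testing function \<open>local_test\<close>.
\<close>

definition tail_one :: "'u \<Rightarrow> nat \<Rightarrow> 'a \<Rightarrow> real" where
  "tail_one u i x = (\<Sum>j\<in>{i..<M}. kernel_one u j x)"

text \<open>The value at \<open>x\<close> of the shift applied to the indicator of the cell \<open>cl k x\<close>, that is, \<open>1\<^sub>Q T 1\<^sub>Q\<close>.\<close>

definition local_test :: "'u \<Rightarrow> nat \<Rightarrow> 'a \<Rightarrow> real" where
  "local_test u k x = (\<Sum>y\<in>cl k x. \<sigma> y * (\<Sum>j<M. ker u j x y))"

definition ratio :: "nat \<Rightarrow> 'a \<Rightarrow> real" where
  "ratio k x = (\<Sum>y\<in>cl k x. \<sigma> y) / V k"

text \<open>
  The testing condition and the quadratic condition, dualized: the left-hand norm is replaced by the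
  pairing with an arbitrary \<open>G\<close>, and \<open>r\<close> plays the role of the exponent conjugate to \<open>q\<close>. A collection of
  coefficients indexed by cubes is a sequence of functions \<open>b k\<close> constant on cells of level \<open>k\<close>.
\<close>

definition testing_form :: "real \<Rightarrow> real \<Rightarrow> real \<Rightarrow> bool" where
  "testing_form p r T \<longleftrightarrow> (\<forall>b G. (\<forall>u k. S.adapted k (b u k)) \<longrightarrow>
     (\<Sum>x\<in>X. w x * (\<Sum>u\<in>U. \<Sum>k<M. b u k x * local_test u k x * G u k x))
       \<le> T * wnorm X \<sigma> p (\<lambda>x. L2_set (\<lambda>(u, k). b u k x) (U \<times> {..<M}))
           * wnorm X w r (\<lambda>x. L2_set (\<lambda>(u, k). G u k x) (U \<times> {..<M})))"

definition A_form :: "real \<Rightarrow> real \<Rightarrow> real \<Rightarrow> bool" where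
  "A_form p r A \<longleftrightarrow> (\<forall>b G. (\<forall>k. S.adapted k (b k)) \<longrightarrow>
     (\<Sum>x\<in>X. w x * (\<Sum>k<M. b k x * ratio k x * G k x))
       \<le> A * wnorm X \<sigma> p (\<lambda>x. L2_set (\<lambda>k. b k x) {..<M})
           * wnorm X w r (\<lambda>x. L2_set (\<lambda>k. G k x) {..<M}))"

lemma A_formD:
  "A_form p r A \<Longrightarrow> (\<And>k. S.adapted k (b k)) \<Longrightarrow>
     (\<Sum>x\<in>X. w x * (\<Sum>k<M. b k x * ratio k x * G k x))
       \<le> A * wnorm X \<sigma> p (\<lambda>x. L2_set (\<lambda>k. b k x) {..<M})
           * wnorm X w r (\<lambda>x. L2_set (\<lambda>k. G k x) {..<M})"
  unfolding A_form_def by blast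

lemma testing_formD:
  "testing_form p r T \<Longrightarrow> (\<And>u k. S.adapted k (b u k)) \<Longrightarrow>
     (\<Sum>x\<in>X. w x * (\<Sum>u\<in>U. \<Sum>k<M. b u k x * local_test u k x * G u k x))
       \<le> T * wnorm X \<sigma> p (\<lambda>x. L2_set (\<lambda>(u, k). b u k x) (U \<times> {..<M}))
           * wnorm X w r (\<lambda>x. L2_set (\<lambda>(u, k). G u k x) (U \<times> {..<M}))"
  unfolding testing_form_def by blast

definition form :: "('u \<Rightarrow> 'a \<Rightarrow> real) \<Rightarrow> ('u \<Rightarrow> 'a \<Rightarrow> real) \<Rightarrow> real" where
  "form f g = (\<Sum>u\<in>U. \<Sum>x\<in>X. \<Sum>y\<in>X. w x * \<sigma> y * (\<Sum>j<M. ker u j x y) * f u y * g u x)"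

lemma ratio_nonneg: "x \<in> X \<Longrightarrow> 0 \<le> ratio k x"
  unfolding ratio_def using S.cl_weight_nonneg V_pos by (simp add: less_imp_le)

lemma adapted_ratio: "S.adapted k (ratio k)"
  unfolding S.adapted_def ratio_def using S.cl_eq by metis

lemma adapted_kernel_one: "u \<in> U \<Longrightarrow> S.adapted (j + s) (kernel_one u j)"
proof (rule S.adaptedI)
  fix x y assume u: "u \<in> U" and xy: "x \<in> X" "y \<in> X" "y \<in> cl (j + s) x"
  have "y \<in> cl j x" using S.cl_mono[of x j "j + s"] xy by auto
  then have "cl j y = cl j x" using S.cl_eq xy by blast
  moreover have "ker u j y z = ker u j x z" if "z \<in> cl j x" for z
    using S.adaptedD[OF ker_out[OF u, of z j]] that xy S.cl_sub by blast
  ultimately show "kernel_one u j y = kernel_one u j x" unfolding kernel_one_def by (auto intro!: sum.cong)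
qed

lemma tail_one_out_of_range: "M \<le> i \<Longrightarrow> tail_one u i x = 0"
  by (simp add: tail_one_def)

text \<open>
  One sequence of coefficients is as good as a family of them: the Cauchy--Schwarz inequality collapses
  the family to the lengths \<open>b'\<close>, which are again constant on cells.
\<close>

lemma A_form_vector:
  assumes A: "A_form p r A" and b: "\<And>i k. S.adapted k (b i k)"
  shows "(\<Sum>x\<in>X. w x * (\<Sum>i\<in>I. \<Sum>k<M. b i k x * ratio k x * G i k x))
       \<le> A * wnorm X \<sigma> p (\<lambda>x. L2_set (\<lambda>(i, k). b i k x) (I \<times> {..<M}))
           * wnorm X w r (\<lambda>x. L2_set (\<lambda>(i, k). G i k x) (I \<times> {..<M}))"
proof -
  define b' where "b' k x = L2_set (\<lambda>i. b i k x) I" for k x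
  define G' where "G' k x = L2_set (\<lambda>i. G i k x) I" for k x
  have ad: "S.adapted k (b' k)" for k unfolding b'_def using b by (rule S.adapted_L2)
  have "(\<Sum>x\<in>X. w x * (\<Sum>i\<in>I. \<Sum>k<M. b i k x * ratio k x * G i k x))
      \<le> (\<Sum>x\<in>X. w x * (\<Sum>k<M. b' k x * ratio k x * G' k x))"
  proof (intro sum_mono mult_left_mono W.weight_nonneg)
    fix x assume x: "x \<in> X"
    have "(\<Sum>i\<in>I. \<Sum>k<M. b i k x * ratio k x * G i k x) = (\<Sum>k<M. ratio k x * (\<Sum>i\<in>I. b i k x * G i k x))"
      by (subst sum.swap) (simp add: sum_distrib_left mult_ac)
    also have "\<dots> \<le> (\<Sum>k<M. ratio k x * (b' k x * G' k x))"
      unfolding b'_def G'_def by (intro sum_mono mult_left_mono L2_set_Cauchy_Schwarz ratio_nonneg x)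
    finally show "(\<Sum>i\<in>I. \<Sum>k<M. b i k x * ratio k x * G i k x) \<le> (\<Sum>k<M. b' k x * ratio k x * G' k x)"
      by (simp add: mult_ac)
  qed
  also have "\<dots> \<le> A * wnorm X \<sigma> p (\<lambda>x. L2_set (\<lambda>k. b' k x) {..<M}) * wnorm X w r (\<lambda>x. L2_set (\<lambda>k. G' k x) {..<M})"
    using A ad by (rule A_formD)
  finally show ?thesis by (simp add: b'_def G'_def L2_set_L2_set)
qed

text \<open>Both sides are sums of \<open>\<psi> * \<sigma>(Q) * w(Q)\<close> over the cells \<open>Q\<close> of level \<open>k\<close>.\<close>

lemma weight_swap:
  assumes \<psi>: "S.adapted k \<psi>"
  shows "(\<Sum>x\<in>X. \<sigma> x * (\<psi> x * (\<Sum>y\<in>cl k x. w y))) = (\<Sum>x\<in>X. w x * (\<psi> x * (\<Sum>y\<in>cl k x. \<sigma> y)))"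
proof -
  have "(\<Sum>x\<in>X. \<sigma> x * (\<psi> x * (\<Sum>y\<in>cl k x. w y))) = (\<Sum>x\<in>X. \<Sum>y\<in>X. if y \<in> cl k x then \<sigma> x * (\<psi> x * w y) else 0)"
    by (intro sum.cong refl) (simp add: S.sum_cl_eq[symmetric] sum_distrib_left)
  also have "\<dots> = (\<Sum>y\<in>X. \<Sum>x\<in>X. if y \<in> cl k x then \<sigma> x * (\<psi> x * w y) else 0)"
    by (rule sum.swap)
  also have "\<dots> = (\<Sum>y\<in>X. \<Sum>x\<in>X. if x \<in> cl k y then w y * (\<psi> y * \<sigma> x) else 0)"
  proof (rule sum.cong[OF refl], rule sum.cong[OF refl])
    fix x y assume "x \<in> X" "y \<in> X"
    then show "(if y \<in> cl k x then \<sigma> x * (\<psi> x * w y) else 0) = (if x \<in> cl k y then w y * (\<psi> y * \<sigma> x) else 0)"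
      using S.cl_sym[of x y k] S.adaptedD[OF \<psi>, of y x] by simp
  qed
  also have "\<dots> = (\<Sum>x\<in>X. w x * (\<psi> x * (\<Sum>y\<in>cl k x. \<sigma> y)))"
    by (intro sum.cong refl) (simp add: S.sum_cl_eq[symmetric] sum_distrib_left)
  finally show ?thesis .
qed

text \<open>
  The quadratic condition is self-dual up to a constant: \<open>G\<close> may be averaged over cells because the
  other factors are constant on them, then \<open>weight_swap\<close> moves the pairing from \<open>\<sigma>\<close> to \<open>w\<close>, and Stein's
  inequality removes the averages.
\<close>

lemma A_form_swapped:
  assumes A: "A_form p r A" and p: "1 < p" and A0: "0 \<le> A"
  shows "shift_kernels.A_form X cl M w \<sigma> V r p (A * maximal_const p)"
proof -
  interpret sw: shift_kernels X cl M w \<sigma> V s U "\<lambda>u j x y. ker u j y x" by (rule swapped)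
  show ?thesis
    unfolding sw.A_form_def
  proof (intro allI impI)
    fix b G :: "nat \<Rightarrow> 'a \<Rightarrow> real"
    assume b: "\<forall>k. S.adapted k (b k)"
    have one: "(\<Sum>x\<in>X. \<sigma> x * (b k x * sw.ratio k x * G k x)) = (\<Sum>x\<in>X. w x * (S.avg k (G k) x * ratio k x * b k x))" for k
    proof -
      have bk: "S.adapted k (b k)" using b by blast
      have "S.adapted k (\<lambda>x. b k x * sw.ratio k x)"
        using bk sw.adapted_ratio by (rule S.adapted_comp2)
      then have "(\<Sum>x\<in>X. \<sigma> x * (b k x * sw.ratio k x * G k x)) = (\<Sum>x\<in>X. \<sigma> x * (b k x * sw.ratio k x * S.avg k (G k) x))"
        by (rule S.integral_avg[symmetric])
      also have "\<dots> = (\<Sum>x\<in>X. \<sigma> x * ((b k x * S.avg k (G k) x / V k) * (\<Sum>y\<in>cl k x. w y)))"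
        by (simp add: sw.ratio_def mult_ac)
      also have "\<dots> = (\<Sum>x\<in>X. w x * ((b k x * S.avg k (G k) x / V k) * (\<Sum>y\<in>cl k x. \<sigma> y)))"
        using bk S.adapted_avg[of k "G k"] by (intro weight_swap) (auto simp: S.adapted_def)
      also have "\<dots> = (\<Sum>x\<in>X. w x * (S.avg k (G k) x * ratio k x * b k x))"
        by (simp add: ratio_def mult_ac)
      finally show ?thesis .
    qed
    have "(\<Sum>x\<in>X. \<sigma> x * (\<Sum>k<M. b k x * sw.ratio k x * G k x)) = (\<Sum>k<M. \<Sum>x\<in>X. \<sigma> x * (b k x * sw.ratio k x * G k x))"
      unfolding sum_distrib_left by (rule sum.swap)
    also have "\<dots> = (\<Sum>x\<in>X. w x * (\<Sum>k<M. S.avg k (G k) x * ratio k x * b k x))"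
      unfolding one sum_distrib_left by (rule sum.swap)
    also have "\<dots> \<le> A * wnorm X \<sigma> p (\<lambda>x. L2_set (\<lambda>k. S.avg k (G k) x) {..<M}) * wnorm X w r (\<lambda>x. L2_set (\<lambda>k. b k x) {..<M})"
      using A S.adapted_avg by (rule A_formD)
    also have "\<dots> \<le> A * (maximal_const p * wnorm X \<sigma> p (\<lambda>x. L2_set (\<lambda>k. G k x) {..<M})) * wnorm X w r (\<lambda>x. L2_set (\<lambda>k. b k x) {..<M})"
      using A0 p S.Stein_inequality[OF p, of "{..<M}" "\<lambda>k. k" G] by (intro mult_right_mono mult_left_mono) auto
    finally show "(\<Sum>x\<in>X. \<sigma> x * (\<Sum>k<M. b k x * sw.ratio k x * G k x))
      \<le> A * maximal_const p * wnorm X w r (\<lambda>x. L2_set (\<lambda>k. b k x) {..<M}) * wnorm X \<sigma> p (\<lambda>x. L2_set (\<lambda>k. G k x) {..<M})"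
      by (simp add: mult_ac)
  qed
qed

lemma sum_inverse_V: "(\<Sum>j<k. 1 / V j) \<le> 1 / V k"
proof (induction k)
  case (Suc k)
  have "(\<Sum>j<Suc k. 1 / V j) \<le> 2 / V k" using Suc by simp
  also have "\<dots> \<le> 1 / V (Suc k)" using V_half[of k] V_pos by (simp add: field_simps)
  finally show ?case .
qed (use V_pos[of 0] in simp)

text \<open>
  The difference consists of the levels below \<open>k\<close>, whose kernels are bounded by \<open>1 / V j\<close>; these bounds
  form a geometric series because \<open>V\<close> at least halves from one level to the next.
\<close>

lemma local_test_tail_one:
  assumes u: "u \<in> U" and x: "x \<in> X"
  shows "\<bar>local_test u k x - tail_one u k x\<bar> \<le> ratio k x"
proof -
  have split: "(\<Sum>j<M. ker u j x y) = (\<Sum>j<min k M. ker u j x y) + (\<Sum>j\<in>{k..<M}. ker u j x y)" for y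
    by (subst sum.union_disjoint[symmetric]) (auto intro!: sum.cong)
  have loc: "kernel_one u j x = (\<Sum>y\<in>cl k x. \<sigma> y * ker u j x y)" if "k \<le> j" for j
  proof -
    have "ker u j x y = 0" if "y \<in> cl k x - cl j x" for y
      using ker_supp[OF u x, of y j] that S.cl_sub[OF x, of k] by blast
    then show ?thesis
      unfolding kernel_one_def using S.cl_mono[OF x that] S.fin_cl[OF x] by (intro sum.mono_neutral_left) auto
  qed
  have "tail_one u k x = (\<Sum>y\<in>cl k x. \<sigma> y * (\<Sum>j\<in>{k..<M}. ker u j x y))"
    unfolding tail_one_def sum_distrib_left by (subst sum.swap) (simp add: loc)
  then have "local_test u k x - tail_one u k x = (\<Sum>y\<in>cl k x. \<sigma> y * (\<Sum>j<min k M. ker u j x y))"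
    by (simp add: local_test_def split distrib_left sum.distrib)
  also have "\<bar>\<dots>\<bar> \<le> (\<Sum>y\<in>cl k x. \<sigma> y * (1 / V k))"
  proof (rule order_trans[OF sum_abs], rule sum_mono)
    fix y assume y: "y \<in> cl k x"
    then have yX: "y \<in> X" using S.cl_sub x by blast
    have "\<bar>\<Sum>j<min k M. ker u j x y\<bar> \<le> (\<Sum>j<min k M. 1 / V j)"
      using ker_bound[OF u x yX] by (intro order_trans[OF sum_abs] sum_mono) auto
    also have "\<dots> \<le> (\<Sum>j<k. 1 / V j)" using V_pos by (intro sum_mono2) (auto simp: less_imp_le)
    also have "\<dots> \<le> 1 / V k" by (rule sum_inverse_V)
    finally show "\<bar>\<sigma> y * (\<Sum>j<min k M. ker u j x y)\<bar> \<le> \<sigma> y * (1 / V k)"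
      using S.weight_nonneg[OF yX] by (simp only: abs_mult abs_of_nonneg mult_left_mono)
  qed
  also have "\<dots> = ratio k x" by (simp add: ratio_def sum_distrib_right[symmetric] sum_divide_distrib)
  finally show ?thesis .
qed

lemma L2_set_abs: "L2_set (\<lambda>(u, k). \<bar>b u k\<bar>) A = L2_set (\<lambda>(u, k). b u k) A" for b :: "'b \<Rightarrow> 'c \<Rightarrow> real"
  by (simp add: L2_set_def split_def)

text \<open>
  The testing condition in the form in which it is applied: with \<open>tail_one\<close> in place of the shift
  of the indicator of a cell, at the cost of the quadratic condition.
\<close>

lemma localized_testing:
  assumes T: "testing_form p r T" and A: "A_form p r A" and b: "\<And>u k. S.adapted k (b u k)"
  shows "(\<Sum>x\<in>X. w x * (\<Sum>u\<in>U. \<Sum>k<M. b u k x * tail_one u k x * G u k x))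
       \<le> (T + A) * wnorm X \<sigma> p (\<lambda>x. L2_set (\<lambda>(u, k). b u k x) (U \<times> {..<M}))
           * wnorm X w r (\<lambda>x. L2_set (\<lambda>(u, k). G u k x) (U \<times> {..<M}))"
proof -
  let ?b = "wnorm X \<sigma> p (\<lambda>x. L2_set (\<lambda>(u, k). b u k x) (U \<times> {..<M}))"
  let ?G = "wnorm X w r (\<lambda>x. L2_set (\<lambda>(u, k). G u k x) (U \<times> {..<M}))"
  have "(\<Sum>x\<in>X. w x * (\<Sum>u\<in>U. \<Sum>k<M. b u k x * tail_one u k x * G u k x))
     \<le> (\<Sum>x\<in>X. w x * (\<Sum>u\<in>U. \<Sum>k<M. b u k x * local_test u k x * G u k x + \<bar>b u k x\<bar> * ratio k x * \<bar>G u k x\<bar>))"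
  proof (intro sum_mono mult_left_mono W.weight_nonneg)
    fix x u k assume x: "x \<in> X" and u: "u \<in> U"
    have "b u k x * (tail_one u k x - local_test u k x) * G u k x \<le> \<bar>b u k x\<bar> * \<bar>local_test u k x - tail_one u k x\<bar> * \<bar>G u k x\<bar>"
      by (metis abs_ge_self abs_minus_commute abs_mult)
    also have "\<dots> \<le> \<bar>b u k x\<bar> * ratio k x * \<bar>G u k x\<bar>"
      using local_test_tail_one[OF u x] by (intro mult_right_mono mult_left_mono) auto
    finally show "b u k x * tail_one u k x * G u k x \<le> b u k x * local_test u k x * G u k x + \<bar>b u k x\<bar> * ratio k x * \<bar>G u k x\<bar>"
      by (simp add: algebra_simps)
  qed
  also have "\<dots> = (\<Sum>x\<in>X. w x * (\<Sum>u\<in>U. \<Sum>k<M. b u k x * local_test u k x * G u k x))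
      + (\<Sum>x\<in>X. w x * (\<Sum>u\<in>U. \<Sum>k<M. \<bar>b u k x\<bar> * ratio k x * \<bar>G u k x\<bar>))"
    by (simp only: sum.distrib distrib_left)
  also have "\<dots> \<le> T * ?b * ?G + A * ?b * ?G"
  proof (rule add_mono)
    show "(\<Sum>x\<in>X. w x * (\<Sum>u\<in>U. \<Sum>k<M. b u k x * local_test u k x * G u k x)) \<le> T * ?b * ?G"
      using T b by (rule testing_formD)
    have "S.adapted k (\<lambda>x. \<bar>b u k x\<bar>)" for u k using b by (rule S.adapted_comp)
    from A_form_vector[OF A, where b = "\<lambda>u k x. \<bar>b u k x\<bar>" and I = U and G = "\<lambda>u k x. \<bar>G u k x\<bar>", OF this]
    show "(\<Sum>x\<in>X. w x * (\<Sum>u\<in>U. \<Sum>k<M. \<bar>b u k x\<bar> * ratio k x * \<bar>G u k x\<bar>)) \<le> A * ?b * ?G"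
      by (simp only: L2_set_abs)
  qed
  finally show ?thesis by (simp add: algebra_simps)
qed

end

section \<open>The bilinear form of the kernels\<close>

context shift_kernels
begin

lemma T_kernel_const:
  assumes u: "u \<in> U" and x: "x \<in> X" and \<phi>: "S.adapted j \<phi>"
  shows "(\<Sum>y\<in>X. \<sigma> y * (ker u j x y * \<phi> y)) = \<phi> x * kernel_one u j x"
proof -
  have "(\<Sum>y\<in>X. \<sigma> y * (ker u j x y * \<phi> y)) = (\<Sum>y\<in>cl j x. \<sigma> y * (ker u j x y * \<phi> y))"
    using ker_supp[OF u x] S.cl_sub[OF x] S.fin by (intro sum.mono_neutral_right) auto
  also have "\<dots> = (\<Sum>y\<in>cl j x. \<phi> x * (\<sigma> y * ker u j x y))"
    using S.adaptedD[OF \<phi> x] by (intro sum.cong) auto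
  finally show ?thesis by (simp add: kernel_one_def sum_distrib_left)
qed

text \<open>The kernel of level \<open>j\<close> is constant on cells of level \<open>j + s\<close>, over which finer differences integrate to zero.\<close>

lemma T_kernel_dif:
  assumes u: "u \<in> U" and x: "x \<in> X" and k: "j + s < k"
  shows "(\<Sum>y\<in>X. \<sigma> y * (ker u j x y * S.dif k f y)) = 0"
proof -
  obtain k' where k': "k = Suc k'" "j + s \<le> k'" using k by (cases k) auto
  show ?thesis unfolding k'(1)
    using S.adapted_mono[OF ker_in[OF u x] k'(2)] by (rule S.integral_dif_0)
qed

text \<open>The contribution of the differences of levels \<open>k\<close> and \<open>l\<close> to the part of level \<open>j\<close> of the form.\<close>

definition block :: "'u \<Rightarrow> nat \<Rightarrow> nat \<Rightarrow> nat \<Rightarrow> ('a \<Rightarrow> real) \<Rightarrow> ('a \<Rightarrow> real) \<Rightarrow> real" where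
  "block u j k l f g = (\<Sum>x\<in>X. w x * (W.dif l g x * (\<Sum>y\<in>X. \<sigma> y * (ker u j x y * S.dif k f y))))"

lemma block_zero_in: "u \<in> U \<Longrightarrow> j + s < k \<Longrightarrow> block u j k l f g = 0"
  by (simp add: block_def T_kernel_dif)

lemma block_swap:
  "block u j k l f g = shift_kernels.block X cl w \<sigma> (\<lambda>u j x y. ker u j y x) u j l k g f"
proof -
  interpret sw: shift_kernels X cl M w \<sigma> V s U "\<lambda>u j x y. ker u j y x" by (rule swapped)
  show ?thesis
    unfolding block_def sw.block_def sum_distrib_left
    by (subst sum.swap) (simp add: mult_ac)
qed

lemma block_zero_out:
  assumes "u \<in> U" "j + s < l"
  shows "block u j k l f g = 0"
proof -
  interpret sw: shift_kernels X cl M w \<sigma> V s U "\<lambda>u j x y. ker u j y x" by (rule swapped)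
  show ?thesis unfolding block_swap using assms by (rule sw.block_zero_in)
qed

lemma block_const:
  assumes "u \<in> U" "k \<le> j"
  shows "block u j k l f g = (\<Sum>x\<in>X. w x * (S.dif k f x * kernel_one u j x * W.dif l g x))"
  unfolding block_def using assms
  by (intro sum.cong refl) (simp add: T_kernel_const S.adapted_mono[OF S.adapted_dif])

text \<open>
  Cells of level at least \<open>M\<close> are points, so the differences up to level \<open>M + s - 1\<close> sum up to the
  function itself wherever the weight does not vanish. The upper limit \<open>M + s\<close> instead of \<open>M + 1\<close> keeps
  the ranges below uniform; the additional differences are zero.
\<close>

lemma form_block:
  "form f g = (\<Sum>u\<in>U. \<Sum>j<M. \<Sum>k<M + s. \<Sum>l<M + s. block u j k l (f u) (g u))"
proof -
  have f: "\<sigma> y * f u y = \<sigma> y * (\<Sum>k<M + s. S.dif k (f u) y)" if "y \<in> X" for u y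
  proof -
    have "(\<Sum>k<M + s. S.dif k (f u) y) = S.avg (M + s - 1) (f u) y"
      using S.sum_dif[where k = "M + s - 1"] s_pos by (metis Suc_diff_1 add_gr_0 less_le_trans lessThan_Suc_atMost zero_less_one)
    then show ?thesis using S.avg_fine[OF that, of "M + s - 1" "f u"] s_pos by (cases "\<sigma> y = 0") auto
  qed
  have g: "w x * g u x = w x * (\<Sum>l<M + s. W.dif l (g u) x)" if "x \<in> X" for u x
  proof -
    have "(\<Sum>l<M + s. W.dif l (g u) x) = W.avg (M + s - 1) (g u) x"
      using W.sum_dif[where k = "M + s - 1"] s_pos by (metis Suc_diff_1 add_gr_0 less_le_trans lessThan_Suc_atMost zero_less_one)
    then show ?thesis using W.avg_fine[OF that, of "M + s - 1" "g u"] s_pos by (cases "w x = 0") auto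
  qed
  have "form f g = (\<Sum>u\<in>U. \<Sum>x\<in>X. \<Sum>y\<in>X. \<Sum>j<M. ker u j x y * (\<sigma> y * f u y) * (w x * g u x))"
    unfolding form_def by (simp add: sum_distrib_left sum_distrib_right mult_ac)
  also have "\<dots> = (\<Sum>u\<in>U. \<Sum>x\<in>X. \<Sum>y\<in>X. \<Sum>j<M. ker u j x y * (\<sigma> y * (\<Sum>k<M + s. S.dif k (f u) y)) * (w x * (\<Sum>l<M + s. W.dif l (g u) x)))"
    by (intro sum.cong refl) (simp only: f g)
  also have "\<dots> = (\<Sum>u\<in>U. \<Sum>j<M. \<Sum>x\<in>X. \<Sum>y\<in>X. ker u j x y * (\<sigma> y * (\<Sum>k<M + s. S.dif k (f u) y)) * (w x * (\<Sum>l<M + s. W.dif l (g u) x)))"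
    by (rule sum.cong[OF refl], rule sym, subst sum.swap, rule sum.cong[OF refl], rule sum.swap)
  also have "\<dots> = (\<Sum>u\<in>U. \<Sum>j<M. \<Sum>k<M + s. \<Sum>l<M + s. block u j k l (f u) (g u))"
  proof (rule sum.cong[OF refl], rule sum.cong[OF refl])
    fix u j
    let ?P = "\<lambda>k l x y. w x * (W.dif l (g u) x * (\<sigma> y * (ker u j x y * S.dif k (f u) y)))"
    have "(\<Sum>x\<in>X. \<Sum>y\<in>X. ker u j x y * (\<sigma> y * (\<Sum>k<M + s. S.dif k (f u) y)) * (w x * (\<Sum>l<M + s. W.dif l (g u) x)))
       = (\<Sum>x\<in>X. \<Sum>y\<in>X. \<Sum>k<M + s. \<Sum>l<M + s. ?P k l x y)"
      by (simp add: sum_distrib_left sum_distrib_right mult_ac)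
    also have "\<dots> = (\<Sum>x\<in>X. \<Sum>k<M + s. \<Sum>y\<in>X. \<Sum>l<M + s. ?P k l x y)"
      by (rule sum.cong[OF refl], rule sum.swap)
    also have "\<dots> = (\<Sum>x\<in>X. \<Sum>k<M + s. \<Sum>l<M + s. \<Sum>y\<in>X. ?P k l x y)"
      by (rule sum.cong[OF refl], rule sum.cong[OF refl], rule sum.swap)
    also have "\<dots> = (\<Sum>k<M + s. \<Sum>x\<in>X. \<Sum>l<M + s. \<Sum>y\<in>X. ?P k l x y)"
      by (rule sum.swap)
    also have "\<dots> = (\<Sum>k<M + s. \<Sum>l<M + s. \<Sum>x\<in>X. \<Sum>y\<in>X. ?P k l x y)"
      by (rule sum.cong[OF refl], rule sum.swap)
    also have "\<dots> = (\<Sum>k<M + s. \<Sum>l<M + s. block u j k l (f u) (g u))"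
      by (simp only: block_def sum_distrib_left)
    finally show "(\<Sum>x\<in>X. \<Sum>y\<in>X. ker u j x y * (\<sigma> y * (\<Sum>k<M + s. S.dif k (f u) y)) * (w x * (\<Sum>l<M + s. W.dif l (g u) x)))
       = (\<Sum>k<M + s. \<Sum>l<M + s. block u j k l (f u) (g u))" .
  qed
  finally show ?thesis .
qed

subsection \<open>The paraproduct\<close>

text \<open>
  For fixed \<open>l = i + s\<close> the differences of \<open>f\<close> of levels \<open>k \<le> i\<close> add up to the average of level \<open>i\<close>, and
  levels \<open>j < i\<close> of the kernel do not see a difference of level \<open>l\<close>; the others add up to
  \<open>tail_one\<close>.
\<close>

lemma paraproduct_eq:
  assumes u: "u \<in> U"
  shows "(\<Sum>j<M. \<Sum>k<M + s. \<Sum>l<M + s. if k + s \<le> l then block u j k l f g else 0)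
     = (\<Sum>i<M. \<Sum>x\<in>X. w x * (S.avg i f x * tail_one u i x * W.dif (i + s) g x))"
proof -
  have inner: "(\<Sum>k<M + s. if k \<le> i then block u j k (i + s) f g else 0) =
      (if i \<le> j then \<Sum>x\<in>X. w x * (S.avg i f x * kernel_one u j x * W.dif (i + s) g x) else 0)"
    if "i < M" for i j
  proof (cases "i \<le> j")
    case True
    have "(\<Sum>k<M + s. if k \<le> i then block u j k (i + s) f g else 0) = (\<Sum>k\<le>i. block u j k (i + s) f g)"
      using that by (subst sum.inter_filter[symmetric]) (auto intro!: sum.cong)
    also have "\<dots> = (\<Sum>k\<le>i. \<Sum>x\<in>X. w x * (S.dif k f x * kernel_one u j x * W.dif (i + s) g x))"
      using True u by (intro sum.cong refl block_const) auto
    also have "\<dots> = (\<Sum>x\<in>X. w x * ((\<Sum>k\<le>i. S.dif k f x) * kernel_one u j x * W.dif (i + s) g x))"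
      by (subst sum.swap) (simp add: sum_distrib_left sum_distrib_right)
    finally show ?thesis using True by (simp add: S.sum_dif)
  next
    case False
    then show ?thesis using block_zero_out[OF u, of j "i + s"] by (auto intro!: sum.neutral)
  qed
  have "(\<Sum>j<M. \<Sum>k<M + s. \<Sum>l<M + s. if k + s \<le> l then block u j k l f g else 0)
      = (\<Sum>j<M. \<Sum>l<M + s. \<Sum>k<M + s. if k + s \<le> l then block u j k l f g else 0)"
    by (rule sum.cong[OF refl], rule sum.swap)
  also have "\<dots> = (\<Sum>j<M. \<Sum>i<M. \<Sum>k<M + s. if k \<le> i then block u j k (i + s) f g else 0)"
  proof (rule sum.cong[OF refl])
    fix j
    have "(\<Sum>l<M + s. \<Sum>k<M + s. if k + s \<le> l then block u j k l f g else 0)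
        = (\<Sum>l\<in>{s..<M + s}. \<Sum>k<M + s. if k + s \<le> l then block u j k l f g else 0)"
      by (rule sum.mono_neutral_right) (auto intro!: sum.neutral)
    also have "\<dots> = (\<Sum>i<M. \<Sum>k<M + s. if k + s \<le> i + s then block u j k (i + s) f g else 0)"
      by (rule sum.reindex_bij_witness[of _ "\<lambda>i. i + s" "\<lambda>l. l - s"]) (auto cong: if_cong)
    finally show "(\<Sum>l<M + s. \<Sum>k<M + s. if k + s \<le> l then block u j k l f g else 0)
       = (\<Sum>i<M. \<Sum>k<M + s. if k \<le> i then block u j k (i + s) f g else 0)" by simp
  qed
  also have "\<dots> = (\<Sum>i<M. \<Sum>j<M. \<Sum>k<M + s. if k \<le> i then block u j k (i + s) f g else 0)"
    by (rule sum.swap)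
  also have "\<dots> = (\<Sum>i<M. \<Sum>j<M. if i \<le> j then \<Sum>x\<in>X. w x * (S.avg i f x * kernel_one u j x * W.dif (i + s) g x) else 0)"
    using inner by (intro sum.cong refl) simp
  also have "\<dots> = (\<Sum>i<M. \<Sum>x\<in>X. w x * (S.avg i f x * tail_one u i x * W.dif (i + s) g x))"
  proof (rule sum.cong[OF refl])
    fix i
    have "(\<Sum>j<M. if i \<le> j then \<Sum>x\<in>X. w x * (S.avg i f x * kernel_one u j x * W.dif (i + s) g x) else 0)
       = (\<Sum>j\<in>{i..<M}. \<Sum>x\<in>X. w x * (S.avg i f x * kernel_one u j x * W.dif (i + s) g x))"
      by (subst sum.inter_filter[symmetric]) (auto intro!: sum.cong)
    also have "\<dots> = (\<Sum>x\<in>X. w x * (S.avg i f x * tail_one u i x * W.dif (i + s) g x))"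
      unfolding tail_one_def by (subst sum.swap) (simp add: sum_distrib_left sum_distrib_right)
    finally show "(\<Sum>j<M. if i \<le> j then \<Sum>x\<in>X. w x * (S.avg i f x * kernel_one u j x * W.dif (i + s) g x) else 0)
       = (\<Sum>x\<in>X. w x * (S.avg i f x * tail_one u i x * W.dif (i + s) g x))" .
  qed
  finally show ?thesis .
qed

text \<open>
  The level of the stopping cell around \<open>x\<close>, for the family of cells on which the average of \<open>|f|\<close> has more
  than doubled.
\<close>

definition stop_level :: "('a \<Rightarrow> real) \<Rightarrow> nat \<Rightarrow> 'a \<Rightarrow> nat" where
  "stop_level f i x = stop (\<lambda>i. S.avg i (\<lambda>y. \<bar>f y\<bar>) x) i"

lemma adapted_stop_level: "S.adapted i (stop_level f i)"
  unfolding S.adapted_def stop_level_def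
proof (intro ballI, rule stop_cong)
  fix x y j assume "x \<in> X" "y \<in> cl i x" "j \<le> i"
  then show "S.avg j (\<lambda>y. \<bar>f y\<bar>) y = S.avg j (\<lambda>y. \<bar>f y\<bar>) x"
    using S.adaptedD[OF S.adapted_mono[OF S.adapted_avg]] by blast
qed

lemma abs_avg_le_stop_level: "x \<in> X \<Longrightarrow> \<bar>S.avg i f x\<bar> \<le> 2 * S.avg (stop_level f i x) (\<lambda>y. \<bar>f y\<bar>) x"
  unfolding stop_level_def
  by (rule order_trans[OF S.abs_avg_le le_stop[where c = "\<lambda>i. S.avg i (\<lambda>y. \<bar>f y\<bar>) x"]])
     (auto intro: S.avg_nonneg)

text \<open>
  Replacing the localized testing function at level \<open>i\<close> by the one at the stopping level changes
  it by a function that is constant on the cells of level \<open>i + s - 1\<close>, hence orthogonal to the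
  martingale differences of level \<open>i + s\<close>.
\<close>

lemma tail_one_to_stopping_level:
  assumes u: "u \<in> U" and i: "i < M"
  shows "(\<Sum>x\<in>X. w x * (S.avg i f x * tail_one u i x * W.dif (i + s) g x))
     = (\<Sum>x\<in>X. w x * (S.avg i f x * tail_one u (stop_level f i x) x * W.dif (i + s) g x))"
proof -
  obtain k where k: "i + s = Suc k" using s_pos by (cases s) auto
  define \<phi> where "\<phi> x = S.avg i f x * (\<Sum>j<i. if stop_level f i x \<le> j then kernel_one u j x else 0)" for x
  have eq: "S.avg i f x * tail_one u (stop_level f i x) x = S.avg i f x * tail_one u i x + \<phi> x" for x
  proof -
    have le: "stop_level f i x \<le> i" unfolding stop_level_def by (rule stop_le)
    then have "tail_one u (stop_level f i x) x = (\<Sum>j\<in>{stop_level f i x..<i}. kernel_one u j x) + tail_one u i x"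
      unfolding tail_one_def using i by (simp add: sum.atLeastLessThan_concat)
    moreover have "(\<Sum>j\<in>{stop_level f i x..<i}. kernel_one u j x) = (\<Sum>j<i. if stop_level f i x \<le> j then kernel_one u j x else 0)"
      by (subst sum.inter_filter[symmetric]) (auto intro!: sum.cong)
    ultimately show ?thesis by (simp add: \<phi>_def algebra_simps)
  qed
  have "S.adapted k \<phi>"
  proof (rule S.adaptedI)
    fix x y assume xy: "x \<in> X" "y \<in> cl k x"
    have ik: "i \<le> k" using k s_pos by simp
    have 1: "S.avg i f y = S.avg i f x" "stop_level f i y = stop_level f i x"
      using S.adaptedD[OF S.adapted_mono[OF S.adapted_avg ik] xy] S.adaptedD[OF S.adapted_mono[OF adapted_stop_level ik] xy] by auto
    have "kernel_one u j y = kernel_one u j x" if "j < i" for j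
      using S.adaptedD[OF S.adapted_mono[OF adapted_kernel_one[OF u, of j], of k] xy] k that by simp
    then show "\<phi> y = \<phi> x" by (auto simp: \<phi>_def 1 intro!: sum.cong)
  qed
  then have "(\<Sum>x\<in>X. w x * (\<phi> x * W.dif (i + s) g x)) = 0"
    unfolding k by (rule W.integral_dif_0)
  then show ?thesis unfolding eq by (simp add: distrib_left distrib_right sum.distrib)
qed

text \<open>
  After moving \<open>tail_one\<close> to the stopping level, group the terms by the stopping level \<open>r\<close>. The
  coefficient \<open>b u r\<close> is the average of \<open>|f u|\<close> on the stopping cell, and \<open>v u r\<close> collects the differences of
  \<open>g u\<close> that belong to it, multiplied by the ratio \<open>\<theta>\<close> between the average and its stopping value, which
  is at most \<open>2\<close>. Localized testing separates \<open>b\<close> from \<open>v\<close>. Since stopping values grow geometrically,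
  the square sum of \<open>b\<close> is bounded by the maximal function. Since each difference of \<open>g u\<close> is used for one
  stopping level only, the square function estimates, applied once in each direction, bound \<open>v\<close> by \<open>g\<close>.
\<close>

lemma paraproduct_bound:
  assumes p: "1 < p" and r: "1 < r" and T: "testing_form p r T" and A: "A_form p r A" and TA: "0 \<le> T + A"
  shows "(\<Sum>u\<in>U. \<Sum>j<M. \<Sum>k<M + s. \<Sum>l<M + s. if k + s \<le> l then block u j k l (f u) (g u) else 0)
    \<le> 4 * maximal_const p * square_const (conj_exponent r) * square_const r * (T + A)
       * (wnorm X \<sigma> p (\<lambda>x. L2_set (\<lambda>u. f u x) U) * wnorm X w r (\<lambda>x. L2_set (\<lambda>u. g u x) U))"
proof -
  define c where "c u i x = S.avg i (\<lambda>y. \<bar>f u y\<bar>) x" for u i x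
  define \<rho> where "\<rho> u i x = stop_level (f u) i x" for u i x
  define b where "b u r x = (if \<rho> u r x = r then c u r x else 0)" for u r x
  define \<theta> where "\<theta> u i x = S.avg i (f u) x / c u (\<rho> u i x) x" for u i x
  define \<delta> where "\<delta> = (\<lambda>(u, r) l x. if s \<le> l \<and> l - s < M \<and> \<rho> u (l - s) x = r
      then \<theta> u (l - s) x * W.dif l (g u) x else 0)"
  define v where "v = (\<lambda>u r x. \<Sum>l\<le>M + s. \<delta> (u, r) l x)"
  have \<rho>_stop: "\<rho> u i x = stop (\<lambda>i. c u i x) i" for u i x by (simp add: \<rho>_def stop_level_def c_def)
  have cnn: "0 \<le> c u i x" if "x \<in> X" for u i x unfolding c_def using that by (intro S.avg_nonneg) auto
  have ac: "\<bar>S.avg i (f u) x\<bar> \<le> 2 * c u (\<rho> u i x) x" if "x \<in> X" for u i x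
    using abs_avg_le_stop_level[OF that, of i "f u"] by (simp add: c_def \<rho>_def)
  have \<theta>2: "\<bar>\<theta> u i x\<bar> \<le> 2" if "x \<in> X" for u i x
  proof (cases "c u (\<rho> u i x) x = 0")
    case False
    then have "0 < c u (\<rho> u i x) x" using cnn[OF that, of u "\<rho> u i x"] by simp
    then show ?thesis using ac[OF that, of i u] by (simp add: \<theta>_def abs_divide divide_le_eq)
  qed (simp add: \<theta>_def)
  have \<theta>c: "S.avg i (f u) x = c u (\<rho> u i x) x * \<theta> u i x" if "x \<in> X" for u i x
    using ac[OF that, of i u] by (cases "c u (\<rho> u i x) x = 0") (auto simp: \<theta>_def)
  have ad_\<rho>: "S.adapted i (\<rho> u i)" for u i unfolding \<rho>_def by (rule adapted_stop_level)
  have ad_c: "S.adapted i (c u i)" for u i using S.adapted_avg by (simp add: c_def[abs_def])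
  have ad_b: "S.adapted i (b u i)" for u i
    using ad_\<rho>[of i u] ad_c[of i u] by (auto simp: S.adapted_def b_def)
  have ad_\<theta>: "S.adapted i (\<theta> u i)" for u i
  proof (rule S.adaptedI)
    fix x y assume xy: "x \<in> X" "y \<in> cl i x"
    have \<rho>y: "\<rho> u i y = \<rho> u i x" using S.adaptedD[OF ad_\<rho> xy] .
    have "\<rho> u i x \<le> i" unfolding \<rho>_stop by (rule stop_le)
    then have "c u (\<rho> u i x) y = c u (\<rho> u i x) x"
      using S.adaptedD[OF S.adapted_mono[OF ad_c] xy] by blast
    then show "\<theta> u i y = \<theta> u i x"
      using S.adaptedD[OF S.adapted_avg xy, of "f u"] by (simp add: \<theta>_def \<rho>y)
  qed
  have v_eq: "v u r x = (\<Sum>i<M. if \<rho> u i x = r then \<theta> u i x * W.dif (i + s) (g u) x else 0)" for u r x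
  proof -
    have "v u r x = (\<Sum>l\<in>{s..<M + s}. \<delta> (u, r) l x)"
      unfolding v_def by (rule sum.mono_neutral_right) (auto simp: \<delta>_def)
    also have "\<dots> = (\<Sum>i<M. \<delta> (u, r) (i + s) x)"
      by (rule sum.reindex_bij_witness[of _ "\<lambda>i. i + s" "\<lambda>l. l - s"]) auto
    finally show ?thesis by (simp add: \<delta>_def cong: if_cong)
  qed
  have ad_coef: "S.adapted i (\<lambda>x. if \<rho> u i x = r then \<theta> u i x else 0)" for u i r
    using ad_\<rho>[of i u] ad_\<theta>[of i u] by (auto simp: S.adapted_def)
  have \<delta>_eq: "\<delta> (u, r) l x = (if s \<le> l \<and> l - s < M then (if \<rho> u (l - s) x = r then \<theta> u (l - s) x else 0) * W.dif l (g u) x else 0)" for u r l x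
    by (simp add: \<delta>_def)
  have ad_\<delta>: "S.adapted l (\<delta> i l)" for i l
  proof (cases i)
    case (Pair u r)
    have "S.adapted l (\<lambda>x. if \<rho> u (l - s) x = r then \<theta> u (l - s) x else 0)"
      using ad_coef by (rule S.adapted_mono) simp
    then show ?thesis using W.adapted_dif[of l "g u"] unfolding Pair S.adapted_def \<delta>_eq by auto
  qed
  have orth: "(\<Sum>x\<in>X. w x * (\<phi> x * \<delta> i (Suc k) x)) = 0" if \<phi>: "S.adapted k \<phi>" for \<phi> i k
  proof (cases i)
    case (Pair u r)
    let ?i = "Suc k - s"
    have "S.adapted k (\<lambda>x. if \<rho> u ?i x = r then \<theta> u ?i x else 0)"
      using ad_coef by (rule S.adapted_mono) (use s_pos in simp)
    then have "S.adapted k (\<lambda>x. \<phi> x * (if \<rho> u ?i x = r then \<theta> u ?i x else 0))"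
      using \<phi> by (auto simp: S.adapted_def)
    from W.integral_dif_0[OF this, of "g u"] show ?thesis
      unfolding Pair \<delta>_eq
      by (cases "s \<le> Suc k \<and> Suc k - s < M") (simp_all only: if_True if_False mult.assoc mult_zero_right sum.neutral_const simp_thms)
  qed
  let ?nf = "wnorm X \<sigma> p (\<lambda>x. L2_set (\<lambda>u. f u x) U)"
  let ?ng = "wnorm X w r (\<lambda>x. L2_set (\<lambda>u. g u x) U)"
  \<comment> \<open>The stopping values are dominated by the maximal function.\<close>
  have nb: "wnorm X \<sigma> p (\<lambda>x. L2_set (\<lambda>(u, k). b u k x) (U \<times> {..<M})) \<le> 2 * maximal_const p * ?nf"
  proof -
    have "wnorm X \<sigma> p (\<lambda>x. L2_set (\<lambda>(u, k). b u k x) (U \<times> {..<M}))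
        \<le> wnorm X \<sigma> p (\<lambda>x. 2 * L2_set (\<lambda>u. S.running_max (f u) (Suc M) x) U)"
    proof (rule wnorm_mono)
      fix x assume x: "x \<in> X"
      have "L2_set (\<lambda>(u, k). b u k x) (U \<times> {..<M}) = sqrt (\<Sum>u\<in>U. \<Sum>k<M. (b u k x)\<^sup>2)"
        unfolding L2_set_Times by (subst sum.swap) simp
      also have "\<dots> \<le> sqrt (\<Sum>u\<in>U. (2 * S.running_max (f u) (Suc M) x)\<^sup>2)"
      proof (intro real_sqrt_le_mono sum_mono)
        fix u
        let ?c = "\<lambda>i. c u i x"
        have "(\<Sum>k<M. (b u k x)\<^sup>2) \<le> (\<Sum>k\<le>M. (if stop ?c k = k then ?c k else 0)\<^sup>2)"
          by (auto simp add: b_def \<rho>_stop intro!: sum_mono2)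
        also have "\<dots> \<le> 4/3 * (?c (stop ?c M))\<^sup>2" using cnn[OF x] by (rule sum_stop_le)
        also have "\<dots> \<le> 4 * (S.running_max (f u) (Suc M) x)\<^sup>2"
        proof (intro mult_mono power_mono)
          show "?c (stop ?c M) \<le> S.running_max (f u) (Suc M) x"
            unfolding c_def by (rule S.avg_le_running_max) (use stop_le[of _ M] in \<open>simp add: le_imp_less_Suc\<close>)
        qed (use cnn[OF x] in auto)
        finally show "(\<Sum>k<M. (b u k x)\<^sup>2) \<le> (2 * S.running_max (f u) (Suc M) x)\<^sup>2" by (simp add: power_mult_distrib)
      qed
      also have "\<dots> = 2 * L2_set (\<lambda>u. S.running_max (f u) (Suc M) x) U"
        using L2_set_scale[of 2 "\<lambda>u. S.running_max (f u) (Suc M) x" U] by (simp only: L2_set_def)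
      finally show "L2_set (\<lambda>(u, k). b u k x) (U \<times> {..<M}) \<le> 2 * L2_set (\<lambda>u. S.running_max (f u) (Suc M) x) U" .
    qed (use p in \<open>auto simp: S.weight_nonneg\<close>)
    also have "\<dots> = 2 * wnorm X \<sigma> p (\<lambda>x. L2_set (\<lambda>u. S.running_max (f u) (Suc M) x) U)"
      using p by (intro wnorm_scale) (auto simp: S.weight_nonneg)
    also have "\<dots> \<le> 2 * (maximal_const p * ?nf)"
      using maximal_const_ge[of p] p S.maximal_inequality[OF p, of f "Suc M" U]
      by (intro mult_left_mono, subst wnorm_le_iff) (auto simp: S.weight_nonneg simp del: S.running_max.simps)
    finally show ?thesis by simp
  qed
  \<comment> \<open>For each \<open>(u, r)\<close> the functions \<open>\<delta> (u, r) l\<close> form a martingale difference sequence in \<open>l\<close> with sum \<open>v u r\<close>.\<close>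
  have nv: "wnorm X w r (\<lambda>x. L2_set (\<lambda>(u, k). v u k x) (U \<times> {..<M})) \<le> 2 * square_const (conj_exponent r) * square_const r * ?ng"
  proof -
    have "wnorm X w r (\<lambda>x. L2_set (\<lambda>(u, k). v u k x) (U \<times> {..<M}))
        = wnorm X w r (\<lambda>x. L2_set (\<lambda>i. \<Sum>l\<le>M + s. \<delta> i l x) (U \<times> {..<M}))"
      by (simp add: v_def split_def)
    also have "\<dots> \<le> square_const (conj_exponent r) * wnorm X w r (\<lambda>x. L2_set (\<lambda>(i, l). \<delta> i l x) ((U \<times> {..<M}) \<times> {..M + s}))"
      using r ad_\<delta> orth by (rule W.square_function_lower)
    also have "wnorm X w r (\<lambda>x. L2_set (\<lambda>(i, l). \<delta> i l x) ((U \<times> {..<M}) \<times> {..M + s}))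
        \<le> wnorm X w r (\<lambda>x. 2 * L2_set (\<lambda>(u, l). W.dif l (g u) x) (U \<times> {..M + s}))"
    proof (rule wnorm_mono)
      fix x assume x: "x \<in> X"
      have "L2_set (\<lambda>(i, l). \<delta> i l x) ((U \<times> {..<M}) \<times> {..M + s}) = sqrt (\<Sum>l\<le>M + s. \<Sum>u\<in>U. \<Sum>k<M. (\<delta> (u, k) l x)\<^sup>2)"
        by (simp add: L2_set_Times) (simp add: sum.cartesian_product split_def)
      also have "\<dots> \<le> sqrt (\<Sum>l\<le>M + s. \<Sum>u\<in>U. (2 * W.dif l (g u) x)\<^sup>2)"
      proof (intro real_sqrt_le_mono sum_mono)
        fix l u
        let ?h = "\<theta> u (l - s) x * W.dif l (g u) x"
        have "(\<Sum>k<M. (\<delta> (u, k) l x)\<^sup>2) \<le> (\<Sum>k<M. if \<rho> u (l - s) x = k then ?h\<^sup>2 else 0)"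
          by (intro sum_mono) (auto simp: \<delta>_def)
        also have "\<dots> \<le> ?h\<^sup>2" by (simp add: sum.delta')
        also have "\<dots> \<le> (2 * W.dif l (g u) x)\<^sup>2"
          unfolding abs_le_square_iff[symmetric] abs_mult
          using \<theta>2[OF x, of u "l - s"] by (intro mult_right_mono) auto
        finally show "(\<Sum>k<M. (\<delta> (u, k) l x)\<^sup>2) \<le> (2 * W.dif l (g u) x)\<^sup>2" .
      qed
      also have "\<dots> = 2 * L2_set (\<lambda>(u, l). W.dif l (g u) x) (U \<times> {..M + s})"
        by (simp add: L2_set_Times power_mult_distrib sum_distrib_left[symmetric] real_sqrt_mult)
      finally show "L2_set (\<lambda>(i, l). \<delta> i l x) ((U \<times> {..<M}) \<times> {..M + s}) \<le> 2 * L2_set (\<lambda>(u, l). W.dif l (g u) x) (U \<times> {..M + s})" .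
    qed (use r in \<open>auto simp: W.weight_nonneg\<close>)
    also have "\<dots> = 2 * wnorm X w r (\<lambda>x. L2_set (\<lambda>(u, l). W.dif l (g u) x) (U \<times> {..M + s}))"
      using r by (intro wnorm_scale) (auto simp: W.weight_nonneg)
    also have "wnorm X w r (\<lambda>x. L2_set (\<lambda>(u, l). W.dif l (g u) x) (U \<times> {..M + s})) \<le> square_const r * ?ng"
      using r by (rule W.square_function_upper)
    finally show ?thesis using square_const_pos[of "conj_exponent r"] by (simp add: mult_ac)
  qed
  have "(\<Sum>u\<in>U. \<Sum>j<M. \<Sum>k<M + s. \<Sum>l<M + s. if k + s \<le> l then block u j k l (f u) (g u) else 0)
     = (\<Sum>u\<in>U. \<Sum>i<M. \<Sum>x\<in>X. w x * (S.avg i (f u) x * tail_one u (\<rho> u i x) x * W.dif (i + s) (g u) x))"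
    by (rule sum.cong[OF refl]) (simp add: paraproduct_eq tail_one_to_stopping_level \<rho>_def)
  also have "\<dots> = (\<Sum>x\<in>X. w x * (\<Sum>u\<in>U. \<Sum>i<M. S.avg i (f u) x * tail_one u (\<rho> u i x) x * W.dif (i + s) (g u) x))"
    unfolding sum_distrib_left by (rule sym, subst sum.swap, rule sum.cong[OF refl], rule sum.swap)
  also have "\<dots> = (\<Sum>x\<in>X. w x * (\<Sum>u\<in>U. \<Sum>k<M. b u k x * tail_one u k x * v u k x))"
  proof (rule sum.cong[OF refl], rule arg_cong2[where f = "(*)", OF refl], rule sum.cong[OF refl])
    fix x u assume x: "x \<in> X"
    have "(\<Sum>k<M. b u k x * tail_one u k x * v u k x)
        = (\<Sum>k<M. \<Sum>i<M. if \<rho> u i x = k then b u k x * tail_one u k x * (\<theta> u i x * W.dif (i + s) (g u) x) else 0)"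
      by (simp add: v_eq sum_distrib_left if_distrib cong: if_cong)
    also have "\<dots> = (\<Sum>i<M. \<Sum>k<M. if \<rho> u i x = k then b u k x * tail_one u k x * (\<theta> u i x * W.dif (i + s) (g u) x) else 0)"
      by (rule sum.swap)
    also have "\<dots> = (\<Sum>i<M. S.avg i (f u) x * tail_one u (\<rho> u i x) x * W.dif (i + s) (g u) x)"
    proof (rule sum.cong[OF refl])
      fix i assume "i \<in> {..<M}"
      then have "\<rho> u i x < M" using stop_le[of "\<lambda>i. c u i x" i] by (simp add: \<rho>_stop)
      moreover have "b u (\<rho> u i x) x = c u (\<rho> u i x) x" by (simp add: b_def \<rho>_stop stop_stop)
      ultimately show "(\<Sum>k<M. if \<rho> u i x = k then b u k x * tail_one u k x * (\<theta> u i x * W.dif (i + s) (g u) x) else 0)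
          = S.avg i (f u) x * tail_one u (\<rho> u i x) x * W.dif (i + s) (g u) x"
        using \<theta>c[OF x, of i u] by (simp add: sum.delta')
    qed
    finally show "(\<Sum>i<M. S.avg i (f u) x * tail_one u (\<rho> u i x) x * W.dif (i + s) (g u) x) = (\<Sum>k<M. b u k x * tail_one u k x * v u k x)" by simp
  qed
  also have "\<dots> \<le> (T + A) * wnorm X \<sigma> p (\<lambda>x. L2_set (\<lambda>(u, k). b u k x) (U \<times> {..<M}))
      * wnorm X w r (\<lambda>x. L2_set (\<lambda>(u, k). v u k x) (U \<times> {..<M}))"
    using T A ad_b by (rule localized_testing)
  also have "\<dots> \<le> (T + A) * (2 * maximal_const p * ?nf) * (2 * square_const (conj_exponent r) * square_const r * ?ng)"
    using nb nv TA maximal_const_ge[of p] by (intro mult_mono mult_left_mono mult_nonneg_nonneg) auto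
  finally show ?thesis by (simp add: mult_ac)
qed

end

context weighted_filtration
begin

text \<open>The square function estimate for differences that are listed without repetition in some other order.\<close>

lemma wnorm_dif_reindex:
  fixes \<pi> :: "nat \<Rightarrow> nat" and N :: nat
  assumes p: "1 < p" and inj: "inj_on \<pi> {m. m < N \<and> P m}"
  shows "wnorm X \<mu> p (\<lambda>x. L2_set (\<lambda>(u, m). if P m then dif (\<pi> m) (f u) x else 0) (U \<times> {..<N}))
    \<le> square_const p * wnorm X \<mu> p (\<lambda>x. L2_set (\<lambda>u. f u x) U)"
proof -
  obtain n where n: "\<And>m. m < N \<Longrightarrow> \<pi> m < n"
    using finite_nat_set_iff_bounded[of "\<pi> ` {..<N}"] by auto
  have "wnorm X \<mu> p (\<lambda>x. L2_set (\<lambda>(u, m). if P m then dif (\<pi> m) (f u) x else 0) (U \<times> {..<N}))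
      \<le> wnorm X \<mu> p (\<lambda>x. L2_set (\<lambda>(u, k). dif k (f u) x) (U \<times> {..n}))"
  proof (rule wnorm_mono)
    fix x
    have "(\<Sum>m<N. (if P m then dif (\<pi> m) (f u) x else 0)\<^sup>2) \<le> (\<Sum>k\<le>n. (dif k (f u) x)\<^sup>2)" for u
    proof -
      have "(\<Sum>m<N. (if P m then dif (\<pi> m) (f u) x else 0)\<^sup>2) = (\<Sum>m<N. if P m then (dif (\<pi> m) (f u) x)\<^sup>2 else 0)"
        by (intro sum.cong) auto
      also have "\<dots> \<le> (\<Sum>k<Suc n. (dif k (f u) x)\<^sup>2)"
        using inj n by (intro sum_shift_le) (auto simp: less_SucI)
      finally show ?thesis by (simp only: lessThan_Suc_atMost)
    qed
    then have "(\<Sum>u\<in>U. \<Sum>m<N. (if P m then dif (\<pi> m) (f u) x else 0)\<^sup>2) \<le> (\<Sum>u\<in>U. \<Sum>k\<le>n. (dif k (f u) x)\<^sup>2)"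
      by (rule sum_mono)
    then show "L2_set (\<lambda>(u, m). if P m then dif (\<pi> m) (f u) x else 0) (U \<times> {..<N})
        \<le> L2_set (\<lambda>(u, k). dif k (f u) x) (U \<times> {..n})"
      unfolding L2_set_Times by (subst (1 2) sum.swap) (rule real_sqrt_le_mono)
  qed (use p in \<open>auto simp: weight_nonneg\<close>)
  also have "\<dots> \<le> square_const p * wnorm X \<mu> p (\<lambda>x. L2_set (\<lambda>u. f u x) U)"
    using p by (rule square_function_upper)
  finally show ?thesis .
qed

end

context shift_kernels
begin

subsection \<open>The diagonal part\<close>

text \<open>
  When \<open>k\<close> and \<open>l\<close> are at most \<open>j\<close>, both differences are constant on the cells of level \<open>j\<close> and come out of the
  kernel. Summing over \<open>j\<close> leaves \<open>tail_one\<close> at the larger one of the levels \<open>k\<close>, \<open>l\<close>; the terms are then sorted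
  by the difference \<open>t\<close> of these levels.
\<close>

lemma diagonal_eq:
  fixes f g :: "'a \<Rightarrow> real"
  assumes u: "u \<in> U"
  defines "Q \<equiv> \<lambda>k l. \<Sum>x\<in>X. w x * (S.dif k f x * tail_one u (max k l) x * W.dif l g x)"
  shows "(\<Sum>j<M. \<Sum>k<M + s. \<Sum>l<M + s. if (k < l + s \<and> l < k + s) \<and> k \<le> j \<and> l \<le> j then block u j k l f g else 0)
     = (\<Sum>t<s. \<Sum>k<M. if t \<le> k then Q k (k - t) else 0) + (\<Sum>t\<in>{1..<s}. \<Sum>l<M. if t \<le> l then Q (l - t) l else 0)"
proof -
  let ?N = "M + s"
  have Q0: "Q k l = 0" if "M \<le> max k l" for k l using that by (simp add: Q_def tail_one_out_of_range)
  have "(\<Sum>j<M. \<Sum>k<?N. \<Sum>l<?N. if (k < l + s \<and> l < k + s) \<and> k \<le> j \<and> l \<le> j then block u j k l f g else 0)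
      = (\<Sum>k<?N. \<Sum>l<?N. \<Sum>j<M. if (k < l + s \<and> l < k + s) \<and> k \<le> j \<and> l \<le> j then block u j k l f g else 0)"
    by (subst sum.swap, rule sum.cong[OF refl], rule sum.swap)
  also have "\<dots> = (\<Sum>k<?N. \<Sum>l<?N. if k < l + s \<and> l < k + s then Q k l else 0)"
  proof (rule sum.cong[OF refl], rule sum.cong[OF refl])
    fix k l
    have "(\<Sum>j<M. if k \<le> j \<and> l \<le> j then block u j k l f g else 0) = (\<Sum>j\<in>{max k l..<M}. block u j k l f g)"
      by (subst sum.inter_filter[symmetric]) (auto intro!: sum.cong)
    also have "\<dots> = (\<Sum>j\<in>{max k l..<M}. \<Sum>x\<in>X. w x * (S.dif k f x * kernel_one u j x * W.dif l g x))"
      using u by (intro sum.cong refl block_const) auto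
    also have "\<dots> = Q k l"
      unfolding Q_def tail_one_def by (subst sum.swap) (simp add: sum_distrib_left sum_distrib_right)
    finally have "(\<Sum>j<M. if k \<le> j \<and> l \<le> j then block u j k l f g else 0) = Q k l" .
    then show "(\<Sum>j<M. if (k < l + s \<and> l < k + s) \<and> k \<le> j \<and> l \<le> j then block u j k l f g else 0)
        = (if k < l + s \<and> l < k + s then Q k l else 0)"
      by (cases "k < l + s \<and> l < k + s") (simp_all only: simp_thms if_False sum.neutral_const if_True)
  qed
  also have "\<dots> = (\<Sum>k<?N. \<Sum>l<?N. if l \<le> k \<and> k < l + s then Q k l else 0) + (\<Sum>k<?N. \<Sum>l<?N. if k < l \<and> l < k + s then Q k l else 0)"
    unfolding sum.distrib[symmetric] using s_pos by (intro sum.cong refl) auto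
  also have "(\<Sum>k<?N. \<Sum>l<?N. if k < l \<and> l < k + s then Q k l else 0) = (\<Sum>l<?N. \<Sum>k<?N. if k < l \<and> l < k + s then Q k l else 0)"
    by (rule sum.swap)
  also have "\<dots> = (\<Sum>l<?N. \<Sum>t\<in>{1..<s}. if t \<le> l then Q (l - t) l else 0)"
    by (intro sum.cong refl sum_lower_band') simp
  also have "\<dots> = (\<Sum>t\<in>{1..<s}. \<Sum>l<?N. if t \<le> l then Q (l - t) l else 0)"
    by (rule sum.swap)
  also have "\<dots> = (\<Sum>t\<in>{1..<s}. \<Sum>l<M. if t \<le> l then Q (l - t) l else 0)"
    by (rule sum.cong[OF refl], rule sum.mono_neutral_right) (auto intro: Q0)
  also have "(\<Sum>k<?N. \<Sum>l<?N. if l \<le> k \<and> k < l + s then Q k l else 0) = (\<Sum>k<?N. \<Sum>t<s. if t \<le> k then Q k (k - t) else 0)"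
    by (intro sum.cong refl sum_lower_band) simp
  also have "\<dots> = (\<Sum>t<s. \<Sum>k<?N. if t \<le> k then Q k (k - t) else 0)"
    by (rule sum.swap)
  also have "\<dots> = (\<Sum>t<s. \<Sum>k<M. if t \<le> k then Q k (k - t) else 0)"
    by (rule sum.cong[OF refl], rule sum.mono_neutral_right) (auto intro: Q0)
  finally show ?thesis .
qed

text \<open>
  For a fixed difference \<open>t\<close> of the levels, the difference of \<open>f\<close> or that of \<open>g\<close> which has the coarser
  level is still constant on the cells of the finer level. So the differences of \<open>f\<close> serve as
  coefficients in the localized testing condition, and the square function estimate bounds both sides.
\<close>

lemma diagonal_bound:
  assumes p: "1 < p" and r: "1 < r" and T: "testing_form p r T" and A: "A_form p r A" and TA: "0 \<le> T + A"
  shows "(\<Sum>u\<in>U. \<Sum>j<M. \<Sum>k<M + s. \<Sum>l<M + s. if (k < l + s \<and> l < k + s) \<and> k \<le> j \<and> l \<le> j then block u j k l (f u) (g u) else 0)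
    \<le> 2 * real s * (square_const p * square_const r) * (T + A)
       * (wnorm X \<sigma> p (\<lambda>x. L2_set (\<lambda>u. f u x) U) * wnorm X w r (\<lambda>x. L2_set (\<lambda>u. g u x) U))"
proof -
  let ?nf = "wnorm X \<sigma> p (\<lambda>x. L2_set (\<lambda>u. f u x) U)"
  let ?ng = "wnorm X w r (\<lambda>x. L2_set (\<lambda>u. g u x) U)"
  define Q where "Q u k l = (\<Sum>x\<in>X. w x * (S.dif k (f u) x * tail_one u (max k l) x * W.dif l (g u) x))" for u k l
  define B where "B = (T + A) * (square_const p * ?nf) * (square_const r * ?ng)"
  have test: "(\<Sum>u\<in>U. \<Sum>k<M. \<Sum>x\<in>X. w x * (b u k x * tail_one u k x * G u k x)) \<le> B"
    if b: "\<And>u k. S.adapted k (b u k)"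
      and nb: "wnorm X \<sigma> p (\<lambda>x. L2_set (\<lambda>(u, k). b u k x) (U \<times> {..<M})) \<le> square_const p * ?nf"
      and nG: "wnorm X w r (\<lambda>x. L2_set (\<lambda>(u, k). G u k x) (U \<times> {..<M})) \<le> square_const r * ?ng" for b G
  proof -
    have "(\<Sum>u\<in>U. \<Sum>k<M. \<Sum>x\<in>X. w x * (b u k x * tail_one u k x * G u k x)) =
        (\<Sum>x\<in>X. w x * (\<Sum>u\<in>U. \<Sum>k<M. b u k x * tail_one u k x * G u k x))"
      unfolding sum_distrib_left by (rule sym, subst sum.swap, rule sum.cong[OF refl], rule sum.swap)
    also have "\<dots> \<le> (T + A) * wnorm X \<sigma> p (\<lambda>x. L2_set (\<lambda>(u, k). b u k x) (U \<times> {..<M}))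
           * wnorm X w r (\<lambda>x. L2_set (\<lambda>(u, k). G u k x) (U \<times> {..<M}))"
      using T A b by (rule localized_testing)
    also have "\<dots> \<le> B"
      unfolding B_def using nb nG TA square_const_pos[of p]
      by (intro mult_mono mult_left_mono mult_nonneg_nonneg) (auto simp: less_imp_le)
    finally show ?thesis .
  qed
  have ad_if: "S.adapted k (\<lambda>x. if t \<le> k then S.dif (k - t) (f u) x else 0)" for t k u
    using S.adapted_mono[OF S.adapted_dif[of "k - t" "f u"], of k] by (auto simp: S.adapted_def)
  have full_f: "wnorm X \<sigma> p (\<lambda>x. L2_set (\<lambda>(u, k). S.dif k (f u) x) (U \<times> {..<M})) \<le> square_const p * ?nf"
    using S.wnorm_dif_reindex[OF p, of "\<lambda>m. m" M "\<lambda>_. True" f U] by simp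
  have full_g: "wnorm X w r (\<lambda>x. L2_set (\<lambda>(u, k). W.dif k (g u) x) (U \<times> {..<M})) \<le> square_const r * ?ng"
    using W.wnorm_dif_reindex[OF r, of "\<lambda>m. m" M "\<lambda>_. True" g U] by simp
  have inj: "inj_on (\<lambda>k. k - t) {k. k < M \<and> t \<le> k}" for t :: nat by (auto simp: inj_on_def)
  have 1: "(\<Sum>u\<in>U. \<Sum>k<M. if t \<le> k then Q u k (k - t) else 0) \<le> B" for t
  proof -
    have "(\<Sum>u\<in>U. \<Sum>k<M. if t \<le> k then Q u k (k - t) else 0)
       = (\<Sum>u\<in>U. \<Sum>k<M. \<Sum>x\<in>X. w x * (S.dif k (f u) x * tail_one u k x * (if t \<le> k then W.dif (k - t) (g u) x else 0)))"
      by (intro sum.cong refl) (auto simp: Q_def)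
    also have "\<dots> \<le> B"
      using S.adapted_dif full_f W.wnorm_dif_reindex[OF r inj] by (rule test)
    finally show ?thesis .
  qed
  have 2: "(\<Sum>u\<in>U. \<Sum>k<M. if t \<le> k then Q u (k - t) k else 0) \<le> B" for t
  proof -
    have "(\<Sum>u\<in>U. \<Sum>k<M. if t \<le> k then Q u (k - t) k else 0)
       = (\<Sum>u\<in>U. \<Sum>k<M. \<Sum>x\<in>X. w x * ((if t \<le> k then S.dif (k - t) (f u) x else 0) * tail_one u k x * W.dif k (g u) x))"
      by (intro sum.cong refl) (auto simp: Q_def)
    also have "\<dots> \<le> B"
      using ad_if S.wnorm_dif_reindex[OF p inj] full_g by (rule test)
    finally show ?thesis .
  qed
  have "(\<Sum>u\<in>U. \<Sum>j<M. \<Sum>k<M + s. \<Sum>l<M + s. if (k < l + s \<and> l < k + s) \<and> k \<le> j \<and> l \<le> j then block u j k l (f u) (g u) else 0)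
    = (\<Sum>u\<in>U. (\<Sum>t<s. \<Sum>k<M. if t \<le> k then Q u k (k - t) else 0) + (\<Sum>t\<in>{1..<s}. \<Sum>l<M. if t \<le> l then Q u (l - t) l else 0))"
    by (intro sum.cong refl) (simp only: diagonal_eq Q_def)
  also have "\<dots> = (\<Sum>t<s. \<Sum>u\<in>U. \<Sum>k<M. if t \<le> k then Q u k (k - t) else 0)
      + (\<Sum>t\<in>{1..<s}. \<Sum>u\<in>U. \<Sum>l<M. if t \<le> l then Q u (l - t) l else 0)"
    unfolding sum.distrib by (intro arg_cong2[where f = "(+)"] sum.swap)
  also have "\<dots> \<le> (\<Sum>t<s. B) + (\<Sum>t\<in>{1..<s}. B)"
    by (intro add_mono sum_mono 1 2)
  also have "\<dots> = (2 * real s - 1) * B"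
    using s_pos by (simp add: of_nat_diff algebra_simps)
  also have "\<dots> \<le> 2 * real s * B"
    unfolding B_def using TA square_const_pos[of p] square_const_pos[of r]
    by (intro mult_right_mono mult_nonneg_nonneg) (auto simp: less_imp_le)
  finally show ?thesis unfolding B_def by (simp only: mult_ac)
qed

subsection \<open>The part controlled by the quadratic condition alone\<close>

text \<open>
  Only the size and the support of the kernel are used. The second average is inserted because the rest of
  the integrand is constant on the cells of level \<open>j\<close>.
\<close>

lemma block_abs_le:
  assumes u: "u \<in> U"
  shows "\<bar>block u j k l f g\<bar> \<le> (\<Sum>x\<in>X. w x * (S.avg j (\<lambda>y. \<bar>S.dif k f y\<bar>) x * ratio j x * W.avg j (\<lambda>y. \<bar>W.dif l g y\<bar>) x))"
proof -
  let ?a = "\<lambda>y. \<bar>S.dif k f y\<bar>"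
  have "\<bar>block u j k l f g\<bar> \<le> (\<Sum>x\<in>X. w x * (S.avg j ?a x * ratio j x * \<bar>W.dif l g x\<bar>))"
    unfolding block_def
  proof (rule order_trans[OF sum_abs], rule sum_mono)
    fix x assume x: "x \<in> X"
    have "(\<Sum>y\<in>X. \<sigma> y * (ker u j x y * S.dif k f y)) = (\<Sum>y\<in>cl j x. \<sigma> y * (ker u j x y * S.dif k f y))"
      using ker_supp[OF u x] S.cl_sub[OF x] S.fin by (intro sum.mono_neutral_right) auto
    also have "\<bar>\<dots>\<bar> \<le> (\<Sum>y\<in>cl j x. \<sigma> y * (1 / V j * ?a y))"
    proof (rule order_trans[OF sum_abs], rule sum_mono)
      fix y assume "y \<in> cl j x"
      then have y: "y \<in> X" using S.cl_sub[OF x] by blast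
      have "\<bar>ker u j x y\<bar> * ?a y \<le> 1 / V j * ?a y"
        using ker_bound[OF u x y] by (intro mult_right_mono) auto
      then show "\<bar>\<sigma> y * (ker u j x y * S.dif k f y)\<bar> \<le> \<sigma> y * (1 / V j * ?a y)"
        using S.weight_nonneg[OF y] by (simp only: abs_mult abs_of_nonneg mult_left_mono)
    qed
    also have "\<dots> = (\<Sum>y\<in>cl j x. \<sigma> y * ?a y) / V j" by (simp add: sum_divide_distrib)
    also have "\<dots> = S.avg j ?a x * ratio j x"
      by (simp add: S.cl_weight_avg[OF x, symmetric] ratio_def mult.commute)
    finally have le: "\<bar>\<Sum>y\<in>X. \<sigma> y * (ker u j x y * S.dif k f y)\<bar> \<le> S.avg j ?a x * ratio j x" .
    have "\<bar>W.dif l g x\<bar> * \<bar>\<Sum>y\<in>X. \<sigma> y * (ker u j x y * S.dif k f y)\<bar> \<le> \<bar>W.dif l g x\<bar> * (S.avg j ?a x * ratio j x)"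
      using le by (rule mult_left_mono) simp
    then show "\<bar>w x * (W.dif l g x * (\<Sum>y\<in>X. \<sigma> y * (ker u j x y * S.dif k f y)))\<bar>
        \<le> w x * (S.avg j ?a x * ratio j x * \<bar>W.dif l g x\<bar>)"
      using W.weight_nonneg[OF x] by (simp add: abs_mult mult_left_mono mult.commute mult.left_commute)
  qed
  also have "\<dots> = (\<Sum>x\<in>X. w x * (S.avg j ?a x * ratio j x * W.avg j (\<lambda>y. \<bar>W.dif l g y\<bar>) x))"
    using S.adapted_avg[of j ?a] adapted_ratio[of j]
    by (intro W.integral_avg[symmetric]) (auto simp: S.adapted_def)
  finally show ?thesis .
qed

text \<open>
  A block vanishes if \<open>k\<close> or \<open>l\<close> exceeds \<open>j + s\<close>. So here \<open>k\<close> and \<open>l\<close> lie in the window from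
  \<open>j - s + 1\<close> to \<open>j + s\<close>, and are written as \<open>j + \<alpha> - s\<close> and \<open>j + \<beta> - s\<close> with \<open>\<alpha>\<close>, \<open>\<beta>\<close> from \<open>1\<close> to \<open>2 s\<close>.
  For fixed \<open>\<alpha>\<close> and \<open>\<beta>\<close> the quadratic condition applies to the averages of the differences, which Stein's
  inequality and the square function estimate bound by \<open>f\<close> and \<open>g\<close>.
\<close>

lemma near_bound:
  assumes p: "1 < p" and r: "1 < r" and A: "A_form p r A" and A0: "0 \<le> A"
  shows "(\<Sum>u\<in>U. \<Sum>j<M. \<Sum>k<M + s. \<Sum>l<M + s. if (k < l + s \<and> l < k + s) \<and> \<not> (k \<le> j \<and> l \<le> j) then block u j k l (f u) (g u) else 0)
    \<le> 4 * (real s)\<^sup>2 * (maximal_const p * maximal_const r * square_const p * square_const r) * A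
       * (wnorm X \<sigma> p (\<lambda>x. L2_set (\<lambda>u. f u x) U) * wnorm X w r (\<lambda>x. L2_set (\<lambda>u. g u x) U))"
proof -
  let ?nf = "wnorm X \<sigma> p (\<lambda>x. L2_set (\<lambda>u. f u x) U)"
  let ?ng = "wnorm X w r (\<lambda>x. L2_set (\<lambda>u. g u x) U)"
  let ?N = "M + s"
  define B where "B = A * (maximal_const p * (square_const p * ?nf)) * (maximal_const r * (square_const r * ?ng))"
  define a where "a \<alpha> u j y = \<bar>if s \<le> j + \<alpha> then S.dif (j + \<alpha> - s) (f u) y else 0\<bar>" for \<alpha> u j y
  define b where "b \<beta> u j y = \<bar>if s \<le> j + \<beta> then W.dif (j + \<beta> - s) (g u) y else 0\<bar>" for \<beta> u j y
  have inj: "inj_on (\<lambda>j. j + \<alpha> - s) {j. j < M \<and> s \<le> j + \<alpha>}" for \<alpha> by (auto simp: inj_on_def)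
  have na: "wnorm X \<sigma> p (\<lambda>x. L2_set (\<lambda>(u, j). S.avg j (a \<alpha> u j) x) (U \<times> {..<M})) \<le> maximal_const p * (square_const p * ?nf)" for \<alpha>
  proof -
    have "wnorm X \<sigma> p (\<lambda>x. L2_set (\<lambda>(u, j). S.avg j (a \<alpha> u j) x) (U \<times> {..<M}))
       \<le> maximal_const p * wnorm X \<sigma> p (\<lambda>x. L2_set (\<lambda>(u, j). a \<alpha> u j x) (U \<times> {..<M}))"
      using S.Stein_inequality[OF p, of "U \<times> {..<M}" snd "\<lambda>(u, j). a \<alpha> u j"] fin_U by (simp add: split_def)
    also have "\<dots> \<le> maximal_const p * (square_const p * ?nf)"
      unfolding a_def L2_set_abs using maximal_const_ge[of p] S.wnorm_dif_reindex[OF p inj]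
      by (intro mult_left_mono) auto
    finally show ?thesis .
  qed
  have nb: "wnorm X w r (\<lambda>x. L2_set (\<lambda>(u, j). W.avg j (b \<beta> u j) x) (U \<times> {..<M})) \<le> maximal_const r * (square_const r * ?ng)" for \<beta>
  proof -
    have "wnorm X w r (\<lambda>x. L2_set (\<lambda>(u, j). W.avg j (b \<beta> u j) x) (U \<times> {..<M}))
       \<le> maximal_const r * wnorm X w r (\<lambda>x. L2_set (\<lambda>(u, j). b \<beta> u j x) (U \<times> {..<M}))"
      using W.Stein_inequality[OF r, of "U \<times> {..<M}" snd "\<lambda>(u, j). b \<beta> u j"] fin_U by (simp add: split_def)
    also have "\<dots> \<le> maximal_const r * (square_const r * ?ng)"
      unfolding b_def L2_set_abs using maximal_const_ge[of r] W.wnorm_dif_reindex[OF r inj]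
      by (intro mult_left_mono) auto
    finally show ?thesis .
  qed
  define R where "R \<alpha> \<beta> u j = (\<Sum>x\<in>X. w x * (S.avg j (a \<alpha> u j) x * ratio j x * W.avg j (b \<beta> u j) x))" for \<alpha> \<beta> u j
  have R: "(\<Sum>u\<in>U. \<Sum>j<M. R \<alpha> \<beta> u j) \<le> B" for \<alpha> \<beta>
  proof -
    have "(\<Sum>u\<in>U. \<Sum>j<M. R \<alpha> \<beta> u j) = (\<Sum>x\<in>X. w x * (\<Sum>u\<in>U. \<Sum>j<M. S.avg j (a \<alpha> u j) x * ratio j x * W.avg j (b \<beta> u j) x))"
      unfolding R_def sum_distrib_left by (rule sym, subst sum.swap, rule sum.cong[OF refl], rule sum.swap)
    also have "\<dots> \<le> A * wnorm X \<sigma> p (\<lambda>x. L2_set (\<lambda>(u, j). S.avg j (a \<alpha> u j) x) (U \<times> {..<M}))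
        * wnorm X w r (\<lambda>x. L2_set (\<lambda>(u, j). W.avg j (b \<beta> u j) x) (U \<times> {..<M}))"
      using A S.adapted_avg by (rule A_form_vector)
    also have "\<dots> \<le> B"
      unfolding B_def using na nb A0 maximal_const_ge[of p] square_const_pos[of p]
      by (intro mult_mono mult_left_mono mult_nonneg_nonneg) (auto simp: less_imp_le)
    finally show ?thesis .
  qed
  have pt: "(\<Sum>k<?N. \<Sum>l<?N. if (k < l + s \<and> l < k + s) \<and> \<not> (k \<le> j \<and> l \<le> j) then block u j k l (f u) (g u) else 0)
      \<le> (\<Sum>\<alpha>\<in>{1..2 * s}. \<Sum>\<beta>\<in>{1..2 * s}. R \<alpha> \<beta> u j)" if u: "u \<in> U" and j: "j < M" for u j
  proof -
    let ?H = "\<lambda>k l. \<bar>block u j k l (f u) (g u)\<bar>"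
    have "(\<Sum>k<?N. \<Sum>l<?N. if (k < l + s \<and> l < k + s) \<and> \<not> (k \<le> j \<and> l \<le> j) then block u j k l (f u) (g u) else 0)
       \<le> (\<Sum>k<?N. \<Sum>l<?N. if j < k + s \<and> k \<le> j + s then if j < l + s \<and> l \<le> j + s then ?H k l else 0 else 0)"
    proof (intro sum_mono)
      fix k l
      show "(if (k < l + s \<and> l < k + s) \<and> \<not> (k \<le> j \<and> l \<le> j) then block u j k l (f u) (g u) else 0)
        \<le> (if j < k + s \<and> k \<le> j + s then if j < l + s \<and> l \<le> j + s then ?H k l else 0 else 0)"
        using block_zero_in[OF u, of j k l "f u" "g u"] block_zero_out[OF u, of j l k "f u" "g u"] by auto
    qed
    also have "\<dots> = (\<Sum>k<?N. if j < k + s \<and> k \<le> j + s then \<Sum>\<beta>\<in>{1..2 * s}. if s \<le> j + \<beta> then ?H k (j + \<beta> - s) else 0 else 0)"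
    proof (rule sum.cong[OF refl])
      fix k
      show "(\<Sum>l<?N. if j < k + s \<and> k \<le> j + s then if j < l + s \<and> l \<le> j + s then ?H k l else 0 else 0) =
        (if j < k + s \<and> k \<le> j + s then \<Sum>\<beta>\<in>{1..2 * s}. if s \<le> j + \<beta> then ?H k (j + \<beta> - s) else 0 else 0)"
        using sum_window[of j s ?N "?H k"] j
        by (cases "j < k + s \<and> k \<le> j + s") (simp_all only: if_True if_False sum.neutral_const simp_thms add_less_cancel_right)
    qed
    also have "\<dots> = (\<Sum>\<alpha>\<in>{1..2 * s}. if s \<le> j + \<alpha> then \<Sum>\<beta>\<in>{1..2 * s}. if s \<le> j + \<beta> then ?H (j + \<alpha> - s) (j + \<beta> - s) else 0 else 0)"
      by (rule sum_window) (use j in simp)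
    also have "\<dots> \<le> (\<Sum>\<alpha>\<in>{1..2 * s}. \<Sum>\<beta>\<in>{1..2 * s}. R \<alpha> \<beta> u j)"
    proof (intro sum_mono)
      fix \<alpha>
      have Rnn: "0 \<le> R \<alpha> \<beta> u j" for \<beta>
        unfolding R_def by (intro sum_nonneg mult_nonneg_nonneg W.weight_nonneg S.avg_nonneg W.avg_nonneg ratio_nonneg) (auto simp: a_def b_def)
      have le: "?H (j + \<alpha> - s) (j + \<beta> - s) \<le> R \<alpha> \<beta> u j" if "s \<le> j + \<alpha>" "s \<le> j + \<beta>" for \<beta>
        using block_abs_le[OF u, of j "j + \<alpha> - s" "j + \<beta> - s" "f u" "g u"] that
        by (simp add: R_def a_def[abs_def] b_def[abs_def])
      show "(if s \<le> j + \<alpha> then \<Sum>\<beta>\<in>{1..2 * s}. if s \<le> j + \<beta> then ?H (j + \<alpha> - s) (j + \<beta> - s) else 0 else 0)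
        \<le> (\<Sum>\<beta>\<in>{1..2 * s}. R \<alpha> \<beta> u j)"
        using Rnn le by (auto intro!: sum_mono sum_nonneg)
    qed
    finally show ?thesis .
  qed
  have "(\<Sum>u\<in>U. \<Sum>j<M. \<Sum>k<?N. \<Sum>l<?N. if (k < l + s \<and> l < k + s) \<and> \<not> (k \<le> j \<and> l \<le> j) then block u j k l (f u) (g u) else 0)
     \<le> (\<Sum>u\<in>U. \<Sum>j<M. \<Sum>\<alpha>\<in>{1..2 * s}. \<Sum>\<beta>\<in>{1..2 * s}. R \<alpha> \<beta> u j)"
    by (intro sum_mono pt) auto
  also have "\<dots> = (\<Sum>u\<in>U. \<Sum>\<alpha>\<in>{1..2 * s}. \<Sum>\<beta>\<in>{1..2 * s}. \<Sum>j<M. R \<alpha> \<beta> u j)"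
    by (rule sum.cong[OF refl], subst sum.swap, rule sum.cong[OF refl], rule sum.swap)
  also have "\<dots> = (\<Sum>\<alpha>\<in>{1..2 * s}. \<Sum>\<beta>\<in>{1..2 * s}. \<Sum>u\<in>U. \<Sum>j<M. R \<alpha> \<beta> u j)"
    by (subst sum.swap, rule sum.cong[OF refl], rule sum.swap)
  also have "\<dots> \<le> (\<Sum>\<alpha>\<in>{1..2 * s}. \<Sum>\<beta>\<in>{1..2 * s}. B)"
    by (intro sum_mono R)
  also have "\<dots> = 4 * (real s)\<^sup>2 * B" by (simp add: power2_eq_square)
  finally show ?thesis unfolding B_def by (simp only: mult_ac)
qed

end

text \<open>
  One summand for each part of the decomposition: the two paraproducts, the diagonal part, and the part in
  which \<open>k\<close> or \<open>l\<close> exceeds \<open>j\<close>.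
\<close>

definition core_const :: "real \<Rightarrow> real \<Rightarrow> real" where
  "core_const p r =
     4 * maximal_const p * square_const (conj_exponent r) * square_const r
     + 4 * maximal_const r * square_const (conj_exponent p) * square_const p * maximal_const p
     + 4 * square_const p * square_const r
     + 4 * maximal_const p * maximal_const r * square_const p * square_const r"

text \<open>
  The four conditions on \<open>j\<close>, \<open>k\<close>, \<open>l\<close> are exhaustive and mutually exclusive because \<open>s \<ge> 1\<close>. The second
  paraproduct is the first one for the adjoint kernels; it needs the quadratic condition with the weights
  exchanged, whence the factor \<open>maximal_const p\<close> in its constant.
\<close>

theorem (in shift_kernels) form_bound:
  assumes p: "1 < p" and r: "1 < r" and T: "testing_form p r T" and A: "A_form p r A"
    and T': "shift_kernels.testing_form X cl M w \<sigma> U (\<lambda>u j x y. ker u j y x) r p T'"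
    and nn: "0 \<le> T" "0 \<le> T'" "0 \<le> A"
  shows "form f g \<le> core_const p r * (real s * (T + T') + (real s)\<^sup>2 * A)
       * (wnorm X \<sigma> p (\<lambda>x. L2_set (\<lambda>u. f u x) U) * wnorm X w r (\<lambda>x. L2_set (\<lambda>u. g u x) U))"
proof -
  interpret sw: shift_kernels X cl M w \<sigma> V s U "\<lambda>u j x y. ker u j y x" by (rule swapped)
  let ?nf = "wnorm X \<sigma> p (\<lambda>x. L2_set (\<lambda>u. f u x) U)"
  let ?ng = "wnorm X w r (\<lambda>x. L2_set (\<lambda>u. g u x) U)"
  let ?N = "M + s"
  define m where "m = maximal_const p"
  define m' where "m' = maximal_const r"
  define a where "a = square_const p"
  define a' where "a' = square_const (conj_exponent p)"
  define b where "b = square_const r"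
  define b' where "b' = square_const (conj_exponent r)"
  have pos: "1 \<le> m" "0 < m'" "0 < a" "0 < a'" "0 < b" "0 < b'"
    using maximal_const_ge[of p] maximal_const_ge[of r] by (auto simp: m_def m'_def a_def a'_def b_def b'_def square_const_pos)
  define P1 where "P1 = (\<Sum>u\<in>U. \<Sum>j<M. \<Sum>k<?N. \<Sum>l<?N. if k + s \<le> l then block u j k l (f u) (g u) else 0)"
  define P2 where "P2 = (\<Sum>u\<in>U. \<Sum>j<M. \<Sum>k<?N. \<Sum>l<?N. if l + s \<le> k then block u j k l (f u) (g u) else 0)"
  define D where "D = (\<Sum>u\<in>U. \<Sum>j<M. \<Sum>k<?N. \<Sum>l<?N. if (k < l + s \<and> l < k + s) \<and> k \<le> j \<and> l \<le> j then block u j k l (f u) (g u) else 0)"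
  define E where "E = (\<Sum>u\<in>U. \<Sum>j<M. \<Sum>k<?N. \<Sum>l<?N. if (k < l + s \<and> l < k + s) \<and> \<not> (k \<le> j \<and> l \<le> j) then block u j k l (f u) (g u) else 0)"
  have "form f g = P1 + P2 + D + E"
    unfolding form_block P1_def P2_def D_def E_def sum.distrib[symmetric]
    using s_pos by (intro sum.cong refl) auto
  moreover have "P1 \<le> 4 * m * b' * b * (T + A) * (?nf * ?ng)"
    using paraproduct_bound[OF p r T A, of f g] nn by (simp add: P1_def m_def b'_def b_def)
  moreover have "P2 \<le> 4 * m' * a' * a * (T' + A * m) * (?nf * ?ng)"
  proof -
    have "P2 = (\<Sum>u\<in>U. \<Sum>j<M. \<Sum>l<?N. \<Sum>k<?N. if l + s \<le> k then sw.block u j l k (g u) (f u) else 0)"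
      unfolding P2_def block_swap by (rule sum.cong[OF refl], rule sum.cong[OF refl], rule sum.swap)
    then show ?thesis
      using sw.paraproduct_bound[OF r p T' A_form_swapped[OF A p nn(3)], of g f] nn pos
      by (simp add: m'_def a'_def a_def m_def mult_ac)
  qed
  moreover have "D \<le> 2 * real s * (a * b) * (T + A) * (?nf * ?ng)"
    using diagonal_bound[OF p r T A, of f g] nn by (simp add: D_def a_def b_def)
  moreover have "E \<le> 4 * (real s)\<^sup>2 * (m * m' * a * b) * A * (?nf * ?ng)"
    using near_bound[OF p r A nn(3), of f g] by (simp add: E_def m_def m'_def a_def b_def)
  ultimately have "form f g \<le> (4 * m * b' * b * (T + A) + 4 * m' * a' * a * (T' + A * m)
      + 2 * real s * (a * b) * (T + A) + 4 * (real s)\<^sup>2 * (m * m' * a * b) * A) * (?nf * ?ng)"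
    by (simp add: distrib_right)
  also have "\<dots> \<le> core_const p r * (real s * (T + T') + (real s)\<^sup>2 * A) * (?nf * ?ng)"
  proof (rule mult_right_mono)
    define Z where "Z = real s * (T + T') + (real s)\<^sup>2 * A"
    have s1: "1 \<le> real s" "1 \<le> (real s)\<^sup>2" "real s \<le> (real s)\<^sup>2"
      using s_pos mult_mono[of 1 "real s" 1 "real s"] by (auto simp: power2_eq_square)
    have sT: "T \<le> real s * T" "T' \<le> real s * T'" "0 \<le> real s * T" "0 \<le> real s * T'"
      using s1 nn mult_right_mono[of 1 "real s" T] mult_right_mono[of 1 "real s" T'] by auto
    have sA: "A \<le> (real s)\<^sup>2 * A" "real s * A \<le> (real s)\<^sup>2 * A"
      using s1 nn mult_right_mono[of 1 "(real s)\<^sup>2" A] mult_right_mono[of "real s" "(real s)\<^sup>2" A] by auto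
    have Z: "T + A \<le> Z" "T' + A \<le> Z" "real s * (T + A) \<le> Z" "(real s)\<^sup>2 * A \<le> Z"
      using sT sA unfolding Z_def distrib_left by linarith+
    have "T' + A * m \<le> m * (T' + A)" using mult_right_mono[of 1 m T'] pos nn by (simp add: algebra_simps)
    also have "\<dots> \<le> m * Z" using Z pos by (intro mult_left_mono) auto
    finally have "T' + A * m \<le> m * Z" .
    then have "4 * m' * a' * a * (T' + A * m) \<le> 4 * m' * a' * a * (m * Z)" using pos by (intro mult_left_mono) auto
    moreover have "4 * m * b' * b * (T + A) \<le> 4 * m * b' * b * Z" using pos Z by (intro mult_left_mono) auto
    moreover have "2 * (a * b) * (real s * (T + A)) \<le> 4 * (a * b) * Z"
      using pos Z nn s1 by (intro mult_mono mult_nonneg_nonneg) auto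
    moreover have "4 * (m * m' * a * b) * ((real s)\<^sup>2 * A) \<le> 4 * (m * m' * a * b) * Z"
      using pos Z by (intro mult_left_mono) auto
    ultimately have "4 * m * b' * b * (T + A) + 4 * m' * a' * a * (T' + A * m)
      + 2 * (a * b) * (real s * (T + A)) + 4 * (m * m' * a * b) * ((real s)\<^sup>2 * A)
      \<le> 4 * m * b' * b * Z + 4 * m' * a' * a * (m * Z) + 4 * (a * b) * Z + 4 * (m * m' * a * b) * Z" by linarith
    also have "\<dots> = core_const p r * Z"
      by (simp add: core_const_def m_def m'_def a_def a'_def b_def b'_def algebra_simps)
    finally show "4 * m * b' * b * (T + A) + 4 * m' * a' * a * (T' + A * m)
      + 2 * real s * (a * b) * (T + A) + 4 * (real s)\<^sup>2 * (m * m' * a * b) * A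
      \<le> core_const p r * (real s * (T + T') + (real s)\<^sup>2 * A)"
      by (simp add: Z_def mult_ac)
  qed simp
  finally show ?thesis .
qed

section \<open>Random signs\<close>

text \<open>Signs indexed by an arbitrary finite set, for inductions over this set.\<close>

definition signs :: "nat set \<Rightarrow> (nat \<Rightarrow> real) pmf" where
  "signs A = Pi_pmf A 0 (\<lambda>_. pmf_of_set {-1, 1})"

lemma finite_signs [simp]: "finite A \<Longrightarrow> finite (set_pmf (signs A))"
  unfolding signs_def by (subst set_Pi_pmf) (auto simp: set_pmf_of_set)

lemma signs_empty [simp]: "signs {} = return_pmf (\<lambda>_. 0)"
  by (simp add: signs_def)

lemma integrable_signs: "finite A \<Longrightarrow> integrable (measure_pmf (signs A)) (g :: _ \<Rightarrow> real)"
  by (rule integrable_measure_pmf_finite) simp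

lemma expectation_signs_insert:
  fixes g :: "(nat \<Rightarrow> real) \<Rightarrow> real"
  assumes "finite A" "u \<notin> A"
  shows "measure_pmf.expectation (signs (insert u A)) g =
    measure_pmf.expectation (signs A) (\<lambda>\<epsilon>. (g (\<epsilon>(u := 1)) + g (\<epsilon>(u := -1))) / 2)"
proof -
  have "signs (insert u A) = pmf_of_set {-1, 1} \<bind> (\<lambda>y. map_pmf (\<lambda>\<epsilon>. \<epsilon>(u := y)) (signs A))"
    using assms by (simp add: signs_def Pi_pmf_insert' map_pmf_def)
  then have "measure_pmf.expectation (signs (insert u A)) g =
      (\<Sum>y\<in>{-1, 1}. measure_pmf.expectation (map_pmf (\<lambda>\<epsilon>. \<epsilon>(u := y)) (signs A)) g /\<^sub>R real (card {-1, 1 :: real}))"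
    using assms by (simp only:) (rule pmf_expectation_bind_pmf_of_set; simp)
  also have "\<dots> = measure_pmf.expectation (signs A) (\<lambda>\<epsilon>. (g (\<epsilon>(u := 1)) + g (\<epsilon>(u := -1))) / 2)"
    using assms by (simp add: integrable_signs)
  finally show ?thesis .
qed

lemma signed_sum_update:
  fixes a :: "nat \<Rightarrow> real"
  assumes "finite A" "u \<notin> A"
  shows "(\<Sum>v\<in>insert u A. (\<epsilon>(u := y)) v * a v) = y * a u + (\<Sum>v\<in>A. \<epsilon> v * a v)"
proof -
  have "(\<Sum>v\<in>A. (\<epsilon>(u := y)) v * a v) = (\<Sum>v\<in>A. \<epsilon> v * a v)"
    using assms by (intro sum.cong) auto
  then show ?thesis using assms by simp
qed

lemma cosh_le_exp_half_square: "(exp a + exp (- a)) / 2 \<le> exp (a\<^sup>2 / 2)" for a :: real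
proof -
  have main: "(exp b + exp (- b)) / 2 \<le> exp (b\<^sup>2 / 2)" if "0 \<le> b" for b :: real
  proof -
    have pos: "0 < 1 + 1/2 * (exp (2 * b) - 1)" using exp_gt_zero[of "2 * b"] by (simp add: field_simps add_pos_pos)
    have "- (2 * b) * (1/2) + ln (1 + 1/2 * (exp (2 * b) - 1)) \<le> (2 * b)\<^sup>2 / 8"
      using that by (intro Hoeffdings_lemma_aux) auto
    then have "exp (- b + ln (1 + 1/2 * (exp (2 * b) - 1))) \<le> exp (b\<^sup>2 / 2)"
      by (simp add: power_mult_distrib)
    moreover have "exp (- b + ln (1 + 1/2 * (exp (2 * b) - 1))) = exp (- b) * (1 + 1/2 * (exp (2 * b) - 1))"
      using pos by (simp only: exp_add exp_ln)
    moreover have "\<dots> = (exp b + exp (- b)) / 2"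
      by (simp add: algebra_simps flip: exp_add)
    ultimately show ?thesis by linarith
  qed
  show ?thesis using main[of a] main[of "- a"] by (cases "0 \<le> a") (auto simp: add.commute)
qed

lemma signs_mgf:
  assumes "finite A"
  shows "measure_pmf.expectation (signs A) (\<lambda>\<epsilon>. exp (\<Sum>u\<in>A. \<epsilon> u * a u)) \<le> exp ((\<Sum>u\<in>A. (a u)\<^sup>2) / 2)"
  using assms
proof (induction A)
  case (insert u A)
  have "measure_pmf.expectation (signs (insert u A)) (\<lambda>\<epsilon>. exp (\<Sum>v\<in>insert u A. \<epsilon> v * a v))
      = measure_pmf.expectation (signs A) (\<lambda>\<epsilon>. (exp (a u) + exp (- a u)) / 2 * exp (\<Sum>v\<in>A. \<epsilon> v * a v))"
    unfolding expectation_signs_insert[OF insert(1,2)] signed_sum_update[OF insert(1,2)]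
    by (simp add: exp_add exp_diff exp_minus field_simps)
  also have "\<dots> = (exp (a u) + exp (- a u)) / 2 * measure_pmf.expectation (signs A) (\<lambda>\<epsilon>. exp (\<Sum>v\<in>A. \<epsilon> v * a v))"
    by (rule integral_mult_right_zero)
  also have "\<dots> \<le> exp ((a u)\<^sup>2 / 2) * exp ((\<Sum>u\<in>A. (a u)\<^sup>2) / 2)"
    using insert.IH by (intro mult_mono cosh_le_exp_half_square integral_nonneg) auto
  also have "\<dots> = exp ((\<Sum>u\<in>insert u A. (a u)\<^sup>2) / 2)"
    using insert by (simp add: exp_add[symmetric] add_divide_distrib)
  finally show ?case .
qed simp

lemma signs_second_moment:
  assumes "finite A"
  shows "measure_pmf.expectation (signs A) (\<lambda>\<epsilon>. (\<Sum>u\<in>A. \<epsilon> u * a u)\<^sup>2) = (\<Sum>u\<in>A. (a u)\<^sup>2)"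
  using assms
proof (induction A)
  case (insert u A)
  have "measure_pmf.expectation (signs (insert u A)) (\<lambda>\<epsilon>. (\<Sum>v\<in>insert u A. \<epsilon> v * a v)\<^sup>2)
      = measure_pmf.expectation (signs A) (\<lambda>\<epsilon>. (a u)\<^sup>2 + (\<Sum>v\<in>A. \<epsilon> v * a v)\<^sup>2)"
    unfolding expectation_signs_insert[OF insert(1,2)] signed_sum_update[OF insert(1,2)]
    by (intro arg_cong[where f = "measure_pmf.expectation _"] ext) (simp add: power2_eq_square algebra_simps)
  also have "\<dots> = (a u)\<^sup>2 + measure_pmf.expectation (signs A) (\<lambda>\<epsilon>. (\<Sum>v\<in>A. \<epsilon> v * a v)\<^sup>2)"
    by (simp add: integrable_signs[OF insert(1)])
  finally show ?case using insert by simp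
qed simp

text \<open>
  For coefficients of length \<open>1\<close> the exponential moments are at most those of a standard Gaussian variable, and
  \<open>|x| powr q \<le> q powr q * exp |x|\<close>.
\<close>

lemma Khintchine_upper:
  assumes A: "finite A" and q: "1 \<le> q"
  shows "measure_pmf.expectation (signs A) (\<lambda>\<epsilon>. \<bar>\<Sum>u\<in>A. \<epsilon> u * a u\<bar> powr q) \<le> 4 * q powr q * L2_set a A powr q"
proof (cases "L2_set a A = 0")
  case True
  then have "\<forall>u\<in>A. a u = 0" using A by (simp add: L2_set_eq_0_iff)
  then show ?thesis by (simp add: True)
next
  case False
  define L where "L = L2_set a A"
  have L: "0 < L" using False by (simp add: L_def less_le)
  define b where "b u = a u / L" for u
  have b1: "(\<Sum>u\<in>A. (b u)\<^sup>2) = 1"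
    using L by (simp add: b_def power_divide sum_divide_distrib[symmetric] L2_set_power2[symmetric] L_def)
  have pt: "\<bar>x\<bar> powr q \<le> q powr q * (exp x + exp (- x))" for x :: real
  proof -
    have "\<bar>x\<bar> / q \<le> exp (\<bar>x\<bar> / q)" using exp_ge_add_one_self[of "\<bar>x\<bar> / q"] by linarith
    then have "\<bar>x\<bar> \<le> q * exp (\<bar>x\<bar> / q)" using q by (simp add: field_simps)
    then have "\<bar>x\<bar> powr q \<le> (q * exp (\<bar>x\<bar> / q)) powr q" using q by (intro powr_mono2) auto
    also have "\<dots> = q powr q * exp \<bar>x\<bar>" using q by (simp add: powr_mult exp_powr_real)
    also have "\<dots> \<le> q powr q * (exp x + exp (- x))" by (intro mult_left_mono) (auto simp: abs_if)
    finally show ?thesis .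
  qed
  let ?E = "measure_pmf.expectation (signs A)"
  have scale: "\<bar>\<Sum>u\<in>A. \<epsilon> u * a u\<bar> powr q = L powr q * \<bar>\<Sum>u\<in>A. \<epsilon> u * b u\<bar> powr q" for \<epsilon>
  proof -
    have "(\<Sum>u\<in>A. \<epsilon> u * a u) = L * (\<Sum>u\<in>A. \<epsilon> u * b u)" using L by (simp add: b_def sum_distrib_left)
    then show ?thesis using L by (simp add: abs_mult powr_mult)
  qed
  have "?E (\<lambda>\<epsilon>. \<bar>\<Sum>u\<in>A. \<epsilon> u * b u\<bar> powr q) \<le> ?E (\<lambda>\<epsilon>. q powr q * (exp (\<Sum>u\<in>A. \<epsilon> u * b u) + exp (\<Sum>u\<in>A. \<epsilon> u * (- b u))))"
    using pt by (intro integral_mono integrable_signs A) (simp add: sum_negf)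
  also have "\<dots> = q powr q * (?E (\<lambda>\<epsilon>. exp (\<Sum>u\<in>A. \<epsilon> u * b u)) + ?E (\<lambda>\<epsilon>. exp (\<Sum>u\<in>A. \<epsilon> u * (- b u))))"
    by (simp only: integral_mult_right_zero Bochner_Integration.integral_add integrable_signs A)
  also have "\<dots> \<le> q powr q * (exp (1/2) + exp (1/2))"
    using signs_mgf[OF A, of b] signs_mgf[OF A, of "\<lambda>u. - b u"] by (intro mult_left_mono add_mono) (auto simp: b1)
  also have "\<dots> \<le> q powr q * 4"
  proof -
    have "(exp (1/2::real))\<^sup>2 \<le> 2\<^sup>2" using exp_le by (simp add: exp_double[symmetric])
    then have "exp (1/2::real) \<le> 2" by (rule power2_le_imp_le) simp
    then show ?thesis by (intro mult_left_mono) auto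
  qed
  finally have "L powr q * ?E (\<lambda>\<epsilon>. \<bar>\<Sum>u\<in>A. \<epsilon> u * b u\<bar> powr q) \<le> L powr q * (q powr q * 4)"
    by (rule mult_left_mono) simp
  then show ?thesis unfolding scale by (simp add: L_def mult_ac)
qed

text \<open>
  The fourth moment method: integrate the pointwise inequality \<open>|x| \<ge> x\<^sup>2/s - x\<^sup>4/s\<^sup>3\<close> with \<open>s\<close> a multiple of
  the standard deviation.
\<close>

lemma Khintchine_lower:
  assumes A: "finite A"
  shows "L2_set a A \<le> 96 * measure_pmf.expectation (signs A) (\<lambda>\<epsilon>. \<bar>\<Sum>u\<in>A. \<epsilon> u * a u\<bar>)"
proof (cases "L2_set a A = 0")
  case True
  then show ?thesis by (simp add: integral_nonneg)
next
  case False
  define L where "L = L2_set a A"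
  have L: "0 < L" using False by (simp add: L_def less_le)
  let ?E = "measure_pmf.expectation (signs A)"
  let ?X = "\<lambda>\<epsilon>. \<Sum>u\<in>A. \<epsilon> u * a u"
  define s where "s = 48 * L"
  have s: "0 < s" using L by (simp add: s_def)
  \<comment> \<open>The constant 48 makes the fourth moment term smaller than half of the second moment term.\<close>
  have pt: "x\<^sup>2 / s - x ^ 4 / s ^ 3 \<le> \<bar>x\<bar>" for x :: real
  proof (cases "\<bar>x\<bar> \<le> s")
    case True
    have "x\<^sup>2 = \<bar>x\<bar> * \<bar>x\<bar>" by (simp add: power2_eq_square)
    also have "\<dots> \<le> \<bar>x\<bar> * s" using True by (intro mult_left_mono) auto
    finally have "x\<^sup>2 / s \<le> \<bar>x\<bar>" using s by (simp add: divide_le_eq)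
    moreover have "0 \<le> x ^ 4 / s ^ 3" using s by simp
    ultimately show ?thesis by linarith
  next
    case False
    then have "s\<^sup>2 \<le> \<bar>x\<bar>\<^sup>2" using s by (intro power_mono) auto
    then have "x\<^sup>2 * s\<^sup>2 \<le> x\<^sup>2 * x\<^sup>2" by (intro mult_left_mono) auto
    then have "x\<^sup>2 * s\<^sup>2 / s ^ 3 \<le> x ^ 4 / s ^ 3" using s by (intro divide_right_mono) (auto simp flip: power_add)
    moreover have "x\<^sup>2 * s\<^sup>2 / s ^ 3 = x\<^sup>2 / s" using s by (simp add: power2_eq_square power3_eq_cube)
    ultimately show ?thesis by simp
  qed
  have E4: "?E (\<lambda>\<epsilon>. ?X \<epsilon> ^ 4) \<le> 1024 * L ^ 4"
  proof -
    have "\<bar>?X \<epsilon>\<bar> powr 4 = ?X \<epsilon> ^ 4" for \<epsilon> by (simp add: powr_numeral)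
    then have "?E (\<lambda>\<epsilon>. ?X \<epsilon> ^ 4) = ?E (\<lambda>\<epsilon>. \<bar>?X \<epsilon>\<bar> powr 4)" by simp
    also have "\<dots> \<le> 4 * 4 powr 4 * L powr 4" unfolding L_def by (rule Khintchine_upper[OF A]) simp
    also have "\<dots> = 1024 * L ^ 4" using L by (simp add: powr_numeral)
    finally show ?thesis .
  qed
  have "?E (\<lambda>\<epsilon>. (?X \<epsilon>)\<^sup>2) / s - ?E (\<lambda>\<epsilon>. ?X \<epsilon> ^ 4) / s ^ 3 = ?E (\<lambda>\<epsilon>. (?X \<epsilon>)\<^sup>2 / s - ?X \<epsilon> ^ 4 / s ^ 3)"
    by (simp add: integrable_signs A)
  also have "\<dots> \<le> ?E (\<lambda>\<epsilon>. \<bar>?X \<epsilon>\<bar>)" by (intro integral_mono integrable_signs A pt)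
  finally have "L\<^sup>2 / s - 1024 * L ^ 4 / s ^ 3 \<le> ?E (\<lambda>\<epsilon>. \<bar>?X \<epsilon>\<bar>)"
    using E4 s divide_right_mono[OF E4, of "s ^ 3"] by (simp add: signs_second_moment[OF A] L_def L2_set_power2)
  moreover have "L\<^sup>2 / s = L / 48" using L by (simp add: s_def power2_eq_square)
  moreover have "1024 * L ^ 4 / s ^ 3 = 1024 / 110592 * L"
    using L by (simp add: s_def power_mult_distrib) (simp add: power3_eq_cube power4_eq_xxxx)
  ultimately show ?thesis using L by (simp add: L_def)
qed

section \<open>Random sums and square functions\<close>

lemma epowr_ennreal: "0 \<le> t \<Longrightarrow> epowr (ennreal t) r = ennreal (t powr r)"
  by (simp add: epowr_def)

lemma epowr_top [simp]: "epowr \<infinity> r = \<infinity>" "epowr top r = top"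
  by (simp_all add: epowr_def)

lemma epowr_mono: "0 \<le> r \<Longrightarrow> x \<le> y \<Longrightarrow> epowr x r \<le> epowr y r"
  by (cases x; cases y) (auto simp: epowr_def top_unique intro!: ennreal_leI powr_mono2)

lemma epowr_less_top: "epowr x r < \<infinity> \<longleftrightarrow> x < \<infinity>"
  by (simp add: epowr_def less_top)

lemma Lp_norm_alt: "Lp_norm \<mu> p f = epowr (\<integral>\<^sup>+x. ennreal (\<bar>f x\<bar> powr p) \<partial>\<mu>) (1/p)"
  by (simp add: Lp_norm_def eLp_norm_def epowr_ennreal)

lemma Lp_norm_real:
  assumes "(\<integral>\<^sup>+x. ennreal (\<bar>f x\<bar> powr p) \<partial>\<mu>) = ennreal t" "0 \<le> t"
  shows "Lp_norm \<mu> p f = ennreal (t powr (1/p))"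
  using assms by (simp add: Lp_norm_alt epowr_ennreal)

lemma Lp_norm_leI:
  assumes p: "0 < p" and C: "0 < C"
    and le: "(\<integral>\<^sup>+x. ennreal (\<bar>f x\<bar> powr p) \<partial>\<mu>) \<le> ennreal (C powr p) * (\<integral>\<^sup>+x. ennreal (\<bar>g x\<bar> powr p) \<partial>\<nu>)"
  shows "Lp_norm \<mu> p f \<le> ennreal C * Lp_norm \<nu> p g"
proof (cases "(\<integral>\<^sup>+x. ennreal (\<bar>g x\<bar> powr p) \<partial>\<nu>)")
  case (real t)
  then have "(\<integral>\<^sup>+x. ennreal (\<bar>f x\<bar> powr p) \<partial>\<mu>) \<le> ennreal (C powr p * t)"
    using le by (simp add: ennreal_mult)
  then have "Lp_norm \<mu> p f \<le> epowr (ennreal (C powr p * t)) (1/p)"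
    unfolding Lp_norm_alt using p by (intro epowr_mono) auto
  also have "\<dots> = ennreal ((C powr p * t) powr (1/p))"
    using real by (simp add: epowr_ennreal)
  also have "(C powr p * t) powr (1/p) = C * t powr (1/p)"
    using real C p by (simp add: powr_mult powr_powr)
  also have "ennreal \<dots> = ennreal C * Lp_norm \<nu> p g"
    using real C by (simp add: Lp_norm_alt epowr_ennreal ennreal_mult)
  finally show ?thesis .
next
  case top
  then show ?thesis using C by (simp add: Lp_norm_alt ennreal_mult_top)
qed

lemma power_mean_le:
  fixes P y :: "'a \<Rightarrow> real"
  assumes S: "finite S" and P: "\<And>i. i \<in> S \<Longrightarrow> 0 \<le> P i" "(\<Sum>i\<in>S. P i) = 1"
    and y: "\<And>i. i \<in> S \<Longrightarrow> 0 \<le> y i" and q: "1 < q"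
  shows "(\<Sum>i\<in>S. P i * y i) powr q \<le> (\<Sum>i\<in>S. P i * y i powr q)"
proof -
  have "(\<Sum>i\<in>S. P i * (y i * 1)) \<le> wnorm S P q y * wnorm S P (conj_exponent q) (\<lambda>_. 1)"
    using assms by (intro wnorm_Hoelder) auto
  also have "wnorm S P (conj_exponent q) (\<lambda>_. 1) = 1" using P by (simp add: wnorm_def)
  finally have "(\<Sum>i\<in>S. P i * y i) powr q \<le> wnorm S P q y powr q"
    using q P y by (intro powr_mono2 sum_nonneg mult_nonneg_nonneg) auto
  also have "\<dots> = (\<Sum>i\<in>S. P i * y i powr q)" using P q by (intro wnorm_powr) auto
  finally show ?thesis .
qed

lemma random_signs_eq: "random_signs U = signs {1..U}"
  by (simp add: random_signs_def signs_def)

lemma sum_pmf_signs: "finite A \<Longrightarrow> (\<Sum>\<epsilon>\<in>set_pmf (signs A). pmf (signs A) \<epsilon>) = 1"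
  by (rule sum_pmf_eq_1) auto

lemma expectation_signs_sum:
  "finite A \<Longrightarrow> measure_pmf.expectation (signs A) g = (\<Sum>\<epsilon>\<in>set_pmf (signs A). pmf (signs A) \<epsilon> * g \<epsilon>)" for g :: "_ \<Rightarrow> real"
  by (subst integral_measure_pmf[of "set_pmf (signs A)"]) auto

lemma nn_integral_signs_sum:
  "finite A \<Longrightarrow> (\<integral>\<^sup>+\<epsilon>. g \<epsilon> \<partial>signs A) = (\<Sum>\<epsilon>\<in>set_pmf (signs A). g \<epsilon> * ennreal (pmf (signs A) \<epsilon>))"
  by (rule nn_integral_measure_pmf_finite) auto

text \<open>
  Jensen's inequality bounds the mean of the norms by the \<open>q\<close>-th root of the mean of their \<open>q\<close>-th powers,
  which can be computed pointwise by means of Khintchine's inequality. If the square function has infinite norm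
  there is nothing to show; otherwise all norms are finite and the argument takes place in the reals.
\<close>

theorem random_sum_le_square_function:
  assumes A: "finite A" and q: "1 < q" and f: "\<And>u. u \<in> A \<Longrightarrow> f u \<in> borel_measurable \<nu>"
  shows "(\<integral>\<^sup>+\<epsilon>. Lp_norm \<nu> q (\<lambda>x. \<Sum>u\<in>A. \<epsilon> u * f u x) \<partial>signs A)
     \<le> ennreal (4 * q) * Lp_norm \<nu> q (\<lambda>x. sqrt (\<Sum>u\<in>A. (f u x)\<^sup>2))"
proof -
  let ?S = "set_pmf (signs A)"
  let ?P = "pmf (signs A)"
  let ?F = "\<lambda>\<epsilon> x. \<Sum>u\<in>A. \<epsilon> u * f u x"
  define I where "I \<epsilon> = (\<integral>\<^sup>+x. ennreal (\<bar>?F \<epsilon> x\<bar> powr q) \<partial>\<nu>)" for \<epsilon>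
  define J where "J = (\<integral>\<^sup>+x. ennreal (\<bar>sqrt (\<Sum>u\<in>A. (f u x)\<^sup>2)\<bar> powr q) \<partial>\<nu>)"
  note [measurable] = f
  have "(\<Sum>\<epsilon>\<in>?S. ennreal (?P \<epsilon>) * I \<epsilon>) = (\<integral>\<^sup>+x. (\<Sum>\<epsilon>\<in>?S. ennreal (?P \<epsilon> * \<bar>?F \<epsilon> x\<bar> powr q)) \<partial>\<nu>)"
    unfolding I_def by (subst nn_integral_sum) (auto simp: ennreal_mult nn_integral_cmult)
  also have "\<dots> \<le> (\<integral>\<^sup>+x. ennreal ((4 * q) powr q) * ennreal (\<bar>sqrt (\<Sum>u\<in>A. (f u x)\<^sup>2)\<bar> powr q) \<partial>\<nu>)"
  proof (rule nn_integral_mono)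
    fix x
    have "(\<Sum>\<epsilon>\<in>?S. ?P \<epsilon> * \<bar>?F \<epsilon> x\<bar> powr q) \<le> 4 * q powr q * L2_set (\<lambda>u. f u x) A powr q"
      unfolding expectation_signs_sum[OF A, symmetric] using A q by (intro Khintchine_upper) auto
    also have "\<dots> \<le> (4 * q) powr q * L2_set (\<lambda>u. f u x) A powr q"
    proof (rule mult_right_mono)
      have "4 powr 1 \<le> (4::real) powr q" using q by (intro powr_mono) auto
      then show "4 * q powr q \<le> (4 * q) powr q" using q by (simp add: powr_mult mult_right_mono)
    qed simp
    finally have "(\<Sum>\<epsilon>\<in>?S. ?P \<epsilon> * \<bar>?F \<epsilon> x\<bar> powr q) \<le> (4 * q) powr q * \<bar>sqrt (\<Sum>u\<in>A. (f u x)\<^sup>2)\<bar> powr q"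
      by (simp add: L2_set_def sum_nonneg)
    then show "(\<Sum>\<epsilon>\<in>?S. ennreal (?P \<epsilon> * \<bar>?F \<epsilon> x\<bar> powr q)) \<le> ennreal ((4 * q) powr q) * ennreal (\<bar>sqrt (\<Sum>u\<in>A. (f u x)\<^sup>2)\<bar> powr q)"
      by (simp add: sum_ennreal ennreal_mult'[symmetric] ennreal_leI)
  qed
  also have "\<dots> = ennreal ((4 * q) powr q) * J" unfolding J_def by (rule nn_integral_cmult) measurable
  finally have main: "(\<Sum>\<epsilon>\<in>?S. ennreal (?P \<epsilon>) * I \<epsilon>) \<le> ennreal ((4 * q) powr q) * J" .
  show ?thesis
  proof (cases J)
    case top
    then have "Lp_norm \<nu> q (\<lambda>x. sqrt (\<Sum>u\<in>A. (f u x)\<^sup>2)) = top"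
      by (simp add: Lp_norm_alt J_def)
    then show ?thesis using q by (simp add: ennreal_mult_top)
  next
    case (real j)
    define i where "i \<epsilon> = enn2real (I \<epsilon>)" for \<epsilon>
    have fin: "I \<epsilon> = ennreal (i \<epsilon>)" if "\<epsilon> \<in> ?S" for \<epsilon>
    proof -
      have "ennreal (?P \<epsilon>) * I \<epsilon> \<le> (\<Sum>\<epsilon>\<in>?S. ennreal (?P \<epsilon>) * I \<epsilon>)"
        using that A by (intro member_le_sum) auto
      also have "\<dots> < top" using main real by (auto simp: ennreal_mult_less_top intro: le_less_trans)
      finally have "I \<epsilon> < top" using that by (auto simp: ennreal_mult_less_top set_pmf_iff pmf_pos)
      then show ?thesis by (simp add: i_def)
    qed
    have inn: "0 \<le> i \<epsilon>" for \<epsilon> by (simp add: i_def)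
    have "(\<Sum>\<epsilon>\<in>?S. ennreal (?P \<epsilon>) * I \<epsilon>) = ennreal (\<Sum>\<epsilon>\<in>?S. ?P \<epsilon> * i \<epsilon>)"
      by (simp add: fin inn ennreal_mult'[symmetric] sum_ennreal)
    with main real have main': "(\<Sum>\<epsilon>\<in>?S. ?P \<epsilon> * i \<epsilon>) \<le> (4 * q) powr q * j"
      by (simp add: ennreal_mult'[symmetric])
    have "(\<integral>\<^sup>+\<epsilon>. Lp_norm \<nu> q (?F \<epsilon>) \<partial>signs A) = (\<Sum>\<epsilon>\<in>?S. ennreal (i \<epsilon> powr (1/q)) * ennreal (?P \<epsilon>))"
      unfolding nn_integral_signs_sum[OF A]
      by (intro sum.cong refl arg_cong2[where f = "(*)"] Lp_norm_real) (auto simp: fin[symmetric] I_def inn)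
    also have "\<dots> = ennreal (\<Sum>\<epsilon>\<in>?S. ?P \<epsilon> * i \<epsilon> powr (1/q))"
      by (simp add: ennreal_mult'[symmetric] sum_ennreal mult.commute)
    also have "(\<Sum>\<epsilon>\<in>?S. ?P \<epsilon> * i \<epsilon> powr (1/q)) \<le> 4 * q * j powr (1/q)"
    proof -
      have "(\<Sum>\<epsilon>\<in>?S. ?P \<epsilon> * i \<epsilon> powr (1/q)) powr q \<le> (\<Sum>\<epsilon>\<in>?S. ?P \<epsilon> * (i \<epsilon> powr (1/q)) powr q)"
        using A q sum_pmf_signs[OF A] by (intro power_mean_le) auto
      also have "\<dots> \<le> (4 * q) powr q * j" using main' q by (simp add: powr_powr inn)
      finally have "((\<Sum>\<epsilon>\<in>?S. ?P \<epsilon> * i \<epsilon> powr (1/q)) powr q) powr (1/q) \<le> ((4 * q) powr q * j) powr (1/q)"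
        using q by (intro powr_mono2) auto
      moreover have "((\<Sum>\<epsilon>\<in>?S. ?P \<epsilon> * i \<epsilon> powr (1/q)) powr q) powr (1/q) = (\<Sum>\<epsilon>\<in>?S. ?P \<epsilon> * i \<epsilon> powr (1/q))"
        using q by (simp add: powr_powr sum_nonneg)
      moreover have "((4 * q) powr q * j) powr (1/q) = 4 * q * j powr (1/q)"
        using q real by (simp add: powr_mult powr_powr)
      ultimately show ?thesis by simp
    qed
    also have "ennreal (4 * q * j powr (1/q)) = ennreal (4 * q) * Lp_norm \<nu> q (\<lambda>x. sqrt (\<Sum>u\<in>A. (f u x)\<^sup>2))"
      using real q J_def by (subst Lp_norm_real[where t = j]) (auto simp: ennreal_mult)
    finally show ?thesis by (simp add: ennreal_leI)
  qed
qed

text \<open>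
  By Khintchine's inequality the square function is dominated by the mean \<open>E\<close> of \<open>|\<Sum>\<^sub>u \<epsilon>\<^sub>u f\<^sub>u|\<close>, and by
  Minkowski's inequality the norm of a mean is at most the mean of the norms.
\<close>

theorem square_function_le_random_sum:
  assumes A: "finite A" and q: "1 < q" and f: "\<And>u. u \<in> A \<Longrightarrow> f u \<in> borel_measurable \<nu>"
  shows "Lp_norm \<nu> q (\<lambda>x. sqrt (\<Sum>u\<in>A. (f u x)\<^sup>2))
     \<le> ennreal 96 * (\<integral>\<^sup>+\<epsilon>. Lp_norm \<nu> q (\<lambda>x. \<Sum>u\<in>A. \<epsilon> u * f u x) \<partial>signs A)"
proof -
  let ?S = "set_pmf (signs A)"
  let ?P = "pmf (signs A)"
  let ?F = "\<lambda>\<epsilon> x. \<Sum>u\<in>A. \<epsilon> u * f u x"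
  note [measurable] = f
  define E where "E x = (\<Sum>\<epsilon>\<in>?S. ?P \<epsilon> * \<bar>?F \<epsilon> x\<bar>)" for x
  have Enn: "0 \<le> E x" for x unfolding E_def by (intro sum_nonneg) auto
  have 1: "Lp_norm \<nu> q (\<lambda>x. sqrt (\<Sum>u\<in>A. (f u x)\<^sup>2)) \<le> ennreal 96 * Lp_norm \<nu> q E"
  proof (rule Lp_norm_leI)
    have "(\<integral>\<^sup>+x. ennreal (\<bar>sqrt (\<Sum>u\<in>A. (f u x)\<^sup>2)\<bar> powr q) \<partial>\<nu>) \<le> (\<integral>\<^sup>+x. ennreal (96 powr q) * ennreal (\<bar>E x\<bar> powr q) \<partial>\<nu>)"
    proof (rule nn_integral_mono)
      fix x
      have "sqrt (\<Sum>u\<in>A. (f u x)\<^sup>2) \<le> 96 * E x"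
        using Khintchine_lower[OF A, of "\<lambda>u. f u x"] by (simp add: expectation_signs_sum[OF A] L2_set_def E_def)
      then have "\<bar>sqrt (\<Sum>u\<in>A. (f u x)\<^sup>2)\<bar> powr q \<le> (96 * E x) powr q"
        using q by (intro powr_mono2) (auto simp: sum_nonneg)
      then show "ennreal (\<bar>sqrt (\<Sum>u\<in>A. (f u x)\<^sup>2)\<bar> powr q) \<le> ennreal (96 powr q) * ennreal (\<bar>E x\<bar> powr q)"
        using Enn by (simp add: powr_mult ennreal_mult'[symmetric] ennreal_leI)
    qed
    also have "\<dots> = ennreal (96 powr q) * (\<integral>\<^sup>+x. ennreal (\<bar>E x\<bar> powr q) \<partial>\<nu>)"
      unfolding E_def by (rule nn_integral_cmult) measurable
    finally show "(\<integral>\<^sup>+x. ennreal (\<bar>sqrt (\<Sum>u\<in>A. (f u x)\<^sup>2)\<bar> powr q) \<partial>\<nu>) \<le> ennreal (96 powr q) * (\<integral>\<^sup>+x. ennreal (\<bar>E x\<bar> powr q) \<partial>\<nu>)" .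
  qed (use q in auto)
  have 2: "Lp_norm \<nu> q E \<le> (\<integral>\<^sup>+\<epsilon>. Lp_norm \<nu> q (?F \<epsilon>) \<partial>signs A)"
  proof (rule ennreal_le_epsilon)
    fix e :: real
    assume "(\<integral>\<^sup>+\<epsilon>. Lp_norm \<nu> q (?F \<epsilon>) \<partial>signs A) < top" and e: "0 < e"
    then have top: "(\<Sum>\<epsilon>\<in>?S. Lp_norm \<nu> q (?F \<epsilon>) * ennreal (?P \<epsilon>)) < top" by (simp add: nn_integral_signs_sum[OF A])
    define n where "n \<epsilon> = enn2real (Lp_norm \<nu> q (?F \<epsilon>))" for \<epsilon>
    have fin: "Lp_norm \<nu> q (?F \<epsilon>) = ennreal (n \<epsilon>)" if "\<epsilon> \<in> ?S" for \<epsilon>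
    proof -
      have "Lp_norm \<nu> q (?F \<epsilon>) * ennreal (?P \<epsilon>) \<le> (\<Sum>\<epsilon>\<in>?S. Lp_norm \<nu> q (?F \<epsilon>) * ennreal (?P \<epsilon>))"
        using that A by (intro member_le_sum) auto
      also note top
      finally have "Lp_norm \<nu> q (?F \<epsilon>) < top" using that by (auto simp: ennreal_mult_less_top set_pmf_iff pmf_pos)
      then show ?thesis by (simp add: n_def)
    qed
    have nn: "0 \<le> n \<epsilon>" for \<epsilon> by (simp add: n_def)
    have I: "(\<integral>\<^sup>+x. ennreal (\<bar>?F \<epsilon> x\<bar> powr q) \<partial>\<nu>) = ennreal (n \<epsilon> powr q)" if "\<epsilon> \<in> ?S" for \<epsilon>
    proof (cases "\<integral>\<^sup>+x. ennreal (\<bar>?F \<epsilon> x\<bar> powr q) \<partial>\<nu>")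
      case (real t)
      then have "n \<epsilon> = t powr (1/q)" using fin[OF that] Lp_norm_real[OF real(2,1)] nn by simp
      then show ?thesis using real q by (simp add: powr_powr)
    next
      case top
      then show ?thesis using fin[OF that] by (simp add: Lp_norm_alt)
    qed
    \<comment> \<open>Minkowski's inequality as a convexity statement: normalize each function by its norm \<open>n \<epsilon>\<close> and take
    the convex combination with the weights \<open>lam \<epsilon>\<close>. The \<open>e\<close> avoids a division by zero.\<close>
    define N where "N = (\<Sum>\<epsilon>\<in>?S. ?P \<epsilon> * (n \<epsilon> + e))"
    have N: "N = (\<Sum>\<epsilon>\<in>?S. ?P \<epsilon> * n \<epsilon>) + e"
      by (simp add: N_def distrib_left sum.distrib sum_distrib_right[symmetric] sum_pmf_signs[OF A])
    have Npos: "0 < N" unfolding N using e nn by (intro add_nonneg_pos sum_nonneg) auto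
    define lam where "lam \<epsilon> = ?P \<epsilon> * (n \<epsilon> + e) / N" for \<epsilon>
    have lam: "0 \<le> lam \<epsilon>" for \<epsilon> using nn[of \<epsilon>] e Npos by (simp add: lam_def)
    have lam1: "(\<Sum>\<epsilon>\<in>?S. lam \<epsilon>) = 1" using Npos by (simp add: lam_def sum_divide_distrib[symmetric] N_def[symmetric])
    define c where "c \<epsilon> = N powr q * lam \<epsilon> / (n \<epsilon> + e) powr q" for \<epsilon>
    have cnn: "0 \<le> c \<epsilon>" for \<epsilon> using lam[of \<epsilon>] by (simp add: c_def)
    have "(\<integral>\<^sup>+x. ennreal (\<bar>E x\<bar> powr q) \<partial>\<nu>) \<le> (\<integral>\<^sup>+x. (\<Sum>\<epsilon>\<in>?S. ennreal (c \<epsilon>) * ennreal (\<bar>?F \<epsilon> x\<bar> powr q)) \<partial>\<nu>)"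
    proof (rule nn_integral_mono)
      fix x
      have "E x = N * (\<Sum>\<epsilon>\<in>?S. lam \<epsilon> * (\<bar>?F \<epsilon> x\<bar> / (n \<epsilon> + e)))"
      proof -
        have "n \<epsilon> + e \<noteq> 0" for \<epsilon> using nn[of \<epsilon>] e by linarith
        then show ?thesis using Npos by (simp add: E_def lam_def sum_distrib_left)
      qed
      then have "\<bar>E x\<bar> powr q = N powr q * (\<Sum>\<epsilon>\<in>?S. lam \<epsilon> * (\<bar>?F \<epsilon> x\<bar> / (n \<epsilon> + e))) powr q"
        using Npos lam nn e by (simp add: powr_mult abs_mult sum_nonneg)
      also have "\<dots> \<le> N powr q * (\<Sum>\<epsilon>\<in>?S. lam \<epsilon> * (\<bar>?F \<epsilon> x\<bar> / (n \<epsilon> + e)) powr q)"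
        using A q lam lam1 nn e by (intro mult_left_mono power_mean_le) auto
      also have "\<dots> = (\<Sum>\<epsilon>\<in>?S. c \<epsilon> * \<bar>?F \<epsilon> x\<bar> powr q)"
        using nn e by (simp add: c_def sum_distrib_left powr_divide add_nonneg_nonneg mult.assoc)
      finally show "ennreal (\<bar>E x\<bar> powr q) \<le> (\<Sum>\<epsilon>\<in>?S. ennreal (c \<epsilon>) * ennreal (\<bar>?F \<epsilon> x\<bar> powr q))"
        using cnn by (simp add: ennreal_mult'[symmetric] sum_ennreal ennreal_leI)
    qed
    also have "\<dots> = (\<Sum>\<epsilon>\<in>?S. ennreal (c \<epsilon>) * ennreal (n \<epsilon> powr q))"
      by (subst nn_integral_sum) (auto simp: nn_integral_cmult I[symmetric])
    also have "\<dots> = ennreal (\<Sum>\<epsilon>\<in>?S. c \<epsilon> * n \<epsilon> powr q)"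
      using cnn by (simp add: ennreal_mult'[symmetric] sum_ennreal)
    also have "(\<Sum>\<epsilon>\<in>?S. c \<epsilon> * n \<epsilon> powr q) \<le> (\<Sum>\<epsilon>\<in>?S. N powr q * lam \<epsilon>)"
    proof (rule sum_mono)
      fix \<epsilon>
      have "n \<epsilon> powr q \<le> (n \<epsilon> + e) powr q" using nn[of \<epsilon>] e q by (intro powr_mono2) auto
      then have "c \<epsilon> * n \<epsilon> powr q \<le> c \<epsilon> * (n \<epsilon> + e) powr q" using cnn by (intro mult_left_mono) auto
      also have "\<dots> = N powr q * lam \<epsilon>"
      proof -
        have "0 < n \<epsilon> + e" using nn[of \<epsilon>] e by linarith
        then show ?thesis by (simp add: c_def)
      qed
      finally show "c \<epsilon> * n \<epsilon> powr q \<le> N powr q * lam \<epsilon>" .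
    qed
    also have "\<dots> = N powr q" by (simp add: sum_distrib_left[symmetric] lam1)
    finally have "Lp_norm \<nu> q E \<le> epowr (ennreal (N powr q)) (1/q)"
      unfolding Lp_norm_alt using q by (intro epowr_mono) (auto simp: ennreal_leI)
    also have "\<dots> = ennreal N" using Npos q by (simp add: epowr_ennreal powr_powr)
    also have "\<dots> = (\<integral>\<^sup>+\<epsilon>. Lp_norm \<nu> q (?F \<epsilon>) \<partial>signs A) + ennreal e"
      using nn e by (simp add: N nn_integral_signs_sum[OF A] fin ennreal_mult'[symmetric] sum_ennreal sum_nonneg mult.commute)
    finally show "Lp_norm \<nu> q E \<le> (\<integral>\<^sup>+\<epsilon>. Lp_norm \<nu> q (?F \<epsilon>) \<partial>signs A) + ennreal e" .
  qed
  show ?thesis using 1 2 by (meson mult_left_mono order_trans zero_le)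
qed

section \<open>Dyadic cubes\<close>

lemma mem_half_open_cube: "y \<in> half_open_cube x l \<longleftrightarrow> (\<forall>i. x $ i \<le> y $ i \<and> y $ i < x $ i + l)"
  by (simp add: half_open_cube_def)

lemma half_open_cube_nonempty: "0 < l \<Longrightarrow> x \<in> half_open_cube x l"
  by (simp add: mem_half_open_cube)

lemma half_open_cube_borel [measurable]: "half_open_cube x l \<in> sets borel"
  unfolding half_open_cube_def by measurable

lemma half_open_cube_subset_cbox: "half_open_cube x l \<subseteq> cbox x (x + (\<chi> i. l))"
  by (auto simp: mem_half_open_cube mem_box_cart less_imp_le)

lemma box_subset_half_open_cube: "box x (x + (\<chi> i. l)) \<subseteq> half_open_cube x l"
  by (auto simp: mem_half_open_cube mem_box_cart less_imp_le)

lemma vol_half_open_cube: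
  fixes x :: "real ^ 'n"
  assumes "0 \<le> l"
  shows "vol (half_open_cube x l) = l ^ CARD('n)"
proof -
  let ?y = "x + (\<chi> i. l)"
  have "emeasure lborel (box x ?y) \<le> emeasure lborel (half_open_cube x l)"
    using box_subset_half_open_cube by (intro emeasure_mono) auto
  moreover have "emeasure lborel (half_open_cube x l) \<le> emeasure lborel (cbox x ?y)"
    using half_open_cube_subset_cbox by (intro emeasure_mono) auto
  moreover have "emeasure lborel (box x ?y) = emeasure lborel (cbox x ?y)"
    by (simp add: emeasure_lborel_box_eq emeasure_lborel_cbox_eq)
  moreover have "emeasure lborel (cbox x ?y) = ennreal (l ^ CARD('n))"
  proof -
    have "cbox x ?y \<noteq> {}" using assms by (simp add: interval_ne_empty_cart)
    then have "measure lborel (cbox x ?y) = l ^ CARD('n)" by (simp add: content_cbox_cart)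
    then show ?thesis using emeasure_eq_ennreal_measure[of lborel "cbox x ?y"] by (simp add: emeasure_lborel_cbox_eq)
  qed
  ultimately have "emeasure lborel (half_open_cube x l) = ennreal (l ^ CARD('n))" by simp
  then show ?thesis using assms by (simp add: measure_def)
qed

text \<open>
  A half-open cube of side \<open>l / 2\<close> contains at most one of the \<open>2 ^ N\<close> points that are obtained from
  one corner by moving a distance at least \<open>l / 2\<close> along a set of axes. So if \<open>2 ^ N\<close> such cubes tile a
  cube of side \<open>l\<close>, each contains exactly one of the points, and letting the distance tend to \<open>l\<close>
  determines the position of the tiles.
\<close>

lemma half_cube_tiles:
  fixes x y :: "real ^ 'n"
  assumes l: "0 < l" and C: "card C = 2 ^ CARD('n)" and U: "half_open_cube x l = \<Union>C"
    and half: "\<And>R. R \<in> C \<Longrightarrow> \<exists>y. R = half_open_cube y (l / 2)"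
    and R: "half_open_cube y (l / 2) \<in> C"
  shows "y $ i = x $ i \<or> y $ i = x $ i + l / 2"
proof -
  let ?R = "half_open_cube y (l / 2)"
  have finC: "finite C" using C by (metis card.infinite power_not_zero zero_neq_numeral)
  have Rsub: "?R \<subseteq> half_open_cube x l" using R U by blast
  have yx: "x $ i \<le> y $ i" for i
    using subsetD[OF Rsub half_open_cube_nonempty] l by (simp add: mem_half_open_cube)
  have yl: "y $ i \<le> x $ i + l / 2"
  proof (rule ccontr)
    assume "\<not> y $ i \<le> x $ i + l / 2"
    define t where "t = max 0 (x $ i + l - y $ i)"
    define z where "z = (\<chi> j. y $ j + (if j = i then t else 0))"
    have "0 \<le> t" "t < l / 2" using \<open>\<not> y $ i \<le> x $ i + l / 2\<close> l by (auto simp: t_def max_def)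
    then have "z \<in> ?R" using l by (auto simp: mem_half_open_cube z_def)
    then have "z \<in> half_open_cube x l" using Rsub by blast
    then have "z $ i < x $ i + l" by (simp add: mem_half_open_cube)
    then show False by (simp add: z_def t_def split: if_splits)
  qed
  have corner: "\<exists>A. (\<chi> j. x $ j + (if j \<in> A then l - d else 0)) \<in> ?R" if d: "0 < d" "d \<le> l / 2" for d
  proof -
    define pt where "pt A = (\<chi> j. x $ j + (if j \<in> A then l - d else 0))" for A :: "'n set"
    have ptin: "pt A \<in> half_open_cube x l" for A using d l by (auto simp: mem_half_open_cube pt_def)
    define F where "F A = (SOME R. R \<in> C \<and> pt A \<in> R)" for A
    have F: "F A \<in> C \<and> pt A \<in> F A" for A
      unfolding F_def using ptin[of A] U by (intro someI_ex[where P = "\<lambda>R. R \<in> C \<and> pt A \<in> R"]) blast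
    have "inj F"
    proof (rule injI)
      fix A B assume AB: "F A = F B"
      obtain v where v: "F A = half_open_cube v (l / 2)" using half F by blast
      have pA: "pt A \<in> half_open_cube v (l / 2)" and pB: "pt B \<in> half_open_cube v (l / 2)"
        using F[of A] F[of B] AB v by auto
      show "A = B"
      proof (rule set_eqI)
        fix j
        have "v $ j \<le> pt A $ j" "pt A $ j < v $ j + l / 2" "v $ j \<le> pt B $ j" "pt B $ j < v $ j + l / 2"
          using pA pB by (auto simp: mem_half_open_cube)
        then show "j \<in> A \<longleftrightarrow> j \<in> B" using d by (auto simp: pt_def split: if_splits)
      qed
    qed
    moreover have "F ` UNIV \<subseteq> C" using F by blast
    moreover have "card (UNIV :: 'n set set) = card C" using C by (simp add: card_UNIV_set Cardinality.card_set)
    ultimately have "F ` UNIV = C" using finC by (metis card_image card_subset_eq)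
    then obtain A where "F A = ?R" using R by (metis imageE)
    then show ?thesis using F[of A] by (auto simp: pt_def)
  qed
  show ?thesis
  proof (cases "y $ i = x $ i")
    case False
    then have gt: "x $ i < y $ i" using yx[of i] by simp
    have "x $ i + l / 2 - d \<le> y $ i" if d: "0 < d" "d \<le> l / 2" for d
    proof -
      obtain A where A: "(\<chi> j. x $ j + (if j \<in> A then l - d else 0)) \<in> ?R" using corner[OF d] by blast
      then have "y $ i \<le> x $ i + (if i \<in> A then l - d else 0)" "x $ i + (if i \<in> A then l - d else 0) < y $ i + l / 2"
        by (auto simp: mem_half_open_cube)
      then show ?thesis using gt by (auto split: if_splits)
    qed
    then have near: "x $ i + l / 2 \<le> y $ i + d" if "0 < d" "d \<le> l / 2" for d using that by (simp add: algebra_simps)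
    have "x $ i + l / 2 \<le> y $ i"
    proof (rule field_le_epsilon)
      fix e :: real assume e: "0 < e"
      have "x $ i + l / 2 \<le> y $ i + min e (l / 2)" 
        using near[of "min e (l / 2)"] e l by simp
      then show "x $ i + l / 2 \<le> y $ i + e" by linarith
    qed
    then show ?thesis using yl by simp
  qed simp
qed

text \<open>The cubes are addressed by their generation and one of their points; \<open>cube k x\<close> is the cube of generation \<open>k\<close> that contains \<open>x\<close>.\<close>

locale lattice =
  fixes D :: "int \<Rightarrow> (real ^ 'n) set set"
  assumes lattice: "dyadic_lattice D"
begin

definition cube :: "int \<Rightarrow> real ^ 'n \<Rightarrow> (real ^ 'n) set" where
  "cube k x = (THE Q. Q \<in> D k \<and> x \<in> Q)"

lemma D_disjoint: "Q \<in> D k \<Longrightarrow> R \<in> D k \<Longrightarrow> x \<in> Q \<Longrightarrow> x \<in> R \<Longrightarrow> Q = R"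
  using lattice unfolding dyadic_lattice_def disjoint_def by (metis IntI empty_iff)

lemma D_half_open_cube: "Q \<in> D k \<Longrightarrow> \<exists>x. Q = half_open_cube x (2 powi (- k))"
  using lattice unfolding dyadic_lattice_def by blast

lemma cube_ex1: "\<exists>!Q. Q \<in> D k \<and> x \<in> Q"
proof -
  have "x \<in> \<Union>(D k)" using lattice unfolding dyadic_lattice_def by auto
  then show ?thesis using D_disjoint by blast
qed

lemma cube_in: "cube k x \<in> D k" and cube_self: "x \<in> cube k x"
  using theI'[OF cube_ex1[of k x]] unfolding cube_def by auto

lemma cube_eqI: "Q \<in> D k \<Longrightarrow> x \<in> Q \<Longrightarrow> cube k x = Q"
  using cube_in cube_self D_disjoint by blast

lemma cube_eq: "y \<in> cube k x \<Longrightarrow> cube k y = cube k x"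
  using cube_in cube_eqI by blast

lemma cube_eq_iff: "cube k y = cube k x \<longleftrightarrow> y \<in> cube k x"
  using cube_self cube_eq by blast

lemma D_nonempty: "Q \<in> D k \<Longrightarrow> \<exists>x. x \<in> Q \<and> Q = cube k x"
proof -
  assume Q: "Q \<in> D k"
  then obtain x where "Q = half_open_cube x (2 powi (- k))" using D_half_open_cube by blast
  then have "x \<in> Q" using half_open_cube_nonempty[of "2 powi (- k)" x] by simp
  then show ?thesis using cube_eqI[OF Q] by blast
qed

lemma cube_Suc: "cube (k + 1) x \<subseteq> cube k x"
proof -
  obtain C where C: "C \<subseteq> D (k + 1)" "cube k x = \<Union>C"
    using lattice cube_in[of k x] unfolding dyadic_lattice_def by meson
  then obtain R where "R \<in> C" "x \<in> R" using cube_self by blast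
  then have "cube (k + 1) x = R" using C cube_eqI by blast
  then show ?thesis using C \<open>R \<in> C\<close> by blast
qed

lemma cube_mono:
  assumes "j \<le> k"
  shows "cube k x \<subseteq> cube j x"
  using assms
proof (induction k rule: int_ge_induct)
  case (step i)
  then show ?case using cube_Suc[of i x] by blast
qed simp

lemma cube_eq_mono: "cube k y = cube k x \<Longrightarrow> j \<le> k \<Longrightarrow> cube j y = cube j x"
  using cube_mono[of j k x] by (auto simp: cube_eq_iff)

lemma D_vol: "Q \<in> D k \<Longrightarrow> vol Q = (2 powi (- k)) ^ CARD('n)"
  using D_half_open_cube[of Q k] vol_half_open_cube[of "2 powi (- k)"] by auto

lemma D_vol_pos: "Q \<in> D k \<Longrightarrow> 0 < vol Q"
  by (simp add: D_vol)

lemma D_level_unique: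
  assumes "Q \<in> D j" "Q \<in> D k"
  shows "j = k"
proof -
  have "(2 powi (- j)) ^ CARD('n) = (2 powi (- k) :: real) ^ CARD('n)" using assms D_vol by metis
  then have "2 powi (- j) = (2 powi (- k) :: real)" by (rule power_eq_imp_eq_base) auto
  then show ?thesis
    using power_int_strict_increasing[of "- j" "- k" "2 :: real"] power_int_strict_increasing[of "- k" "- j" "2 :: real"]
    by (cases j k rule: linorder_cases) auto
qed

lemma D_borel: "Q \<in> D k \<Longrightarrow> Q \<in> sets borel"
  using D_half_open_cube half_open_cube_borel by blast

lemma ancestor_cube: "ancestor D r (cube k x) = cube (k - int r) x"
  unfolding ancestor_def
proof (rule the_equality)
  show "\<exists>k'. cube k x \<in> D k' \<and> cube (k - int r) x \<in> D (k' - int r) \<and> cube k x \<subseteq> cube (k - int r) x"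
    using cube_in cube_mono[of "k - int r" k x] by auto
next
  fix R assume "\<exists>k'. cube k x \<in> D k' \<and> R \<in> D (k' - int r) \<and> cube k x \<subseteq> R"
  then obtain k' where k': "cube k x \<in> D k'" "R \<in> D (k' - int r)" "cube k x \<subseteq> R" by blast
  have "k' = k" using D_level_unique k'(1) cube_in by blast
  then show "R = cube (k - int r) x" using k' cube_self[of x k] cube_eqI[of R "k - int r" x] by auto
qed

lemma descendants_finite:
  assumes "P \<in> D k"
  shows "finite {Q \<in> D (k + int m). Q \<subseteq> P}"
proof (induction m)
  case 0
  have "{Q \<in> D (k + int 0). Q \<subseteq> P} \<subseteq> {P}" using assms D_nonempty D_disjoint by fastforce
  then show ?case by (rule finite_subset) simp
next
  case (Suc m)
  have child: "finite {Q \<in> D (j + 1). Q \<subseteq> R}" if R: "R \<in> D j" for R j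
  proof -
    obtain C where C: "C \<subseteq> D (j + 1)" "card C = 2 ^ CARD('n)" "R = \<Union>C"
      using lattice R unfolding dyadic_lattice_def by meson
    have "finite C" using C by (metis card.infinite power_not_zero zero_neq_numeral)
    moreover have "{Q \<in> D (j + 1). Q \<subseteq> R} \<subseteq> C"
    proof
      fix Q assume Q: "Q \<in> {Q \<in> D (j + 1). Q \<subseteq> R}"
      then obtain x where x: "x \<in> Q" using D_nonempty by blast
      then obtain Q' where "Q' \<in> C" "x \<in> Q'" using Q C by blast
      then show "Q \<in> C" using D_disjoint[of Q "j + 1" Q' x] Q C x by blast
    qed
    ultimately show ?thesis by (rule finite_subset[rotated])
  qed
  have "{Q \<in> D (k + int (Suc m)). Q \<subseteq> P} \<subseteq> (\<Union>R\<in>{Q \<in> D (k + int m). Q \<subseteq> P}. {Q \<in> D (k + int m + 1). Q \<subseteq> R})"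
  proof
    fix Q assume Q: "Q \<in> {Q \<in> D (k + int (Suc m)). Q \<subseteq> P}"
    then obtain x where x: "x \<in> Q" "Q = cube (k + int m + 1) x" using D_nonempty[of Q "k + int m + 1"] by (auto simp: ac_simps)
    have "cube (k + int m) x \<subseteq> cube k x" by (rule cube_mono) simp
    moreover have "cube k x = P" using Q x assms cube_eqI by blast
    ultimately show "Q \<in> (\<Union>R\<in>{Q \<in> D (k + int m). Q \<subseteq> P}. {Q \<in> D (k + int m + 1). Q \<subseteq> R})"
      using x cube_in cube_Suc[of "k + int m" x] by blast
  qed
  then show ?case using Suc child by (rule finite_subset[OF _ finite_UN_I]) auto
qed

subsection \<open>Haar functions\<close>

lemma proj_half_open_cube:
  assumes "0 < l"
  shows "(\<lambda>y. y $ i) ` half_open_cube x l = {x $ i..<x $ i + l}"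
proof
  show "{x $ i..<x $ i + l} \<subseteq> (\<lambda>y. y $ i) ` half_open_cube x l"
  proof
    fix t assume "t \<in> {x $ i..<x $ i + l}"
    then have "(\<chi> j. if j = i then t else x $ j) \<in> half_open_cube x l"
      using assms by (auto simp: mem_half_open_cube)
    then show "t \<in> (\<lambda>y. y $ i) ` half_open_cube x l" by (rule rev_image_eqI) simp
  qed
qed (auto simp: mem_half_open_cube)

lemma haar_interval_eq:
  assumes "0 < l"
  shows "haar_interval e {a..<a + l} t =
    (if a \<le> t \<and> t < a + l then (if e \<and> a + l / 2 \<le> t then -1 else 1) / sqrt l else 0)"
proof -
  have 1: "Inf {a..<a + l} = a" "Sup {a..<a + l} = a + l" using assms by auto
  have 2: "(a + (a + l)) / 2 = a + l / 2" by (simp add: field_simps)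
  have 3: "measure lborel {a..<a + l} = l" using assms by simp
  show ?thesis
    unfolding haar_interval_def left_half_def right_half_def 1 2 3 using assms by (auto simp: indicator_def)
qed

lemma haar_bound:
  assumes Q: "Q \<in> D k"
  shows "\<bar>haar Q \<eta> x\<bar> \<le> indicator Q x / sqrt (vol Q)"
proof -
  obtain a where a: "Q = half_open_cube a (2 powi (- k))" using D_half_open_cube Q by blast
  let ?l = "2 powi (- k) :: real"
  have l: "0 < ?l" by simp
  have "\<bar>haar Q \<eta> x\<bar> = (\<Prod>i\<in>UNIV. \<bar>haar_interval (\<eta> i) {a $ i..<a $ i + ?l} (x $ i)\<bar>)"
    by (simp only: haar_def a proj_half_open_cube[OF l] abs_prod)
  also have "\<dots> \<le> (\<Prod>i\<in>UNIV. (if a $ i \<le> x $ i \<and> x $ i < a $ i + ?l then 1 else 0) / sqrt ?l)"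
    by (rule prod_mono) (simp add: haar_interval_eq[OF l] abs_divide)
  also have "\<dots> = indicator Q x / sqrt (vol Q)"
  proof (cases "x \<in> Q")
    case True
    then show ?thesis using l Q by (simp add: a mem_half_open_cube D_vol prod_dividef real_sqrt_power power_one_over divide_simps)
  next
    case False
    then obtain i where "\<not> (a $ i \<le> x $ i \<and> x $ i < a $ i + ?l)" by (auto simp: a mem_half_open_cube)
    then have "(\<Prod>i\<in>UNIV. (if a $ i \<le> x $ i \<and> x $ i < a $ i + ?l then 1 else 0) / sqrt ?l) = 0"
      by (intro prod_zero) auto
    then show ?thesis using False by simp
  qed
  finally show ?thesis .
qed

text \<open>
  By \<open>half_cube_tiles\<close> the children of \<open>Q\<close> are products of halves of its sides, although a lattice is only
  required to have children that are cubes. Inside \<open>Q\<close>, a Haar function can only change from half to half.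
\<close>

lemma haar_const:
  assumes Q: "Q \<in> D k" and eq: "cube (k + 1) x' = cube (k + 1) x"
  shows "haar Q \<eta> x' = haar Q \<eta> x"
proof (cases "x \<in> Q")
  case False
  have "x' \<notin> Q"
  proof
    assume "x' \<in> Q"
    then have "cube k x = Q" using cube_eq_mono[OF eq, of k] cube_eqI[OF Q] by auto
    then show False using False cube_self by blast
  qed
  then show ?thesis using haar_bound[OF Q, of \<eta> x] haar_bound[OF Q, of \<eta> x'] False by simp
next
  case True
  then have Qx: "Q = cube k x" using cube_eqI[OF Q] by simp
  let ?l = "2 powi (- k) :: real"
  have l: "0 < ?l" by simp
  have l2: "2 powi (- (k + 1)) = ?l / 2" by (simp add: power_int_diff power_int_minus power_int_add field_simps)
  obtain a where a: "Q = half_open_cube a ?l" using D_half_open_cube Q by blast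
  obtain b where b: "cube (k + 1) x = half_open_cube b (?l / 2)" using D_half_open_cube[OF cube_in[of "k + 1" x]] l2 by metis
  obtain C where C: "C \<subseteq> D (k + 1)" "card C = 2 ^ CARD('n)" "Q = \<Union>C"
    using lattice Q unfolding dyadic_lattice_def by meson
  have halfC: "\<exists>y. R = half_open_cube y (?l / 2)" if "R \<in> C" for R
    using D_half_open_cube[of R "k + 1", unfolded l2] C that by blast
  obtain R where R: "R \<in> C" "x \<in> R" using True C by blast
  then have "R = cube (k + 1) x" using cube_eqI[of R "k + 1" x] C by auto
  then have "half_open_cube b (?l / 2) \<in> C" using R b by simp
  then have tiles: "b $ i = a $ i \<or> b $ i = a $ i + ?l / 2" for i
    using half_cube_tiles[OF l C(2) _ halfC, of a b i] C(3) a by metis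
  have x: "x \<in> half_open_cube b (?l / 2)" and x': "x' \<in> half_open_cube b (?l / 2)"
    using b cube_self[of x "k + 1"] cube_self[of x' "k + 1"] eq by auto
  have "haar_interval (\<eta> i) {a $ i..<a $ i + ?l} (x' $ i) = haar_interval (\<eta> i) {a $ i..<a $ i + ?l} (x $ i)" for i
  proof -
    have "b $ i \<le> x $ i" "x $ i < b $ i + ?l / 2" "b $ i \<le> x' $ i" "x' $ i < b $ i + ?l / 2"
      using x x' by (auto simp: mem_half_open_cube)
    then show ?thesis using tiles[of i] l unfolding haar_interval_eq[OF l] by auto
  qed
  then show ?thesis by (simp only: haar_def a proj_half_open_cube[OF l])
qed

lemma haar_measurable:
  assumes Q: "Q \<in> D k"
  shows "haar Q \<eta> \<in> borel_measurable borel"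
proof -
  let ?l = "2 powi (- k) :: real"
  obtain a where a: "Q = half_open_cube a ?l" using D_half_open_cube Q by blast
  have "haar Q \<eta> = (\<lambda>x. \<Prod>i\<in>UNIV. (if a $ i \<le> x $ i \<and> x $ i < a $ i + ?l
      then (if \<eta> i \<and> a $ i + ?l / 2 \<le> x $ i then -1 else 1) / sqrt ?l else 0))"
    by (rule ext) (simp only: haar_def a proj_half_open_cube haar_interval_eq zero_less_power_int zero_less_numeral)
  also have "\<dots> \<in> borel_measurable borel" by measurable
  finally show ?thesis .
qed

subsection \<open>Kernels of dyadic shifts\<close>

text \<open>The integral kernel of the part of the shift that belongs to the cube \<open>K\<close>; the input variable is \<open>y\<close>.\<close>

definition kern :: "'n dyadic_shift \<Rightarrow> (real ^ 'n) set \<Rightarrow> real ^ 'n \<Rightarrow> real ^ 'n \<Rightarrow> real" where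
  "kern S K x y = (\<Sum>(I, J)\<in>shift_pairs D S K. sh_coeff S I J K * sh_in S I J y * sh_out S I J x)"

lemma shift_pairs_eq:
  assumes K: "K \<in> D k"
  shows "shift_pairs D S K = {Q \<in> D (k + int (sh_m S)). Q \<subseteq> K} \<times> {Q \<in> D (k + int (sh_n S)). Q \<subseteq> K}"
proof -
  have anc: "I \<in> cubes D \<and> ancestor D r I = K \<longleftrightarrow> I \<in> D (k + int r) \<and> I \<subseteq> K" for r I
  proof
    assume "I \<in> cubes D \<and> ancestor D r I = K"
    then obtain k' where k': "I \<in> D k'" "ancestor D r I = K" by (auto simp: cubes_def)
    then obtain x where x: "I = cube k' x" using D_nonempty by blast
    then have "K = cube (k' - int r) x" using k' ancestor_cube by simp
    then have "k = k' - int r" using D_level_unique[OF K] cube_in by blast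
    then show "I \<in> D (k + int r) \<and> I \<subseteq> K"
      using k' x \<open>K = cube (k' - int r) x\<close> cube_mono[of "k' - int r" k' x] by simp
  next
    assume I: "I \<in> D (k + int r) \<and> I \<subseteq> K"
    then obtain x where x: "x \<in> I" "I = cube (k + int r) x" using D_nonempty by blast
    then have "ancestor D r I = cube k x" by (simp add: ancestor_cube)
    also have "\<dots> = K" using x I K cube_eqI by blast
    finally show "I \<in> cubes D \<and> ancestor D r I = K" using I by (auto simp: cubes_def)
  qed
  have "(I, J) \<in> shift_pairs D S K \<longleftrightarrow>
      (I \<in> cubes D \<and> ancestor D (sh_m S) I = K) \<and> (J \<in> cubes D \<and> ancestor D (sh_n S) J = K)" for I J
    by (auto simp: shift_pairs_def)
  then show ?thesis unfolding anc by auto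
qed

lemma finite_shift_pairs: "K \<in> D k \<Longrightarrow> finite (shift_pairs D S K)"
  by (simp add: shift_pairs_eq descendants_finite)

context
  fixes S K k
  assumes S: "is_dyadic_shift D S" and K: "K \<in> D k"
begin

lemma shift_pairD:
  assumes "(I, J) \<in> shift_pairs D S K"
  shows "haar_related I (sh_in S I J)" "haar_related J (sh_out S I J)"
    "\<bar>sh_coeff S I J K\<bar> \<le> sqrt (vol I * vol J) / vol K"
    "I \<in> D (k + int (sh_m S))" "J \<in> D (k + int (sh_n S))" "I \<subseteq> K" "J \<subseteq> K"
proof -
  have "K \<in> cubes D" using K by (auto simp: cubes_def)
  then have "\<forall>(I, J)\<in>shift_pairs D S K. haar_related I (sh_in S I J) \<and> haar_related J (sh_out S I J) \<and>
      \<bar>sh_coeff S I J K\<bar> \<le> sqrt (vol I * vol J) / vol K"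
    using S unfolding is_dyadic_shift_def by blast
  then show "haar_related I (sh_in S I J)" "haar_related J (sh_out S I J)"
    "\<bar>sh_coeff S I J K\<bar> \<le> sqrt (vol I * vol J) / vol K"
    using assms by auto
  show "I \<in> D (k + int (sh_m S))" "J \<in> D (k + int (sh_n S))" "I \<subseteq> K" "J \<subseteq> K"
    using assms unfolding shift_pairs_eq[OF K] by auto
qed

lemma haar_in_out:
  assumes "(I, J) \<in> shift_pairs D S K"
  shows "\<bar>sh_in S I J y\<bar> \<le> indicator I y / sqrt (vol I)" "\<bar>sh_out S I J x\<bar> \<le> indicator J x / sqrt (vol J)"
    "sh_in S I J \<in> borel_measurable borel" "sh_out S I J \<in> borel_measurable borel"
  using shift_pairD[OF assms] haar_bound haar_measurable unfolding haar_related_def by metis+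

text \<open>
  The cubes \<open>I\<close> of one generation are disjoint, and so are the cubes \<open>J\<close>. Hence at most one term of the sum is
  non-zero at a given point, and there the normalizations of the coefficient and of the Haar functions
  cancel.
\<close>

lemma kern_abs_le: "\<bar>kern S K x y\<bar> \<le> indicator K x * indicator K y / vol K"
proof -
  have "\<bar>kern S K x y\<bar> \<le> (\<Sum>(I, J)\<in>shift_pairs D S K. (if y \<in> I \<and> x \<in> J then 1 / vol K else 0))"
    unfolding kern_def
  proof (rule order_trans[OF sum_abs], rule sum_mono)
    fix P assume "P \<in> shift_pairs D S K"
    then obtain I J where P: "P = (I, J)" and IJ: "(I, J) \<in> shift_pairs D S K" by (cases P) auto
    note D = shift_pairD[OF IJ]
    have v: "0 < vol I" "0 < vol J" "0 < vol K" using D_vol_pos D(4,5) K by auto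
    have "\<bar>sh_coeff S I J K * sh_in S I J y * sh_out S I J x\<bar>
        \<le> sqrt (vol I * vol J) / vol K * (indicator I y / sqrt (vol I)) * (indicator J x / sqrt (vol J))"
      unfolding abs_mult using D(3) haar_in_out(1,2)[OF IJ] v by (intro mult_mono mult_nonneg_nonneg) auto
    also have "\<dots> = (if y \<in> I \<and> x \<in> J then 1 / vol K else 0)"
      using v by (auto simp: real_sqrt_mult)
    finally show "\<bar>case P of (I, J) \<Rightarrow> sh_coeff S I J K * sh_in S I J y * sh_out S I J x\<bar>
        \<le> (case P of (I, J) \<Rightarrow> if y \<in> I \<and> x \<in> J then 1 / vol K else 0)" by (simp add: P)
  qed
  also have "\<dots> = (\<Sum>P\<in>{P \<in> shift_pairs D S K. y \<in> fst P \<and> x \<in> snd P}. 1 / vol K)"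
    by (subst sum.inter_filter[OF finite_shift_pairs[OF K]]) (simp add: split_def)
  also have "\<dots> \<le> indicator K x * indicator K y / vol K"
  proof -
    let ?P = "{P \<in> shift_pairs D S K. y \<in> fst P \<and> x \<in> snd P}"
    have sub: "?P \<subseteq> (if x \<in> K \<and> y \<in> K then {(cube (k + int (sh_m S)) y, cube (k + int (sh_n S)) x)} else {})"
    proof
      fix P assume P: "P \<in> ?P"
      have IJ: "(fst P, snd P) \<in> shift_pairs D S K" using P by auto
      note D = shift_pairD[OF IJ]
      have "fst P = cube (k + int (sh_m S)) y" "snd P = cube (k + int (sh_n S)) x"
        using D P cube_eqI by blast+
      moreover have "x \<in> K \<and> y \<in> K" using D P by auto
      ultimately show "P \<in> (if x \<in> K \<and> y \<in> K then {(cube (k + int (sh_m S)) y, cube (k + int (sh_n S)) x)} else {})"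
        by (cases P) auto
    qed
    then have "card ?P \<le> (if x \<in> K \<and> y \<in> K then 1 else 0)"
      using card_mono[OF _ sub] by (auto split: if_splits)
    then have "real (card ?P) \<le> indicator K x * indicator K y"
      by (auto split: if_splits)
    then show ?thesis using D_vol_pos[OF K] by (simp add: divide_right_mono less_imp_le)
  qed
  finally show ?thesis .
qed

lemma kern_zero: "x \<notin> K \<or> y \<notin> K \<Longrightarrow> kern S K x y = 0"
  using kern_abs_le[of x y] by auto

lemma kern_const_out:
  assumes "cube (k + int (sh_n S) + 1) x' = cube (k + int (sh_n S) + 1) x"
  shows "kern S K x' y = kern S K x y"
  unfolding kern_def
proof (rule sum.cong[OF refl], clarify)
  fix I J assume IJ: "(I, J) \<in> shift_pairs D S K"
  note D = shift_pairD[OF IJ]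
  have "sh_out S I J x' = sh_out S I J x"
    using D(2) haar_const[OF D(5) assms] unfolding haar_related_def by auto
  then show "sh_coeff S I J K * sh_in S I J y * sh_out S I J x' = sh_coeff S I J K * sh_in S I J y * sh_out S I J x" by simp
qed

lemma kern_const_in:
  assumes "cube (k + int (sh_m S) + 1) y' = cube (k + int (sh_m S) + 1) y"
  shows "kern S K x y' = kern S K x y"
  unfolding kern_def
proof (rule sum.cong[OF refl], clarify)
  fix I J assume IJ: "(I, J) \<in> shift_pairs D S K"
  note D = shift_pairD[OF IJ]
  have "sh_in S I J y' = sh_in S I J y"
    using D(1) haar_const[OF D(4) assms] unfolding haar_related_def by auto
  then show "sh_coeff S I J K * sh_in S I J y' * sh_out S I J x = sh_coeff S I J K * sh_in S I J y * sh_out S I J x" by simp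
qed

end

end

subsection \<open>The adjoint shift\<close>

text \<open>The formal adjoint of a shift is a shift, with the two cubes and their Haar functions exchanged.\<close>

definition swap_shift :: "'n::finite dyadic_shift \<Rightarrow> 'n dyadic_shift" where
  "swap_shift S = \<lparr>sh_m = sh_n S, sh_n = sh_m S, sh_coeff = (\<lambda>I J. sh_coeff S J I),
     sh_in = (\<lambda>I J. sh_out S J I), sh_out = (\<lambda>I J. sh_in S J I)\<rparr>"

lemma swap_shift_simps [simp]:
  "sh_m (swap_shift S) = sh_n S" "sh_n (swap_shift S) = sh_m S"
  "sh_coeff (swap_shift S) I J K = sh_coeff S J I K"
  "sh_in (swap_shift S) I J = sh_out S J I" "sh_out (swap_shift S) I J = sh_in S J I"
  by (simp_all add: swap_shift_def)

lemma shift_pairs_swap: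
  fixes S :: "'n::finite dyadic_shift"
  shows "shift_pairs D (swap_shift S) K = prod.swap ` shift_pairs D S K"
proof (rule set_eqI)
  fix P :: "(real ^ 'n) set \<times> (real ^ 'n) set"
  obtain I J where P: "P = (I, J)" by (cases P)
  show "P \<in> shift_pairs D (swap_shift S) K \<longleftrightarrow> P \<in> prod.swap ` shift_pairs D S K"
    unfolding P pair_in_swap_image by (simp add: shift_pairs_def conj_ac)
qed

lemma sum_shift_pairs_swap:
  "(\<Sum>(I, J)\<in>shift_pairs D (swap_shift S) K. g I J) = (\<Sum>(I, J)\<in>shift_pairs D S K. g J I)"
  unfolding shift_pairs_swap by (subst sum.reindex) (auto simp: split_def)

lemma complexity_swap [simp]: "complexity (swap_shift S) = complexity S"
  by (simp add: complexity_def max.commute)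

lemma is_dyadic_shift_swap: "is_dyadic_shift D S \<Longrightarrow> is_dyadic_shift D (swap_shift S)"
  unfolding is_dyadic_shift_def shift_pairs_swap by (auto simp: split_def mult.commute)

lemma shift_adj_eq: "shift_adj D w S = shift_op D w (swap_shift S)"
  unfolding shift_adj_def[abs_def] shift_op_def[abs_def] sum_shift_pairs_swap by simp

lemma (in lattice) kern_swap: "kern (swap_shift S) K x y = kern S K y x"
  unfolding kern_def sum_shift_pairs_swap by (simp add: mult_ac)

subsection \<open>Radon measures and local integrability\<close>

lemma (in lattice) D_compact_cover:
  assumes "Q \<in> D k"
  shows "\<exists>K. compact K \<and> Q \<subseteq> K"
proof -
  obtain x where "Q = half_open_cube x (2 powi (- k))" using D_half_open_cube[OF assms] by blast
  then show ?thesis using half_open_cube_subset_cbox[of x "2 powi (- k)"] compact_cbox by metis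
qed

lemma (in lattice) radon_cube_finite:
  assumes "radon_measure \<mu>" "Q \<in> D k"
  shows "emeasure \<mu> Q < \<infinity>"
proof -
  obtain K where K: "compact K" "Q \<subseteq> K" using D_compact_cover assms by blast
  have "K \<in> sets \<mu>" using K assms by (simp add: radon_measure_def borel_compact)
  then have "emeasure \<mu> Q \<le> emeasure \<mu> K" using K by (intro emeasure_mono) auto
  also have "\<dots> < \<infinity>" using assms K by (simp add: radon_measure_def)
  finally show ?thesis .
qed

lemma radon_sets: "radon_measure \<mu> \<Longrightarrow> sets \<mu> = sets borel"
  by (simp add: radon_measure_def)

lemma radon_measurable: "radon_measure \<mu> \<Longrightarrow> f \<in> borel_measurable borel \<Longrightarrow> f \<in> borel_measurable \<mu>"
  using measurable_cong_sets[of \<mu> borel borel borel] radon_sets by blast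

lemma radon_measurable_iff:
  fixes f :: "real ^ 'n \<Rightarrow> real"
  shows "radon_measure \<mu> \<Longrightarrow> f \<in> borel_measurable \<mu> \<longleftrightarrow> f \<in> borel_measurable borel"
  using measurable_cong_sets[of \<mu> borel borel borel] radon_sets by blast

lemma LpD:
  assumes "f \<in> Lp \<mu> p"
  shows "f \<in> borel_measurable \<mu>" "(\<integral>\<^sup>+x. ennreal (\<bar>f x\<bar> powr p) \<partial>\<mu>) < \<infinity>"
  using assms by (auto simp: Lp_def Lp_norm_alt epowr_less_top[unfolded infinity_ennreal_def])

lemma Lp_integrable:
  assumes f: "f \<in> Lp \<mu> p" and p: "1 < p" and Q: "Q \<in> sets \<mu>" "emeasure \<mu> Q < \<infinity>"
  shows "integrable \<mu> (\<lambda>z. indicator Q z * f z)"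
proof (rule integrableI_bounded)
  note [measurable] = LpD(1)[OF f] Q(1)
  show "(\<lambda>z. indicator Q z * f z) \<in> borel_measurable \<mu>" by measurable
  have "(\<integral>\<^sup>+z. ennreal (norm (indicator Q z * f z)) \<partial>\<mu>) \<le> (\<integral>\<^sup>+z. indicator Q z + ennreal (\<bar>f z\<bar> powr p) \<partial>\<mu>)"
  proof (rule nn_integral_mono)
    fix z
    have "\<bar>f z\<bar> \<le> 1 + \<bar>f z\<bar> powr p"
    proof (cases "\<bar>f z\<bar> \<le> 1")
      case False
      then have "\<bar>f z\<bar> powr 1 \<le> \<bar>f z\<bar> powr p" using p by (intro powr_mono) auto
      then show ?thesis using False by simp
    qed (simp add: add_increasing2)
    then show "ennreal (norm (indicator Q z * f z)) \<le> indicator Q z + ennreal (\<bar>f z\<bar> powr p)"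
      by (cases "z \<in> Q") (auto simp: ennreal_plus[symmetric] simp flip: ennreal_1 intro!: ennreal_leI simp del: ennreal_plus)
  qed
  also have "\<dots> = emeasure \<mu> Q + (\<integral>\<^sup>+x. ennreal (\<bar>f x\<bar> powr p) \<partial>\<mu>)"
    by (subst nn_integral_add) auto
  also have "\<dots> < \<infinity>" using Q LpD(2)[OF f] by simp
  finally show "(\<integral>\<^sup>+z. ennreal (norm (indicator Q z * f z)) \<partial>\<mu>) < \<infinity>" .
qed

section \<open>Restriction to finitely many atoms\<close>

text \<open>
  The region of interest is the union of the cubes in \<open>Tops\<close>, all of generation \<open>k0\<close>. It is divided into the
  cubes of generation \<open>k0 + M\<close>, the atoms, and \<open>X\<close> consists of one point of each atom. Functions on \<open>X\<close>
  stand for functions that are constant on atoms.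
\<close>

locale atoms = lattice D for D :: "int \<Rightarrow> (real ^ 'n) set set" +
  fixes k0 :: int and M :: nat and Tops :: "(real ^ 'n) set set" and X :: "(real ^ 'n) set"
  assumes fin_X: "finite X"
    and X_inj: "x \<in> X \<Longrightarrow> y \<in> X \<Longrightarrow> cube (k0 + int M) x = cube (k0 + int M) y \<Longrightarrow> x = y"
    and X_Tops: "x \<in> X \<Longrightarrow> cube k0 x \<in> Tops"
    and X_cover: "cube k0 z \<in> Tops \<Longrightarrow> \<exists>x\<in>X. cube (k0 + int M) z = cube (k0 + int M) x"
begin

definition atom :: "real ^ 'n \<Rightarrow> (real ^ 'n) set" where
  "atom x = cube (k0 + int M) x"

definition cell :: "nat \<Rightarrow> real ^ 'n \<Rightarrow> (real ^ 'n) set" where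
  "cell i x = {y \<in> X. cube (k0 + int i) y = cube (k0 + int i) x}"

definition wt :: "(real ^ 'n) measure \<Rightarrow> real ^ 'n \<Rightarrow> real" where
  "wt \<mu> x = measure \<mu> (atom x)"

definition region :: "(real ^ 'n) set" where
  "region = {z. cube k0 z \<in> Tops}"

lemma X_region: "x \<in> X \<Longrightarrow> x \<in> region"
  by (simp add: region_def X_Tops)

lemma weighted_cells: "weighted_filtration X cell M (wt \<mu>)"
proof
  fix x k assume x: "x \<in> X"
  have mono: "y \<in> cell j x" if "y \<in> cell k x" "j \<le> k" for y j k
    using that cube_eq_mono[of "k0 + int k" y x "k0 + int j"] by (simp add: cell_def)
  show "cell (Suc k) x \<subseteq> cell k x" using mono[of _ "Suc k" k] by auto
  show "cell k x = {x}" if "M \<le> k"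
  proof
    show "cell k x \<subseteq> {x}"
    proof
      fix y assume "y \<in> cell k x"
      then have "y \<in> cell M x" using that by (rule mono)
      then have "y = x" using x by (intro X_inj) (auto simp: cell_def)
      then show "y \<in> {x}" by simp
    qed
  qed (use x in \<open>simp add: cell_def\<close>)
qed (use fin_X in \<open>auto simp: cell_def wt_def\<close>)

lemma atom_self: "x \<in> atom x"
  by (simp add: atom_def cube_self)

lemma atom_eqD: "z \<in> atom x \<Longrightarrow> i \<le> M \<Longrightarrow> cube (k0 + int i) z = cube (k0 + int i) x"
  unfolding atom_def using cube_eq cube_eq_mono[of "k0 + int M" z x "k0 + int i"] by auto

lemma atom_region: "x \<in> X \<Longrightarrow> z \<in> atom x \<Longrightarrow> z \<in> region"
  using atom_eqD[of z x 0] X_Tops by (simp add: region_def)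

lemma region_atom: "z \<in> region \<Longrightarrow> \<exists>x\<in>X. z \<in> atom x"
  using X_cover[of z] cube_self by (auto simp: region_def atom_def)

lemma atoms_disjoint: "x \<in> X \<Longrightarrow> y \<in> X \<Longrightarrow> z \<in> atom x \<Longrightarrow> z \<in> atom y \<Longrightarrow> x = y"
  using X_inj cube_eq unfolding atom_def by metis

lemma atom_borel: "atom x \<in> sets borel"
  unfolding atom_def using cube_in by (rule D_borel)

lemma sum_atoms_indicator:
  assumes "x \<in> X" "z \<in> atom x"
  shows "(\<Sum>y\<in>X. indicator (atom y) z * g y) = (g x :: 'b :: semiring_1)"
proof -
  have "(\<Sum>y\<in>X. indicator (atom y) z * g y) = (\<Sum>y\<in>{x}. indicator (atom y) z * g y)"
    using assms atoms_disjoint fin_X by (intro sum.mono_neutral_right) (auto simp: indicator_def)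
  then show ?thesis using assms by simp
qed

lemma cube_cell:
  assumes x: "x \<in> X" and i: "i \<le> M"
  shows "cube (k0 + int i) x = (\<Union>y\<in>cell i x. atom y)"
proof
  show "cube (k0 + int i) x \<subseteq> (\<Union>y\<in>cell i x. atom y)"
  proof
    fix z assume z: "z \<in> cube (k0 + int i) x"
    then have eq: "cube (k0 + int i) z = cube (k0 + int i) x" by (rule cube_eq)
    then have "cube k0 z = cube k0 x" by (rule cube_eq_mono) simp
    then obtain y where y: "y \<in> X" "z \<in> atom y" using region_atom[of z] X_Tops[OF x] by (auto simp: region_def)
    then show "z \<in> (\<Union>y\<in>cell i x. atom y)" using atom_eqD[OF y(2) i] eq by (auto simp: cell_def)
  qed
  show "(\<Union>y\<in>cell i x. atom y) \<subseteq> cube (k0 + int i) x"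
    using atom_eqD[OF _ i] by (auto simp: cell_def) (metis cube_self)
qed

lemma measure_cube:
  assumes \<mu>: "radon_measure \<mu>" and x: "x \<in> X" and i: "i \<le> M"
  shows "measure \<mu> (cube (k0 + int i) x) = (\<Sum>y\<in>cell i x. wt \<mu> y)"
  unfolding cube_cell[OF x i] wt_def
proof (rule measure_finite_Union)
  show "finite (cell i x)" using fin_X by (simp add: cell_def)
  show "atom ` cell i x \<subseteq> sets \<mu>" using atom_borel radon_sets[OF \<mu>] by auto
  show "disjoint_family_on atom (cell i x)" using atoms_disjoint by (auto simp: disjoint_family_on_def cell_def)
  show "emeasure \<mu> (atom y) \<noteq> \<infinity>" for y using radon_cube_finite[OF \<mu> cube_in] unfolding atom_def by (metis less_irrefl)
qed

definition atomic :: "(real ^ 'n \<Rightarrow> 'b::zero) \<Rightarrow> bool" where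
  "atomic g \<longleftrightarrow> (\<forall>x\<in>X. \<forall>z\<in>atom x. g z = g x) \<and> (\<forall>z. z \<notin> region \<longrightarrow> g z = 0)"

lemma atomic_sum:
  fixes g :: "real ^ 'n \<Rightarrow> 'b::semiring_1"
  assumes "atomic g"
  shows "g z = (\<Sum>x\<in>X. indicator (atom x) z * g x)"
proof (cases "z \<in> region")
  case True
  then obtain x where x: "x \<in> X" "z \<in> atom x" using region_atom by blast
  then show ?thesis using sum_atoms_indicator[OF x, of g] assms by (simp add: atomic_def)
next
  case False
  then have "(\<Sum>x\<in>X. indicator (atom x) z * g x) = 0"
    using atom_region by (intro sum.neutral) (auto simp: indicator_def)
  then show ?thesis using False assms by (simp add: atomic_def)
qed

lemma atomic_measurable:
  fixes g :: "real ^ 'n \<Rightarrow> real"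
  assumes "atomic g"
  shows "g \<in> borel_measurable borel"
proof -
  have "g = (\<lambda>z. \<Sum>x\<in>X. indicator (atom x) z * g x)" using atomic_sum[OF assms] by blast
  also have "\<dots> \<in> borel_measurable borel" using atom_borel by measurable
  finally show ?thesis .
qed

lemma nn_integral_atomic:
  fixes g :: "real ^ 'n \<Rightarrow> real"
  assumes \<mu>: "radon_measure \<mu>" and g: "atomic g" and nn: "\<And>x. 0 \<le> g x"
  shows "(\<integral>\<^sup>+z. ennreal (g z) \<partial>\<mu>) = ennreal (\<Sum>x\<in>X. wt \<mu> x * g x)"
proof -
  have at: "atom x \<in> sets \<mu>" for x using atom_borel radon_sets[OF \<mu>] by auto
  have em: "emeasure \<mu> (atom x) = ennreal (wt \<mu> x)" for x
    using radon_cube_finite[OF \<mu> cube_in, of "k0 + int M" x] unfolding wt_def atom_def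
    by (intro emeasure_eq_ennreal_measure) auto
  have "(\<integral>\<^sup>+z. ennreal (g z) \<partial>\<mu>) = (\<integral>\<^sup>+z. (\<Sum>x\<in>X. ennreal (g x) * indicator (atom x) z) \<partial>\<mu>)"
  proof (rule nn_integral_cong)
    fix z
    have "ennreal (g z) = ennreal (\<Sum>x\<in>X. indicator (atom x) z * g x)" using atomic_sum[OF g, of z] by simp
    also have "\<dots> = (\<Sum>x\<in>X. ennreal (indicator (atom x) z * g x))" using nn by (intro sum_ennreal[symmetric]) auto
    also have "\<dots> = (\<Sum>x\<in>X. ennreal (g x) * indicator (atom x) z)"
      by (intro sum.cong refl) (auto simp: indicator_def)
    finally show "ennreal (g z) = (\<Sum>x\<in>X. ennreal (g x) * indicator (atom x) z)" .
  qed
  also have "\<dots> = (\<Sum>x\<in>X. ennreal (g x) * emeasure \<mu> (atom x))"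
    using at by (subst nn_integral_sum) (auto simp: nn_integral_cmult_indicator)
  also have "\<dots> = ennreal (\<Sum>x\<in>X. wt \<mu> x * g x)"
    using nn by (simp add: em ennreal_mult'[symmetric] wt_def mult.commute sum_ennreal)
  finally show ?thesis .
qed

lemma Lp_norm_atomic:
  fixes g :: "real ^ 'n \<Rightarrow> real"
  assumes \<mu>: "radon_measure \<mu>" and g: "atomic g" and q: "0 < q"
  shows "Lp_norm \<mu> q g = ennreal (wnorm X (wt \<mu>) q (\<lambda>x. \<bar>g x\<bar>))"
  unfolding wnorm_def
proof (rule Lp_norm_real)
  have "atomic (\<lambda>z. \<bar>g z\<bar> powr q)" using g by (auto simp: atomic_def)
  from nn_integral_atomic[OF \<mu> this]
  show "(\<integral>\<^sup>+z. ennreal (\<bar>g z\<bar> powr q) \<partial>\<mu>) = ennreal (\<Sum>x\<in>X. wt \<mu> x * \<bar>g x\<bar> powr q)" by simp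
qed (auto intro!: sum_nonneg simp: wt_def)

definition atom_int :: "(real ^ 'n) measure \<Rightarrow> (real ^ 'n \<Rightarrow> real) \<Rightarrow> real ^ 'n \<Rightarrow> real" where
  "atom_int \<mu> f x = (\<integral>z. indicator (atom x) z * f z \<partial>\<mu>)"

definition atom_avg :: "(real ^ 'n) measure \<Rightarrow> (real ^ 'n \<Rightarrow> real) \<Rightarrow> real ^ 'n \<Rightarrow> real" where
  "atom_avg \<mu> f x = atom_int \<mu> f x / wt \<mu> x"

text \<open>If the atom has measure zero, both sides vanish, whatever the default value of the quotient is.\<close>

lemma atom_int_atom_avg:
  assumes \<mu>: "radon_measure \<mu>"
  shows "atom_int \<mu> f x = wt \<mu> x * atom_avg \<mu> f x"
proof (cases "wt \<mu> x = 0")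
  case True
  have "emeasure \<mu> (atom x) = ennreal (wt \<mu> x)"
    using radon_cube_finite[OF \<mu> cube_in, of "k0 + int M" x] unfolding wt_def atom_def
    by (intro emeasure_eq_ennreal_measure) auto
  then have "atom x \<in> null_sets \<mu>" using True atom_borel radon_sets[OF \<mu>] by (auto simp: null_sets_def)
  then have "AE z in \<mu>. indicator (atom x) z * f z = 0"
    by (rule eventually_mono[OF AE_not_in]) simp
  then have "atom_int \<mu> f x = 0" unfolding atom_int_def by (rule integral_eq_zero_AE)
  then show ?thesis using True by simp
qed (simp add: atom_avg_def)

text \<open>Local integrability, required on dyadic cubes only.\<close>

definition loc_int :: "(real ^ 'n) measure \<Rightarrow> (real ^ 'n \<Rightarrow> real) \<Rightarrow> bool" where
  "loc_int \<mu> f \<longleftrightarrow> f \<in> borel_measurable borel \<and> (\<forall>k. \<forall>Q\<in>D k. integrable \<mu> (\<lambda>z. indicator Q z * f z))"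

lemma Lp_loc_int:
  assumes "radon_measure \<mu>" "f \<in> Lp \<mu> p" "1 < p"
  shows "loc_int \<mu> f"
  unfolding loc_int_def
  using LpD(1)[OF assms(2)] radon_measurable_iff[OF assms(1)] Lp_integrable[OF assms(2,3)] D_borel radon_sets[OF assms(1)]
    radon_cube_finite[OF assms(1)] by blast

lemma loc_int_atom: "loc_int \<mu> f \<Longrightarrow> integrable \<mu> (\<lambda>z. indicator (atom x) z * f z)"
  unfolding loc_int_def atom_def using cube_in by blast

lemma atom_int_add: "loc_int \<mu> f \<Longrightarrow> loc_int \<mu> g \<Longrightarrow> atom_int \<mu> (\<lambda>z. f z + g z) x = atom_int \<mu> f x + atom_int \<mu> g x"
  unfolding atom_int_def distrib_left
  by (rule Bochner_Integration.integral_add) (auto dest: loc_int_atom)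

lemma atom_int_scale: "atom_int \<mu> (\<lambda>z. c * f z) x = c * atom_int \<mu> f x"
proof -
  have "atom_int \<mu> (\<lambda>z. c * f z) x = (\<integral>z. c * (indicator (atom x) z * f z) \<partial>\<mu>)"
    unfolding atom_int_def by (intro Bochner_Integration.integral_cong) auto
  then show ?thesis by (simp add: atom_int_def)
qed

lemma atom_int_cong_AE:
  assumes "radon_measure \<mu>" "loc_int \<mu> f" "loc_int \<mu> g" "AE z in \<mu>. f z = g z"
  shows "atom_int \<mu> f x = atom_int \<mu> g x"
  unfolding atom_int_def
proof (rule integral_cong_AE)
  have "(\<lambda>z. indicator (atom x) z * h z) \<in> borel_measurable borel" if "h \<in> borel_measurable borel" for h :: "real ^ 'n \<Rightarrow> real"
    using that atom_borel by measurable
  then show "(\<lambda>z. indicator (atom x) z * f z) \<in> borel_measurable \<mu>" "(\<lambda>z. indicator (atom x) z * g z) \<in> borel_measurable \<mu>"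
    using assms by (auto simp: loc_int_def radon_measurable_iff)
  show "AE z in \<mu>. indicator (atom x) z * f z = indicator (atom x) z * g z"
    using assms(4) by (rule eventually_mono) simp
qed

lemma integral_atomic:
  assumes f: "loc_int \<mu> f" and g: "atomic g"
  shows "(\<integral>z. f z * g z \<partial>\<mu>) = (\<Sum>x\<in>X. g x * atom_int \<mu> f x)"
proof -
  have int: "integrable \<mu> (\<lambda>z. indicator (atom x) z * f z)" for x
    using f cube_in unfolding loc_int_def atom_def by blast
  have "f z * g z = (\<Sum>x\<in>X. g x * (indicator (atom x) z * f z))" for z
    by (subst atomic_sum[OF g]) (simp add: sum_distrib_left mult_ac)
  then have "(\<integral>z. f z * g z \<partial>\<mu>) = (\<integral>z. (\<Sum>x\<in>X. g x * (indicator (atom x) z * f z)) \<partial>\<mu>)" by simp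
  also have "\<dots> = (\<Sum>x\<in>X. g x * atom_int \<mu> f x)"
    unfolding atom_int_def using int by (subst Bochner_Integration.integral_sum) auto
  finally show ?thesis .
qed

text \<open>Averaging over atoms is a contraction for the vector valued norm; this is Jensen's inequality,
  used through the tangent \<open>|v|^p \<ge> p t^(p - 1) (v, e) - (p - 1) t^p\<close>, where \<open>t e\<close> is the average of
  the vectors \<open>v\<close> and \<open>e\<close> is a unit vector.\<close>

lemma Jensen_atom:
  assumes \<mu>: "radon_measure \<mu>" and p: "1 < p" and f: "\<And>u. u \<in> A \<Longrightarrow> loc_int \<mu> (f u)" and A: "finite A"
  shows "ennreal (wt \<mu> x * L2_set (\<lambda>u. atom_avg \<mu> (f u) x) A powr p)
     \<le> (\<integral>\<^sup>+z. indicator (atom x) z * ennreal (L2_set (\<lambda>u. f u z) A powr p) \<partial>\<mu>)"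
proof (cases "\<integral>\<^sup>+z. indicator (atom x) z * ennreal (L2_set (\<lambda>u. f u z) A powr p) \<partial>\<mu>")
  case top
  then show ?thesis by simp
next
  case (real I)
  define t where "t = L2_set (\<lambda>u. atom_avg \<mu> (f u) x) A"
  have tnn: "0 \<le> t" by (simp add: t_def)
  have fm [measurable]: "f u \<in> borel_measurable \<mu>" if "u \<in> A" for u
    using f[OF that] by (simp add: loc_int_def radon_measurable_iff[OF \<mu>])
  have at [measurable]: "atom x \<in> sets \<mu>" using atom_borel radon_sets[OF \<mu>] by simp
  show ?thesis
  proof (cases "t = 0")
    case True
    then show ?thesis by (simp add: t_def)
  next
    case False
    then have t: "0 < t" using tnn by simp
    define e where "e u = atom_avg \<mu> (f u) x / t" for u
    have L2e: "L2_set e A = 1"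
    proof -
      have "L2_set e A = L2_set (\<lambda>u. 1 / t * atom_avg \<mu> (f u) x) A" by (simp add: e_def[abs_def])
      then show ?thesis using t by (simp only: L2_set_scale) (simp add: t_def[symmetric])
    qed
    have int_f: "integrable \<mu> (\<lambda>z. indicator (atom x) z * f u z)" if "u \<in> A" for u
      using f[OF that] cube_in unfolding loc_int_def atom_def by blast
    have int_h: "integrable \<mu> (\<lambda>z. \<Sum>u\<in>A. e u * (indicator (atom x) z * f u z))"
      using int_f by (intro Bochner_Integration.integrable_sum integrable_mult_right) auto
    have h: "(\<integral>z. (\<Sum>u\<in>A. e u * (indicator (atom x) z * f u z)) \<partial>\<mu>) = wt \<mu> x * t"
    proof -
      have "(\<integral>z. (\<Sum>u\<in>A. e u * (indicator (atom x) z * f u z)) \<partial>\<mu>) = (\<Sum>u\<in>A. e u * atom_int \<mu> (f u) x)"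
        unfolding atom_int_def using int_f by (subst Bochner_Integration.integral_sum) auto
      also have "\<dots> = wt \<mu> x / t * (\<Sum>u\<in>A. (atom_avg \<mu> (f u) x)\<^sup>2)"
        by (simp add: atom_int_atom_avg[OF \<mu>] e_def sum_distrib_left power2_eq_square mult_ac)
      also have "\<dots> = wt \<mu> x / t * t\<^sup>2" by (simp add: t_def L2_set_power2)
      finally show ?thesis using t by (simp add: power2_eq_square)
    qed
    have "integrable \<mu> (\<lambda>z. indicator (atom x) z * L2_set (\<lambda>u. f u z) A powr p)"
      and I: "(\<integral>z. indicator (atom x) z * L2_set (\<lambda>u. f u z) A powr p \<partial>\<mu>) = I"
    proof -
      have m: "(\<lambda>z. indicator (atom x) z * L2_set (\<lambda>u. f u z) A powr p) \<in> borel_measurable \<mu>"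
        unfolding L2_set_def by measurable
      have nn: "(\<integral>\<^sup>+z. ennreal (indicator (atom x) z * L2_set (\<lambda>u. f u z) A powr p) \<partial>\<mu>) = ennreal I"
        using real by (simp add: ennreal_mult' ennreal_indicator)
      show "integrable \<mu> (\<lambda>z. indicator (atom x) z * L2_set (\<lambda>u. f u z) A powr p)"
        using m nn by (intro integrableI_nonneg) auto
      show "(\<integral>z. indicator (atom x) z * L2_set (\<lambda>u. f u z) A powr p \<partial>\<mu>) = I"
        using m nn real by (subst integral_eq_nn_integral) auto
    qed
    then have int_L: "integrable \<mu> (\<lambda>z. indicator (atom x) z * L2_set (\<lambda>u. f u z) A powr p)" by blast
    have int_1: "integrable \<mu> (\<lambda>z. indicator (atom x) z :: real)"
      using radon_cube_finite[OF \<mu> cube_in, of "k0 + int M" x] by (simp add: atom_def[symmetric])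
    have "p * t powr (p - 1) * (wt \<mu> x * t) = (\<integral>z. p * t powr (p - 1) * (\<Sum>u\<in>A. e u * (indicator (atom x) z * f u z)) \<partial>\<mu>)"
      using int_h by (simp add: h)
    also have "\<dots> \<le> (\<integral>z. indicator (atom x) z * L2_set (\<lambda>u. f u z) A powr p + (p - 1) * t powr p * indicator (atom x) z \<partial>\<mu>)"
    proof (rule integral_mono)
      fix z
      show "p * t powr (p - 1) * (\<Sum>u\<in>A. e u * (indicator (atom x) z * f u z))
          \<le> indicator (atom x) z * L2_set (\<lambda>u. f u z) A powr p + (p - 1) * t powr p * indicator (atom x) z"
      proof (cases "z \<in> atom x")
        case True
        let ?L = "L2_set (\<lambda>u. f u z) A"
        have "(\<Sum>u\<in>A. e u * f u z) \<le> L2_set e A * ?L" by (rule L2_set_Cauchy_Schwarz)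
        then have "p * t powr (p - 1) * (\<Sum>u\<in>A. e u * f u z) \<le> p * t powr (p - 1) * ?L"
          using p L2e by (intro mult_left_mono) auto
        also have "\<dots> = p * (1 * (?L * t powr (p - 1)))" by simp
        also have "\<dots> \<le> p * ((1 * ?L) powr p / p + (1 - 1/p) * t powr p)"
          using p tnn by (intro mult_left_mono Young_absorb) auto
        also have "\<dots> = ?L powr p + (p - 1) * t powr p" using p by (simp add: field_simps)
        finally show ?thesis using True by simp
      qed simp
    qed (use int_h int_L int_1 in auto)
    also have "\<dots> = I + (p - 1) * t powr p * wt \<mu> x"
      using int_L int_1 at by (simp add: I wt_def)
    finally have "wt \<mu> x * t powr p \<le> I"
    proof -
      assume le: "p * t powr (p - 1) * (wt \<mu> x * t) \<le> I + (p - 1) * t powr p * wt \<mu> x"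
      have e: "t powr (p - 1) * t = t powr p" using powr_mult_base[of t "p - 1"] t by (simp add: mult.commute)
      have "p * t powr (p - 1) * (wt \<mu> x * t) = p * (wt \<mu> x * (t powr (p - 1) * t))" by (simp only: mult_ac)
      also have "\<dots> = p * (wt \<mu> x * t powr p)" by (simp only: e)
      finally have "p * (wt \<mu> x * t powr p) \<le> I + (p - 1) * t powr p * wt \<mu> x" using le by (simp only:)
      then show ?thesis by (simp add: algebra_simps)
    qed
    then show ?thesis using real by (simp add: t_def ennreal_leI)
  qed
qed

lemma wnorm_atom_avg_le:
  assumes \<mu>: "radon_measure \<mu>" and p: "1 < p" and A: "finite A" and f: "\<And>u. u \<in> A \<Longrightarrow> f u \<in> Lp \<mu> p"
  shows "ennreal (wnorm X (wt \<mu>) p (\<lambda>x. L2_set (\<lambda>u. atom_avg \<mu> (f u) x) A)) \<le> Lp_norm \<mu> p (\<lambda>z. sqrt (\<Sum>u\<in>A. (f u z)\<^sup>2))"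
proof -
  have fm [measurable]: "f u \<in> borel_measurable \<mu>" if "u \<in> A" for u using LpD(1)[OF f[OF that]] .
  have at [measurable]: "atom x \<in> sets \<mu>" for x using atom_borel radon_sets[OF \<mu>] by simp
  have nn: "0 \<le> wt \<mu> x" for x by (simp add: wt_def)
  have "ennreal (\<Sum>x\<in>X. wt \<mu> x * L2_set (\<lambda>u. atom_avg \<mu> (f u) x) A powr p)
      = (\<Sum>x\<in>X. ennreal (wt \<mu> x * L2_set (\<lambda>u. atom_avg \<mu> (f u) x) A powr p))"
    using nn by (intro sum_ennreal[symmetric]) auto
  also have "\<dots> \<le> (\<Sum>x\<in>X. \<integral>\<^sup>+z. indicator (atom x) z * ennreal (L2_set (\<lambda>u. f u z) A powr p) \<partial>\<mu>)"
    using \<mu> p A f by (intro sum_mono Jensen_atom) (auto intro: Lp_loc_int)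
  also have "\<dots> = (\<integral>\<^sup>+z. (\<Sum>x\<in>X. indicator (atom x) z * ennreal (L2_set (\<lambda>u. f u z) A powr p)) \<partial>\<mu>)"
    unfolding L2_set_def by (rule nn_integral_sum[symmetric]) measurable
  also have "\<dots> \<le> (\<integral>\<^sup>+z. ennreal (\<bar>sqrt (\<Sum>u\<in>A. (f u z)\<^sup>2)\<bar> powr p) \<partial>\<mu>)"
  proof (rule nn_integral_mono)
    fix z
    have "(\<Sum>x\<in>X. indicator (atom x) z * ennreal (L2_set (\<lambda>u. f u z) A powr p)) \<le> ennreal (L2_set (\<lambda>u. f u z) A powr p)"
    proof (cases "z \<in> region")
      case True
      then obtain x where "x \<in> X" "z \<in> atom x" using region_atom by blast
      then show ?thesis using sum_atoms_indicator[of x z "\<lambda>_. ennreal (L2_set (\<lambda>u. f u z) A powr p)"] by simp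
    next
      case False
      then have "(\<Sum>x\<in>X. indicator (atom x) z * ennreal (L2_set (\<lambda>u. f u z) A powr p)) = 0"
        using atom_region by (intro sum.neutral) (auto simp: indicator_def)
      then show ?thesis by simp
    qed
    then show "(\<Sum>x\<in>X. indicator (atom x) z * ennreal (L2_set (\<lambda>u. f u z) A powr p)) \<le> ennreal (\<bar>sqrt (\<Sum>u\<in>A. (f u z)\<^sup>2)\<bar> powr p)"
      by (simp add: L2_set_def sum_nonneg)
  qed
  finally have "epowr (ennreal (\<Sum>x\<in>X. wt \<mu> x * L2_set (\<lambda>u. atom_avg \<mu> (f u) x) A powr p)) (1/p) \<le> Lp_norm \<mu> p (\<lambda>z. sqrt (\<Sum>u\<in>A. (f u z)\<^sup>2))"
    unfolding Lp_norm_alt using p by (intro epowr_mono) auto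
  then show ?thesis using nn by (simp add: epowr_ennreal wnorm_def sum_nonneg)
qed

subsection \<open>Shifts on atoms\<close>

definition active :: "'n dyadic_shift \<Rightarrow> (real ^ 'n) set \<Rightarrow> bool" where
  "active S K \<longleftrightarrow> K \<in> cubes D \<and> (\<exists>(I, J)\<in>shift_pairs D S K. sh_coeff S I J K \<noteq> 0)"

text \<open>
  All cubes that carry a coefficient of the shift lie in the region. They are at least \<open>\<kappa> + 1\<close> generations
  coarser than the atoms, so the Haar functions that belong to them are constant on atoms.
\<close>

definition resolved :: "nat \<Rightarrow> 'n dyadic_shift \<Rightarrow> bool" where
  "resolved \<kappa> S \<longleftrightarrow> is_dyadic_shift D S \<and> complexity S \<le> \<kappa> \<and>
     (\<forall>K. active S K \<longrightarrow> (\<exists>i z. i + \<kappa> + 1 \<le> M \<and> K = cube (k0 + int i) z \<and> z \<in> region))"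

definition ker :: "'n dyadic_shift \<Rightarrow> nat \<Rightarrow> real ^ 'n \<Rightarrow> real ^ 'n \<Rightarrow> real" where
  "ker S j x y = kern S (cube (k0 + int j) x) x y"

lemma kern_inactive: "K \<in> cubes D \<Longrightarrow> \<not> active S K \<Longrightarrow> kern S K x y = 0"
  unfolding kern_def active_def by (intro sum.neutral) auto

lemma resolved_level:
  assumes "resolved \<kappa> S" "active S (cube (k0 + int j) z)"
  shows "j + \<kappa> + 1 \<le> M" "z \<in> region"
proof -
  obtain i z' where i: "i + \<kappa> + 1 \<le> M" "cube (k0 + int j) z = cube (k0 + int i) z'" "z' \<in> region"
    using assms unfolding resolved_def by metis
  have "k0 + int j = k0 + int i" using D_level_unique cube_in i(2) by metis
  then have ij: "i = j" by simp
  then show "j + \<kappa> + 1 \<le> M" using i by simp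
  have "cube k0 z = cube k0 z'" using i ij by (intro cube_eq_mono[of "k0 + int j" z z' k0]) auto
  then show "z \<in> region" using i by (simp add: region_def)
qed

lemma ker_const_out:
  assumes S: "is_dyadic_shift D S" "complexity S \<le> \<kappa>" and eq: "cube (k0 + int (j + (\<kappa> + 1))) x' = cube (k0 + int (j + (\<kappa> + 1))) x"
  shows "ker S j x' y = ker S j x y"
proof -
  have 1: "cube (k0 + int j) x' = cube (k0 + int j) x" using eq by (rule cube_eq_mono) simp
  have 2: "cube (k0 + int j + int (sh_n S) + 1) x' = cube (k0 + int j + int (sh_n S) + 1) x"
    using eq by (rule cube_eq_mono) (use S(2) in \<open>simp add: complexity_def\<close>)
  show ?thesis unfolding ker_def 1 using kern_const_out[OF S(1) cube_in 2] .
qed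

lemma ker_const_in:
  assumes S: "is_dyadic_shift D S" "complexity S \<le> \<kappa>" and eq: "cube (k0 + int (j + (\<kappa> + 1))) y' = cube (k0 + int (j + (\<kappa> + 1))) y"
  shows "ker S j x y' = ker S j x y"
proof -
  have 2: "cube (k0 + int j + int (sh_m S) + 1) y' = cube (k0 + int j + int (sh_m S) + 1) y"
    using eq by (rule cube_eq_mono) (use S(2) in \<open>simp add: complexity_def\<close>)
  show ?thesis unfolding ker_def using kern_const_in[OF S(1) cube_in 2] .
qed

lemma ker_atom_out:
  assumes S: "resolved \<kappa> S" and z: "z \<in> atom x" and j: "j < M"
  shows "ker S j z y = ker S j x y"
proof (cases "active S (cube (k0 + int j) x)")
  case True
  then have "j + (\<kappa> + 1) \<le> M" using resolved_level[OF S] by simp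
  then have eq: "cube (k0 + int (j + (\<kappa> + 1))) z = cube (k0 + int (j + (\<kappa> + 1))) x" by (rule atom_eqD[OF z])
  have "is_dyadic_shift D S" "complexity S \<le> \<kappa>" using S by (auto simp: resolved_def)
  from this eq show ?thesis by (rule ker_const_out)
next
  case False
  have 1: "cube (k0 + int j) z = cube (k0 + int j) x" using atom_eqD[OF z] j by simp
  have "cube (k0 + int j) x \<in> cubes D" using cube_in by (auto simp: cubes_def)
  then show ?thesis using kern_inactive False by (simp add: ker_def 1)
qed

lemma ker_atomic_in:
  assumes S: "resolved \<kappa> S" and z: "z \<in> region"
  shows "atomic (\<lambda>y. ker S j z y)"
proof (cases "active S (cube (k0 + int j) z)")
  case True
  have S': "is_dyadic_shift D S" using S by (simp add: resolved_def)
  have jM: "j + (\<kappa> + 1) \<le> M" using resolved_level[OF S True] by simp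
  show ?thesis unfolding atomic_def
  proof (intro conjI ballI allI impI)
    fix x y assume "x \<in> X" and y: "y \<in> atom x"
    have eq: "cube (k0 + int (j + (\<kappa> + 1))) y = cube (k0 + int (j + (\<kappa> + 1))) x" using y jM by (rule atom_eqD)
    have "is_dyadic_shift D S" "complexity S \<le> \<kappa>" using S by (auto simp: resolved_def)
    from this eq show "ker S j z y = ker S j z x" by (rule ker_const_in)
  next
    fix y assume "y \<notin> region"
    then have "y \<notin> cube (k0 + int j) z" using z cube_eq_mono[of "k0 + int j" y z k0] cube_eq by (auto simp: region_def)
    then show "ker S j z y = 0" unfolding ker_def using kern_zero[OF S' cube_in] by blast
  qed
next
  case False
  have "cube (k0 + int j) z \<in> cubes D" using cube_in by (auto simp: cubes_def)
  then have "ker S j z y = 0" for y using kern_inactive False by (simp add: ker_def)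
  then show ?thesis by (simp add: atomic_def)
qed

lemma shift_op_kern:
  assumes S: "is_dyadic_shift D S" and f: "loc_int \<mu> f" and \<mu>: "radon_measure \<mu>" and K: "K \<in> D k"
  shows "(\<Sum>(I, J)\<in>shift_pairs D S K. sh_coeff S I J K * (\<integral>y. f y * sh_in S I J y \<partial>\<mu>) * sh_out S I J x)
     = (\<integral>y. f y * kern S K x y \<partial>\<mu>)"
proof -
  have int: "integrable \<mu> (\<lambda>y. f y * sh_in S I J y)" if IJ: "(I, J) \<in> shift_pairs D S K" for I J
  proof -
    note D = shift_pairD[OF S K IJ] and H = haar_in_out[OF S K IJ]
    have "integrable \<mu> (\<lambda>y. indicator I y * f y)" using f D(4) unfolding loc_int_def by blast
    then have "integrable \<mu> (\<lambda>y. (1 / sqrt (vol I)) * (indicator I y * f y))" by simp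
    then show ?thesis
    proof (rule Bochner_Integration.integrable_bound)
      show "(\<lambda>y. f y * sh_in S I J y) \<in> borel_measurable \<mu>"
        using f H(3) unfolding loc_int_def radon_measurable_iff[OF \<mu>] by auto
      show "AE y in \<mu>. norm (f y * sh_in S I J y) \<le> norm (1 / sqrt (vol I) * (indicator I y * f y))"
      proof (rule AE_I2)
        fix y
        have "\<bar>f y\<bar> * \<bar>sh_in S I J y\<bar> \<le> \<bar>f y\<bar> * (indicator I y / sqrt (vol I))" using H(1) by (intro mult_left_mono) auto
        then show "norm (f y * sh_in S I J y) \<le> norm (1 / sqrt (vol I) * (indicator I y * f y))"
          by (simp add: abs_mult mult_ac)
      qed
    qed
  qed
  have "(\<integral>y. f y * kern S K x y \<partial>\<mu>) = (\<integral>y. (\<Sum>P\<in>shift_pairs D S K. (sh_coeff S (fst P) (snd P) K * sh_out S (fst P) (snd P) x) * (f y * sh_in S (fst P) (snd P) y)) \<partial>\<mu>)"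
    by (simp add: kern_def split_def sum_distrib_left mult_ac)
  also have "\<dots> = (\<Sum>P\<in>shift_pairs D S K. (sh_coeff S (fst P) (snd P) K * sh_out S (fst P) (snd P) x) * (\<integral>y. f y * sh_in S (fst P) (snd P) y \<partial>\<mu>))"
    using int by (subst Bochner_Integration.integral_sum) auto
  finally show ?thesis by (simp add: split_def mult_ac)
qed

text \<open>
  A resolved shift is a matrix on the atoms. The infinite sum over all cubes reduces to the active cubes
  that contain \<open>z\<close>, at most one in each generation \<open>k0 + j\<close> with \<open>j < M\<close>.
\<close>

lemma shift_op_atoms:
  assumes S: "resolved \<kappa> S" and f: "loc_int \<mu> f" and \<mu>: "radon_measure \<mu>"
  shows "shift_op D \<mu> S f z = (if z \<in> region then \<Sum>y\<in>X. (\<Sum>j<M. ker S j z y) * atom_int \<mu> f y else 0)"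
proof -
  have S': "is_dyadic_shift D S" using S by (simp add: resolved_def)
  define G where "G K = (\<integral>y. f y * kern S K z y \<partial>\<mu>)" for K
  have op: "shift_op D \<mu> S f z = (\<Sum>\<^sub>\<infinity>K\<in>cubes D. G K)"
    unfolding shift_op_def G_def
  proof (rule infsum_cong)
    fix K assume "K \<in> cubes D"
    then obtain k where "K \<in> D k" unfolding cubes_def by blast
    then show "(\<Sum>(I, J)\<in>shift_pairs D S K. sh_coeff S I J K * (\<integral>y. f y * sh_in S I J y \<partial>\<mu>) * sh_out S I J z)
        = (\<integral>y. f y * kern S K z y \<partial>\<mu>)" using shift_op_kern[OF S' f \<mu>] by blast
  qed
  have G0: "G K = 0" if K: "K \<in> cubes D" and inactive: "\<not> (active S K \<and> z \<in> K)" for K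
  proof -
    obtain k where "K \<in> D k" using K unfolding cubes_def by blast
    then have "kern S K z y = 0" for y
      using K inactive kern_inactive[of K S z y] kern_zero[OF S', of K k z y] by blast
    then show ?thesis by (simp add: G_def)
  qed
  let ?B = "(\<lambda>j. cube (k0 + int j) z) ` {..<M}"
  have supp: "z \<in> region \<and> K \<in> ?B" if act: "active S K" and zK: "z \<in> K" for K
  proof -
    obtain i z' where i: "i + \<kappa> + 1 \<le> M" "K = cube (k0 + int i) z'" "z' \<in> region"
      using S act unfolding resolved_def by metis
    have K: "K = cube (k0 + int i) z" using zK unfolding i(2) by (rule cube_eq[symmetric])
    have "z \<in> region" using S act unfolding K by (rule resolved_level(2))
    moreover have "K \<in> ?B" unfolding K using i(1) by (intro imageI) simp
    ultimately show ?thesis by simp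
  qed
  show ?thesis
  proof (cases "z \<in> region")
    case False
    then have "G K = 0" if "K \<in> cubes D" for K using G0[OF that] supp by blast
    then show ?thesis using False by (simp add: op infsum_0)
  next
    case True
    have "(\<Sum>\<^sub>\<infinity>K\<in>cubes D. G K) = (\<Sum>\<^sub>\<infinity>K\<in>?B. G K)"
    proof (rule infsum_cong_neutral)
      fix K assume "K \<in> cubes D - ?B"
      then show "G K = 0" using G0[of K] supp[of K] by blast
    next
      fix K assume "K \<in> ?B - cubes D"
      then show "G K = 0" using cube_in by (auto simp: cubes_def)
    qed simp
    also have "\<dots> = (\<Sum>K\<in>?B. G K)" by simp
    also have "\<dots> = (\<Sum>j<M. G (cube (k0 + int j) z))"
    proof (rule sum.reindex[unfolded o_def])
      show "inj_on (\<lambda>j. cube (k0 + int j) z) {..<M}"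
      proof (rule inj_onI)
        fix i j assume "cube (k0 + int i) z = cube (k0 + int j) z"
        then have "k0 + int i = k0 + int j" using D_level_unique cube_in by metis
        then show "i = j" by simp
      qed
    qed
    also have "\<dots> = (\<Sum>j<M. \<Sum>y\<in>X. ker S j z y * atom_int \<mu> f y)"
      unfolding G_def using integral_atomic[OF f ker_atomic_in[OF S True]] by (simp add: ker_def)
    also have "\<dots> = (\<Sum>y\<in>X. (\<Sum>j<M. ker S j z y) * atom_int \<mu> f y)"
      by (subst sum.swap) (simp add: sum_distrib_right)
    finally show ?thesis using True op by simp
  qed
qed

lemma shift_op_atomic:
  assumes S: "resolved \<kappa> S" and f: "loc_int \<mu> f" and \<mu>: "radon_measure \<mu>"
  shows "atomic (shift_op D \<mu> S f)"
  unfolding atomic_def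
proof (intro conjI ballI allI impI)
  fix x z assume x: "x \<in> X" and z: "z \<in> atom x"
  show "shift_op D \<mu> S f z = shift_op D \<mu> S f x"
    using atom_region[OF x z] X_region[OF x] ker_atom_out[OF S z] by (simp add: shift_op_atoms[OF S f \<mu>])
qed (simp add: shift_op_atoms[OF S f \<mu>])

lemma shift_op_atom_avg:
  assumes S: "resolved \<kappa> S" and f: "loc_int \<mu> f" and \<mu>: "radon_measure \<mu>" and x: "x \<in> X"
  shows "shift_op D \<mu> S f x = (\<Sum>y\<in>X. wt \<mu> y * (\<Sum>j<M. ker S j x y) * atom_avg \<mu> f y)"
  using X_region[OF x] by (simp add: shift_op_atoms[OF S f \<mu>] atom_int_atom_avg[OF \<mu>] mult_ac)

lemma atomic_L2:
  assumes "\<And>u. u \<in> A \<Longrightarrow> atomic (f u :: real ^ 'n \<Rightarrow> real)"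
  shows "atomic (\<lambda>z. L2_set (\<lambda>u. f u z) A)"
  unfolding atomic_def
proof (intro conjI ballI allI impI)
  fix x z assume "x \<in> X" "z \<in> atom x"
  then show "L2_set (\<lambda>u. f u z) A = L2_set (\<lambda>u. f u x) A"
    using assms by (intro L2_set_cong) (auto simp: atomic_def)
next
  fix z assume "z \<notin> region"
  then show "L2_set (\<lambda>u. f u z) A = 0" using assms by (intro L2_set_0') (auto simp: atomic_def)
qed

text \<open>
  Resolved shifts of complexity at most \<open>\<kappa>\<close> are instances of the discrete model with \<open>s = \<kappa> + 1\<close>: the
  children of the cubes \<open>I\<close> and \<open>J\<close> on which the Haar functions are constant lie at most \<open>\<kappa> + 1\<close> generations
  below \<open>K\<close>.
\<close>

lemma kernels_on_atoms:
  assumes U: "finite U" and S: "\<And>u. u \<in> U \<Longrightarrow> resolved \<kappa> (S u)"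
  shows "shift_kernels X cell M (wt \<sigma>) (wt w) (\<lambda>j. (2 powi (- (k0 + int j))) ^ CARD('n)) (\<kappa> + 1) U (\<lambda>u. ker (S u))"
proof -
  interpret S: weighted_filtration X cell M "wt \<sigma>" by (rule weighted_cells)
  interpret W: weighted_filtration X cell M "wt w" by (rule weighted_cells)
  show ?thesis
  proof
    fix j
    have "(2 powi (- (k0 + int (Suc j)))) ^ CARD('n) = (2 powi (- (k0 + int j)) / 2 :: real) ^ CARD('n)"
      by (simp add: power_int_diff power_int_minus power_int_add field_simps)
    also have "\<dots> = (2 powi (- (k0 + int j))) ^ CARD('n) / 2 ^ CARD('n)" by (simp add: power_divide)
    also have "\<dots> \<le> (2 powi (- (k0 + int j))) ^ CARD('n) / 2"
    proof (rule divide_left_mono)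
      have "(2::real) ^ 1 \<le> 2 ^ CARD('n)" by (rule power_increasing) (auto simp: Suc_leI)
      then show "(2::real) \<le> 2 ^ CARD('n)" by simp
    qed auto
    finally show "2 * (2 powi (- (k0 + int (Suc j)))) ^ CARD('n) \<le> ((2 powi (- (k0 + int j))) ^ CARD('n) :: real)" by simp
  next
    fix u j x y assume u: "u \<in> U" and "x \<in> X" "y \<in> X"
    have S': "is_dyadic_shift D (S u)" using S[OF u] by (simp add: resolved_def)
    have "\<bar>ker (S u) j x y\<bar> \<le> indicator (cube (k0 + int j) x) x * indicator (cube (k0 + int j) x) y / vol (cube (k0 + int j) x)"
      unfolding ker_def by (rule kern_abs_le[OF S' cube_in])
    also have "\<dots> \<le> 1 / vol (cube (k0 + int j) x)"
      using D_vol_pos[OF cube_in, of "k0 + int j" x] by (intro divide_right_mono) (auto simp: indicator_def)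
    finally show "\<bar>ker (S u) j x y\<bar> \<le> 1 / (2 powi (- (k0 + int j))) ^ CARD('n)" by (simp only: D_vol[OF cube_in])
    assume "y \<notin> cell j x"
    then have "y \<notin> cube (k0 + int j) x" using \<open>y \<in> X\<close> cube_eq by (auto simp: cell_def)
    then show "ker (S u) j x y = 0" unfolding ker_def using kern_zero[OF S' cube_in] by blast
  next
    fix u j y assume u: "u \<in> U" "y \<in> X"
    have S': "is_dyadic_shift D (S u)" "complexity (S u) \<le> \<kappa>" using S[OF u(1)] by (auto simp: resolved_def)
    show "S.adapted (j + (\<kappa> + 1)) (\<lambda>x. ker (S u) j x y)"
      by (rule S.adaptedI, rule ker_const_out[OF S']) (simp add: cell_def)
    show "S.adapted (j + (\<kappa> + 1)) (\<lambda>z. ker (S u) j y z)"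
      by (rule S.adaptedI, rule ker_const_in[OF S']) (simp add: cell_def)
  qed (use U in auto)
qed

lemma ker_swap:
  assumes "is_dyadic_shift D S"
  shows "ker (swap_shift S) j x y = ker S j y x"
proof (cases "cube (k0 + int j) x = cube (k0 + int j) y")
  case True
  then show ?thesis by (simp add: ker_def kern_swap)
next
  case False
  then have "y \<notin> cube (k0 + int j) x" "x \<notin> cube (k0 + int j) y" using cube_eq by metis+
  then show ?thesis using kern_zero[OF assms cube_in] by (simp add: ker_def kern_swap)
qed

lemma resolved_swap:
  assumes "resolved \<kappa> S"
  shows "resolved \<kappa> (swap_shift S)"
proof -
  have "active (swap_shift S) K \<longleftrightarrow> active S K" for K
    unfolding active_def shift_pairs_swap by (auto simp: split_def)
  then show ?thesis using assms is_dyadic_shift_swap unfolding resolved_def by auto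
qed

end

text \<open>
  Take \<open>k0\<close> to be the coarsest generation in the given finite collection, and place the atoms \<open>d + 1\<close>
  generations below the finest one. The point \<open>0\<close> is inserted in the set of generations only to make its minimum and maximum
  meaningful for an empty collection.
\<close>

lemma (in lattice) atoms_exist:
  assumes Q: "finite \<Q>" "\<Q> \<subseteq> cubes D"
  shows "\<exists>k0 M Tops X. atoms D k0 M Tops X \<and>
     (\<forall>Q\<in>\<Q>. \<exists>i z. i + d + 1 \<le> M \<and> Q = cube (k0 + int i) z \<and> cube k0 z \<in> Tops)"
proof -
  have "\<forall>Q\<in>\<Q>. \<exists>k. Q \<in> D k" using Q(2) unfolding cubes_def by blast
  then obtain lv where lv: "\<And>Q. Q \<in> \<Q> \<Longrightarrow> Q \<in> D (lv Q)" by metis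
  have "\<forall>Q. \<exists>z. (\<exists>k. Q \<in> D k) \<longrightarrow> z \<in> Q" using D_nonempty by blast
  then obtain pt where pt: "\<And>Q k. Q \<in> D k \<Longrightarrow> pt Q \<in> Q" by metis
  define k0 where "k0 = Min (insert 0 (lv ` \<Q>))"
  define k1 where "k1 = Max (insert 0 (lv ` \<Q>))"
  define M where "M = nat (k1 - k0) + d + 1"
  define Tops where "Tops = (\<lambda>Q. cube k0 (pt Q)) ` \<Q>"
  define At where "At = (\<Union>T\<in>Tops. {A \<in> D (k0 + int M). A \<subseteq> T})"
  define X where "X = pt ` At"
  have k: "k0 \<le> lv Q" "lv Q \<le> k1" if "Q \<in> \<Q>" for Q
    using that Q(1) by (auto simp: k0_def k1_def)
  have TD: "T \<in> D k0" if "T \<in> Tops" for T using that cube_in by (auto simp: Tops_def)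
  have At: "cube (k0 + int M) (pt A) = A \<and> cube k0 (pt A) \<in> Tops" if "A \<in> At" for A
  proof -
    obtain T where T: "T \<in> Tops" "A \<in> D (k0 + int M)" "A \<subseteq> T" using \<open>A \<in> At\<close> unfolding At_def by blast
    have "pt A \<in> A" using pt T by blast
    then have "cube (k0 + int M) (pt A) = A" "cube k0 (pt A) = T"
      using T TD[OF T(1)] cube_eqI by blast+
    then show ?thesis using T by simp
  qed
  have "atoms D k0 M Tops X"
  proof
    show "finite X"
      unfolding X_def At_def using Q(1) descendants_finite[OF TD] by (intro finite_imageI finite_UN_I) (auto simp: Tops_def)
    show "x = y" if "x \<in> X" "y \<in> X" "cube (k0 + int M) x = cube (k0 + int M) y" for x y
      using that At unfolding X_def by (metis imageE)
    show "cube k0 x \<in> Tops" if "x \<in> X" for x using that At unfolding X_def by blast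
    show "\<exists>x\<in>X. cube (k0 + int M) z = cube (k0 + int M) x" if z: "cube k0 z \<in> Tops" for z
    proof -
      have "cube (k0 + int M) z \<subseteq> cube k0 z" by (rule cube_mono) simp
      then have "cube (k0 + int M) z \<in> At" using z cube_in unfolding At_def by blast
      then show ?thesis using At unfolding X_def by (metis image_eqI)
    qed
  qed
  moreover have "\<exists>i z. i + d + 1 \<le> M \<and> Q = cube (k0 + int i) z \<and> cube k0 z \<in> Tops" if Q: "Q \<in> \<Q>" for Q
  proof (intro exI conjI)
    show "nat (lv Q - k0) + d + 1 \<le> M" using k[OF Q] by (simp add: M_def nat_mono)
    have "k0 + int (nat (lv Q - k0)) = lv Q" using k[OF Q] by simp
    then show "Q = cube (k0 + int (nat (lv Q - k0))) (pt Q)" using cube_eqI[OF lv[OF Q] pt[OF lv[OF Q]]] by simp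
    show "cube k0 (pt Q) \<in> Tops" using Q by (simp add: Tops_def)
  qed
  ultimately show ?thesis by blast
qed

section \<open>The two conditions on atoms\<close>

lemma quadratic_testingD:
  fixes a :: "nat \<Rightarrow> real"
  assumes "quadratic_testing D \<mu> r \<nu> s op \<S> C" "1 \<le> n" "\<forall>u\<in>{1..n}. S u \<in> \<S> \<and> Q u \<in> cubes D"
  shows "Lp_norm \<nu> s (\<lambda>x. sqrt (\<Sum>u=1..n. (a u * indicator (Q u) x * op (S u) (indicator (Q u)) x)\<^sup>2))
        \<le> C * Lp_norm \<mu> r (\<lambda>x. sqrt (\<Sum>u=1..n. (a u)\<^sup>2 * indicator (Q u) x))"
proof -
  have "\<forall>a S Q. (\<forall>u\<in>{1..n}. S u \<in> \<S> \<and> Q u \<in> cubes D) \<longrightarrow>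
      Lp_norm \<nu> s (\<lambda>x. sqrt (\<Sum>u=1..n. (a u * indicator (Q u) x * op (S u) (indicator (Q u)) x)\<^sup>2))
        \<le> C * Lp_norm \<mu> r (\<lambda>x. sqrt (\<Sum>u=1..n. (a u)\<^sup>2 * indicator (Q u) x))"
    using assms(1)[unfolded quadratic_testing_def, THEN spec, THEN mp, OF assms(2)] .
  from this[THEN spec[where x = a], THEN spec[where x = S], THEN spec[where x = Q], THEN mp, OF assms(3)]
  show ?thesis .
qed

text \<open>
  A best constant is attained, provided that the right-hand side is finite: for \<open>y = \<infinity>\<close> and
  \<open>Inf S = 0\<close> the product would be \<open>0\<close>.
\<close>

lemma le_Inf_mult_ennreal:
  fixes x y :: ennreal
  assumes "S \<noteq> {}" and le: "\<And>C. C \<in> S \<Longrightarrow> x \<le> C * y" and y: "y < top"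
  shows "x \<le> Inf S * y"
proof (cases "y = 0")
  case True
  then show ?thesis using assms by fastforce
next
  case False
  have "x / y \<le> C" if "C \<in> S" for C
    using divide_right_mono_ennreal[OF le[OF that], of y] mult_divide_eq_ennreal[of y C] False y by simp
  then have "x / y \<le> Inf S" by (intro Inf_greatest)
  then have "x / y * y \<le> Inf S * y" by (rule mult_right_mono) simp
  then show ?thesis using False y by (simp add: ennreal_divide_times ennreal_times_divide mult_divide_eq_ennreal)
qed

context atoms
begin

lemma cell_iff: "y \<in> X \<Longrightarrow> y \<in> cell k x \<longleftrightarrow> y \<in> cube (k0 + int k) x"
  by (simp add: cell_def cube_eq_iff)

lemma indicator_cube_atomic:
  assumes "i \<le> M" "z0 \<in> region"
  shows "atomic (\<lambda>z. indicator (cube (k0 + int i) z0) z :: real)"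
  unfolding atomic_def
proof (intro conjI ballI allI impI)
  fix x z assume "x \<in> X" "z \<in> atom x"
  then have "cube (k0 + int i) z = cube (k0 + int i) x" using assms by (intro atom_eqD)
  then have "z \<in> cube (k0 + int i) z0 \<longleftrightarrow> x \<in> cube (k0 + int i) z0" by (simp add: cube_eq_iff[symmetric])
  then show "indicator (cube (k0 + int i) z0) z = (indicator (cube (k0 + int i) z0) x :: real)"
    by (simp add: indicator_def)
next
  fix z assume "z \<notin> region"
  then have "z \<notin> cube (k0 + int i) z0"
    using assms cube_eq_mono[of "k0 + int i" z z0 k0] by (auto simp: region_def cube_eq_iff[symmetric])
  then show "indicator (cube (k0 + int i) z0) z = (0::real)" by simp
qed

lemma atomic_mult: "atomic f \<Longrightarrow> atomic g \<Longrightarrow> atomic (\<lambda>z. f z * g z :: real)"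
  by (auto simp: atomic_def)

lemma atomic_scale: "atomic f \<Longrightarrow> atomic (\<lambda>z. c * f z :: real)"
  by (auto simp: atomic_def)

lemma loc_int_indicator:
  assumes \<mu>: "radon_measure \<mu>" and Q: "Q \<in> D k"
  shows "loc_int \<mu> (indicator Q)"
  unfolding loc_int_def
proof (intro conjI allI ballI)
  show "indicator Q \<in> borel_measurable borel" using D_borel[OF Q] by simp
  fix k' R assume R: "R \<in> D k'"
  have "integrable \<mu> (indicator R :: _ \<Rightarrow> real)" using radon_cube_finite[OF \<mu> R] D_borel[OF R] radon_sets[OF \<mu>] by simp
  then show "integrable \<mu> (\<lambda>z. indicator R z * indicator Q z :: real)"
    using D_borel[OF R] D_borel[OF Q] radon_sets[OF \<mu>]
    by (rule_tac Bochner_Integration.integrable_bound) (auto simp: indicator_def intro!: AE_I2)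
qed

lemma atom_int_indicator:
  assumes \<mu>: "radon_measure \<mu>" and "y \<in> X" "k \<le> M"
  shows "atom_int \<mu> (indicator (cube (k0 + int k) x)) y = (if y \<in> cell k x then wt \<mu> y else 0)"
proof -
  have eq: "z \<in> cube (k0 + int k) x \<longleftrightarrow> y \<in> cell k x" if "z \<in> atom y" for z
    using atom_eqD[OF that assms(3)] assms(2) by (simp add: cell_def cube_eq_iff[symmetric])
  have "space \<mu> = UNIV" using sets_eq_imp_space_eq[OF radon_sets[OF \<mu>]] by simp
  have "atom_int \<mu> (indicator (cube (k0 + int k) x)) y = (\<integral>z. (if y \<in> cell k x then 1 else 0) * indicator (atom y) z \<partial>\<mu>)"
    unfolding atom_int_def by (intro Bochner_Integration.integral_cong) (auto simp: indicator_def eq)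
  then show ?thesis using \<open>space \<mu> = UNIV\<close> by (auto simp: wt_def)
qed

definition kernel_op :: "(real ^ 'n) measure \<Rightarrow> 'n dyadic_shift \<Rightarrow> (real ^ 'n \<Rightarrow> real) \<Rightarrow> real ^ 'n \<Rightarrow> real" where
  "kernel_op \<mu> S F x = (\<Sum>y\<in>X. wt \<mu> y * (\<Sum>j<M. ker S j x y) * F y)"

lemma shift_op_indicator:
  assumes S: "resolved \<kappa> S" and \<mu>: "radon_measure \<mu>" and x: "x \<in> X" and k: "k \<le> M"
  shows "shift_op D \<mu> S (indicator (cube (k0 + int k) z)) x = kernel_op \<mu> S (indicator (cell k z)) x"
  unfolding shift_op_atoms[OF S loc_int_indicator[OF \<mu> cube_in] \<mu>] kernel_op_def
  using X_region[OF x] atom_int_indicator[OF \<mu> _ k] by (auto intro!: sum.cong simp: indicator_def)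

text \<open>
  A sequence of functions \<open>b k\<close> that are constant on cells is turned into coefficients \<open>a Q\<close> of cubes, which
  vanish for all other cubes. The infinite sums over cubes then have at most \<open>M\<close> non-zero terms at
  each point and define functions that are constant on atoms, so both norms are finite sums.
\<close>

lemma quadratic_A_wnorm:
  assumes \<sigma>: "radon_measure \<sigma>" and w: "radon_measure w" and pq: "0 < p" "0 < q" and A: "0 \<le> A"
    and le: "\<And>a :: (real ^ 'n) set \<Rightarrow> real.
       eLp_norm \<sigma> p (\<lambda>x. epowr (\<Sum>\<^sub>\<infinity>Q\<in>cubes D. ennreal ((a Q)\<^sup>2 * indicator Q x)) (1 / 2)) < top \<Longrightarrow>
       eLp_norm w q (\<lambda>x. epowr (\<Sum>\<^sub>\<infinity>Q\<in>cubes D.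
           ennreal ((a Q * (measure \<sigma> Q / vol Q))\<^sup>2 * indicator Q x)) (1 / 2))
       \<le> ennreal A * eLp_norm \<sigma> p (\<lambda>x. epowr (\<Sum>\<^sub>\<infinity>Q\<in>cubes D. ennreal ((a Q)\<^sup>2 * indicator Q x)) (1 / 2))"
    and b: "\<And>k x y. x \<in> X \<Longrightarrow> y \<in> cell k x \<Longrightarrow> b k y = b k x"
  shows "wnorm X (wt w) q (\<lambda>x. L2_set (\<lambda>k. b k x * ((\<Sum>y\<in>cell k x. wt \<sigma> y) / (2 powi (- (k0 + int k))) ^ CARD('n))) {..<M})
     \<le> A * wnorm X (wt \<sigma>) p (\<lambda>x. L2_set (\<lambda>k. b k x) {..<M})"
proof -
  define cond where "cond Q P \<longleftrightarrow> fst P < M \<and> snd P \<in> X \<and> Q = cube (k0 + int (fst P)) (snd P)" for Q P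
  define ch where "ch Q = (SOME P. cond Q P)" for Q
  define a where "a Q = (if \<exists>P. cond Q P then b (fst (ch Q)) (snd (ch Q)) else 0)" for Q
  have a_cube: "a (cube (k0 + int k) x) = b k x" if "k < M" "x \<in> X" for k x
  proof -
    have ex: "\<exists>P. cond (cube (k0 + int k) x) P" using that by (intro exI[of _ "(k, x)"]) (simp add: cond_def)
    then have c: "cond (cube (k0 + int k) x) (ch (cube (k0 + int k) x))" unfolding ch_def by (rule someI_ex)
    obtain k' x' where P: "ch (cube (k0 + int k) x) = (k', x')" by (cases "ch (cube (k0 + int k) x)")
    have c': "x' \<in> X" "cube (k0 + int k) x = cube (k0 + int k') x'" using c P by (auto simp: cond_def)
    have "k0 + int k = k0 + int k'" using c'(2) D_level_unique cube_in by metis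
    then have "k' = k" by simp
    then have "x' \<in> cell k x" using c' by (simp add: cell_def)
    then have "b k x' = b k x" using b that by blast
    then show ?thesis using ex P \<open>k' = k\<close> by (simp add: a_def)
  qed
  have a0: "\<exists>k<M. \<exists>x\<in>X. Q = cube (k0 + int k) x" if "a Q \<noteq> 0" for Q
    using that unfolding a_def cond_def by (auto split: if_splits)
  have sq: "epowr (\<Sum>\<^sub>\<infinity>Q\<in>cubes D. ennreal ((a Q * c Q)\<^sup>2 * indicator Q z)) (1 / 2)
     = ennreal (if z \<in> region then L2_set (\<lambda>k. a (cube (k0 + int k) z) * c (cube (k0 + int k) z)) {..<M} else 0)" for c :: "(real ^ 'n) set \<Rightarrow> real" and z
  proof -
    let ?B = "(\<lambda>k. cube (k0 + int k) z) ` {..<M}"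
    have supp: "z \<in> region \<and> Q \<in> ?B" if "a Q \<noteq> 0" "z \<in> Q" for Q
    proof -
      obtain k x where kx: "k < M" "x \<in> X" "Q = cube (k0 + int k) x" using a0[OF \<open>a Q \<noteq> 0\<close>] by blast
      then have eq: "cube (k0 + int k) z = cube (k0 + int k) x" using \<open>z \<in> Q\<close> cube_eq by blast
      then have "cube k0 z = cube k0 x" by (rule cube_eq_mono) simp
      then have "z \<in> region" using X_Tops[OF kx(2)] by (simp add: region_def)
      then show ?thesis using kx eq by auto
    qed
    show ?thesis
    proof (cases "z \<in> region")
      case False
      then have "(\<Sum>\<^sub>\<infinity>Q\<in>cubes D. ennreal ((a Q * c Q)\<^sup>2 * indicator Q z)) = 0"
        using supp by (intro infsum_0) (auto simp: indicator_def)
      then show ?thesis using False epowr_ennreal[of 0 "1/2"] by simp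
    next
      case True
      have "(\<Sum>\<^sub>\<infinity>Q\<in>cubes D. ennreal ((a Q * c Q)\<^sup>2 * indicator Q z)) = (\<Sum>\<^sub>\<infinity>Q\<in>?B. ennreal ((a Q * c Q)\<^sup>2 * indicator Q z))"
      proof (rule infsum_cong_neutral)
        fix Q assume "Q \<in> cubes D - ?B"
        then show "ennreal ((a Q * c Q)\<^sup>2 * indicator Q z) = 0" using supp[of Q] by (auto simp: indicator_def)
      next
        fix Q assume "Q \<in> ?B - cubes D"
        then show "ennreal ((a Q * c Q)\<^sup>2 * indicator Q z) = 0" using cube_in by (auto simp: cubes_def)
      qed simp
      also have "\<dots> = (\<Sum>Q\<in>?B. ennreal ((a Q * c Q)\<^sup>2 * indicator Q z))" by simp
      also have "\<dots> = (\<Sum>k<M. ennreal ((a (cube (k0 + int k) z) * c (cube (k0 + int k) z))\<^sup>2 * indicator (cube (k0 + int k) z) z))"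
      proof (rule sum.reindex[unfolded o_def])
        show "inj_on (\<lambda>k. cube (k0 + int k) z) {..<M}"
        proof (rule inj_onI)
          fix i j assume "cube (k0 + int i) z = cube (k0 + int j) z"
          then have "k0 + int i = k0 + int j" using D_level_unique cube_in by metis
          then show "i = j" by simp
        qed
      qed
      also have "\<dots> = ennreal (\<Sum>k<M. (a (cube (k0 + int k) z) * c (cube (k0 + int k) z))\<^sup>2)"
        using cube_self by (simp add: sum_ennreal)
      finally show ?thesis using True
        by (simp add: epowr_ennreal sum_nonneg powr_half_sqrt L2_set_def)
    qed
  qed
  have atomic: "atomic (\<lambda>z. if z \<in> region then L2_set (\<lambda>k. a (cube (k0 + int k) z) * c (cube (k0 + int k) z)) {..<M} else 0)" for c
    unfolding atomic_def
  proof (intro conjI ballI allI impI)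
    fix x z assume x: "x \<in> X" and z: "z \<in> atom x"
    have "cube (k0 + int k) z = cube (k0 + int k) x" if "k < M" for k using z that by (intro atom_eqD) auto
    then have "L2_set (\<lambda>k. a (cube (k0 + int k) z) * c (cube (k0 + int k) z)) {..<M} = L2_set (\<lambda>k. a (cube (k0 + int k) x) * c (cube (k0 + int k) x)) {..<M}"
      by (intro L2_set_cong) auto
    then show "(if z \<in> region then L2_set (\<lambda>k. a (cube (k0 + int k) z) * c (cube (k0 + int k) z)) {..<M} else 0) =
        (if x \<in> region then L2_set (\<lambda>k. a (cube (k0 + int k) x) * c (cube (k0 + int k) x)) {..<M} else 0)"
      using atom_region[OF x z] X_region[OF x] by simp
  qed simp
  have norm: "eLp_norm \<mu> r (\<lambda>z. epowr (\<Sum>\<^sub>\<infinity>Q\<in>cubes D. ennreal ((a Q * c Q)\<^sup>2 * indicator Q z)) (1 / 2))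
     = ennreal (wnorm X (wt \<mu>) r (\<lambda>x. L2_set (\<lambda>k. b k x * c (cube (k0 + int k) x)) {..<M}))"
    if \<mu>: "radon_measure \<mu>" and r: "0 < r" for \<mu> r c
  proof -
    have "eLp_norm \<mu> r (\<lambda>z. epowr (\<Sum>\<^sub>\<infinity>Q\<in>cubes D. ennreal ((a Q * c Q)\<^sup>2 * indicator Q z)) (1 / 2))
       = Lp_norm \<mu> r (\<lambda>z. if z \<in> region then L2_set (\<lambda>k. a (cube (k0 + int k) z) * c (cube (k0 + int k) z)) {..<M} else 0)"
      unfolding sq Lp_norm_def by (intro arg_cong[where f = "eLp_norm \<mu> r"] ext) simp
    also have "\<dots> = ennreal (wnorm X (wt \<mu>) r (\<lambda>x. \<bar>if x \<in> region then L2_set (\<lambda>k. a (cube (k0 + int k) x) * c (cube (k0 + int k) x)) {..<M} else 0\<bar>))"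
      by (rule Lp_norm_atomic[OF \<mu> atomic r])
    also have "wnorm X (wt \<mu>) r (\<lambda>x. \<bar>if x \<in> region then L2_set (\<lambda>k. a (cube (k0 + int k) x) * c (cube (k0 + int k) x)) {..<M} else 0\<bar>)
        = wnorm X (wt \<mu>) r (\<lambda>x. L2_set (\<lambda>k. b k x * c (cube (k0 + int k) x)) {..<M})"
      using X_region a_cube by (intro wnorm_cong) (auto intro!: L2_set_cong)
    finally show ?thesis .
  qed
  have "ennreal (wnorm X (wt w) q (\<lambda>x. L2_set (\<lambda>k. b k x * (measure \<sigma> (cube (k0 + int k) x) / vol (cube (k0 + int k) x))) {..<M}))
     \<le> ennreal A * ennreal (wnorm X (wt \<sigma>) p (\<lambda>x. L2_set (\<lambda>k. b k x * 1) {..<M}))"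
    using le[of a] norm[OF w pq(2), of "\<lambda>Q. measure \<sigma> Q / vol Q"] norm[OF \<sigma> pq(1), of "\<lambda>_. 1"] by simp
  then have "wnorm X (wt w) q (\<lambda>x. L2_set (\<lambda>k. b k x * (measure \<sigma> (cube (k0 + int k) x) / vol (cube (k0 + int k) x))) {..<M})
     \<le> A * wnorm X (wt \<sigma>) p (\<lambda>x. L2_set (\<lambda>k. b k x) {..<M})"
    using A by (simp add: ennreal_mult[symmetric])
  moreover have "wnorm X (wt w) q (\<lambda>x. L2_set (\<lambda>k. b k x * (measure \<sigma> (cube (k0 + int k) x) / vol (cube (k0 + int k) x))) {..<M})
     = wnorm X (wt w) q (\<lambda>x. L2_set (\<lambda>k. b k x * ((\<Sum>y\<in>cell k x. wt \<sigma> y) / (2 powi (- (k0 + int k))) ^ CARD('n))) {..<M})"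
    by (intro wnorm_cong L2_set_cong) (auto simp: measure_cube[OF \<sigma>] D_vol[OF cube_in])
  ultimately show ?thesis by simp
qed

lemma testing_norm_indicators:
  assumes \<mu>: "radon_measure \<mu>" and p: "0 < p"
    and k: "\<And>i. i \<in> I \<Longrightarrow> k i \<le> M" and z: "\<And>i. i \<in> I \<Longrightarrow> z i \<in> region"
  shows "Lp_norm \<mu> p (\<lambda>x. sqrt (\<Sum>i\<in>I. (a i)\<^sup>2 * indicator (cube (k0 + int (k i)) (z i)) x))
       = ennreal (wnorm X (wt \<mu>) p (\<lambda>x. L2_set (\<lambda>i. a i * indicator (cell (k i) (z i)) x) I))"
proof -
  let ?Q = "\<lambda>i. cube (k0 + int (k i)) (z i)"
  have ind: "indicator (?Q i) x = (indicator (cell (k i) (z i)) x :: real)" if "x \<in> X" for x i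
    using that cell_iff by (simp add: indicator_def)
  have sq: "sqrt (\<Sum>i\<in>I. (a i)\<^sup>2 * indicator (?Q i) x) = L2_set (\<lambda>i. a i * indicator (?Q i) x) I" for x
    unfolding L2_set_def by (intro arg_cong[where f = sqrt] sum.cong) (auto simp: indicator_def)
  have at: "atomic (\<lambda>x. L2_set (\<lambda>i. a i * indicator (?Q i) x) I)"
    by (intro atomic_L2 atomic_scale indicator_cube_atomic k z)
  show ?thesis
    unfolding sq Lp_norm_atomic[OF \<mu> at p]
    by (intro arg_cong[where f = ennreal] wnorm_cong) (simp add: ind)
qed

lemma testing_norm_shift:
  assumes \<mu>: "radon_measure \<mu>" and \<nu>: "radon_measure \<nu>" and q: "0 < q"
    and S: "\<And>i. i \<in> I \<Longrightarrow> resolved \<kappa> (S i)"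
    and k: "\<And>i. i \<in> I \<Longrightarrow> k i \<le> M" and z: "\<And>i. i \<in> I \<Longrightarrow> z i \<in> region"
  shows "Lp_norm \<nu> q (\<lambda>x. sqrt (\<Sum>i\<in>I. (a i * indicator (cube (k0 + int (k i)) (z i)) x
           * shift_op D \<mu> (S i) (indicator (cube (k0 + int (k i)) (z i))) x)\<^sup>2))
       = ennreal (wnorm X (wt \<nu>) q (\<lambda>x. L2_set (\<lambda>i. a i * indicator (cell (k i) (z i)) x * kernel_op \<mu> (S i) (indicator (cell (k i) (z i))) x) I))"
proof -
  let ?Q = "\<lambda>i. cube (k0 + int (k i)) (z i)"
  have ind: "indicator (?Q i) x = (indicator (cell (k i) (z i)) x :: real)" if "x \<in> X" for x i
    using that cell_iff by (simp add: indicator_def)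
  have at: "atomic (\<lambda>x. L2_set (\<lambda>i. a i * indicator (?Q i) x * shift_op D \<mu> (S i) (indicator (?Q i)) x) I)"
    by (intro atomic_L2 atomic_mult atomic_scale indicator_cube_atomic shift_op_atomic[OF S] loc_int_indicator[OF \<mu> cube_in] k z \<mu>)
  have "Lp_norm \<nu> q (\<lambda>x. sqrt (\<Sum>i\<in>I. (a i * indicator (?Q i) x * shift_op D \<mu> (S i) (indicator (?Q i)) x)\<^sup>2))
      = ennreal (wnorm X (wt \<nu>) q (\<lambda>x. \<bar>L2_set (\<lambda>i. a i * indicator (?Q i) x * shift_op D \<mu> (S i) (indicator (?Q i)) x) I\<bar>))"
    using Lp_norm_atomic[OF \<nu> at q] by (simp only: L2_set_def)
  also have "wnorm X (wt \<nu>) q (\<lambda>x. \<bar>L2_set (\<lambda>i. a i * indicator (?Q i) x * shift_op D \<mu> (S i) (indicator (?Q i)) x) I\<bar>)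
      = wnorm X (wt \<nu>) q (\<lambda>x. L2_set (\<lambda>i. a i * indicator (cell (k i) (z i)) x * kernel_op \<mu> (S i) (indicator (cell (k i) (z i))) x) I)"
  proof (rule wnorm_cong)
    fix x assume x: "x \<in> X"
    have "L2_set (\<lambda>i. a i * indicator (?Q i) x * shift_op D \<mu> (S i) (indicator (?Q i)) x) I
        = L2_set (\<lambda>i. a i * indicator (cell (k i) (z i)) x * kernel_op \<mu> (S i) (indicator (cell (k i) (z i))) x) I"
      using shift_op_indicator[OF S \<mu> x k] ind[OF x] by (intro L2_set_cong refl) simp
    then show "\<bar>L2_set (\<lambda>i. a i * indicator (?Q i) x * shift_op D \<mu> (S i) (indicator (?Q i)) x) I\<bar>
        = L2_set (\<lambda>i. a i * indicator (cell (k i) (z i)) x * kernel_op \<mu> (S i) (indicator (cell (k i) (z i))) x) I" by simp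
  qed
  finally show ?thesis .
qed

text \<open>
  The testing condition is about finite lists of shifts, cubes and numbers, whereas the discrete condition is
  about functions \<open>b u k\<close> that are constant on cells. One list entry is needed for each triple
  of a shift \<open>u\<close>, a level \<open>k\<close> and a cell of level \<open>k\<close>; the cell is represented by its selected
  point \<open>rep k x\<close>, so that every cell is counted once.
\<close>

lemma quadratic_testing_wnorm:
  assumes \<mu>: "radon_measure \<mu>" and \<nu>: "radon_measure \<nu>" and pq: "0 < p" "0 < q" and T: "0 \<le> T"
    and test: "quadratic_testing D \<mu> p \<nu> q (shift_op D \<mu>) \<S> (ennreal T)"
    and U: "finite U" and S: "\<And>u. u \<in> U \<Longrightarrow> S u \<in> \<S> \<and> resolved \<kappa> (S u)"
    and b: "\<And>u k x y. x \<in> X \<Longrightarrow> y \<in> cell k x \<Longrightarrow> b u k y = b u k x"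
  shows "wnorm X (wt \<nu>) q (\<lambda>x. L2_set (\<lambda>(u, k). b u k x * (\<Sum>y\<in>cell k x. wt \<mu> y * (\<Sum>j<M. ker (S u) j x y))) (U \<times> {..<M}))
     \<le> T * wnorm X (wt \<mu>) p (\<lambda>x. L2_set (\<lambda>(u, k). b u k x) (U \<times> {..<M}))"
proof -
  define rep where "rep k x = (SOME y. y \<in> cell k x)" for k x
  have rep: "rep k x \<in> cell k x" if "x \<in> X" for k x
    unfolding rep_def using that by (intro someI_ex[where P = "\<lambda>y. y \<in> cell k x"] exI[of _ x]) (simp add: cell_def)
  have rep_eq: "rep k y = rep k x" if "cube (k0 + int k) y = cube (k0 + int k) x" for k x y
    using that by (simp add: rep_def cell_def)
  define I where "I = (SIGMA v:U \<times> {..<M}. rep (snd v) ` X)"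
  let ?S = "\<lambda>v. S (fst (fst v))" and ?k = "\<lambda>v. snd (fst v)" and ?z = "\<lambda>v. snd v"
  let ?a = "\<lambda>v. b (fst (fst v)) (snd (fst v)) (snd v)"
  let ?L = "\<lambda>x. L2_set (\<lambda>v. ?a v * indicator (cell (?k v) (?z v)) x * kernel_op \<mu> (?S v) (indicator (cell (?k v) (?z v))) x) I"
  let ?R = "\<lambda>x. L2_set (\<lambda>v. ?a v * indicator (cell (?k v) (?z v)) x) I"
  have finI: "finite I" unfolding I_def using U fin_X by auto
  have main: "wnorm X (wt \<nu>) q ?L \<le> T * wnorm X (wt \<mu>) p ?R"
  proof (cases "I = {}")
    case True
    then have "wnorm X (wt \<nu>) q ?L = 0" by (simp add: wnorm_def)
    then show ?thesis using T by simp
  next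
    case False
    define n where "n = card I"
    have n: "1 \<le> n" using False finI by (simp add: n_def Suc_leI card_gt_0_iff)
    obtain e where e: "bij_betw e {1..n} I" using ex_bij_betw_nat_finite_1[OF finI] unfolding n_def by blast
    have eI: "e i \<in> I" if "i \<in> {1..n}" for i using bij_betwE[OF e] that by blast
    have IX: "snd v \<in> X" "fst (fst v) \<in> U" "snd (fst v) < M" if "v \<in> I" for v
      using that rep unfolding I_def by (auto simp: cell_def)
    have "Lp_norm \<nu> q (\<lambda>x. sqrt (\<Sum>i=1..n. (?a (e i) * indicator (cube (k0 + int (?k (e i))) (?z (e i))) x
           * shift_op D \<mu> (?S (e i)) (indicator (cube (k0 + int (?k (e i))) (?z (e i)))) x)\<^sup>2))
        \<le> ennreal T * Lp_norm \<mu> p (\<lambda>x. sqrt (\<Sum>i=1..n. (?a (e i))\<^sup>2 * indicator (cube (k0 + int (?k (e i))) (?z (e i))) x))"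
    proof -
      have ok: "\<forall>i\<in>{1..n}. ?S (e i) \<in> \<S> \<and> cube (k0 + int (?k (e i))) (?z (e i)) \<in> cubes D"
      proof
        fix i assume "i \<in> {1..n}"
        then have "?S (e i) \<in> \<S>" using S IX(2)[OF eI] by blast
        moreover have "cube (k0 + int (?k (e i))) (?z (e i)) \<in> cubes D"
          unfolding cubes_def using cube_in by (rule UN_I[OF UNIV_I])
        ultimately show "?S (e i) \<in> \<S> \<and> cube (k0 + int (?k (e i))) (?z (e i)) \<in> cubes D" ..
      qed
      show ?thesis by (rule quadratic_testingD[OF test n ok, where a = "\<lambda>i. ?a (e i)"])
    qed
    then have "Lp_norm \<nu> q (\<lambda>x. sqrt (\<Sum>v\<in>I. (?a v * indicator (cube (k0 + int (?k v)) (?z v)) x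
           * shift_op D \<mu> (?S v) (indicator (cube (k0 + int (?k v)) (?z v))) x)\<^sup>2))
        \<le> ennreal T * Lp_norm \<mu> p (\<lambda>x. sqrt (\<Sum>v\<in>I. (?a v)\<^sup>2 * indicator (cube (k0 + int (?k v)) (?z v)) x))"
      by (simp only: sum.reindex_bij_betw[OF e, of "\<lambda>v. (?a v * indicator (cube (k0 + int (?k v)) (?z v)) x
           * shift_op D \<mu> (?S v) (indicator (cube (k0 + int (?k v)) (?z v))) x)\<^sup>2" for x]
          sum.reindex_bij_betw[OF e, of "\<lambda>v. (?a v)\<^sup>2 * indicator (cube (k0 + int (?k v)) (?z v)) x" for x])
    moreover have norms: "resolved \<kappa> (?S v)" "?k v \<le> M" "?z v \<in> region" if "v \<in> I" for v
      using IX[OF that] S X_region by (auto simp: less_imp_le)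
    ultimately have "ennreal (wnorm X (wt \<nu>) q ?L) \<le> ennreal T * ennreal (wnorm X (wt \<mu>) p ?R)"
      using testing_norm_shift[OF \<mu> \<nu> pq(2), of I \<kappa> ?S ?k ?z ?a]
        testing_norm_indicators[OF \<mu> pq(1), of I ?k ?z ?a] by simp
    then show ?thesis using T by (simp add: ennreal_mult[symmetric])
  qed
  \<comment> \<open>At a given point only one cell of each level contributes to the square sum over all triples.\<close>
  have collapse: "L2_set (\<lambda>v. ?a v * indicator (cell (?k v) (?z v)) x * h (fst v) (cell (?k v) (?z v))) I
      = L2_set (\<lambda>(u, k). b u k x * h (u, k) (cell k x)) (U \<times> {..<M})" if x: "x \<in> X" for x and h :: "_ \<Rightarrow> _ \<Rightarrow> real"
  proof -
    have one: "(\<Sum>y\<in>rep k ` X. (b u k y * indicator (cell k y) x * h (u, k) (cell k y))\<^sup>2) = (b u k x * h (u, k) (cell k x))\<^sup>2" for u k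
    proof -
      have "(\<Sum>y\<in>rep k ` X. (b u k y * indicator (cell k y) x * h (u, k) (cell k y))\<^sup>2)
          = (\<Sum>y\<in>{rep k x}. (b u k y * indicator (cell k y) x * h (u, k) (cell k y))\<^sup>2)"
      proof (rule sum.mono_neutral_right)
        show "\<forall>y\<in>rep k ` X - {rep k x}. (b u k y * indicator (cell k y) x * h (u, k) (cell k y))\<^sup>2 = 0"
        proof
          fix y assume y: "y \<in> rep k ` X - {rep k x}"
          then obtain x' where x': "x' \<in> X" "y = rep k x'" by blast
          then have "cube (k0 + int k) y = cube (k0 + int k) x'" using rep[of x' k] by (simp add: cell_def)
          then have "x \<notin> cell k y" using y x' rep_eq[of k x x'] by (auto simp: cell_def)
          then show "(b u k y * indicator (cell k y) x * h (u, k) (cell k y))\<^sup>2 = 0" by simp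
        qed
      qed (use fin_X x in auto)
      moreover have "cell k (rep k x) = cell k x" "x \<in> cell k (rep k x)"
        using rep[OF x, of k] x by (auto simp: cell_def)
      ultimately show ?thesis using b[OF x rep[OF x, of k]] by simp
    qed
    have "(\<Sum>v\<in>I. (?a v * indicator (cell (?k v) (?z v)) x * h (fst v) (cell (?k v) (?z v)))\<^sup>2)
        = (\<Sum>v\<in>U \<times> {..<M}. \<Sum>y\<in>rep (snd v) ` X. (b (fst v) (snd v) y * indicator (cell (snd v) y) x * h v (cell (snd v) y))\<^sup>2)"
      unfolding I_def using U fin_X by (subst sum.Sigma) (auto simp: split_def)
    also have "\<dots> = (\<Sum>v\<in>U \<times> {..<M}. (b (fst v) (snd v) x * h v (cell (snd v) x))\<^sup>2)"
      using one[of "fst v" "snd v" for v] by (intro sum.cong refl) simp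
    finally show ?thesis by (simp add: L2_set_def split_def)
  qed
  have local_test: "kernel_op \<mu> (S u) (indicator (cell k x)) x' = (\<Sum>y\<in>cell k x. wt \<mu> y * (\<Sum>j<M. ker (S u) j x' y))" for u k x x'
  proof -
    have "(\<Sum>y\<in>X. wt \<mu> y * (\<Sum>j<M. ker (S u) j x' y) * indicator (cell k x) y) = (\<Sum>y\<in>cell k x. wt \<mu> y * (\<Sum>j<M. ker (S u) j x' y) * indicator (cell k x) y)"
      using fin_X by (intro sum.mono_neutral_right) (auto simp: cell_def indicator_def)
    then show ?thesis by (simp add: kernel_op_def)
  qed
  have "wnorm X (wt \<nu>) q ?L = wnorm X (wt \<nu>) q (\<lambda>x. L2_set (\<lambda>(u, k). b u k x * (\<Sum>y\<in>cell k x. wt \<mu> y * (\<Sum>j<M. ker (S u) j x y))) (U \<times> {..<M}))"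
  proof (rule wnorm_cong)
    fix x assume x: "x \<in> X"
    show "?L x = L2_set (\<lambda>(u, k). b u k x * (\<Sum>y\<in>cell k x. wt \<mu> y * (\<Sum>j<M. ker (S u) j x y))) (U \<times> {..<M})"
      using collapse[OF x, of "\<lambda>v c. kernel_op \<mu> (S (fst v)) (indicator c) x"] by (simp add: local_test)
  qed
  moreover have "wnorm X (wt \<mu>) p ?R = wnorm X (wt \<mu>) p (\<lambda>x. L2_set (\<lambda>(u, k). b u k x) (U \<times> {..<M}))"
    using collapse[of _ "\<lambda>_ _. 1"] by (intro wnorm_cong) simp
  ultimately show ?thesis using main by simp
qed

end

section \<open>R-boundedness and testing\<close>

lemma swap_shift_swap [simp]: "swap_shift (swap_shift S) = S"
  by (simp add: swap_shift_def)

text \<open>The dual testing condition is the direct one for the adjoint shifts, so both are treated by the same lemmas.\<close>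

lemma quadratic_testing_swap:
  "quadratic_testing D \<mu> r \<nu> s (shift_adj D \<mu>) \<S> C \<longleftrightarrow> quadratic_testing D \<mu> r \<nu> s (shift_op D \<mu>) (swap_shift ` \<S>) C"
  (is "?L \<longleftrightarrow> ?R")
proof
  assume L: ?L
  show ?R
    unfolding quadratic_testing_def
  proof (intro allI impI)
    fix n :: nat and a :: "nat \<Rightarrow> real" and S Q
    assume n: "1 \<le> n" and ok: "\<forall>u\<in>{1..n}. S u \<in> swap_shift ` \<S> \<and> Q u \<in> cubes D"
    have ok': "\<forall>u\<in>{1..n}. swap_shift (S u) \<in> \<S> \<and> Q u \<in> cubes D"
    proof
      fix u assume "u \<in> {1..n}"
      then obtain S' where "S' \<in> \<S>" "S u = swap_shift S'" "Q u \<in> cubes D" using ok by blast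
      then show "swap_shift (S u) \<in> \<S> \<and> Q u \<in> cubes D" by simp
    qed
    from quadratic_testingD[OF L n ok', of a]
    show "Lp_norm \<nu> s (\<lambda>x. sqrt (\<Sum>u=1..n. (a u * indicator (Q u) x * shift_op D \<mu> (S u) (indicator (Q u)) x)\<^sup>2))
        \<le> C * Lp_norm \<mu> r (\<lambda>x. sqrt (\<Sum>u=1..n. (a u)\<^sup>2 * indicator (Q u) x))"
      by (simp add: shift_adj_eq)
  qed
next
  assume R: ?R
  show ?L
    unfolding quadratic_testing_def
  proof (intro allI impI)
    fix n :: nat and a :: "nat \<Rightarrow> real" and S Q
    assume n: "1 \<le> n" and ok: "\<forall>u\<in>{1..n}. S u \<in> \<S> \<and> Q u \<in> cubes D"
    then have ok': "\<forall>u\<in>{1..n}. swap_shift (S u) \<in> swap_shift ` \<S> \<and> Q u \<in> cubes D" by blast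
    from quadratic_testingD[OF R n ok', of a]
    show "Lp_norm \<nu> s (\<lambda>x. sqrt (\<Sum>u=1..n. (a u * indicator (Q u) x * shift_adj D \<mu> (S u) (indicator (Q u)) x)\<^sup>2))
        \<le> C * Lp_norm \<mu> r (\<lambda>x. sqrt (\<Sum>u=1..n. (a u)\<^sup>2 * indicator (Q u) x))"
      by (simp add: shift_adj_eq)
  qed
qed

text \<open>
  The quadratic condition with a given constant. It is restricted to coefficients for which the right-hand
  norm is finite, since otherwise it could fail for the best constant if this is zero.
\<close>

definition quadratic_A_bound ::
  "(int \<Rightarrow> (real ^ 'n) set set) \<Rightarrow> real \<Rightarrow> real \<Rightarrow> (real ^ 'n) measure \<Rightarrow> (real ^ 'n) measure \<Rightarrow> real \<Rightarrow> bool" where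
  "quadratic_A_bound D p q \<sigma> w A \<longleftrightarrow> (\<forall>a :: (real ^ 'n) set \<Rightarrow> real.
     eLp_norm \<sigma> p (\<lambda>x. epowr (\<Sum>\<^sub>\<infinity>Q\<in>cubes D. ennreal ((a Q)\<^sup>2 * indicator Q x)) (1 / 2)) < top \<longrightarrow>
     eLp_norm w q (\<lambda>x. epowr (\<Sum>\<^sub>\<infinity>Q\<in>cubes D. ennreal ((a Q * (measure \<sigma> Q / vol Q))\<^sup>2 * indicator Q x)) (1 / 2))
       \<le> ennreal A * eLp_norm \<sigma> p (\<lambda>x. epowr (\<Sum>\<^sub>\<infinity>Q\<in>cubes D. ennreal ((a Q)\<^sup>2 * indicator Q x)) (1 / 2)))"

lemma quadratic_A_const_bound:
  fixes D :: "int \<Rightarrow> (real ^ 'n) set set"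
  assumes fin: "quadratic_A_const D p q \<sigma> w < top"
  shows "quadratic_A_bound D p q \<sigma> w (enn2real (quadratic_A_const D p q \<sigma> w))"
  unfolding quadratic_A_bound_def
proof (intro allI impI)
  fix a :: "(real ^ 'n) set \<Rightarrow> real"
  let ?y = "eLp_norm \<sigma> p (\<lambda>x. epowr (\<Sum>\<^sub>\<infinity>Q\<in>cubes D. ennreal ((a Q)\<^sup>2 * indicator Q x)) (1 / 2))"
  let ?x = "eLp_norm w q (\<lambda>x. epowr (\<Sum>\<^sub>\<infinity>Q\<in>cubes D. ennreal ((a Q * (measure \<sigma> Q / vol Q))\<^sup>2 * indicator Q x)) (1 / 2))"
  assume y: "?y < top"
  let ?S = "{C. \<forall>a :: (real ^ 'n) set \<Rightarrow> real.
       eLp_norm w q (\<lambda>x. epowr (\<Sum>\<^sub>\<infinity>Q\<in>cubes D. ennreal ((a Q * (measure \<sigma> Q / vol Q))\<^sup>2 * indicator Q x)) (1 / 2))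
       \<le> C * eLp_norm \<sigma> p (\<lambda>x. epowr (\<Sum>\<^sub>\<infinity>Q\<in>cubes D. ennreal ((a Q)\<^sup>2 * indicator Q x)) (1 / 2))}"
  have "?S \<noteq> {}"
  proof
    assume "?S = {}"
    then have "quadratic_A_const D p q \<sigma> w = Inf {}" unfolding quadratic_A_const_def by (rule arg_cong)
    then show False using fin by simp
  qed
  then have "?x \<le> Inf ?S * ?y"
  proof (rule le_Inf_mult_ennreal[OF _ _ y])
    fix C assume "C \<in> ?S"
    then show "?x \<le> C * ?y" unfolding mem_Collect_eq by (rule spec)
  qed
  then show "?x \<le> ennreal (enn2real (quadratic_A_const D p q \<sigma> w)) * ?y"
    using fin by (simp only: quadratic_A_const_def[symmetric] ennreal_enn2real)
qed

context lattice
begin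

lemma resolving_atoms_exist:
  assumes fin: "finite \<T>" "finite \<Q>" and \<T>: "\<And>S. S \<in> \<T> \<Longrightarrow> is_dyadic_shift D S \<and> complexity S \<le> \<kappa>"
    and \<Q>: "\<Q> \<subseteq> cubes D"
  obtains k0 M Tops X where "atoms D k0 M Tops X" "\<And>S. S \<in> \<T> \<Longrightarrow> atoms.resolved D k0 M Tops \<kappa> S"
    "\<And>Q. Q \<in> \<Q> \<Longrightarrow> \<exists>i z. i \<le> M \<and> Q = cube (k0 + int i) z \<and> z \<in> atoms.region D k0 Tops"
proof -
  let ?act = "\<lambda>S. {K \<in> cubes D. \<exists>(I, J)\<in>shift_pairs D S K. sh_coeff S I J K \<noteq> 0}"
  have "finite (?act S)" if "S \<in> \<T>" for S using \<T>[OF that] unfolding is_dyadic_shift_def by blast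
  then have fin': "finite (\<Q> \<union> (\<Union>S\<in>\<T>. ?act S))" using fin by simp
  have sub: "\<Q> \<union> (\<Union>S\<in>\<T>. ?act S) \<subseteq> cubes D" using \<Q> by auto
  obtain k0 M Tops X where at: "atoms D k0 M Tops X"
    and cov: "\<forall>Q\<in>\<Q> \<union> (\<Union>S\<in>\<T>. ?act S). \<exists>i z. i + \<kappa> + 1 \<le> M \<and> Q = cube (k0 + int i) z \<and> cube k0 z \<in> Tops"
    using atoms_exist[OF fin' sub, of \<kappa>] by (elim exE conjE)
  interpret atoms D k0 M Tops X by (rule at)
  have "resolved \<kappa> S" if S: "S \<in> \<T>" for S
    unfolding resolved_def
  proof (intro conjI allI impI)
    fix K assume "active S K"
    then have "K \<in> \<Q> \<union> (\<Union>S\<in>\<T>. ?act S)" using S unfolding active_def by blast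
    then show "\<exists>i z. i + \<kappa> + 1 \<le> M \<and> K = cube (k0 + int i) z \<and> z \<in> region"
      using cov unfolding region_def by blast
  qed (use \<T>[OF S] in auto)
  moreover have "\<exists>i z. i \<le> M \<and> Q = cube (k0 + int i) z \<and> z \<in> region" if Q: "Q \<in> \<Q>" for Q
  proof -
    obtain i z where "i + \<kappa> + 1 \<le> M" "Q = cube (k0 + int i) z" "cube k0 z \<in> Tops" using cov Q by blast
    then show ?thesis by (intro exI[of _ i] exI[of _ z]) (simp add: region_def)
  qed
  ultimately show thesis using that[OF at] by blast
qed

text \<open>
  The square function estimate for a finite family of shifts. It exists in two versions: \<open>sq_bound\<close> for
  arbitrary functions in \<open>L\<^sup>p\<close>, and \<open>kernel_bound\<close> for functions on the atoms. For resolved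
  shifts they are equivalent with the same constant.
\<close>

definition sq_bound :: "(real ^ 'n) measure \<Rightarrow> real \<Rightarrow> (real ^ 'n) measure \<Rightarrow> real \<Rightarrow> nat set \<Rightarrow> (nat \<Rightarrow> 'n dyadic_shift) \<Rightarrow> real \<Rightarrow> bool" where
  "sq_bound \<mu> p \<nu> q U S C \<longleftrightarrow> (\<forall>f. (\<forall>u\<in>U. f u \<in> Lp \<mu> p) \<longrightarrow>
     Lp_norm \<nu> q (\<lambda>x. sqrt (\<Sum>u\<in>U. (shift_op D \<mu> (S u) (f u) x)\<^sup>2)) \<le> ennreal C * Lp_norm \<mu> p (\<lambda>x. sqrt (\<Sum>u\<in>U. (f u x)\<^sup>2)))"

lemma sq_boundD:
  "sq_bound \<mu> p \<nu> q U S C \<Longrightarrow> (\<And>u. u \<in> U \<Longrightarrow> f u \<in> Lp \<mu> p) \<Longrightarrow>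
     Lp_norm \<nu> q (\<lambda>x. sqrt (\<Sum>u\<in>U. (shift_op D \<mu> (S u) (f u) x)\<^sup>2)) \<le> ennreal C * Lp_norm \<mu> p (\<lambda>x. sqrt (\<Sum>u\<in>U. (f u x)\<^sup>2))"
  unfolding sq_bound_def by (drule spec[where x = f]) blast

end

context atoms
begin

lemma in_Lp_atomic:
  assumes \<mu>: "radon_measure \<mu>" and g: "atomic (g :: _ \<Rightarrow> real)" and p: "0 < p"
  shows "g \<in> Lp \<mu> p"
  using radon_measurable[OF \<mu> atomic_measurable[OF g]] Lp_norm_atomic[OF \<mu> g p] by (simp add: Lp_def)

lemma shift_linear_Lp_operator:
  assumes \<mu>: "radon_measure \<mu>" and \<nu>: "radon_measure \<nu>" and p: "1 < p" and q: "0 < q" and S: "resolved \<kappa> S"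
  shows "linear_Lp_operator \<mu> p \<nu> q (shift_op D \<mu> S)"
proof -
  note L = Lp_loc_int[OF \<mu> _ p]
  have add: "loc_int \<mu> (\<lambda>z. f z + g z)" if "loc_int \<mu> f" "loc_int \<mu> g" for f g
    using that unfolding loc_int_def distrib_left by auto
  have scale: "loc_int \<mu> (\<lambda>z. c * f z)" if "loc_int \<mu> f" for f c
    using that unfolding loc_int_def mult.left_commute[of _ c] by auto
  show ?thesis
    unfolding linear_Lp_operator_def
  proof (intro conjI ballI allI impI)
    show "shift_op D \<mu> S f \<in> Lp \<nu> q" if "f \<in> Lp \<mu> p" for f
      using shift_op_atomic[OF S L[OF that] \<mu>] in_Lp_atomic[OF \<nu> _ q] by blast
    show "AE x in \<nu>. shift_op D \<mu> S f x = shift_op D \<mu> S g x"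
      if f: "f \<in> Lp \<mu> p" and g: "g \<in> Lp \<mu> p" and ae: "AE x in \<mu>. f x = g x" for f g
      using atom_int_cong_AE[OF \<mu> L[OF f] L[OF g] ae] by (simp add: shift_op_atoms[OF S L[OF f] \<mu>] shift_op_atoms[OF S L[OF g] \<mu>])
    show "AE x in \<nu>. shift_op D \<mu> S (\<lambda>y. f y + g y) x = shift_op D \<mu> S f x + shift_op D \<mu> S g x"
      if f: "f \<in> Lp \<mu> p" and g: "g \<in> Lp \<mu> p" for f g
      using atom_int_add[OF L[OF f] L[OF g]]
      by (simp add: shift_op_atoms[OF S L[OF f] \<mu>] shift_op_atoms[OF S L[OF g] \<mu>] shift_op_atoms[OF S add[OF L[OF f] L[OF g]] \<mu>]
          distrib_left sum.distrib)
    show "AE x in \<nu>. shift_op D \<mu> S (\<lambda>y. c * f y) x = c * shift_op D \<mu> S f x" if f: "f \<in> Lp \<mu> p" for f c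
      by (simp add: shift_op_atoms[OF S L[OF f] \<mu>] shift_op_atoms[OF S scale[OF L[OF f]] \<mu>] atom_int_scale sum_distrib_left mult_ac)
  qed
qed

definition kernel_bound :: "(real ^ 'n) measure \<Rightarrow> real \<Rightarrow> (real ^ 'n) measure \<Rightarrow> real \<Rightarrow> nat set \<Rightarrow> (nat \<Rightarrow> 'n dyadic_shift) \<Rightarrow> real \<Rightarrow> bool" where
  "kernel_bound \<mu> p \<nu> q U S C \<longleftrightarrow> (\<forall>F. wnorm X (wt \<nu>) q (\<lambda>x. L2_set (\<lambda>u. kernel_op \<mu> (S u) (F u) x) U)
     \<le> C * wnorm X (wt \<mu>) p (\<lambda>x. L2_set (\<lambda>u. F u x) U))"

lemma kernel_boundD:
  "kernel_bound \<mu> p \<nu> q U S C \<Longrightarrow> wnorm X (wt \<nu>) q (\<lambda>x. L2_set (\<lambda>u. kernel_op \<mu> (S u) (F u) x) U)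
     \<le> C * wnorm X (wt \<mu>) p (\<lambda>x. L2_set (\<lambda>u. F u x) U)"
  unfolding kernel_bound_def by (rule spec[where x = F])

text \<open>The shifts only see the averages over atoms, and passing to averages decreases the norm (\<open>wnorm_atom_avg_le\<close>).\<close>

lemma sq_bound_of_kernel_bound:
  assumes \<mu>: "radon_measure \<mu>" and \<nu>: "radon_measure \<nu>" and p: "1 < p" and q: "0 < q" and C: "0 \<le> C"
    and U: "finite U" and S: "\<And>u. u \<in> U \<Longrightarrow> resolved \<kappa> (S u)"
    and kb: "kernel_bound \<mu> p \<nu> q U S C"
  shows "sq_bound \<mu> p \<nu> q U S C"
  unfolding sq_bound_def
proof (intro allI impI)
  fix f assume f: "\<forall>u\<in>U. f u \<in> Lp \<mu> p"
  have L: "loc_int \<mu> (f u)" if "u \<in> U" for u using Lp_loc_int[OF \<mu> _ p] f that by blast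
  have at: "atomic (\<lambda>x. L2_set (\<lambda>u. shift_op D \<mu> (S u) (f u) x) U)"
    by (intro atomic_L2 shift_op_atomic[OF S L \<mu>])
  have "Lp_norm \<nu> q (\<lambda>x. sqrt (\<Sum>u\<in>U. (shift_op D \<mu> (S u) (f u) x)\<^sup>2))
      = ennreal (wnorm X (wt \<nu>) q (\<lambda>x. \<bar>L2_set (\<lambda>u. shift_op D \<mu> (S u) (f u) x) U\<bar>))"
    using Lp_norm_atomic[OF \<nu> at q] by (simp only: L2_set_def)
  also have "wnorm X (wt \<nu>) q (\<lambda>x. \<bar>L2_set (\<lambda>u. shift_op D \<mu> (S u) (f u) x) U\<bar>)
      = wnorm X (wt \<nu>) q (\<lambda>x. L2_set (\<lambda>u. kernel_op \<mu> (S u) (atom_avg \<mu> (f u)) x) U)"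
    unfolding abs_of_nonneg[OF L2_set_nonneg]
    by (intro wnorm_cong L2_set_cong refl) (simp add: shift_op_atom_avg[OF S L \<mu>] kernel_op_def)
  also have "\<dots> \<le> C * wnorm X (wt \<mu>) p (\<lambda>x. L2_set (\<lambda>u. atom_avg \<mu> (f u) x) U)"
    using kb by (rule kernel_boundD)
  finally have "Lp_norm \<nu> q (\<lambda>x. sqrt (\<Sum>u\<in>U. (shift_op D \<mu> (S u) (f u) x)\<^sup>2))
      \<le> ennreal C * ennreal (wnorm X (wt \<mu>) p (\<lambda>x. L2_set (\<lambda>u. atom_avg \<mu> (f u) x) U))"
    using C by (simp add: ennreal_mult[symmetric] ennreal_leI)
  also have "\<dots> \<le> ennreal C * Lp_norm \<mu> p (\<lambda>x. sqrt (\<Sum>u\<in>U. (f u x)\<^sup>2))"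
    using f by (intro mult_left_mono wnorm_atom_avg_le[OF \<mu> p U]) auto
  finally show "Lp_norm \<nu> q (\<lambda>x. sqrt (\<Sum>u\<in>U. (shift_op D \<mu> (S u) (f u) x)\<^sup>2))
     \<le> ennreal C * Lp_norm \<mu> p (\<lambda>x. sqrt (\<Sum>u\<in>U. (f u x)\<^sup>2))" .
qed

text \<open>A function on \<open>X\<close> is extended to be constant on each atom and zero outside of the region.\<close>

lemma kernel_bound_of_sq_bound:
  assumes \<mu>: "radon_measure \<mu>" and \<nu>: "radon_measure \<nu>" and p: "1 < p" and q: "0 < q" and C: "0 \<le> C"
    and S: "\<And>u. u \<in> U \<Longrightarrow> resolved \<kappa> (S u)"
    and sb: "sq_bound \<mu> p \<nu> q U S C"
  shows "kernel_bound \<mu> p \<nu> q U S C"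
  unfolding kernel_bound_def
proof
  fix F :: "nat \<Rightarrow> real ^ 'n \<Rightarrow> real"
  define f where "f u z = (\<Sum>x\<in>X. indicator (atom x) z * F u x)" for u z
  have fX: "f u z = F u x" if "x \<in> X" "z \<in> atom x" for u x z
    unfolding f_def using that by (rule sum_atoms_indicator)
  have at_f: "atomic (f u)" for u
    unfolding atomic_def
  proof (intro conjI ballI allI impI)
    fix x z assume "x \<in> X" "z \<in> atom x"
    then show "f u z = f u x" using fX atom_self by simp
  next
    fix z assume "z \<notin> region"
    then show "f u z = 0" unfolding f_def using atom_region by (intro sum.neutral) (auto simp: indicator_def)
  qed
  have f: "f u \<in> Lp \<mu> p" for u using p by (intro in_Lp_atomic[OF \<mu> at_f]) simp
  have L: "loc_int \<mu> (f u)" for u using Lp_loc_int[OF \<mu> f p] .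
  have atom_int: "atom_int \<mu> (f u) y = wt \<mu> y * F u y" if y: "y \<in> X" for u y
  proof -
    have "space \<mu> = UNIV" using sets_eq_imp_space_eq[OF radon_sets[OF \<mu>]] by simp
    moreover have "atom_int \<mu> (f u) y = (\<integral>z. F u y * indicator (atom y) z \<partial>\<mu>)"
      unfolding atom_int_def using fX[OF y] by (intro Bochner_Integration.integral_cong) (auto simp: indicator_def)
    ultimately show ?thesis by (simp add: wt_def)
  qed
  have at: "atomic (\<lambda>x. L2_set (\<lambda>u. shift_op D \<mu> (S u) (f u) x) U)"
    by (intro atomic_L2 shift_op_atomic[OF S L \<mu>])
  have at': "atomic (\<lambda>x. L2_set (\<lambda>u. f u x) U)"
    by (intro atomic_L2 at_f)
  have "ennreal (wnorm X (wt \<nu>) q (\<lambda>x. \<bar>L2_set (\<lambda>u. shift_op D \<mu> (S u) (f u) x) U\<bar>))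
      \<le> ennreal C * ennreal (wnorm X (wt \<mu>) p (\<lambda>x. \<bar>L2_set (\<lambda>u. f u x) U\<bar>))"
    using sq_boundD[OF sb, of f] f Lp_norm_atomic[OF \<nu> at q] Lp_norm_atomic[OF \<mu> at', of p] p
    by (simp add: L2_set_def)
  moreover have "wnorm X (wt \<nu>) q (\<lambda>x. \<bar>L2_set (\<lambda>u. shift_op D \<mu> (S u) (f u) x) U\<bar>)
      = wnorm X (wt \<nu>) q (\<lambda>x. L2_set (\<lambda>u. kernel_op \<mu> (S u) (F u) x) U)"
    unfolding abs_of_nonneg[OF L2_set_nonneg]
    by (intro wnorm_cong L2_set_cong refl) (simp add: shift_op_atoms[OF S L \<mu>] X_region kernel_op_def atom_int mult_ac)
  moreover have "wnorm X (wt \<mu>) p (\<lambda>x. \<bar>L2_set (\<lambda>u. f u x) U\<bar>) = wnorm X (wt \<mu>) p (\<lambda>x. L2_set (\<lambda>u. F u x) U)"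
    unfolding abs_of_nonneg[OF L2_set_nonneg] using fX atom_self by (intro wnorm_cong L2_set_cong refl) simp
  ultimately show "wnorm X (wt \<nu>) q (\<lambda>x. L2_set (\<lambda>u. kernel_op \<mu> (S u) (F u) x) U)
     \<le> C * wnorm X (wt \<mu>) p (\<lambda>x. L2_set (\<lambda>u. F u x) U)"
    using C by (simp add: ennreal_mult[symmetric])
qed

lemma kernel_bound_dual:
  assumes p: "1 < p" and q: "1 < q" and C: "0 \<le> C" and S: "\<And>u. u \<in> U \<Longrightarrow> is_dyadic_shift D (S u)"
    and kb: "kernel_bound \<mu> p \<nu> q U S C"
  shows "kernel_bound \<nu> (conj_exponent q) \<mu> (conj_exponent p) U (\<lambda>u. swap_shift (S u)) C"
  unfolding kernel_bound_def
proof
  fix G :: "nat \<Rightarrow> real ^ 'n \<Rightarrow> real"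
  let ?nG = "wnorm X (wt \<nu>) (conj_exponent q) (\<lambda>x. L2_set (\<lambda>u. G u x) U)"
  show "wnorm X (wt \<mu>) (conj_exponent p) (\<lambda>x. L2_set (\<lambda>u. kernel_op \<nu> (swap_shift (S u)) (G u) x) U) \<le> C * ?nG"
  proof (rule wnorm_duality[OF fin_X])
    fix F :: "nat \<Rightarrow> real ^ 'n \<Rightarrow> real"
    have "(\<Sum>x\<in>X. wt \<mu> x * (\<Sum>u\<in>U. kernel_op \<nu> (swap_shift (S u)) (G u) x * F u x))
        = (\<Sum>x\<in>X. \<Sum>u\<in>U. \<Sum>y\<in>X. wt \<nu> y * (wt \<mu> x * (\<Sum>j<M. ker (S u) j y x) * F u x * G u y))"
      by (simp add: kernel_op_def ker_swap[OF S] sum_distrib_left sum_distrib_right mult_ac)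
    also have "\<dots> = (\<Sum>x\<in>X. \<Sum>y\<in>X. \<Sum>u\<in>U. wt \<nu> y * (wt \<mu> x * (\<Sum>j<M. ker (S u) j y x) * F u x * G u y))"
      by (rule sum.cong[OF refl], rule sum.swap)
    also have "\<dots> = (\<Sum>y\<in>X. \<Sum>x\<in>X. \<Sum>u\<in>U. wt \<nu> y * (wt \<mu> x * (\<Sum>j<M. ker (S u) j y x) * F u x * G u y))"
      by (rule sum.swap)
    also have "\<dots> = (\<Sum>y\<in>X. \<Sum>u\<in>U. \<Sum>x\<in>X. wt \<nu> y * (wt \<mu> x * (\<Sum>j<M. ker (S u) j y x) * F u x * G u y))"
      by (rule sum.cong[OF refl], rule sum.swap)
    also have "\<dots> = (\<Sum>y\<in>X. wt \<nu> y * (\<Sum>u\<in>U. kernel_op \<mu> (S u) (F u) y * G u y))"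
      by (simp add: kernel_op_def sum_distrib_left sum_distrib_right)
    also have "\<dots> \<le> wnorm X (wt \<nu>) q (\<lambda>y. L2_set (\<lambda>u. kernel_op \<mu> (S u) (F u) y) U) * ?nG"
      using q by (intro wnorm_pairing fin_X) (auto simp: wt_def)
    also have "\<dots> \<le> (C * wnorm X (wt \<mu>) p (\<lambda>x. L2_set (\<lambda>u. F u x) U)) * ?nG"
      using kernel_boundD[OF kb] by (intro mult_right_mono) auto
    finally show "(\<Sum>x\<in>X. wt \<mu> x * (\<Sum>u\<in>U. kernel_op \<nu> (swap_shift (S u)) (G u) x * F u x))
        \<le> C * ?nG * wnorm X (wt \<mu>) (conj_exponent (conj_exponent p)) (\<lambda>x. L2_set (\<lambda>u. F u x) U)"
      using p by (simp add: conj_conj_exponent mult_ac)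
  qed (use p C in \<open>auto simp: wt_def conj_exponent_gt_1\<close>)
qed

lemma testing_of_kernel_bound:
  assumes \<mu>: "radon_measure \<mu>" and \<nu>: "radon_measure \<nu>" and p: "0 < p" and q: "0 < q" and C: "0 \<le> C"
    and S: "\<And>u. u \<in> U \<Longrightarrow> resolved \<kappa> (S u)"
    and k: "\<And>u. u \<in> U \<Longrightarrow> k u \<le> M" and z: "\<And>u. u \<in> U \<Longrightarrow> z u \<in> region"
    and kb: "kernel_bound \<mu> p \<nu> q U S C"
  shows "Lp_norm \<nu> q (\<lambda>x. sqrt (\<Sum>i\<in>U. (a i * indicator (cube (k0 + int (k i)) (z i)) x
           * shift_op D \<mu> (S i) (indicator (cube (k0 + int (k i)) (z i))) x)\<^sup>2))
      \<le> ennreal C * Lp_norm \<mu> p (\<lambda>x. sqrt (\<Sum>i\<in>U. (a i)\<^sup>2 * indicator (cube (k0 + int (k i)) (z i)) x))"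
proof -
  have "wnorm X (wt \<nu>) q (\<lambda>x. L2_set (\<lambda>i. a i * indicator (cell (k i) (z i)) x * kernel_op \<mu> (S i) (indicator (cell (k i) (z i))) x) U)
     \<le> wnorm X (wt \<nu>) q (\<lambda>x. L2_set (\<lambda>i. kernel_op \<mu> (S i) (\<lambda>y. a i * indicator (cell (k i) (z i)) y) x) U)"
  proof (rule wnorm_mono)
    fix x
    have lin: "kernel_op \<mu> (S i) (\<lambda>y. a i * indicator (cell (k i) (z i)) y) x = a i * kernel_op \<mu> (S i) (indicator (cell (k i) (z i))) x" for i
      unfolding kernel_op_def by (simp add: sum_distrib_left mult_ac)
    show "L2_set (\<lambda>i. a i * indicator (cell (k i) (z i)) x * kernel_op \<mu> (S i) (indicator (cell (k i) (z i))) x) U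
      \<le> L2_set (\<lambda>i. kernel_op \<mu> (S i) (\<lambda>y. a i * indicator (cell (k i) (z i)) y) x) U"
      unfolding lin by (intro L2_set_mono_abs) (auto simp: indicator_def abs_mult)
  qed (use q in \<open>auto simp: wt_def\<close>)
  also have "\<dots> \<le> C * wnorm X (wt \<mu>) p (\<lambda>x. L2_set (\<lambda>i. a i * indicator (cell (k i) (z i)) x) U)"
    using kb by (rule kernel_boundD)
  finally show ?thesis
    using C unfolding testing_norm_shift[where I = U and S = S and k = k and z = z and a = a, OF \<mu> \<nu> q S k z, simplified]
      testing_norm_indicators[where I = U and k = k and z = z and a = a, OF \<mu> p k z, simplified]
    by (simp add: ennreal_mult[symmetric] ennreal_leI)
qed

text \<open>
  Dualize the left-hand norm and apply \<open>form_bound\<close>. It remains to verify its hypotheses, which are the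
  dualized versions of the conditions on atoms; the exponent conjugate to \<open>q\<close> takes the place of \<open>r\<close>.
\<close>

theorem kernel_bound_of_testing:
  assumes \<sigma>: "radon_measure \<sigma>" and w: "radon_measure w" and p: "1 < p" and q: "1 < q"
    and nn: "0 \<le> T" "0 \<le> T'" "0 \<le> A"
    and A: "quadratic_A_bound D p q \<sigma> w A"
    and T: "quadratic_testing D \<sigma> p w q (shift_op D \<sigma>) \<S> (ennreal T)"
    and T': "quadratic_testing D w (conj_exponent q) \<sigma> (conj_exponent p) (shift_adj D w) \<S> (ennreal T')"
    and U: "finite U" and S: "\<And>u. u \<in> U \<Longrightarrow> S u \<in> \<S> \<and> resolved \<kappa> (S u)"
  shows "kernel_bound \<sigma> p w q U S (core_const p (conj_exponent q) * (real (\<kappa> + 1) * (T + T') + (real (\<kappa> + 1))\<^sup>2 * A))"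
  unfolding kernel_bound_def
proof
  fix F :: "nat \<Rightarrow> real ^ 'n \<Rightarrow> real"
  let ?p' = "conj_exponent p" and ?q' = "conj_exponent q"
  have pos: "1 < ?p'" "1 < ?q'" using p q by (auto simp: conj_exponent_gt_1)
  interpret K: shift_kernels X cell M "wt \<sigma>" "wt w" "\<lambda>j. (2 powi (- (k0 + int j))) ^ CARD('n)" "\<kappa> + 1" U "\<lambda>u. ker (S u)"
    using U S by (intro kernels_on_atoms) auto
  interpret K': shift_kernels X cell M "wt w" "wt \<sigma>" "\<lambda>j. (2 powi (- (k0 + int j))) ^ CARD('n)" "\<kappa> + 1" U "\<lambda>u j x y. ker (S u) j y x"
    by (rule K.swapped)
  have wt: "\<And>x \<mu>. 0 \<le> wt \<mu> x" by (simp add: wt_def)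
  have adapted: "b y = b x" if "K.S.adapted k b" "x \<in> X" "y \<in> cell k x" for k b x y
    using that by (rule K.S.adaptedD)
  have A': "K.A_form p ?q' A"
    unfolding K.A_form_def
  proof (intro allI impI)
    fix b G :: "nat \<Rightarrow> real ^ 'n \<Rightarrow> real"
    assume b: "\<forall>k. K.S.adapted k (b k)"
    let ?nG = "wnorm X (wt w) ?q' (\<lambda>x. L2_set (\<lambda>k. G k x) {..<M})"
    have "(\<Sum>x\<in>X. wt w x * (\<Sum>k<M. b k x * K.ratio k x * G k x))
        \<le> wnorm X (wt w) q (\<lambda>x. L2_set (\<lambda>k. b k x * K.ratio k x) {..<M}) * ?nG"
      using q wt by (intro wnorm_pairing fin_X) auto
    also have "\<dots> \<le> (A * wnorm X (wt \<sigma>) p (\<lambda>x. L2_set (\<lambda>k. b k x) {..<M})) * ?nG"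
      unfolding K.ratio_def using p q adapted[OF b[THEN spec]]
      by (intro mult_right_mono quadratic_A_wnorm[OF \<sigma> w _ _ nn(3) A[unfolded quadratic_A_bound_def, THEN spec, THEN mp]]) auto
    finally show "(\<Sum>x\<in>X. wt w x * (\<Sum>k<M. b k x * K.ratio k x * G k x))
        \<le> A * wnorm X (wt \<sigma>) p (\<lambda>x. L2_set (\<lambda>k. b k x) {..<M}) * ?nG" .
  qed
  have test_in: "K.testing_form p ?q' T"
    unfolding K.testing_form_def
  proof (intro allI impI)
    fix b G :: "nat \<Rightarrow> nat \<Rightarrow> real ^ 'n \<Rightarrow> real"
    assume b: "\<forall>u k. K.S.adapted k (b u k)"
    let ?nG = "wnorm X (wt w) ?q' (\<lambda>x. L2_set (\<lambda>(u, k). G u k x) (U \<times> {..<M}))"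
    have "(\<Sum>x\<in>X. wt w x * (\<Sum>u\<in>U. \<Sum>k<M. b u k x * K.local_test u k x * G u k x))
        = (\<Sum>x\<in>X. wt w x * (\<Sum>i\<in>U \<times> {..<M}. (case i of (u, k) \<Rightarrow> b u k x * K.local_test u k x) * (case i of (u, k) \<Rightarrow> G u k x)))"
      by (simp add: sum.cartesian_product split_def)
    also have "\<dots> \<le> wnorm X (wt w) q (\<lambda>x. L2_set (\<lambda>(u, k). b u k x * K.local_test u k x) (U \<times> {..<M})) * ?nG"
      using q wt by (intro wnorm_pairing fin_X) auto
    also have "\<dots> \<le> (T * wnorm X (wt \<sigma>) p (\<lambda>x. L2_set (\<lambda>(u, k). b u k x) (U \<times> {..<M}))) * ?nG"
      unfolding K.local_test_def using p q
      by (intro mult_right_mono quadratic_testing_wnorm[OF \<sigma> w _ _ nn(1) T U S]) (use adapted[OF b[THEN spec, THEN spec]] in auto)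
    finally show "(\<Sum>x\<in>X. wt w x * (\<Sum>u\<in>U. \<Sum>k<M. b u k x * K.local_test u k x * G u k x))
        \<le> T * wnorm X (wt \<sigma>) p (\<lambda>x. L2_set (\<lambda>(u, k). b u k x) (U \<times> {..<M})) * ?nG" .
  qed
  have test_out: "K'.testing_form ?q' p T'"
    unfolding K'.testing_form_def
  proof (intro allI impI)
    fix b G :: "nat \<Rightarrow> nat \<Rightarrow> real ^ 'n \<Rightarrow> real"
    assume b: "\<forall>u k. K.S.adapted k (b u k)"
    let ?nG = "wnorm X (wt \<sigma>) p (\<lambda>x. L2_set (\<lambda>(u, k). G u k x) (U \<times> {..<M}))"
    have T'': "quadratic_testing D w ?q' \<sigma> ?p' (shift_op D w) (swap_shift ` \<S>) (ennreal T')"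
      using T' unfolding quadratic_testing_swap .
    have S': "swap_shift (S u) \<in> swap_shift ` \<S> \<and> resolved \<kappa> (swap_shift (S u))" if "u \<in> U" for u
      using S[OF that] resolved_swap by blast
    have "(\<Sum>x\<in>X. wt \<sigma> x * (\<Sum>u\<in>U. \<Sum>k<M. b u k x * K'.local_test u k x * G u k x))
        = (\<Sum>x\<in>X. wt \<sigma> x * (\<Sum>i\<in>U \<times> {..<M}. (case i of (u, k) \<Rightarrow> b u k x * K'.local_test u k x) * (case i of (u, k) \<Rightarrow> G u k x)))"
      by (simp add: sum.cartesian_product split_def)
    also have "\<dots> \<le> wnorm X (wt \<sigma>) ?p' (\<lambda>x. L2_set (\<lambda>(u, k). b u k x * K'.local_test u k x) (U \<times> {..<M})) * wnorm X (wt \<sigma>) (conj_exponent ?p') (\<lambda>x. L2_set (\<lambda>(u, k). G u k x) (U \<times> {..<M}))"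
      using pos wt by (intro wnorm_pairing fin_X) auto
    also have "\<dots> = wnorm X (wt \<sigma>) ?p' (\<lambda>x. L2_set (\<lambda>(u, k). b u k x * (\<Sum>y\<in>cell k x. wt w y * (\<Sum>j<M. ker (swap_shift (S u)) j x y))) (U \<times> {..<M})) * ?nG"
    proof -
      have "ker (swap_shift (S u)) j x y = ker (S u) j y x" if "u \<in> U" for u j x y
        using S[OF that] by (intro ker_swap) (simp add: resolved_def)
      then have "wnorm X (wt \<sigma>) ?p' (\<lambda>x. L2_set (\<lambda>(u, k). b u k x * K'.local_test u k x) (U \<times> {..<M}))
         = wnorm X (wt \<sigma>) ?p' (\<lambda>x. L2_set (\<lambda>(u, k). b u k x * (\<Sum>y\<in>cell k x. wt w y * (\<Sum>j<M. ker (swap_shift (S u)) j x y))) (U \<times> {..<M}))"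
        unfolding K'.local_test_def by (intro wnorm_cong L2_set_cong refl) auto
      then show ?thesis using p by (simp add: conj_conj_exponent)
    qed
    also have "\<dots> \<le> (T' * wnorm X (wt w) ?q' (\<lambda>x. L2_set (\<lambda>(u, k). b u k x) (U \<times> {..<M}))) * ?nG"
      using pos by (intro mult_right_mono quadratic_testing_wnorm[OF w \<sigma> _ _ nn(2) T'' U S']) (use adapted[OF b[THEN spec, THEN spec]] in auto)
    finally show "(\<Sum>x\<in>X. wt \<sigma> x * (\<Sum>u\<in>U. \<Sum>k<M. b u k x * K'.local_test u k x * G u k x))
        \<le> T' * wnorm X (wt w) ?q' (\<lambda>x. L2_set (\<lambda>(u, k). b u k x) (U \<times> {..<M})) * ?nG" .
  qed
  let ?C = "core_const p ?q' * (real (\<kappa> + 1) * (T + T') + (real (\<kappa> + 1))\<^sup>2 * A)"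
  have C0: "0 \<le> core_const p ?q'"
    unfolding core_const_def using maximal_const_ge square_const_pos
    by (intro add_nonneg_nonneg mult_nonneg_nonneg) (auto simp: less_imp_le intro: order_trans[OF _ maximal_const_ge])
  show "wnorm X (wt w) q (\<lambda>x. L2_set (\<lambda>u. kernel_op \<sigma> (S u) (F u) x) U) \<le> ?C * wnorm X (wt \<sigma>) p (\<lambda>x. L2_set (\<lambda>u. F u x) U)"
  proof (rule wnorm_duality[OF fin_X wt q])
    show "0 \<le> ?C * wnorm X (wt \<sigma>) p (\<lambda>x. L2_set (\<lambda>u. F u x) U)" using C0 nn by simp
    fix G
    have "(\<Sum>x\<in>X. wt w x * (\<Sum>u\<in>U. kernel_op \<sigma> (S u) (F u) x * G u x)) = K.form F G"
      unfolding K.form_def kernel_op_def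
      by (subst sum.swap) (simp add: sum_distrib_left sum_distrib_right mult_ac)
    also have "\<dots> \<le> ?C * (wnorm X (wt \<sigma>) p (\<lambda>x. L2_set (\<lambda>u. F u x) U) * wnorm X (wt w) ?q' (\<lambda>x. L2_set (\<lambda>u. G u x) U))"
      using p pos test_in A' test_out nn by (intro K.form_bound) auto
    finally show "(\<Sum>x\<in>X. wt w x * (\<Sum>u\<in>U. kernel_op \<sigma> (S u) (F u) x * G u x))
        \<le> ?C * wnorm X (wt \<sigma>) p (\<lambda>x. L2_set (\<lambda>u. F u x) U) * wnorm X (wt w) ?q' (\<lambda>x. L2_set (\<lambda>u. G u x) U)"
      by (simp add: mult_ac)
  qed
qed

end

lemma core_const_pos: "0 < core_const p r"
proof -
  have "0 < maximal_const s" for s using maximal_const_ge[of s] by linarith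
  then show ?thesis unfolding core_const_def using square_const_pos
    by (intro add_pos_pos mult_pos_pos) auto
qed

context lattice
begin

text \<open>The constant is the product of \<open>core_const\<close> with \<open>4 q\<close> and \<open>96\<close> from the comparison of random sums with square functions.\<close>

lemma R_bound_of_testing:
  assumes \<sigma>: "radon_measure \<sigma>" and w: "radon_measure w" and p: "1 < p" and q: "1 < q"
    and nn: "0 \<le> T" "0 \<le> T'" "0 \<le> A"
    and A: "quadratic_A_bound D p q \<sigma> w A"
    and T: "quadratic_testing D \<sigma> p w q (shift_op D \<sigma>) \<S> (ennreal T)"
    and T': "quadratic_testing D w (conj_exponent q) \<sigma> (conj_exponent p) (shift_adj D w) \<S> (ennreal T')"
    and \<S>: "\<And>S. S \<in> \<S> \<Longrightarrow> is_dyadic_shift D S \<and> complexity S \<le> \<kappa>"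
  shows "R_bound \<sigma> p w q (shift_op D \<sigma> ` \<S>)
    (ennreal (384 * q * core_const p (conj_exponent q) * (real (\<kappa> + 1) * (T + T') + (real (\<kappa> + 1))\<^sup>2 * A)))"
  unfolding R_bound_def
proof (intro allI impI)
  fix n :: nat and TT f
  assume n: "1 \<le> n" and ok: "\<forall>u\<in>{1..n}. TT u \<in> shift_op D \<sigma> ` \<S> \<and> f u \<in> Lp \<sigma> p"
  define C where "C = core_const p (conj_exponent q) * (real (\<kappa> + 1) * (T + T') + (real (\<kappa> + 1))\<^sup>2 * A)"
  have C: "0 \<le> C" unfolding C_def using nn core_const_pos[of p "conj_exponent q"] by simp
  have "\<forall>u\<in>{1..n}. \<exists>S. S \<in> \<S> \<and> TT u = shift_op D \<sigma> S" using ok by blast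
  then obtain S where S: "\<And>u. u \<in> {1..n} \<Longrightarrow> S u \<in> \<S> \<and> TT u = shift_op D \<sigma> (S u)" by metis
  obtain k0 M Tops X where at: "atoms D k0 M Tops X" and res: "\<And>S'. S' \<in> S ` {1..n} \<Longrightarrow> atoms.resolved D k0 M Tops \<kappa> S'"
  proof (rule resolving_atoms_exist[of "S ` {1..n}" "{}" \<kappa>])
    show "is_dyadic_shift D S' \<and> complexity S' \<le> \<kappa>" if "S' \<in> S ` {1..n}" for S'
      using that S \<S> by auto
  qed auto
  interpret atoms D k0 M Tops X by (rule at)
  have "kernel_bound \<sigma> p w q {1..n} S C"
    unfolding C_def using S res by (intro kernel_bound_of_testing[OF \<sigma> w p q nn A T T']) auto
  then have "sq_bound \<sigma> p w q {1..n} S C"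
    using q C res by (intro sq_bound_of_kernel_bound[where \<kappa> = \<kappa>, OF \<sigma> w p]) auto
  then have sb: "Lp_norm w q (\<lambda>x. sqrt (\<Sum>u\<in>{1..n}. (shift_op D \<sigma> (S u) (f u) x)\<^sup>2)) \<le> ennreal C * Lp_norm \<sigma> p (\<lambda>x. sqrt (\<Sum>u\<in>{1..n}. (f u x)\<^sup>2))"
    by (rule sq_boundD) (use ok in blast)
  have meas: "shift_op D \<sigma> (S u) (f u) \<in> borel_measurable w" if "u \<in> {1..n}" for u
    using that ok res by (intro radon_measurable[OF w] atomic_measurable shift_op_atomic[where \<kappa> = \<kappa>, OF _ Lp_loc_int[OF \<sigma> _ p] \<sigma>]) auto
  have "(\<integral>\<^sup>+\<epsilon>. Lp_norm w q (\<lambda>x. \<Sum>u=1..n. \<epsilon> u * TT u (f u) x) \<partial>random_signs n)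
      = (\<integral>\<^sup>+\<epsilon>. Lp_norm w q (\<lambda>x. \<Sum>u\<in>{1..n}. \<epsilon> u * shift_op D \<sigma> (S u) (f u) x) \<partial>signs {1..n})"
    unfolding random_signs_eq using S by simp
  also have "\<dots> \<le> ennreal (4 * q) * Lp_norm w q (\<lambda>x. sqrt (\<Sum>u\<in>{1..n}. (shift_op D \<sigma> (S u) (f u) x)\<^sup>2))"
    using q meas by (intro random_sum_le_square_function) auto
  also have "\<dots> \<le> ennreal (4 * q) * (ennreal C * Lp_norm \<sigma> p (\<lambda>x. sqrt (\<Sum>u\<in>{1..n}. (f u x)\<^sup>2)))"
    using sb by (rule mult_left_mono) simp
  also have "\<dots> \<le> ennreal (4 * q) * (ennreal C * (ennreal 96 * (\<integral>\<^sup>+\<epsilon>. Lp_norm \<sigma> p (\<lambda>x. \<Sum>u\<in>{1..n}. \<epsilon> u * f u x) \<partial>signs {1..n})))"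
    using p ok by (intro mult_left_mono square_function_le_random_sum) (auto simp: Lp_def)
  also have "\<dots> = ennreal (384 * q * C) * (\<integral>\<^sup>+\<epsilon>. Lp_norm \<sigma> p (\<lambda>x. \<Sum>u=1..n. \<epsilon> u * f u x) \<partial>random_signs n)"
  proof -
    have "ennreal (384 * q * C) = ennreal (4 * q) * (ennreal C * ennreal 96)"
      using q C by (simp add: ennreal_mult[symmetric] mult_ac del: ennreal_numeral)
    then show ?thesis by (simp only: random_signs_eq mult.assoc)
  qed
  finally show "(\<integral>\<^sup>+\<epsilon>. Lp_norm w q (\<lambda>x. \<Sum>u=1..n. \<epsilon> u * TT u (f u) x) \<partial>random_signs n)
      \<le> ennreal (384 * q * core_const p (conj_exponent q) * (real (\<kappa> + 1) * (T + T') + (real (\<kappa> + 1))\<^sup>2 * A))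
        * (\<integral>\<^sup>+\<epsilon>. Lp_norm \<sigma> p (\<lambda>x. \<Sum>u=1..n. \<epsilon> u * f u x) \<partial>random_signs n)"
    by (simp add: C_def mult.assoc)
qed

lemma shifts_linear:
  assumes \<sigma>: "radon_measure \<sigma>" and w: "radon_measure w" and p: "1 < p" and q: "1 < q"
    and S: "is_dyadic_shift D S"
  shows "linear_Lp_operator \<sigma> p w q (shift_op D \<sigma> S)"
proof -
  obtain k0 M Tops X where at: "atoms D k0 M Tops X" and res: "\<And>S'. S' \<in> {S} \<Longrightarrow> atoms.resolved D k0 M Tops (complexity S) S'"
    by (rule resolving_atoms_exist[of "{S}" "{}" "complexity S"]) (use S in auto)
  interpret atoms D k0 M Tops X by (rule at)
  show ?thesis using shift_linear_Lp_operator[OF \<sigma> w p, of q "complexity S" S] q res by simp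
qed

text \<open>
  R-boundedness gives the square function estimate for all finite subfamilies with one constant \<open>C\<close>, hence
  also its dual. Testing follows by inserting multiples of indicators; the localization to \<open>Q u\<close> only
  decreases the left-hand side.
\<close>

lemma testing_of_R_bounded:
  assumes \<sigma>: "radon_measure \<sigma>" and w: "radon_measure w" and p: "1 < p" and q: "1 < q"
    and \<S>: "\<And>S. S \<in> \<S> \<Longrightarrow> is_dyadic_shift D S \<and> complexity S \<le> \<kappa>"
    and R: "R_bounded \<sigma> p w q (shift_op D \<sigma> ` \<S>)"
  shows "\<exists>C<\<infinity>. quadratic_testing D \<sigma> p w q (shift_op D \<sigma>) \<S> C"
    and "\<exists>C<\<infinity>. quadratic_testing D w (conj_exponent q) \<sigma> (conj_exponent p) (shift_adj D w) \<S> C"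
proof -
  have pos: "0 < conj_exponent p" "0 < conj_exponent q" using conj_exponent_gt_1[OF p] conj_exponent_gt_1[OF q] by auto
  have lin: "linear_Lp_operator \<sigma> p w q T" if "T \<in> shift_op D \<sigma> ` \<S>" for T
    using R that unfolding R_bounded_def by blast
  obtain C0 where C0: "C0 < \<infinity>" "R_bound \<sigma> p w q (shift_op D \<sigma> ` \<S>) C0"
    using R unfolding R_bounded_def by blast
  define C where "C = 96 * (enn2real C0 * (4 * p))"
  have C: "0 \<le> C" using p by (simp add: C_def)
  have sb: "sq_bound \<sigma> p w q {1..n} S C" if n: "1 \<le> n" and S: "\<And>u. u \<in> {1..n} \<Longrightarrow> S u \<in> \<S>" for n S
    unfolding sq_bound_def
  proof (intro allI impI)
    fix f assume f: "\<forall>u\<in>{1..n}. f u \<in> Lp \<sigma> p"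
    have Tf: "shift_op D \<sigma> (S u) (f u) \<in> Lp w q" if "u \<in> {1..n}" for u
      using lin[of "shift_op D \<sigma> (S u)"] S[OF that] f that unfolding linear_Lp_operator_def by blast
    have "Lp_norm w q (\<lambda>x. sqrt (\<Sum>u\<in>{1..n}. (shift_op D \<sigma> (S u) (f u) x)\<^sup>2))
       \<le> ennreal 96 * (\<integral>\<^sup>+\<epsilon>. Lp_norm w q (\<lambda>x. \<Sum>u\<in>{1..n}. \<epsilon> u * shift_op D \<sigma> (S u) (f u) x) \<partial>signs {1..n})"
      using q Tf by (intro square_function_le_random_sum) (auto simp: Lp_def)
    also have "\<dots> \<le> ennreal 96 * (C0 * (\<integral>\<^sup>+\<epsilon>. Lp_norm \<sigma> p (\<lambda>x. \<Sum>u\<in>{1..n}. \<epsilon> u * f u x) \<partial>signs {1..n}))"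
    proof (rule mult_left_mono)
      have "\<forall>u\<in>{1..n}. shift_op D \<sigma> (S u) \<in> shift_op D \<sigma> ` \<S> \<and> f u \<in> Lp \<sigma> p" using S f by blast
      from C0(2)[unfolded R_bound_def, THEN spec, THEN mp, OF n, THEN spec[where x = "\<lambda>u. shift_op D \<sigma> (S u)"], THEN spec[where x = f], THEN mp, OF this]
      show "(\<integral>\<^sup>+\<epsilon>. Lp_norm w q (\<lambda>x. \<Sum>u\<in>{1..n}. \<epsilon> u * shift_op D \<sigma> (S u) (f u) x) \<partial>signs {1..n})
        \<le> C0 * (\<integral>\<^sup>+\<epsilon>. Lp_norm \<sigma> p (\<lambda>x. \<Sum>u\<in>{1..n}. \<epsilon> u * f u x) \<partial>signs {1..n})"
        unfolding random_signs_eq .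
    qed simp
    also have "\<dots> \<le> ennreal 96 * (C0 * (ennreal (4 * p) * Lp_norm \<sigma> p (\<lambda>x. sqrt (\<Sum>u\<in>{1..n}. (f u x)\<^sup>2))))"
      using p f by (intro mult_left_mono random_sum_le_square_function) (auto simp: Lp_def)
    also have "\<dots> = ennreal C * Lp_norm \<sigma> p (\<lambda>x. sqrt (\<Sum>u\<in>{1..n}. (f u x)\<^sup>2))"
    proof -
      have "C0 = ennreal (enn2real C0)" using C0(1) by simp
      then have "ennreal C = ennreal 96 * (C0 * ennreal (4 * p))"
        using p by (metis C_def enn2real_nonneg ennreal_mult' mult_nonneg_nonneg zero_le_numeral)
      then show ?thesis by (simp only: mult.assoc)
    qed
    finally show "Lp_norm w q (\<lambda>x. sqrt (\<Sum>u\<in>{1..n}. (shift_op D \<sigma> (S u) (f u) x)\<^sup>2)) \<le> ennreal C * Lp_norm \<sigma> p (\<lambda>x. sqrt (\<Sum>u\<in>{1..n}. (f u x)\<^sup>2))" .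
  qed
  have both: "Lp_norm w q (\<lambda>x. sqrt (\<Sum>u=1..n. (a u * indicator (Q u) x * shift_op D \<sigma> (S u) (indicator (Q u)) x)\<^sup>2))
        \<le> ennreal C * Lp_norm \<sigma> p (\<lambda>x. sqrt (\<Sum>u=1..n. (a u)\<^sup>2 * indicator (Q u) x)) \<and>
      Lp_norm \<sigma> (conj_exponent p) (\<lambda>x. sqrt (\<Sum>u=1..n. (a u * indicator (Q u) x * shift_adj D w (S u) (indicator (Q u)) x)\<^sup>2))
        \<le> ennreal C * Lp_norm w (conj_exponent q) (\<lambda>x. sqrt (\<Sum>u=1..n. (a u)\<^sup>2 * indicator (Q u) x))"
    if n: "1 \<le> n" and ok: "\<forall>u\<in>{1..n}. S u \<in> \<S> \<and> Q u \<in> cubes D" for n S Q and a :: "nat \<Rightarrow> real"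
  proof -
    have fin: "finite (S ` {1..n})" "finite (Q ` {1..n})" by auto
    have T: "is_dyadic_shift D S' \<and> complexity S' \<le> \<kappa>" if "S' \<in> S ` {1..n}" for S' using \<S> ok that by auto
    have Qs: "Q ` {1..n} \<subseteq> cubes D" using ok by auto
    obtain k0 M Tops X where at: "atoms D k0 M Tops X" and res: "\<And>S'. S' \<in> S ` {1..n} \<Longrightarrow> atoms.resolved D k0 M Tops \<kappa> S'"
      and Q: "\<And>R. R \<in> Q ` {1..n} \<Longrightarrow> \<exists>i z. i \<le> M \<and> R = cube (k0 + int i) z \<and> z \<in> atoms.region D k0 Tops"
      using resolving_atoms_exist[OF fin T Qs] by metis
    interpret atoms D k0 M Tops X by (rule at)
    have "\<forall>u\<in>{1..n}. \<exists>i z. i \<le> M \<and> Q u = cube (k0 + int i) z \<and> z \<in> region" using Q by blast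
    then obtain k z where kz: "\<And>u. u \<in> {1..n} \<Longrightarrow> k u \<le> M \<and> Q u = cube (k0 + int (k u)) (z u) \<and> z u \<in> region" by metis
    have S: "resolved \<kappa> (S u)" "S u \<in> \<S>" "is_dyadic_shift D (S u)" if "u \<in> {1..n}" for u using res ok \<S> that by auto
    have kb: "kernel_bound \<sigma> p w q {1..n} S C"
      using sb[OF n S(2)] q C S(1) by (intro kernel_bound_of_sq_bound[where \<kappa> = \<kappa>, OF \<sigma> w p]) auto
    have kb': "kernel_bound w (conj_exponent q) \<sigma> (conj_exponent p) {1..n} (\<lambda>u. swap_shift (S u)) C"
      using kb S(3) by (intro kernel_bound_dual[OF p q C]) auto
    have t1: "Lp_norm w q (\<lambda>x. sqrt (\<Sum>u=1..n. (a u * indicator (cube (k0 + int (k u)) (z u)) x * shift_op D \<sigma> (S u) (indicator (cube (k0 + int (k u)) (z u))) x)\<^sup>2))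
        \<le> ennreal C * Lp_norm \<sigma> p (\<lambda>x. sqrt (\<Sum>u=1..n. (a u)\<^sup>2 * indicator (cube (k0 + int (k u)) (z u)) x))"
      using p q kz S(1) by (intro testing_of_kernel_bound[where \<kappa> = \<kappa>, OF \<sigma> w _ _ C _ _ _ kb]) auto
    have t2: "Lp_norm \<sigma> (conj_exponent p) (\<lambda>x. sqrt (\<Sum>u=1..n. (a u * indicator (cube (k0 + int (k u)) (z u)) x * shift_op D w (swap_shift (S u)) (indicator (cube (k0 + int (k u)) (z u))) x)\<^sup>2))
        \<le> ennreal C * Lp_norm w (conj_exponent q) (\<lambda>x. sqrt (\<Sum>u=1..n. (a u)\<^sup>2 * indicator (cube (k0 + int (k u)) (z u)) x))"
      using pos kz resolved_swap[OF S(1)] by (intro testing_of_kernel_bound[where \<kappa> = \<kappa>, OF w \<sigma> _ _ C _ _ _ kb']) auto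
    have Qeq: "(\<Sum>u=1..n. h u (cube (k0 + int (k u)) (z u))) = (\<Sum>u=1..n. h u (Q u))" for h :: "nat \<Rightarrow> _ \<Rightarrow> real"
      using kz by (intro sum.cong refl) simp
    show ?thesis
      using t1 t2 unfolding shift_adj_eq
      by (simp only: Qeq[of "\<lambda>u Q. (a u * indicator Q x * shift_op D \<sigma> (S u) (indicator Q) x)\<^sup>2" for x]
          Qeq[of "\<lambda>u Q. (a u * indicator Q x * shift_op D w (swap_shift (S u)) (indicator Q) x)\<^sup>2" for x]
          Qeq[of "\<lambda>u Q. (a u)\<^sup>2 * indicator Q x" for x])
  qed
  show "\<exists>C<\<infinity>. quadratic_testing D \<sigma> p w q (shift_op D \<sigma>) \<S> C"
    using both unfolding quadratic_testing_def by (intro exI[of _ "ennreal C"]) auto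
  show "\<exists>C<\<infinity>. quadratic_testing D w (conj_exponent q) \<sigma> (conj_exponent p) (shift_adj D w) \<S> C"
    using both unfolding quadratic_testing_def by (intro exI[of _ "ennreal C"]) auto
qed

text \<open>The right-hand norms in the testing condition are finite, being finite sums over atoms, so \<open>le_Inf_mult_ennreal\<close> applies.\<close>

lemma testing_const_attained:
  assumes \<mu>: "radon_measure \<mu>" and r: "0 < r" and ex: "\<exists>C<\<infinity>. quadratic_testing D \<mu> r \<nu> s op \<S> C"
  shows "testing_const D \<mu> r \<nu> s op \<S> < \<infinity>" "quadratic_testing D \<mu> r \<nu> s op \<S> (testing_const D \<mu> r \<nu> s op \<S>)"
proof -
  obtain C0 where C0: "C0 < \<infinity>" "quadratic_testing D \<mu> r \<nu> s op \<S> C0" using ex by blast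
  have "testing_const D \<mu> r \<nu> s op \<S> \<le> C0" unfolding testing_const_def using C0 by (intro Inf_lower) simp
  then show "testing_const D \<mu> r \<nu> s op \<S> < \<infinity>" using C0(1) by (rule le_less_trans)
  show "quadratic_testing D \<mu> r \<nu> s op \<S> (testing_const D \<mu> r \<nu> s op \<S>)"
    unfolding quadratic_testing_def
  proof (intro allI impI)
    fix n :: nat and a :: "nat \<Rightarrow> real" and S Q
    assume n: "1 \<le> n" and ok: "\<forall>u\<in>{1..n}. S u \<in> \<S> \<and> Q u \<in> cubes D"
    have fin: "finite ({} :: 'n dyadic_shift set)" "finite (Q ` {1..n})" by auto
    have Qs: "Q ` {1..n} \<subseteq> cubes D" using ok by auto
    have none: "is_dyadic_shift D S \<and> complexity S \<le> 0" if "S \<in> {}" for S :: "'n dyadic_shift" using that by blast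
    obtain k0 M Tops X where at: "atoms D k0 M Tops X"
      and Q: "\<And>R. R \<in> Q ` {1..n} \<Longrightarrow> \<exists>i z. i \<le> M \<and> R = cube (k0 + int i) z \<and> z \<in> atoms.region D k0 Tops"
      using resolving_atoms_exist[OF fin none Qs] by metis
    interpret atoms D k0 M Tops X by (rule at)
    have "\<forall>u\<in>{1..n}. \<exists>i z. i \<le> M \<and> Q u = cube (k0 + int i) z \<and> z \<in> region" using Q by blast
    then obtain k z where kz: "\<And>u. u \<in> {1..n} \<Longrightarrow> k u \<le> M \<and> Q u = cube (k0 + int (k u)) (z u) \<and> z u \<in> region" by metis
    let ?y = "Lp_norm \<mu> r (\<lambda>x. sqrt (\<Sum>u=1..n. (a u)\<^sup>2 * indicator (Q u) x))"
    have "?y = Lp_norm \<mu> r (\<lambda>x. sqrt (\<Sum>u=1..n. (a u)\<^sup>2 * indicator (cube (k0 + int (k u)) (z u)) x))"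
      using kz by (intro arg_cong[where f = "Lp_norm \<mu> r"] ext arg_cong[where f = sqrt] sum.cong refl) simp
    then have "?y < top" using kz by (subst (asm) testing_norm_indicators[OF \<mu> r]) auto
    then show "Lp_norm \<nu> s (\<lambda>x. sqrt (\<Sum>u=1..n. (a u * indicator (Q u) x * op (S u) (indicator (Q u)) x)\<^sup>2))
        \<le> testing_const D \<mu> r \<nu> s op \<S> * ?y"
      unfolding testing_const_def using C0(2) quadratic_testingD[OF _ n ok]
      by (intro le_Inf_mult_ennreal) auto
  qed
qed

end

theorem theorem5p1:
  fixes p q :: real
  assumes "1 < p" and "1 < q"
  shows "\<exists>c::real. c > 0 \<and>
    (\<forall>(D :: int \<Rightarrow> (real ^ 'n) set set) (\<sigma> :: (real ^ 'n) measure) (w :: (real ^ 'n) measure)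
       (\<S> :: 'n dyadic_shift set) (\<kappa> :: nat).
      dyadic_lattice D \<longrightarrow> radon_measure \<sigma> \<longrightarrow> radon_measure w \<longrightarrow>
      quadratic_A_const D p q \<sigma> w < \<infinity> \<longrightarrow>
      (\<forall>S\<in>\<S>. is_dyadic_shift D S \<and> complexity S \<le> \<kappa>) \<longrightarrow>
      (R_bounded \<sigma> p w q (shift_op D \<sigma> ` \<S>) \<longleftrightarrow>
         (\<exists>C<\<infinity>. quadratic_testing D \<sigma> p w q (shift_op D \<sigma>) \<S> C) \<and>
         (\<exists>C<\<infinity>. quadratic_testing D w (conj_exponent q) \<sigma> (conj_exponent p)
                    (shift_adj D w) \<S> C)) \<and>
      (R_bounded \<sigma> p w q (shift_op D \<sigma> ` \<S>) \<longrightarrow>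
         R_const \<sigma> p w q (shift_op D \<sigma> ` \<S>)
           \<le> ennreal c *
              (of_nat (1 + \<kappa>) *
                 (testing_const D \<sigma> p w q (shift_op D \<sigma>) \<S> +
                  testing_const D w (conj_exponent q) \<sigma> (conj_exponent p) (shift_adj D w) \<S>) +
               of_nat (1 + \<kappa>) ^ 2 * quadratic_A_const D p q \<sigma> w)))"
proof (intro exI[of _ "384 * q * core_const p (conj_exponent q)"] conjI allI impI)
  let ?c = "384 * q * core_const p (conj_exponent q)"
  show c: "0 < ?c" using assms core_const_pos by simp
  fix D :: "int \<Rightarrow> (real ^ 'n) set set" and \<sigma> w :: "(real ^ 'n) measure" and \<S> :: "'n dyadic_shift set" and \<kappa> :: nat
  assume D: "dyadic_lattice D" and \<sigma>: "radon_measure \<sigma>" and w: "radon_measure w"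
    and A: "quadratic_A_const D p q \<sigma> w < \<infinity>" and \<S>: "\<forall>S\<in>\<S>. is_dyadic_shift D S \<and> complexity S \<le> \<kappa>"
  interpret lattice D by unfold_locales (rule D)
  let ?R = "R_bounded \<sigma> p w q (shift_op D \<sigma> ` \<S>)"
  let ?T = "\<exists>C<\<infinity>. quadratic_testing D \<sigma> p w q (shift_op D \<sigma>) \<S> C"
  let ?T' = "\<exists>C<\<infinity>. quadratic_testing D w (conj_exponent q) \<sigma> (conj_exponent p) (shift_adj D w) \<S> C"
  let ?t = "testing_const D \<sigma> p w q (shift_op D \<sigma>) \<S>"
  let ?t' = "testing_const D w (conj_exponent q) \<sigma> (conj_exponent p) (shift_adj D w) \<S>"
  let ?a = "quadratic_A_const D p q \<sigma> w"
  have pq: "0 < p" "0 < conj_exponent q" using assms conj_exponent_gt_1[of q] by auto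
  have A': "quadratic_A_bound D p q \<sigma> w (enn2real ?a)" using A by (intro quadratic_A_const_bound) simp
  have bound: "R_bound \<sigma> p w q (shift_op D \<sigma> ` \<S>)
      (ennreal ?c * (of_nat (1 + \<kappa>) * (?t + ?t') + of_nat (1 + \<kappa>) ^ 2 * ?a))" if T: ?T and T': ?T'
  proof -
    note t = testing_const_attained[OF \<sigma> pq(1) T] and t' = testing_const_attained[OF w pq(2) T']
    obtain x y z where xyz: "?t = ennreal x" "?t' = ennreal y" "?a = ennreal z" "0 \<le> x" "0 \<le> y" "0 \<le> z"
      using t(1) t'(1) A by (metis enn2real_nonneg ennreal_enn2real infinity_ennreal_def)
    have "R_bound \<sigma> p w q (shift_op D \<sigma> ` \<S>) (ennreal (?c * (real (\<kappa> + 1) * (x + y) + (real (\<kappa> + 1))\<^sup>2 * z)))"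
      using t(2) t'(2) A' \<S> xyz by (intro R_bound_of_testing[OF \<sigma> w assms]) auto
    moreover have "ennreal (?c * (real (\<kappa> + 1) * (x + y) + (real (\<kappa> + 1))\<^sup>2 * z))
        = ennreal ?c * (of_nat (1 + \<kappa>) * (?t + ?t') + of_nat (1 + \<kappa>) ^ 2 * ?a)"
    proof -
      have "(of_nat (1 + \<kappa>) :: ennreal) = ennreal (real (\<kappa> + 1))" by (simp add: ennreal_of_nat_eq_real_of_nat add.commute)
      then show ?thesis using xyz c
        by (simp only: ennreal_mult ennreal_plus ennreal_power add_nonneg_nonneg mult_nonneg_nonneg zero_le_power of_nat_0_le_iff less_imp_le)
    qed
    ultimately show ?thesis by simp
  qed
  show iff: "?R \<longleftrightarrow> ?T \<and> ?T'"
  proof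
    assume ?R
    then show "?T \<and> ?T'" using testing_of_R_bounded[OF \<sigma> w assms, of \<S> \<kappa>] \<S> by blast
  next
    assume T: "?T \<and> ?T'"
    show ?R
      unfolding R_bounded_def
    proof (intro conjI ballI exI)
      show "linear_Lp_operator \<sigma> p w q T" if "T \<in> shift_op D \<sigma> ` \<S>" for T
        using that shifts_linear[OF \<sigma> w assms] \<S> by blast
      show "R_bound \<sigma> p w q (shift_op D \<sigma> ` \<S>) (ennreal ?c * (of_nat (1 + \<kappa>) * (?t + ?t') + of_nat (1 + \<kappa>) ^ 2 * ?a))"
        using T bound by blast
      have "?t < \<infinity>" "?t' < \<infinity>" using T testing_const_attained(1)[OF \<sigma> pq(1)] testing_const_attained(1)[OF w pq(2)] by blast+
      then show "ennreal ?c * (of_nat (1 + \<kappa>) * (?t + ?t') + of_nat (1 + \<kappa>) ^ 2 * ?a) < \<infinity>"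
        using A by (simp add: ennreal_mult_less_top of_nat_less_top power_less_top_ennreal)
    qed
  qed
  assume ?R
  then have "R_bound \<sigma> p w q (shift_op D \<sigma> ` \<S>) (ennreal ?c * (of_nat (1 + \<kappa>) * (?t + ?t') + of_nat (1 + \<kappa>) ^ 2 * ?a))"
    using iff bound by blast
  then show "R_const \<sigma> p w q (shift_op D \<sigma> ` \<S>) \<le> ennreal ?c * (of_nat (1 + \<kappa>) * (?t + ?t') + of_nat (1 + \<kappa>) ^ 2 * ?a)"
    unfolding R_const_def by (intro Inf_lower) simp
qed

end
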